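(* Fix an integer $d\ge2$, $0<\beta<1$, $\kappa_*>0$, and a probability density $\rho_0\in C_c^{1,\beta}(\mathbb R^d)$. Let $T_*>0$ and the classical solutions $\rho^\kappa$, $0\le\kappa\le\kappa_*$, be as described in the context, and fix $0<T<T_*$. There exists $C_T=C(d,\beta,\kappa_*,\rho_0,T)<\infty$ such that, for every $N\ge2$ and every $0<\kappa\le\kappa_*$, if the Yukawa particle system starts from $\rho_N^0=\rho_0^{\otimes N}$ and $\rho_N(t)$ denotes its law at time $t$, then $$\sup_{t\le T}\Bigl\{\frac1N W_2^2\bigl(\rho_N(t),\rho^\kappa(t)^{\otimes N}\bigr)+\int\bigl[\mathcal F_N^{\kappa,\sharp}(X_N,\rho^\kappa(t))+B\varepsilon_N^\kappa(\eta_N)\bigr]\,d\rho_N(t)\Bigr\}+\int_0^T\!\!\int\mathcal D_N^\kappa(X_N,\rho^\kappa(t))\,d\rho_N(t)\,dt\le C_T\,a_{N,d},$$ and, for every $1\le k\le N$, $$\sup_{t\le T}W_2^2\bigl(\rho_{N:k}(t),\rho^\kappa(t)^{\otimes k}\bigr)\le C_T\,k\,a_{N,d}.$$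
   Context: Kernels: for $\kappa>0$, $g_{\kappa,d}(x)=(2\pi)^{-d/2}(\kappa/|x|)^{\nu_d}K_{\nu_d}(\kappa|x|)$, $\nu_d=\frac d2-1$, with $K_\nu$ the modified Bessel function of the second kind; $(-\Delta+\kappa^2)g_{\kappa,d}=\delta_0$. For $\kappa=0$: $g_{0,2}(x)=-\frac1{2\pi}\log|x|+\frac{\log2-\gamma_E}{2\pi}$ and $g_{0,d}(x)=\frac{|x|^{2-d}}{(d-2)|\mathbb S^{d-1}|}$ for $d\ge3$. Classical solutions: $T_*>0$ (depending only on $d,\rho_0,\beta,\kappa_*$) is a common existence time such that for every $0\le\kappa\le\kappa_*$ the problem $\partial_t\rho+\nabla\cdot(\rho u_\rho^\kappa)=0$, $u_\rho^\kappa=-\nabla g_{\kappa,d}*\rho$, $\rho(0)=\rho_0$ has a unique classical solution $\rho^\kappa\in L^\infty_{loc}([0,T_* );C^{1,\beta})\cap C([0,T_* );C^{1,\beta'})\cap C^1([0,T_* );C^{0,\beta'})$ for all $0<\beta'<\beta$, nonnegative with unit mass, with $\operatorname{supp}\rho^\kappa(t)\subset B_{R_T}$ for $t\le T<T_*$ ($R_T$ independent of $\kappa$), and with $\sup_{0\le\kappa\le\kappa_*}\sup_{t\le T}[\|\rho^\kappa\|_{L^\infty}+[\rho^\kappa]_{C^{0,\beta}}+\int|x|^2\rho^\kappa+\|u^\kappa_{\rho^\kappa}\|_{W^{1,\infty}}]<\infty$ for every $T<T_*$. Particle system: $\dot x_i=-\frac1N\sum_{j\ne i}\nabla g_{\kappa,d}(x_i-x_j)$,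 with global collision-free flow on $(\mathbb R^d)^N\setminus\Delta_N$, $\Delta_N=\{X_N:\exists i\ne j,\ x_i=x_j\}$; $\rho_N(t)$ is the push-forward of $\rho_N^0$ and $\rho_{N:k}(t)$ its $k$-particle marginal. $W_2$ on $(\mathbb R^d)^N$ uses the cost $\sum_i|x_i-y_i|^2$. For $X_N\notin\Delta_N$, $\mu_{X_N}=\frac1N\sum_i\delta_{x_i}$: $\mathcal F_N^{g_{\kappa,d}}(X_N,\rho)=\iint_{x\ne y}g_{\kappa,d}(x-y)\,d(\mu_{X_N}-\rho)(x)d(\mu_{X_N}-\rho)(y)$; $\mathcal H_N^{g_{\kappa,d}}(X_N,\rho;u)=\iint_{x\ne y}(u(x)-u(y))\cdot\nabla g_{\kappa,d}(x-y)\,d(\mu_{X_N}-\rho)(x)d(\mu_{X_N}-\rho)(y)$; $\mathcal F_N^{\kappa,\sharp}=\mathcal F_N^{g_{\kappa,d}}-c_{\kappa,d}/N$ with $c_{\kappa,d}=0$ ($d\ge3$), $c_{\kappa,2}=\frac{\log\kappa}{2\pi}$; $\mathcal D_N^\kappa(X_N,\rho)=\frac1N\sum_i|\frac1N\sum_{j\ne i}\nabla g_{\kappa,d}(x_i-x_j)-\nabla g_{\kappa,d}*\rho(x_i)|^2$. Both $\mathcal F_N^{\kappa,\sharp}$ and $\mathcal D_N^\kappa$ are $+\infty$ on $\Delta_N$. Errors: $\ell_2(r)=1+\log_+(1/r)$, $\ell_d(r)=r^{2-d}$ ($d\ge3$); $\varepsilon_N^\kappa(\eta)=\frac{\ell_d(\eta)}N+\eta^2+\kappa^2\eta^2$;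 $a_{N,2}=\frac{1+\log N}N$, $a_{N,d}=N^{-2/d}$ ($d\ge3$). Constants: $\eta_0=\eta_0(d,\kappa_* )>0$ and $B=B(d,\kappa_*,\Lambda)\ge1$, $C_{\rm com}=C_{\rm com}(d,\kappa_*,\Lambda)\ge 1$ are fixed commutator constants such that for all $N\ge2$, $0<\kappa\le\kappa_*$, $0<\eta<\eta_0$, probability densities $\|\rho\|_{L^\infty}\le\Lambda$, $X_N\notin\Delta_N$, globally Lipschitz $u$: $\mathcal F_N^{\kappa,\sharp}+B\varepsilon_N^\kappa(\eta)\ge\varepsilon_N^\kappa(\eta)\ge 0$ and $|\mathcal H_N^{g_{\kappa,d}}|\le C_{\rm com}\|\nabla u\|_{L^\infty}(\mathcal F_N^{\kappa,\sharp}+B\varepsilon_N^\kappa(\eta))$ (they exist by the paper's uniform commutator theorem); here $B$ is taken with $\Lambda=\Lambda_T:=1+\sup_{0\le\kappa\le\kappa_*}\sup_{t\le T}(\|\rho^\kappa(t)\|_{L^\infty}+\|u_{\rho^\kappa}^\kappa(t)\|_{W^{1,\infty}})$. The radius is $\eta_N=\frac12\min\{1,\eta_0\}N^{-1/d}$. *)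

theory Defs
  imports "HOL-Probability.Probability"
begin

section \<open>Kernels\<close>

text \<open>Modified Bessel function of the second kind, by its standard integral representation,
  which is valid for every real order \<open>\<nu>\<close> and every \<open>z > 0\<close>.\<close>

definition bessel_K :: "real \<Rightarrow> real \<Rightarrow> real" where
  "bessel_K \<nu> z = (LINT t:{0<..}|lborel. exp (- z * cosh t) * cosh (\<nu> * t))"

text \<open>Surface measure of the unit sphere of the \<open>d\<close>-dimensional Euclidean space.\<close>

definition sphere_area :: "real \<Rightarrow> real" where
  "sphere_area d = 2 * pi powr (d / 2) / Gamma (d / 2)"

definition gker :: "real \<Rightarrow> real ^ 'n \<Rightarrow> real" where
  "gker \<kappa> x =
     (let d = real CARD('n); \<nu> = d / 2 - 1 in
      if \<kappa> > 0 then (2 * pi) powr (- d / 2) * (\<kappa> / norm x) powr \<nu> * bessel_K \<nu> (\<kappa> * norm x)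
      else if CARD('n) = 2
        then - (1 / (2 * pi)) * ln (norm x) + (ln 2 - euler_mascheroni) / (2 * pi)
      else norm x powr (2 - d) / ((d - 2) * sphere_area d))"

definition grad :: "(real ^ 'n \<Rightarrow> real) \<Rightarrow> real ^ 'n \<Rightarrow> real ^ 'n" where
  "grad f x = (\<chi> i. frechet_derivative f (at x) (axis i 1))"

definition divergence :: "(real ^ 'n \<Rightarrow> real ^ 'n) \<Rightarrow> real ^ 'n \<Rightarrow> real" where
  "divergence v x = (\<Sum>i\<in>UNIV. frechet_derivative v (at x) (axis i 1) $ i)"

text \<open>The convolution of the (pointwise) gradient of the kernel with \<open>\<rho>\<close>.\<close>

definition grad_gker_conv :: "real \<Rightarrow> (real ^ 'n \<Rightarrow> real) \<Rightarrow> real ^ 'n \<Rightarrow> real ^ 'n" where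
  "grad_gker_conv \<kappa> \<rho> x = (LINT y|lborel. \<rho> y *\<^sub>R grad (gker \<kappa>) (x - y))"

definition velocity :: "real \<Rightarrow> (real ^ 'n \<Rightarrow> real) \<Rightarrow> real ^ 'n \<Rightarrow> real ^ 'n" where
  "velocity \<kappa> \<rho> x = - grad_gker_conv \<kappa> \<rho> x"


section \<open>Norms and function spaces\<close>

text \<open>All norms take values in the extended nonnegative reals.\<close>

definition Linf_norm :: "(real ^ 'n \<Rightarrow> 'b::real_normed_vector) \<Rightarrow> ennreal" where
  "Linf_norm f = esssup lborel (\<lambda>x. ennreal (norm (f x)))"

text \<open>A function with continuous representative has a bounded weak gradient on the whole space
  iff it is Lipschitz; the weak gradient is then the pointwise derivative, which exists almost
  everywhere by Rademacher's theorem (\<open>frechet_derivative\<close> is arbitrary on the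
  remaining null set). The matrix norm is the operator norm.\<close>

definition Linf_grad :: "(real ^ 'n \<Rightarrow> real ^ 'n) \<Rightarrow> ennreal" where
  "Linf_grad u =
     (if \<exists>L. L-lipschitz_on UNIV u
      then esssup lborel (\<lambda>x. ennreal (onorm (frechet_derivative u (at x))))
      else \<infinity>)"

definition W1inf_norm :: "(real ^ 'n \<Rightarrow> real ^ 'n) \<Rightarrow> ennreal" where
  "W1inf_norm u = Linf_norm u + Linf_grad u"

definition sup_norm :: "(real ^ 'n \<Rightarrow> 'b::real_normed_vector) \<Rightarrow> ennreal" where
  "sup_norm f = (SUP x. ennreal (norm (f x)))"

definition holder_seminorm ::
    "real \<Rightarrow> (real ^ 'n \<Rightarrow> 'b::real_normed_vector) \<Rightarrow> ennreal" where
  "holder_seminorm \<beta> f =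
     (SUP (x, y)\<in>{(x, y). x \<noteq> y}. ennreal (norm (f x - f y) / norm (x - y) powr \<beta>))"

definition C0_norm :: "real \<Rightarrow> (real ^ 'n \<Rightarrow> real) \<Rightarrow> ennreal" where
  "C0_norm \<beta> f = sup_norm f + holder_seminorm \<beta> f"

definition C1_norm :: "real \<Rightarrow> (real ^ 'n \<Rightarrow> real) \<Rightarrow> ennreal" where
  "C1_norm \<beta> f = sup_norm f + sup_norm (grad f) + holder_seminorm \<beta> (grad f)"

definition C0_space :: "real \<Rightarrow> (real ^ 'n \<Rightarrow> real) set" where
  "C0_space \<beta> = {f. C0_norm \<beta> f < \<infinity>}"

definition C1_space :: "real \<Rightarrow> (real ^ 'n \<Rightarrow> real) set" where
  "C1_space \<beta> = {f. (\<forall>x. f differentiable at x) \<and> C1_norm \<beta> f < \<infinity>}"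

definition supp :: "(real ^ 'n \<Rightarrow> real) \<Rightarrow> (real ^ 'n) set" where
  "supp f = closure {x. f x \<noteq> 0}"

definition C1c_space :: "real \<Rightarrow> (real ^ 'n \<Rightarrow> real) set" where
  "C1c_space \<beta> = {f \<in> C1_space \<beta>. compact (supp f)}"

definition prob_density :: "(real ^ 'n \<Rightarrow> real) \<Rightarrow> bool" where
  "prob_density f \<longleftrightarrow>
     f \<in> borel_measurable borel \<and> (\<forall>x. 0 \<le> f x) \<and> (\<integral>\<^sup>+x. ennreal (f x) \<partial>lborel) = 1"


section \<open>Classical solutions of the mean-field equation\<close>

definition Linf_loc_C1 :: "real \<Rightarrow> real \<Rightarrow> (real \<Rightarrow> real ^ 'n \<Rightarrow> real) \<Rightarrow> bool" where
  "Linf_loc_C1 \<beta> Ts \<rho> \<longleftrightarrow>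
     (\<forall>T. 0 < T \<and> T < Ts \<longrightarrow>
        (\<exists>M::real. AE t in lborel. t \<in> {0..T} \<longrightarrow>
            \<rho> t \<in> C1_space \<beta> \<and> C1_norm \<beta> (\<rho> t) \<le> ennreal M))"

definition C_time_C1 :: "real \<Rightarrow> real \<Rightarrow> (real \<Rightarrow> real ^ 'n \<Rightarrow> real) \<Rightarrow> bool" where
  "C_time_C1 \<beta> Ts \<rho> \<longleftrightarrow>
     (\<forall>t\<in>{0..<Ts}. \<rho> t \<in> C1_space \<beta> \<and>
        ((\<lambda>s. C1_norm \<beta> (\<lambda>x. \<rho> s x - \<rho> t x)) \<longlongrightarrow> 0) (at t within {0..<Ts}))"

text \<open>\<open>\<rho>\<close> is continuously differentiable in time with values in the Hoelder space of order
  \<open>(0, \<beta>)\<close>, with time derivative \<open>\<rho>'\<close>.\<close>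

definition C1_time_C0 ::
    "real \<Rightarrow> real \<Rightarrow> (real \<Rightarrow> real ^ 'n \<Rightarrow> real) \<Rightarrow> (real \<Rightarrow> real ^ 'n \<Rightarrow> real) \<Rightarrow> bool" where
  "C1_time_C0 \<beta> Ts \<rho> \<rho>' \<longleftrightarrow>
     (\<forall>t\<in>{0..<Ts}. \<rho> t \<in> C0_space \<beta> \<and> \<rho>' t \<in> C0_space \<beta> \<and>
        ((\<lambda>s. C0_norm \<beta> (\<lambda>x. (\<rho> s x - \<rho> t x) / (s - t) - \<rho>' t x)) \<longlongrightarrow> 0)
          (at t within {0..<Ts}) \<and>
        ((\<lambda>s. C0_norm \<beta> (\<lambda>x. \<rho>' s x - \<rho>' t x)) \<longlongrightarrow> 0) (at t within {0..<Ts}))"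

text \<open>Unit mass and locally bounded support belong to the solution class; they make the
  convolution defining the velocity an absolutely convergent integral, also for \<open>\<kappa> = 0\<close>.\<close>

definition classical_solution ::
    "real \<Rightarrow> real \<Rightarrow> real \<Rightarrow> (real ^ 'n \<Rightarrow> real) \<Rightarrow> (real \<Rightarrow> real ^ 'n \<Rightarrow> real) \<Rightarrow> bool" where
  "classical_solution \<beta> \<kappa> Ts \<rho>0 \<rho> \<longleftrightarrow>
     \<rho> 0 = \<rho>0 \<and>
     Linf_loc_C1 \<beta> Ts \<rho> \<and>
     (\<exists>\<rho>'. (\<forall>\<beta>'. 0 < \<beta>' \<and> \<beta>' < \<beta> \<longrightarrow> C_time_C1 \<beta>' Ts \<rho> \<and> C1_time_C0 \<beta>' Ts \<rho> \<rho>') \<and>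
        (\<forall>t\<in>{0..<Ts}. \<forall>x.
           (\<lambda>y. \<rho> t y *\<^sub>R velocity \<kappa> (\<rho> t) y) differentiable at x \<and>
           \<rho>' t x + divergence (\<lambda>y. \<rho> t y *\<^sub>R velocity \<kappa> (\<rho> t) y) x = 0)) \<and>
     (\<forall>t\<in>{0..<Ts}. prob_density (\<rho> t)) \<and>
     (\<forall>T. 0 < T \<and> T < Ts \<longrightarrow> (\<exists>R. \<forall>t\<in>{0..T}. supp (\<rho> t) \<subseteq> ball 0 R))"

text \<open>\<open>Ts\<close> is a common existence time and \<open>\<rho> \<kappa>\<close> is the unique classical solution with
  parameter \<open>\<kappa>\<close>, with support and norm bounds that are uniform in \<open>\<kappa>\<close>.\<close>

definition solution_family ::
    "real \<Rightarrow> real \<Rightarrow> real \<Rightarrow> (real ^ 'n \<Rightarrow> real) \<Rightarrow> (real \<Rightarrow> real \<Rightarrow> real ^ 'n \<Rightarrow> real) \<Rightarrow> bool" where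
  "solution_family \<beta> \<kappa>s Ts \<rho>0 \<rho> \<longleftrightarrow>
     (\<forall>\<kappa>\<in>{0..\<kappa>s}. classical_solution \<beta> \<kappa> Ts \<rho>0 (\<rho> \<kappa>) \<and>
        (\<forall>\<sigma>. classical_solution \<beta> \<kappa> Ts \<rho>0 \<sigma> \<longrightarrow> (\<forall>t\<in>{0..<Ts}. \<sigma> t = \<rho> \<kappa> t))) \<and>
     (\<forall>T. 0 < T \<and> T < Ts \<longrightarrow>
        (\<exists>R. \<forall>\<kappa>\<in>{0..\<kappa>s}. \<forall>t\<in>{0..T}. supp (\<rho> \<kappa> t) \<subseteq> ball 0 R) \<and>
        (SUP \<kappa>\<in>{0..\<kappa>s}. SUP t\<in>{0..T}.
           Linf_norm (\<rho> \<kappa> t) + holder_seminorm \<beta> (\<rho> \<kappa> t)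
           + (\<integral>\<^sup>+x. ennreal ((norm x)\<^sup>2 * \<rho> \<kappa> t x) \<partial>lborel)
           + W1inf_norm (velocity \<kappa> (\<rho> \<kappa> t))) < \<infinity>)"

definition Lambda_T :: "real \<Rightarrow> real \<Rightarrow> (real \<Rightarrow> real \<Rightarrow> real ^ 'n \<Rightarrow> real) \<Rightarrow> real" where
  "Lambda_T \<kappa>s T \<rho> =
     enn2real (1 + (SUP \<kappa>\<in>{0..\<kappa>s}. SUP t\<in>{0..T}.
        Linf_norm (\<rho> \<kappa> t) + W1inf_norm (velocity \<kappa> (\<rho> \<kappa> t))))"


section \<open>Particle system\<close>

text \<open>Configurations of \<open>N\<close> particles are the functions in \<open>{..<N} \<rightarrow>\<^sub>E UNIV\<close>, the space of
  the following product \<open>\<sigma>\<close>-algebra.\<close>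

definition config :: "nat \<Rightarrow> (nat \<Rightarrow> real ^ 'n) measure" where
  "config N = PiM {..<N} (\<lambda>_. borel)"

definition collisions :: "nat \<Rightarrow> (nat \<Rightarrow> real ^ 'n) set" where
  "collisions N = {X \<in> space (config N). \<exists>i<N. \<exists>j<N. i \<noteq> j \<and> X i = X j}"

text \<open>\<open>\<Phi> t X\<close> is the configuration at time \<open>t\<close> of the collision-free solution starting
  from \<open>X\<close>; its values on the null set of collisions are immaterial.\<close>

definition particle_flow ::
    "real \<Rightarrow> nat \<Rightarrow> (real \<Rightarrow> (nat \<Rightarrow> real ^ 'n) \<Rightarrow> nat \<Rightarrow> real ^ 'n) \<Rightarrow> bool" where
  "particle_flow \<kappa> N \<Phi> \<longleftrightarrow>
     (\<forall>t\<ge>0. \<Phi> t \<in> measurable (config N) (config N)) \<and>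
     (\<forall>X\<in>space (config N) - collisions N.
        \<Phi> 0 X = X \<and>
        (\<forall>t\<ge>0. \<Phi> t X \<notin> collisions N \<and>
           (\<forall>i<N. ((\<lambda>s. \<Phi> s X i) has_vector_derivative
               - (1 / real N) *\<^sub>R (\<Sum>j\<in>{..<N} - {i}. grad (gker \<kappa>) (\<Phi> t X i - \<Phi> t X j)))
             (at t within {0..}))))"

definition tensor_power :: "nat \<Rightarrow> (real ^ 'n \<Rightarrow> real) \<Rightarrow> (nat \<Rightarrow> real ^ 'n) measure" where
  "tensor_power k f = PiM {..<k} (\<lambda>_. density lborel (\<lambda>x. ennreal (f x)))"

definition law ::
    "nat \<Rightarrow> (real ^ 'n \<Rightarrow> real) \<Rightarrow> (real \<Rightarrow> (nat \<Rightarrow> real ^ 'n) \<Rightarrow> nat \<Rightarrow> real ^ 'n) \<Rightarrow> real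
      \<Rightarrow> (nat \<Rightarrow> real ^ 'n) measure" where
  "law N \<rho>0 \<Phi> t = distr (tensor_power N \<rho>0) (config N) (\<Phi> t)"

definition marginal :: "nat \<Rightarrow> (nat \<Rightarrow> real ^ 'n) measure \<Rightarrow> (nat \<Rightarrow> real ^ 'n) measure" where
  "marginal k P = distr P (config k) (\<lambda>X. restrict X {..<k})"

definition couplings ::
    "(nat \<Rightarrow> real ^ 'n) measure \<Rightarrow> (nat \<Rightarrow> real ^ 'n) measure
      \<Rightarrow> ((nat \<Rightarrow> real ^ 'n) \<times> (nat \<Rightarrow> real ^ 'n)) measure set" where
  "couplings P Q =
     {\<gamma>. sets \<gamma> = sets (P \<Otimes>\<^sub>M Q) \<and> distr \<gamma> P fst = P \<and> distr \<gamma> Q snd = Q}"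

text \<open>The square of the Wasserstein distance of order two between laws of \<open>n\<close>-particle
  configurations, with cost \<open>\<Sum>i<n. |x\<^sub>i - y\<^sub>i|\<^sup>2\<close>.\<close>

definition W2_sq ::
    "nat \<Rightarrow> (nat \<Rightarrow> real ^ 'n) measure \<Rightarrow> (nat \<Rightarrow> real ^ 'n) measure \<Rightarrow> ennreal" where
  "W2_sq n P Q =
     (INF \<gamma>\<in>couplings P Q. \<integral>\<^sup>+(X, Y). ennreal (\<Sum>i<n. (norm (X i - Y i))\<^sup>2) \<partial>\<gamma>)"


section \<open>Modulated energy, commutator and dissipation\<close>

definition empirical :: "nat \<Rightarrow> (nat \<Rightarrow> real ^ 'n) \<Rightarrow> (real ^ 'n) measure" where
  "empirical N X = distr (uniform_count_measure {..<N}) borel X"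

definition offdiag_integral ::
    "(real ^ 'n \<Rightarrow> real ^ 'n \<Rightarrow> real) \<Rightarrow> (real ^ 'n) measure \<Rightarrow> (real ^ 'n) measure \<Rightarrow> real" where
  "offdiag_integral f \<mu> \<nu> = (LINT (x, y)|(\<mu> \<Otimes>\<^sub>M \<nu>). (if x = y then 0 else f x y))"

text \<open>The off-diagonal double integral of \<open>f\<close> against the square of the signed measure
  \<open>\<mu>\<^sub>X - \<rho>\<close>, expanded by bilinearity since measures are nonnegative here.\<close>

definition modulated_integral ::
    "(real ^ 'n \<Rightarrow> real ^ 'n \<Rightarrow> real) \<Rightarrow> nat \<Rightarrow> (nat \<Rightarrow> real ^ 'n) \<Rightarrow> (real ^ 'n \<Rightarrow> real) \<Rightarrow> real" where
  "modulated_integral f N X \<rho> =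
     (let \<mu> = empirical N X; \<nu> = density lborel (\<lambda>x. ennreal (\<rho> x)) in
      offdiag_integral f \<mu> \<mu> - offdiag_integral f \<mu> \<nu>
      - offdiag_integral f \<nu> \<mu> + offdiag_integral f \<nu> \<nu>)"

definition mod_energy ::
    "real \<Rightarrow> nat \<Rightarrow> (nat \<Rightarrow> real ^ 'n) \<Rightarrow> (real ^ 'n \<Rightarrow> real) \<Rightarrow> real" where
  "mod_energy \<kappa> N X \<rho> = modulated_integral (\<lambda>x y. gker \<kappa> (x - y)) N X \<rho>"

definition commutator ::
    "real \<Rightarrow> nat \<Rightarrow> (nat \<Rightarrow> real ^ 'n) \<Rightarrow> (real ^ 'n \<Rightarrow> real) \<Rightarrow> (real ^ 'n \<Rightarrow> real ^ 'n) \<Rightarrow> real" where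
  "commutator \<kappa> N X \<rho> u =
     modulated_integral (\<lambda>x y. (u x - u y) \<bullet> grad (gker \<kappa>) (x - y)) N X \<rho>"

definition c_ren :: "nat \<Rightarrow> real \<Rightarrow> real" where
  "c_ren d \<kappa> = (if d = 2 then ln \<kappa> / (2 * pi) else 0)"

definition mod_energy_sharp ::
    "real \<Rightarrow> nat \<Rightarrow> (nat \<Rightarrow> real ^ 'n) \<Rightarrow> (real ^ 'n \<Rightarrow> real) \<Rightarrow> ereal" where
  "mod_energy_sharp \<kappa> N X \<rho> =
     (if X \<in> collisions N then \<infinity>
      else ereal (mod_energy \<kappa> N X \<rho> - c_ren CARD('n) \<kappa> / real N))"

definition dissipation ::
    "real \<Rightarrow> nat \<Rightarrow> (nat \<Rightarrow> real ^ 'n) \<Rightarrow> (real ^ 'n \<Rightarrow> real) \<Rightarrow> ennreal" where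
  "dissipation \<kappa> N X \<rho> =
     (if X \<in> collisions N then \<infinity>
      else ennreal (1 / real N * (\<Sum>i<N.
        (norm ((1 / real N) *\<^sub>R (\<Sum>j\<in>{..<N} - {i}. grad (gker \<kappa>) (X i - X j))
               - grad_gker_conv \<kappa> \<rho> (X i)))\<^sup>2)))"


section \<open>Errors and constants\<close>

definition ell :: "nat \<Rightarrow> real \<Rightarrow> real" where
  "ell d r = (if d = 2 then 1 + max 0 (ln (1 / r)) else r powr (2 - real d))"

definition eps :: "nat \<Rightarrow> nat \<Rightarrow> real \<Rightarrow> real \<Rightarrow> real" where
  "eps d N \<kappa> \<eta> = ell d \<eta> / real N + \<eta>\<^sup>2 + \<kappa>\<^sup>2 * \<eta>\<^sup>2"

definition rate :: "nat \<Rightarrow> nat \<Rightarrow> real" where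
  "rate N d = (if d = 2 then (1 + ln (real N)) / real N else real N powr (- 2 / real d))"

definition eta_radius :: "nat \<Rightarrow> real \<Rightarrow> nat \<Rightarrow> real" where
  "eta_radius d \<eta>0 N = 1 / 2 * min 1 \<eta>0 * real N powr (- 1 / real d)"

text \<open>\<open>\<eta>0\<close> depends on the dimension and on \<open>\<kappa>s\<close> only, whereas \<open>B\<close> and \<open>Ccom\<close> may in
  addition depend on the bound \<open>\<Lambda>\<close> for the density. The first argument fixes the dimension.
  The inequality \<open>E \<ge> e\<close> shows that integrating \<open>e2ennreal E\<close> against a law of particles
  truncates nothing.\<close>

definition commutator_constants ::
    "'n::finite itself \<Rightarrow> real \<Rightarrow> real \<Rightarrow> (real \<Rightarrow> real) \<Rightarrow> (real \<Rightarrow> real) \<Rightarrow> bool" where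
  "commutator_constants _ \<kappa>s \<eta>0 B Ccom \<longleftrightarrow>
     0 < \<eta>0 \<and>
     (\<forall>\<Lambda>>0. 1 \<le> B \<Lambda> \<and> 1 \<le> Ccom \<Lambda> \<and>
       (\<forall>N\<ge>2. \<forall>\<kappa> \<eta>. \<forall>\<rho> :: real ^ 'n \<Rightarrow> real. \<forall>X\<in>space (config N) - collisions N.
          0 < \<kappa> \<and> \<kappa> \<le> \<kappa>s \<and> 0 < \<eta> \<and> \<eta> < \<eta>0 \<and> prob_density \<rho> \<and> Linf_norm \<rho> \<le> ennreal \<Lambda> \<longrightarrow>
          (let e = eps CARD('n) N \<kappa> \<eta>;
               E = mod_energy_sharp \<kappa> N X \<rho> + ereal (B \<Lambda> * e)
           in E \<ge> ereal e \<and> e \<ge> 0 \<and>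
              (\<forall>u. (\<exists>L. L-lipschitz_on UNIV u) \<longrightarrow>
                 ereal \<bar>commutator \<kappa> N X \<rho> u\<bar>
                   \<le> ereal (Ccom \<Lambda> * enn2real (Linf_grad u)) * E))))"

end

theory Submission
  imports Defs
begin

text \<open>
  Let \<open>Y\<close> be the flow of the velocity field of \<open>\<rho> \<kappa>\<close>. It transports \<open>\<rho>0\<close> to
  \<open>\<rho> \<kappa> t\<close>, so for independent initial positions \<open>X i\<close> the pair formed by the particle
  positions \<open>x i\<close> at time \<open>t\<close> and the points \<open>Y t (X i)\<close> couples the law of the particles
  with the tensor power of \<open>\<rho> \<kappa> t\<close>.

  Along one collision-free trajectory the time derivative of the modulated energy is minus twice the
  dissipation plus a commutator. The commutator estimate and Gronwall's inequality therefore bound both the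
  modulated energy and the time integral of the dissipation by the initial modulated energy, up to the
  error \<open>B * eps\<close>. The dissipation is the mean square of the difference between the velocity of
  \<open>x i\<close> and the mean-field velocity at \<open>x i\<close>; as the latter is Lipschitz, a second
  application of Gronwall's inequality bounds the sum of the squared distances between \<open>x i\<close> and
  \<open>Y t (X i)\<close> by the same quantity.

  For independent particles the expected initial modulated energy equals the self-interaction energy of
  \<open>\<rho>0\<close> divided by \<open>- N\<close>. Once renormalised by \<open>c_ren\<close>, this self-interaction
  energy is bounded below uniformly in \<open>\<kappa>\<close>, because in dimension two \<open>bessel_K 0 z\<close> is at
  least \<open>- ln z - 1\<close>, while in higher dimensions the kernel is nonnegative. The bound for the marginals
  follows by exchangeability.
\<close>

section \<open>Differentiation under the integral and convolutions\<close>

text \<open>Two obstacles shape the proof. First, uniformity in \<open>\<kappa>\<close>: the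
  constants describing the singularity of the kernel and the regularity of the solution
  (\<open>C\<close>, \<open>R\<close>, \<open>J\<close>, \<open>M\<close>) may depend on
  \<open>\<kappa>\<close>, because they only serve to justify exact identities. The quantitative
  estimates see only \<open>\<Lambda>\<close>, the commutator constants, \<open>\<kappa>s\<close>,
  \<open>T\<close> and the support of \<open>\<rho>0\<close>. Second, lack of smoothness: the kernel
  is singular, so the modulated energy is differentiated through the regularisations
  \<open>G (|x|^2 + \<delta>)\<close>, whose derivatives converge uniformly in time. A test function
  composed with the flow is only Lipschitz, so the law of \<open>Y t\<close> is identified with
  \<open>\<rho> \<kappa> t\<close> by showing that a duality pairing has vanishing derivative, with
  errors governed by Lipschitz constants alone. The factor \<open>- 1 / N\<close> in the expected
  initial energy is the count \<open>(N - 1) / N - 2 + 1\<close> of particle-particle, mixed and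
  density-density terms.\<close>

lemma has_derivative_lebesgue_integral:
  fixes f :: "'a::real_normed_vector \<Rightarrow> 'b \<Rightarrow> 'c::{banach, second_countable_topology}"
  assumes x: "x \<in> S" and r: "0 < r"
    and int: "\<And>z. z \<in> S \<Longrightarrow> dist z x < r \<Longrightarrow> integrable M (f z)"
    and der: "AE y in M. ((\<lambda>z. f z y) has_derivative f' y) (at x within S)"
    and meas: "\<And>h. (\<lambda>y. f' y h) \<in> borel_measurable M"
    and B: "integrable M B"
    and lip: "AE y in M. \<forall>z\<in>S. dist z x < r \<longrightarrow> norm (f z y - f x y) \<le> B y * norm (z - x)"
    and bound: "AE y in M. \<forall>h. norm (f' y h) \<le> B y * norm h"
  shows "((\<lambda>z. LINT y|M. f z y) has_derivative (\<lambda>h. LINT y|M. f' y h)) (at x within S)"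
proof -
  have int': "integrable M (\<lambda>y. f' y h)" for h
    by (rule Bochner_Integration.integrable_bound[OF integrable_mult_left[OF B, of "norm h"] meas])
       (use bound in eventually_elim, metis abs_ge_self order_trans real_norm_def)
  have lin: "AE y in M. bounded_linear (f' y)"
    using der by eventually_elim (rule has_derivative_bounded_linear)
  have bl: "bounded_linear (\<lambda>h. LINT y|M. f' y h)"
  proof (rule bounded_linear_intro)
    fix h k
    have "(LINT y|M. f' y (h + k)) = (LINT y|M. f' y h + f' y k)"
      by (rule integral_cong_AE) (use meas in auto, use lin in eventually_elim,
          simp add: linear_simps)
    then show "(LINT y|M. f' y (h + k)) = (LINT y|M. f' y h) + (LINT y|M. f' y k)"
      using int' by simp
  next
    fix c h
    have "(LINT y|M. f' y (c *\<^sub>R h)) = (LINT y|M. c *\<^sub>R f' y h)"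
      by (rule integral_cong_AE) (use meas in auto, use lin in eventually_elim,
          simp add: linear_simps)
    then show "(LINT y|M. f' y (c *\<^sub>R h)) = c *\<^sub>R (LINT y|M. f' y h)"
      by simp
  next
    fix h
    have "norm (LINT y|M. f' y h) \<le> (LINT y|M. norm (f' y h))" by (rule integral_norm_bound)
    also have "\<dots> \<le> (LINT y|M. B y * norm h)"
      by (rule integral_mono_AE) (use int' B bound in auto)
    finally show "norm (LINT y|M. f' y h) \<le> norm h * (LINT y|M. B y)"
      by (simp add: mult.commute)
  qed
  \<comment> \<open>The derivative is tested along sequences so that dominated convergence applies.
    The Lipschitz bound is required only between \<open>x\<close> and nearby points; together with
    the bound on \<open>f'\<close> it dominates the difference quotients by
    \<open>2 * B\<close>.\<close>
  have lim: "((\<lambda>z. norm ((LINT y|M. f z y) - (LINT y|M. f x y) - (LINT y|M. f' y (z - x))) / norm (z - x)) \<longlongrightarrow> 0)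
      (at x within S)"
    unfolding tendsto_at_iff_sequentially
  proof (intro allI impI)
    fix X assume X: "\<forall>i::nat. X i \<in> S - {x}" "X \<longlonglongrightarrow> x"
    obtain N where N: "\<And>n. n \<ge> N \<Longrightarrow> dist (X n) x < r"
      using X(2) r by (auto simp: LIMSEQ_def)
    \<comment> \<open>Dropping the first \<open>N\<close> terms places the whole sequence in the
      ball where integrability and the Lipschitz bound are assumed.\<close>
    define Y where "Y n = X (n + N)" for n
    have Y: "Y n \<in> S" "Y n \<noteq> x" "dist (Y n) x < r" for n
      using X(1) N by (auto simp: Y_def)
    have Yx: "Y \<longlonglongrightarrow> x" unfolding Y_def by (rule LIMSEQ_ignore_initial_segment[OF X(2)])
    define q where "q n y = (f (Y n) y - f x y - f' y (Y n - x)) /\<^sub>R norm (Y n - x)" for n y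
    have xr: "integrable M (f x)" using int[OF x] r by simp
    have qi: "integrable M (q n)" for n
      unfolding q_def using int[OF Y(1) Y(3)] xr int' by auto
    have "(\<lambda>n. LINT y|M. q n y) \<longlonglongrightarrow> (LINT y|M. 0)"
    proof (rule integral_dominated_convergence[where w="\<lambda>y. 2 * B y"])
      show "(\<lambda>x. 0) \<in> borel_measurable M" by simp
      show "q n \<in> borel_measurable M" for n using qi by auto
      show "integrable M (\<lambda>y. 2 * B y)" using B by simp
      show "AE y in M. (\<lambda>n. q n y) \<longlonglongrightarrow> 0"
        using der
      proof eventually_elim
        fix y assume "((\<lambda>z. f z y) has_derivative f' y) (at x within S)"
        then have "((\<lambda>z. norm (f z y - f x y - f' y (z - x)) / norm (z - x)) \<longlongrightarrow> 0) (at x within S)"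
          by (simp add: has_derivative_iff_norm)
        then have "(\<lambda>n. norm (f (Y n) y - f x y - f' y (Y n - x)) / norm (Y n - x)) \<longlonglongrightarrow> 0"
          unfolding tendsto_at_iff_sequentially using Y Yx by (auto simp: o_def)
        then have "(\<lambda>n. norm (q n y)) \<longlonglongrightarrow> 0"
          by (simp add: q_def divide_inverse mult.commute)
        then show "(\<lambda>n. q n y) \<longlonglongrightarrow> 0" by (rule tendsto_norm_zero_cancel)
      qed
      show "AE y in M. norm (q n y) \<le> 2 * B y" for n
        using lip bound
      proof eventually_elim
        fix y assume a: "\<forall>z\<in>S. dist z x < r \<longrightarrow> norm (f z y - f x y) \<le> B y * norm (z - x)"
          and b: "\<forall>h. norm (f' y h) \<le> B y * norm h"
        have "norm (f (Y n) y - f x y - f' y (Y n - x)) \<le> 2 * B y * norm (Y n - x)"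
          using a[rule_format, OF Y(1) Y(3), of n] b[rule_format, of "Y n - x"]
            norm_triangle_ineq4[of "f (Y n) y - f x y" "f' y (Y n - x)"] by linarith
        moreover have "norm (Y n - x) > 0" using Y(2)[of n] by simp
        ultimately show "norm (q n y) \<le> 2 * B y"
          by (simp add: q_def mult.commute[of "inverse _"] divide_inverse[symmetric] pos_divide_le_eq)
      qed
    qed
    then have "(\<lambda>n. norm (LINT y|M. q n y)) \<longlonglongrightarrow> 0"
      by (simp add: tendsto_norm_zero)
    moreover have "norm (LINT y|M. q n y)
      = norm ((LINT y|M. f (Y n) y) - (LINT y|M. f x y) - (LINT y|M. f' y (Y n - x))) / norm (Y n - x)" for n
    proof -
      have "(LINT y|M. q n y) = ((LINT y|M. f (Y n) y) - (LINT y|M. f x y) - (LINT y|M. f' y (Y n - x))) /\<^sub>R norm (Y n - x)"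
        unfolding q_def using int[OF Y(1) Y(3)] xr int' by simp
      then show ?thesis by (simp add: divide_inverse mult.commute)
    qed
    ultimately have "(\<lambda>n. norm ((LINT y|M. f (Y n) y) - (LINT y|M. f x y) - (LINT y|M. f' y (Y n - x))) / norm (Y n - x)) \<longlonglongrightarrow> 0"
      by simp
    then show "((\<lambda>z. norm ((LINT y|M. f z y) - (LINT y|M. f x y) - (LINT y|M. f' y (z - x))) / norm (z - x)) \<circ> X) \<longlonglongrightarrow> 0"
      unfolding Y_def o_def by (rule LIMSEQ_offset)
  qed
  show ?thesis using bl lim by (simp add: has_derivative_iff_norm)
qed

lemma has_vector_derivative_lebesgue_integral:
  fixes f :: "real \<Rightarrow> 'b \<Rightarrow> 'c::{banach, second_countable_topology}"
  assumes "x \<in> S" and "0 < r"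
    and "\<And>z. z \<in> S \<Longrightarrow> dist z x < r \<Longrightarrow> integrable M (f z)"
    and der: "AE y in M. ((\<lambda>z. f z y) has_vector_derivative f' y) (at x within S)"
    and meas: "f' \<in> borel_measurable M"
    and "integrable M B"
    and "AE y in M. \<forall>z\<in>S. dist z x < r \<longrightarrow> norm (f z y - f x y) \<le> B y * \<bar>z - x\<bar>"
    and bound: "AE y in M. norm (f' y) \<le> B y"
  shows "((\<lambda>z. LINT y|M. f z y) has_vector_derivative (LINT y|M. f' y)) (at x within S)"
proof -
  have "((\<lambda>z. LINT y|M. f z y) has_derivative (\<lambda>h. LINT y|M. h *\<^sub>R f' y)) (at x within S)"
  proof (rule has_derivative_lebesgue_integral[where r=r and B=B])
    show "AE y in M. ((\<lambda>z. f z y) has_derivative (\<lambda>h. h *\<^sub>R f' y)) (at x within S)"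
      using der by (simp add: has_vector_derivative_def)
    show "(\<lambda>y. h *\<^sub>R f' y) \<in> borel_measurable M" for h using meas by simp
    show "AE y in M. \<forall>h. norm (h *\<^sub>R f' y) \<le> B y * norm h"
      using bound by eventually_elim (metis abs_ge_zero mult.commute mult_right_mono norm_scaleR real_norm_def)
  qed (use assms in auto)
  then show ?thesis by (simp add: has_vector_derivative_def)
qed

text \<open>Dyadic shells: where \<open>r (Suc k) < norm x \<le> r k\<close> the integrand is at
  most \<open>r (Suc k) powr (1 - d)\<close>, while the ball of radius \<open>r k\<close> has volume
  of order \<open>r k ^ d\<close>. The products are multiples of \<open>r k\<close> and sum as a
  geometric series. For \<open>R \<le> 0\<close> the ball is empty or a point.\<close>

lemma nn_integral_norm_powr_cball:
  fixes R :: real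
  shows "(\<integral>\<^sup>+(x::'a::euclidean_space). ennreal (norm x powr (1 - real DIM('a))) * indicator (cball 0 R) x \<partial>lborel) < \<infinity>"
proof (cases "R > 0")
  case False
  have "AE x::'a in lborel. x \<noteq> 0"
    by (rule AE_lborel_singleton)
  then have "AE x::'a in lborel. ennreal (norm x powr (1 - real DIM('a))) * indicator (cball 0 R) x = 0"
  proof eventually_elim
    fix x :: 'a assume "x \<noteq> 0"
    then have "norm x > R" using False by (smt (verit) norm_le_zero_iff)
    then show "ennreal (norm x powr (1 - real DIM('a))) * indicator (cball 0 R) x = 0"
      by (simp add: indicator_def)
  qed
  then have "(\<integral>\<^sup>+(x::'a). ennreal (norm x powr (1 - real DIM('a))) * indicator (cball 0 R) x \<partial>lborel) = (\<integral>\<^sup>+(x::'a). 0 \<partial>lborel)"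
    by (rule nn_integral_cong_AE)
  then show ?thesis by simp
next
  case R: True
  define d where "d = real DIM('a)"
  have d1: "d \<ge> 1" using DIM_positive[where 'a='a] unfolding d_def by linarith
  define r where "r k = R * (1/2) ^ k" for k
  have rpos: "r k > 0" for k using R by (simp add: r_def)
  have le: "ennreal (norm x powr (1 - d)) * indicator (cball 0 R) x
      \<le> (\<Sum>k. ennreal (r (Suc k) powr (1 - d)) * indicator (cball 0 (r k)) x)" if "x \<noteq> 0" for x :: 'a
  proof (cases "x \<in> cball 0 R")
    case True
    have "r \<longlonglongrightarrow> R * 0" unfolding r_def by (intro tendsto_intros LIMSEQ_power_zero) auto
    then have "\<forall>\<^sub>F k in sequentially. r k < norm x"
      using that by (intro order_tendstoD) auto
    then have ex: "\<exists>k. r (Suc k) < norm x"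
      by (auto simp: eventually_sequentially intro: le_SucI)
    \<comment> \<open>The index of the shell that contains \<open>x\<close>: by minimality
      \<open>norm x\<close> is at most \<open>r k\<close>, and for \<open>k = 0\<close> this is
      membership in the ball of radius \<open>R\<close>.\<close>
    define k where "k = (LEAST k. r (Suc k) < norm x)"
    have k: "r (Suc k) < norm x" unfolding k_def by (rule LeastI_ex[OF ex])
    have kk: "norm x \<le> r k"
    proof (cases k)
      case 0 then show ?thesis using True by (simp add: r_def)
    next
      case (Suc j)
      then have "\<not> r (Suc j) < norm x" using not_less_Least[of j "\<lambda>k. r (Suc k) < norm x"] by (simp add: k_def)
      then show ?thesis using Suc by simp
    qed
    have "norm x powr (1 - d) \<le> r (Suc k) powr (1 - d)"
      using k rpos d1 by (intro powr_mono2') auto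
    then have "ennreal (norm x powr (1 - d)) * indicator (cball 0 R) x \<le> ennreal (r (Suc k) powr (1 - d)) * indicator (cball 0 (r k)) x"
      using kk True by (simp add: ennreal_leI)
    also have "\<dots> = (\<Sum>i\<in>{k}. ennreal (r (Suc i) powr (1 - d)) * indicator (cball 0 (r i)) x)"
      by (simp only: sum.insert sum.empty finite.emptyI empty_iff not_False_eq_True add_0_right)
    also have "\<dots> \<le> (\<Sum>i. ennreal (r (Suc i) powr (1 - d)) * indicator (cball 0 (r i)) x)"
      by (rule sum_le_suminf) (auto simp: summableI)
    finally show ?thesis .
  next
    case False
    then have "indicator (cball 0 R) x = (0::ennreal)" by (rule indicator_simps)
    then show ?thesis by (metis mult_zero_right zero_le)
  qed
  have "AE x::'a in lborel. x \<noteq> 0" by (rule AE_lborel_singleton)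
  then have "(\<integral>\<^sup>+(x::'a). ennreal (norm x powr (1 - d)) * indicator (cball 0 R) x \<partial>lborel)
    \<le> (\<integral>\<^sup>+(x::'a). (\<Sum>k. ennreal (r (Suc k) powr (1 - d)) * indicator (cball 0 (r k)) x) \<partial>lborel)"
    by (intro nn_integral_mono_AE) (rule eventually_mono, assumption, rule le)
  also have "\<dots> = (\<Sum>k. \<integral>\<^sup>+(x::'a). ennreal (r (Suc k) powr (1 - d)) * indicator (cball 0 (r k)) x \<partial>lborel)"
    by (rule nn_integral_suminf) (intro borel_measurable_times_ennreal borel_measurable_const borel_measurable_indicator, simp)
  also have "\<dots> = (\<Sum>k. ennreal (r (Suc k) powr (1 - d)) * ennreal (unit_ball_vol d * r k ^ DIM('a)))"
    by (intro suminf_cong)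
      (simp add: nn_integral_cmult_indicator emeasure_cball less_imp_le[OF rpos] d_def)
  also have "\<dots> = (\<Sum>k. ennreal (unit_ball_vol d * R * 2 powr (d - 1) * (1/2) ^ k))"
  proof (intro suminf_cong)
    fix k
    have "r (Suc k) powr (1 - d) * r k ^ DIM('a) = R * 2 powr (d - 1) * (1/2) ^ k"
    proof -
      have "r (Suc k) = r k * (1/2)" by (simp add: r_def)
      then have 1: "r (Suc k) powr (1 - d) = r k powr (1 - d) * (1/2) powr (1 - d)"
        using rpos[of k] by (simp only: powr_mult)
      have 2: "r k ^ DIM('a) = r k powr d" unfolding d_def by (rule powr_realpow[OF rpos, symmetric])
      have 3: "r k powr (1 - d) * r k powr d = r k"
        unfolding powr_add[symmetric] using rpos[of k] by simp
      have 4: "(1/2::real) powr (1 - d) = 2 powr (d - 1)"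
        by (simp only: powr_def) (simp add: ln_div algebra_simps)
      have "r (Suc k) powr (1 - d) * r k ^ DIM('a) = (r k powr (1 - d) * r k powr d) * 2 powr (d - 1)"
        unfolding 1 2 4 by (simp only: mult_ac)
      then show ?thesis unfolding 3 by (simp only: r_def mult_ac)
    qed
    then show "ennreal (r (Suc k) powr (1 - d)) * ennreal (unit_ball_vol d * r k ^ DIM('a))
      = ennreal (unit_ball_vol d * R * 2 powr (d - 1) * (1/2) ^ k)"
      using rpos[of k] by (simp add: ennreal_mult[symmetric] mult_ac d_def)
  qed
  also have "\<dots> < \<infinity>"
  proof -
    have "summable (\<lambda>k. unit_ball_vol d * R * 2 powr (d - 1) * (1/2) ^ k)"
      by (intro summable_mult summable_geometric) simp
    then have "(\<Sum>k. ennreal (unit_ball_vol d * R * 2 powr (d - 1) * (1/2) ^ k)) \<noteq> top"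
      by (rule ennreal_suminf_neq_top) (use R in \<open>simp add: d_def\<close>)
    then show ?thesis by (simp add: less_top)
  qed
  finally show ?thesis by (simp add: d_def)
qed

lemma set_integrable_norm_powr_cball:
  "integrable lborel (\<lambda>x::'a::euclidean_space. indicator (cball 0 R) x * norm x powr (1 - real DIM('a)))"
proof (rule integrableI_bounded)
  show "(\<integral>\<^sup>+(x::'a). ennreal (norm (indicator (cball 0 R) x * norm x powr (1 - real DIM('a)))) \<partial>lborel) < \<infinity>"
    using nn_integral_norm_powr_cball[where 'a='a and R=R]
    by (simp add: abs_mult ennreal_mult' mult.commute ennreal_indicator[symmetric] del: ennreal_indicator)
qed (intro borel_measurable_times borel_measurable_indicator powr_real_measurable, simp_all)

section \<open>Convolutions with locally integrable kernels\<close>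

lemma integrable_bounded_compact_support:
  fixes k :: "'a::euclidean_space \<Rightarrow> 'b::{banach, second_countable_topology}"
  assumes k: "integrable lborel (\<lambda>z. indicator (cball 0 r) z *\<^sub>R k z)"
    and [measurable]: "f \<in> borel_measurable borel" "k \<in> borel_measurable borel"
    and f: "\<And>z. \<bar>f z\<bar> \<le> M" "\<And>z. norm z > r \<Longrightarrow> f z = 0"
  shows "integrable lborel (\<lambda>z. f z *\<^sub>R k z)"
proof (rule Bochner_Integration.integrable_bound)
  show "integrable lborel (\<lambda>z. M *\<^sub>R (indicator (cball 0 r) z *\<^sub>R k z))"
    using k by (rule integrable_scaleR_right)
  show "AE z in lborel. norm (f z *\<^sub>R k z) \<le> norm (M *\<^sub>R (indicator (cball 0 r) z *\<^sub>R k z))"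
  proof (rule AE_I2)
    fix z
    have "0 \<le> M" using f(1)[of z] by linarith
    show "norm (f z *\<^sub>R k z) \<le> norm (M *\<^sub>R (indicator (cball 0 r) z *\<^sub>R k z))"
    proof (cases "norm z > r")
      case True then show ?thesis by (simp only: f(2)) simp
    next
      case False
      then have "indicator (cball 0 r) z = (1::real)" by (simp add: indicator_def)
      then show ?thesis using f(1)[of z] \<open>0 \<le> M\<close> by (simp add: mult_right_mono)
    qed
  qed
qed simp

text \<open>In the form \<open>f (x - z) *\<^sub>R k z\<close> the singular factor stays fixed and
  only the continuous one moves with \<open>x\<close>. A convergent sequence is bounded by some
  \<open>b\<close>, so all the integrands live on the ball of radius \<open>b + R\<close>, where
  \<open>k\<close> is integrable.\<close>

lemma convolution_continuous:
  fixes f :: "'a::euclidean_space \<Rightarrow> real" and k :: "'a \<Rightarrow> 'b::{banach, second_countable_topology}"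
  assumes k: "\<And>r. integrable lborel (\<lambda>z. indicator (cball 0 r) z *\<^sub>R k z)"
    and km[measurable]: "k \<in> borel_measurable borel"
    and fc: "continuous_on UNIV f"
    and f: "\<And>z. \<bar>f z\<bar> \<le> M" "\<And>z. norm z > R \<Longrightarrow> f z = 0"
  shows "continuous_on UNIV (\<lambda>x. LINT z|lborel. f (x - z) *\<^sub>R k z)"
proof (rule continuous_at_imp_continuous_on, rule ballI)
  fix x :: 'a
  have fm[measurable]: "f \<in> borel_measurable borel" using fc by (rule borel_measurable_continuous_onI)
  have M: "0 \<le> M" using f(1)[of 0] by linarith
  show "isCont (\<lambda>x. LINT z|lborel. f (x - z) *\<^sub>R k z) x"
    unfolding continuous_at_sequentially o_def
  proof (intro allI impI)
    fix X assume X: "X \<longlonglongrightarrow> x"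
    then have "bounded (range X)" by (rule convergent_imp_bounded)
    then obtain b where b: "\<And>n. norm (X n) \<le> b" unfolding bounded_iff by auto
    let ?w = "\<lambda>z. norm (M *\<^sub>R (indicator (cball 0 (b + R)) z *\<^sub>R k z))"
    show "(\<lambda>n. LINT z|lborel. f (X n - z) *\<^sub>R k z) \<longlonglongrightarrow> (LINT z|lborel. f (x - z) *\<^sub>R k z)"
    proof (rule integral_dominated_convergence[where w="?w"])
      show "integrable lborel ?w" using k by (intro integrable_norm integrable_scaleR_right)
      show "AE z in lborel. (\<lambda>n. f (X n - z) *\<^sub>R k z) \<longlonglongrightarrow> f (x - z) *\<^sub>R k z"
      proof (intro AE_I2 tendsto_intros)
        fix z
        have "isCont f (x - z)" using fc by (simp add: continuous_on_eq_continuous_at)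
        then show "(\<lambda>n. f (X n - z)) \<longlonglongrightarrow> f (x - z)"
          by (rule isCont_tendsto_compose) (intro tendsto_intros X)
      qed
      show "AE z in lborel. norm (f (X n - z) *\<^sub>R k z) \<le> ?w z" for n
      proof (rule AE_I2)
        fix z
        show "norm (f (X n - z) *\<^sub>R k z) \<le> ?w z"
        proof (cases "norm (X n - z) > R")
          case True then show ?thesis by (simp only: f(2)) simp
        next
          case False
          have "norm z \<le> norm (X n) + norm (X n - z)" by (metis add.commute norm_minus_commute norm_triangle_sub)
          then have "indicator (cball 0 (b + R)) z = (1::real)" using False b[of n] by (simp add: indicator_def)
          then show ?thesis using f(1)[of "X n - z"] M by (simp add: mult_right_mono)
        qed
      qed
    qed measurable
  qed
qed

text \<open>The derivative falls on the regular factor \<open>f\<close>, so local integrability of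
  \<open>k\<close> suffices. For \<open>y\<close> within distance 1 of \<open>x\<close>, the
  supports of all \<open>f (y - z)\<close> lie in the ball of radius \<open>norm x + R + 1\<close>,
  which provides one majorant.\<close>

lemma convolution_has_derivative:
  fixes f :: "'a::euclidean_space \<Rightarrow> real" and k :: "'a \<Rightarrow> 'b::{banach, second_countable_topology}"
  assumes k: "\<And>r. integrable lborel (\<lambda>z. indicator (cball 0 r) z *\<^sub>R k z)"
    and km[measurable]: "k \<in> borel_measurable borel"
    and f': "\<And>x. (f has_derivative f' x) (at x)"
    and f'm: "\<And>h. (\<lambda>x. f' x h) \<in> borel_measurable borel"
    and M: "\<And>x h. \<bar>f' x h\<bar> \<le> M * norm h"
    and R: "\<And>z. norm z > R \<Longrightarrow> f z = 0"
  shows "((\<lambda>x. LINT z|lborel. f (x - z) *\<^sub>R k z) has_derivative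
      (\<lambda>h. LINT z|lborel. f' (x - z) h *\<^sub>R k z)) (at x)"
proof (rule has_derivative_lebesgue_integral[where r=1
      and B="\<lambda>z. norm (M *\<^sub>R (indicator (cball 0 (norm x + R + 1)) z *\<^sub>R k z))"])
  have M0: "0 \<le> M"
  proof -
    obtain b :: 'a where "b \<in> Basis" using nonempty_Basis by (meson ex_in_conv)
    then show ?thesis using M[of 0 b] by simp
  qed
  have fc: "continuous_on UNIV f"
    using f' by (meson continuous_at_imp_continuous_on has_derivative_continuous)
  have fm[measurable]: "f \<in> borel_measurable borel" using fc by (rule borel_measurable_continuous_onI)
  have lip: "\<bar>f a - f b\<bar> \<le> M * norm (a - b)" for a b
  proof -
    have "norm (f a - f b) \<le> M * norm (a - b)"
    proof (rule differentiable_bound[of UNIV f f'])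
      show "(f has_derivative f' z) (at z within UNIV)" for z using f' by simp
      show "onorm (f' z) \<le> M" for z using M by (intro onorm_le) (simp add: mult.commute)
    qed auto
    then show ?thesis by simp
  qed
  have cs: "compact (cball (0::'a) R)" by simp
  have "bounded (f ` cball 0 R)"
    by (intro compact_imp_bounded compact_continuous_image cs continuous_on_subset[OF fc]) auto
  then obtain A where "\<forall>z\<in>cball 0 R. \<bar>f z\<bar> \<le> A" by (auto simp: bounded_iff)
  then have A: "\<And>z. norm z \<le> R \<Longrightarrow> \<bar>f z\<bar> \<le> A" by simp
  have fb: "\<bar>f z\<bar> \<le> \<bar>A\<bar>" for z
    using A[of z] R[of z] by (cases "norm z > R") auto
  have f'0: "f' z h = 0" if "norm z > R" for z h
  proof -
    have "open (- cball (0::'a) R)" by (intro open_Compl closed_cball)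
    moreover have "z \<in> - cball 0 R" using that by simp
    ultimately have "(f has_derivative (\<lambda>h. 0)) (at z)"
      by (intro has_derivative_transform_within_open[OF has_derivative_const[of 0]]) (auto simp: R)
    then have "f' z = (\<lambda>h. 0)" using f' has_derivative_unique by blast
    then show ?thesis by simp
  qed
  have ind: "indicator (cball 0 (norm x + R + 1)) z = (1::real)" if "norm (y - z) \<le> R" "dist y x < 1" for y z
  proof -
    have "norm z \<le> norm (z - y) + norm (y - x) + norm x"
      by (metis add.commute add_left_mono norm_triangle_sub order_trans diff_add_cancel norm_triangle_ineq add.assoc)
    then show ?thesis using that by (simp add: indicator_def dist_norm norm_minus_commute)
  qed
  show "integrable lborel (\<lambda>z. f (y - z) *\<^sub>R k z)" for y
  proof (rule integrable_bounded_compact_support[OF k])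
    show "\<bar>f (y - z)\<bar> \<le> \<bar>A\<bar>" for z by (rule fb)
    show "f (y - z) = 0" if "norm z > norm y + R" for z
    proof (rule R)
      have "norm z \<le> norm y + norm (y - z)" by (metis add.commute norm_minus_commute norm_triangle_sub)
      then show "R < norm (y - z)" using that by simp
    qed
  qed measurable
  show "AE z in lborel. ((\<lambda>y. f (y - z) *\<^sub>R k z) has_derivative (\<lambda>h. f' (x - z) h *\<^sub>R k z)) (at x)"
  proof (rule AE_I2)
    fix z
    have "((\<lambda>y. f (y - z)) has_derivative (\<lambda>h. f' (x - z) h)) (at x)"
    proof (rule has_derivative_compose[of "\<lambda>y. y - z" "\<lambda>h. h"])
      show "((\<lambda>y. y - z) has_derivative (\<lambda>h. h)) (at x)" by (auto intro!: derivative_eq_intros)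
    qed (rule f')
    then show "((\<lambda>y. f (y - z) *\<^sub>R k z) has_derivative (\<lambda>h. f' (x - z) h *\<^sub>R k z)) (at x)"
      by (rule has_derivative_scaleR_left)
  qed
  show "(\<lambda>z. f' (x - z) h *\<^sub>R k z) \<in> borel_measurable lborel" for h
    using f'm[of h] by measurable
  show "integrable lborel (\<lambda>z. norm (M *\<^sub>R (indicator (cball 0 (norm x + R + 1)) z *\<^sub>R k z)))"
    using k by (intro integrable_norm integrable_scaleR_right)
  show "AE z in lborel. \<forall>y\<in>UNIV. dist y x < 1 \<longrightarrow> norm (f (y - z) *\<^sub>R k z - f (x - z) *\<^sub>R k z)
      \<le> norm (M *\<^sub>R (indicator (cball 0 (norm x + R + 1)) z *\<^sub>R k z)) * norm (y - x)"
  proof (intro AE_I2 ballI impI)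
    fix z y assume d: "dist y x < 1"
    show "norm (f (y - z) *\<^sub>R k z - f (x - z) *\<^sub>R k z)
      \<le> norm (M *\<^sub>R (indicator (cball 0 (norm x + R + 1)) z *\<^sub>R k z)) * norm (y - x)"
    proof (cases "norm (y - z) \<le> R \<or> norm (x - z) \<le> R")
      case True
      then have i: "indicator (cball 0 (norm x + R + 1)) z = (1::real)" using ind[of y z] ind[of x z] d by auto
      have "norm (f (y - z) *\<^sub>R k z - f (x - z) *\<^sub>R k z) = \<bar>f (y - z) - f (x - z)\<bar> * norm (k z)"
        by (simp add: scaleR_left_diff_distrib[symmetric])
      also have "\<dots> \<le> (M * norm (y - x)) * norm (k z)"
        using lip[of "y - z" "x - z"] by (intro mult_right_mono) auto
      finally show ?thesis using i M0 by (simp add: mult_ac)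
    next
      case False
      then have "f (y - z) = 0" "f (x - z) = 0" using R by auto
      then show ?thesis by simp
    qed
  qed
  show "AE z in lborel. \<forall>h. norm (f' (x - z) h *\<^sub>R k z)
      \<le> norm (M *\<^sub>R (indicator (cball 0 (norm x + R + 1)) z *\<^sub>R k z)) * norm h"
  proof (intro AE_I2 allI)
    fix z h
    show "norm (f' (x - z) h *\<^sub>R k z)
      \<le> norm (M *\<^sub>R (indicator (cball 0 (norm x + R + 1)) z *\<^sub>R k z)) * norm h"
    proof (cases "norm (x - z) \<le> R")
      case True
      then have i: "indicator (cball 0 (norm x + R + 1)) z = (1::real)" using ind[of x z] by auto
      have "\<bar>f' (x - z) h\<bar> * norm (k z) \<le> (M * norm h) * norm (k z)"
        using M by (intro mult_right_mono) auto
      then show ?thesis using i M0 by (simp add: mult_ac)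
    qed (simp add: f'0)
  qed
qed auto

section \<open>Lipschitz functions and integration by parts\<close>

lemma lipschitz_on_normI:
  fixes f :: "'a::real_normed_vector \<Rightarrow> 'b::real_normed_vector"
  shows "0 \<le> L \<Longrightarrow> (\<And>x y. norm (f x - f y) \<le> L * norm (x - y)) \<Longrightarrow> L-lipschitz_on UNIV f"
  by (simp add: lipschitz_on_def dist_norm)

lemma lipschitz_on_normD:
  fixes f :: "'a::real_normed_vector \<Rightarrow> 'b::real_normed_vector"
  shows "L-lipschitz_on UNIV f \<Longrightarrow> norm (f x - f y) \<le> L * norm (x - y)"
  by (simp add: lipschitz_on_def dist_norm)

lemma directional_derivative_LIMSEQ:
  fixes f :: "'a::real_normed_vector \<Rightarrow> 'b::real_normed_vector"
  assumes f': "(f has_derivative f') (at x)"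
  shows "(\<lambda>n. real (Suc n) *\<^sub>R (f (x + (1 / real (Suc n)) *\<^sub>R h) - f x)) \<longlonglongrightarrow> f' h"
proof (cases "h = 0")
  case True
  then show ?thesis using has_derivative_bounded_linear[OF f'] by (simp add: linear_simps)
next
  case False
  let ?k = "\<lambda>n. (1 / real (Suc n)) *\<^sub>R h"
  have lin: "f' (c *\<^sub>R z) = c *\<^sub>R f' z" for c z
    using has_derivative_bounded_linear[OF f'] by (rule linear_cmul[OF bounded_linear.linear])
  have "((\<lambda>k. norm (f (x + k) - f x - f' k) / norm k) \<longlongrightarrow> 0) (at 0)"
    using f' by (simp add: has_derivative_at)
  moreover have "filterlim ?k (at 0) sequentially"
    unfolding filterlim_at
  proof
    have "?k \<longlonglongrightarrow> 0 *\<^sub>R h" by (rule tendsto_scaleR[OF LIMSEQ_Suc[OF lim_1_over_n] tendsto_const])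
    then show "?k \<longlonglongrightarrow> 0" by simp
  qed (use False in auto)
  ultimately have "(\<lambda>n. norm (f (x + ?k n) - f x - f' (?k n)) / norm (?k n)) \<longlonglongrightarrow> 0"
    by (rule filterlim_compose)
  then have "(\<lambda>n. norm (f (x + ?k n) - f x - f' (?k n)) / norm (?k n) * norm h) \<longlonglongrightarrow> 0 * norm h"
    by (intro tendsto_mult tendsto_const)
  moreover have "norm (f (x + ?k n) - f x - f' (?k n)) / norm (?k n) * norm h
      = norm (real (Suc n) *\<^sub>R (f (x + ?k n) - f x) - f' h)" for n
  proof -
    have "real (Suc n) *\<^sub>R (f (x + ?k n) - f x) - f' h = real (Suc n) *\<^sub>R (f (x + ?k n) - f x - f' (?k n))"
      unfolding lin scaleR_diff_right[of "real (Suc n)" "f (x + ?k n) - f x"] by simp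
    then show ?thesis using False by simp
  qed
  ultimately have "(\<lambda>n. norm (real (Suc n) *\<^sub>R (f (x + ?k n) - f x) - f' h)) \<longlonglongrightarrow> 0" by simp
  then show ?thesis by (simp add: tendsto_norm_zero_iff LIM_zero_iff)
qed

lemma lipschitz_imp_derivative_le:
  fixes f :: "'a::real_normed_vector \<Rightarrow> 'b::real_normed_vector"
  assumes L: "L-lipschitz_on UNIV f" and f': "(f has_derivative f') (at x)"
  shows "norm (f' h) \<le> L * norm h"
proof (rule LIMSEQ_le_const2)
  show "(\<lambda>n. norm (real (Suc n) *\<^sub>R (f (x + (1 / real (Suc n)) *\<^sub>R h) - f x))) \<longlonglongrightarrow> norm (f' h)"
    by (intro tendsto_norm directional_derivative_LIMSEQ f')
  have "norm (real (Suc n) *\<^sub>R (f (x + (1 / real (Suc n)) *\<^sub>R h) - f x)) \<le> L * norm h" for n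
  proof -
    have "norm (f (x + (1 / real (Suc n)) *\<^sub>R h) - f x) \<le> L * ((1 / real (Suc n)) * norm h)"
      using lipschitz_on_normD[OF L, of "x + (1 / real (Suc n)) *\<^sub>R h" x] by simp
    then have "real (Suc n) * norm (f (x + (1 / real (Suc n)) *\<^sub>R h) - f x) \<le> real (Suc n) * (L * ((1 / real (Suc n)) * norm h))"
      by (rule mult_left_mono) simp
    then show ?thesis by simp
  qed
  then show "\<exists>N. \<forall>n\<ge>N. norm (real (Suc n) *\<^sub>R (f (x + (1 / real (Suc n)) *\<^sub>R h) - f x)) \<le> L * norm h" by blast
qed

text \<open>A derivative that exists everywhere may be discontinuous, but it is the pointwise limit
  of difference quotients of a continuous function. The direction may vary with the point, as it
  does in \<open>W' x (v x)\<close>.\<close>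

lemma borel_measurable_directional_derivative:
  fixes f :: "'a::euclidean_space \<Rightarrow> 'b::euclidean_space"
  assumes f': "\<And>x. (f has_derivative f' x) (at x)" and h[measurable]: "h \<in> borel_measurable borel"
  shows "(\<lambda>x. f' x (h x)) \<in> borel_measurable borel"
proof (rule borel_measurable_LIMSEQ_metric)
  have [measurable]: "f \<in> borel_measurable borel"
    by (intro borel_measurable_continuous_onI continuous_at_imp_continuous_on ballI has_derivative_continuous[OF f'])
  show "(\<lambda>x. real (Suc n) *\<^sub>R (f (x + (1 / real (Suc n)) *\<^sub>R h x) - f x)) \<in> borel_measurable borel" for n
    by measurable
  show "(\<lambda>n. real (Suc n) *\<^sub>R (f (x + (1 / real (Suc n)) *\<^sub>R h x) - f x)) \<longlonglongrightarrow> f' x (h x)" for x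
    by (rule directional_derivative_LIMSEQ[OF f'])
qed

text \<open>By translation invariance the integral of \<open>F (s *\<^sub>R b + x)\<close> over
  \<open>x\<close> does not depend on \<open>s\<close>; differentiating it at \<open>s = 0\<close>
  under the integral gives the claim. The Lipschitz constant supplies the majorant, so
  \<open>F'\<close> may be discontinuous.\<close>

lemma integral_directional_derivative_eq_0:
  fixes F :: "'a::euclidean_space \<Rightarrow> real"
  assumes L: "L-lipschitz_on UNIV F" and R: "\<And>x. norm x > R \<Longrightarrow> F x = 0"
    and F': "\<And>x. (F has_derivative F' x) (at x)"
  shows "integrable lborel (\<lambda>x. F' x b)" "(LINT x|lborel. F' x b) = 0"
proof -
  have L0: "0 \<le> L" using L by (rule lipschitz_on_nonneg)
  have Fc: "continuous_on UNIV F" using L by (rule lipschitz_on_continuous_on)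
  have [measurable]: "F \<in> borel_measurable borel" using Fc by (rule borel_measurable_continuous_onI)
  have F'm[measurable]: "(\<lambda>x. F' x b) \<in> borel_measurable borel"
    by (rule borel_measurable_directional_derivative[OF F' measurable_const]) simp
  \<comment> \<open>When the shift \<open>s\<close> has absolute value below 1, both
    \<open>F x\<close> and its shifted value vanish for \<open>x\<close> outside this ball.\<close>
  define B where "B x = (L * norm b) * indicator (cball 0 (\<bar>R\<bar> + norm b + 1)) x" for x :: 'a
  have Bi: "integrable lborel B"
    unfolding B_def by (intro integrable_mult_right integrable_real_indicator) (simp_all add: emeasure_lborel_cball_finite[unfolded infinity_ennreal_def])
  have Fint: "integrable lborel F"
  proof -
    have cs: "compact (cball (0::'a) \<bar>R\<bar>)" by simp
    have "integrable lborel (\<lambda>x. indicator (cball 0 \<bar>R\<bar>) x *\<^sub>R F x)"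
      by (intro borel_integrable_compact cs continuous_on_subset[OF Fc]) auto
    also have "(\<lambda>x. indicator (cball 0 \<bar>R\<bar>) x *\<^sub>R F x) = F"
      using R by (auto simp: indicator_def fun_eq_iff)
    finally show ?thesis .
  qed
  have trans: "integrable lborel (\<lambda>x. F (s *\<^sub>R b + x))" "(LINT x|lborel. F (s *\<^sub>R b + x)) = (LINT x|lborel. F x)" for s
  proof -
    have "integrable (distr lborel borel ((+) (s *\<^sub>R b))) F" using Fint by (simp add: lborel_distr_plus)
    then show "integrable lborel (\<lambda>x. F (s *\<^sub>R b + x))" by (subst (asm) integrable_distr_eq) auto
    have "(LINT x|lborel. F x) = (LINT x|distr lborel borel ((+) (s *\<^sub>R b)). F x)" by (simp add: lborel_distr_plus)
    also have "\<dots> = (LINT x|lborel. F (s *\<^sub>R b + x))" by (rule integral_distr) auto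
    finally show "(LINT x|lborel. F (s *\<^sub>R b + x)) = (LINT x|lborel. F x)" by simp
  qed
  have Bge: "L * norm b \<le> B x" if "norm x \<le> \<bar>R\<bar> + norm b + 1" for x
    using that by (simp add: B_def)
  have F'bd: "norm (F' x b) \<le> B x" for x
  proof (cases "norm x > R")
    case True
    have "open (- cball (0::'a) R)" by (intro open_Compl closed_cball)
    moreover have "x \<in> - cball 0 R" using True by simp
    ultimately have "(F has_derivative (\<lambda>h. 0)) (at x)"
      by (intro has_derivative_transform_within_open[OF has_derivative_const[of 0]]) (auto simp: R)
    then have "F' x = (\<lambda>h. 0)" using F' has_derivative_unique by blast
    then show ?thesis using L0 by (simp add: B_def)
  next
    case False
    then have "norm x \<le> \<bar>R\<bar> + norm b + 1" using norm_ge_zero[of b] by linarith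
    then show ?thesis using lipschitz_imp_derivative_le[OF L F', of x b] Bge[of x] by linarith
  qed
  show "integrable lborel (\<lambda>x. F' x b)"
    by (rule Bochner_Integration.integrable_bound[OF Bi]) (use F'bd in \<open>auto intro: order_trans[OF _ abs_ge_self]\<close>)
  have "((\<lambda>s. LINT x|lborel. F (s *\<^sub>R b + x)) has_vector_derivative (LINT x|lborel. F' x b)) (at 0)"
  proof (rule has_vector_derivative_lebesgue_integral[where r=1 and B=B])
    show "AE x in lborel. ((\<lambda>s. F (s *\<^sub>R b + x)) has_vector_derivative F' x b) (at 0)"
    proof (rule AE_I2)
      fix x
      have "((\<lambda>s. F (s *\<^sub>R b + x)) has_derivative (\<lambda>s. F' x (s *\<^sub>R b))) (at 0)"
      proof (rule has_derivative_compose[of "\<lambda>s. s *\<^sub>R b + x" "\<lambda>s. s *\<^sub>R b"])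
        show "((\<lambda>s. s *\<^sub>R b + x) has_derivative (\<lambda>s. s *\<^sub>R b)) (at 0)" by (auto intro!: derivative_eq_intros)
        show "(F has_derivative F' x) (at (0 *\<^sub>R b + x))" using F' by simp
      qed
      then show "((\<lambda>s. F (s *\<^sub>R b + x)) has_vector_derivative F' x b) (at 0)"
        using linear_cmul[OF bounded_linear.linear[OF has_derivative_bounded_linear[OF F'[of x]]]]
        by (simp add: has_vector_derivative_def)
    qed
    show "AE x in lborel. \<forall>s\<in>UNIV. dist s 0 < 1 \<longrightarrow> norm (F (s *\<^sub>R b + x) - F (0 *\<^sub>R b + x)) \<le> B x * \<bar>s - 0\<bar>"
    proof (intro AE_I2 ballI impI)
      fix x and s :: real assume s: "dist s 0 < 1"
      have 1: "norm (F (s *\<^sub>R b + x) - F x) \<le> L * norm b * \<bar>s\<bar>"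
        using lipschitz_on_normD[OF L, of "s *\<^sub>R b + x" x] by (simp add: mult_ac)
      show "norm (F (s *\<^sub>R b + x) - F (0 *\<^sub>R b + x)) \<le> B x * \<bar>s - 0\<bar>"
      proof (cases "norm x \<le> \<bar>R\<bar> + norm b + 1")
        case True
        show ?thesis using 1 mult_right_mono[OF Bge[OF True], of "\<bar>s\<bar>"] by simp
      next
        case False
        have "norm x \<le> norm (s *\<^sub>R b + x) + norm (s *\<^sub>R b)"
          by (metis add.commute add_diff_cancel_right' norm_triangle_sub order_trans norm_triangle_ineq4)
        moreover have "norm (s *\<^sub>R b) \<le> norm b" using s by (simp add: mult_left_le_one_le)
        ultimately have "norm (s *\<^sub>R b + x) > R" "norm x > R" using False norm_ge_zero[of b] by linarith+
        then show ?thesis using R L0 by (simp add: B_def)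
      qed
    qed
    show "AE x in lborel. norm (F' x b) \<le> B x" using F'bd by simp
  qed (use trans Bi in auto)
  moreover have "((\<lambda>s. LINT x|lborel. F (s *\<^sub>R b + x)) has_vector_derivative 0) (at 0)"
    unfolding trans by simp
  ultimately show "(LINT x|lborel. F' x b) = 0" by (rule vector_derivative_unique_at)
qed

section \<open>Integration by parts for compactly supported Lipschitz fields\<close>

lemma integrable_bounded_cball:
  fixes f :: "'a::euclidean_space \<Rightarrow> real"
  assumes f[measurable]: "f \<in> borel_measurable borel" and "\<And>z. \<bar>f z\<bar> \<le> M" "\<And>z. norm z > r \<Longrightarrow> f z = 0"
  shows "integrable lborel f"
proof -
  have "integrable lborel (\<lambda>z. f z *\<^sub>R (1::real))"
  proof (rule integrable_bounded_compact_support[OF _ f _ assms(2,3)])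
    show "integrable lborel (\<lambda>z::'a. indicator (cball 0 r) z *\<^sub>R (1::real))"
      by (simp add: integrable_real_indicator emeasure_lborel_cball_finite[unfolded infinity_ennreal_def])
  qed simp
  then show ?thesis by simp
qed

lemma has_derivative_eq_0_outside:
  fixes f :: "'a::real_normed_vector \<Rightarrow> 'b::real_normed_vector"
  assumes R: "\<And>x. norm x > R \<Longrightarrow> f x = 0" and f': "(f has_derivative f') (at x)" and x: "norm x > R"
  shows "f' = (\<lambda>h. 0)"
proof -
  have "open (- cball (0::'a) R)" by (intro open_Compl closed_cball)
  moreover have "x \<in> - cball 0 R" using x by simp
  ultimately have "(f has_derivative (\<lambda>h. 0)) (at x)"
    by (intro has_derivative_transform_within_open[OF has_derivative_const[of 0]]) (auto simp: R)
  then show ?thesis using f' has_derivative_unique by blast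
qed

text \<open>For each basis vector \<open>b\<close> the product
  \<open>W x * (v x \<bullet> b)\<close> is Lipschitz with bounded support, so the integral of its
  derivative in direction \<open>b\<close> vanishes. Summing over \<open>b\<close> reassembles
  \<open>W' x (v x)\<close> and the divergence of \<open>v\<close>.\<close>

lemma integral_by_parts_divergence:
  fixes W :: "'a::euclidean_space \<Rightarrow> real" and v :: "'a \<Rightarrow> 'a"
  assumes W: "L-lipschitz_on UNIV W" "\<And>x. \<bar>W x\<bar> \<le> M" "\<And>x. (W has_derivative W' x) (at x)"
    and v: "K-lipschitz_on UNIV v" "\<And>x. norm (v x) \<le> V" "\<And>x. (v has_derivative v' x) (at x)"
    and R: "\<And>x. norm x > R \<Longrightarrow> v x = 0"
  shows "integrable lborel (\<lambda>x. W' x (v x))"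
    and "integrable lborel (\<lambda>x. \<Sum>b\<in>Basis. v' x b \<bullet> b)"
    and "integrable lborel (\<lambda>x. W x * (\<Sum>b\<in>Basis. v' x b \<bullet> b))"
    and "(LINT x|lborel. W' x (v x)) = - (LINT x|lborel. W x * (\<Sum>b\<in>Basis. v' x b \<bullet> b))"
proof -
  have nn: "0 \<le> L" "0 \<le> K" "0 \<le> M" "0 \<le> V"
    using lipschitz_on_nonneg[OF W(1)] lipschitz_on_nonneg[OF v(1)] W(2)[of 0] v(2)[of 0]
      norm_ge_zero[of "v 0"] by linarith+
  have Wm[measurable]: "W \<in> borel_measurable borel"
    by (intro borel_measurable_continuous_onI lipschitz_on_continuous_on[OF W(1)])
  have vm[measurable]: "v \<in> borel_measurable borel"
    by (intro borel_measurable_continuous_onI lipschitz_on_continuous_on[OF v(1)])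
  have W'v_m: "(\<lambda>x. W' x (v x)) \<in> borel_measurable borel"
    by (rule borel_measurable_directional_derivative[OF W(3) vm])
  have v'm: "(\<lambda>x. v' x b) \<in> borel_measurable borel" for b
    by (rule borel_measurable_directional_derivative[OF v(3) measurable_const]) simp
  have lin: "linear (W' x)" for x using W(3) by (meson bounded_linear.linear has_derivative_bounded_linear)
  show Wi: "integrable lborel (\<lambda>x. W' x (v x))"
  proof (rule integrable_bounded_cball[OF W'v_m, where M="L * V" and r=R])
    show "\<bar>W' x (v x)\<bar> \<le> L * V" for x
      using lipschitz_imp_derivative_le[OF W(1) W(3), of x "v x"] mult_left_mono[OF v(2)[of x] nn(1)] by simp
    show "W' x (v x) = 0" if "norm x > R" for x using R[OF that] lin by (simp add: linear_0)
  qed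
  have divm: "(\<lambda>x. \<Sum>b\<in>Basis. v' x b \<bullet> b) \<in> borel_measurable borel" using v'm by measurable
  have divb: "\<bar>\<Sum>b\<in>Basis. v' x b \<bullet> b\<bar> \<le> real DIM('a) * K" for x
  proof -
    have "\<bar>\<Sum>b\<in>Basis. v' x b \<bullet> b\<bar> \<le> (\<Sum>b\<in>(Basis::'a set). \<bar>v' x b \<bullet> b\<bar>)" by (rule sum_abs)
    also have "\<dots> \<le> (\<Sum>b\<in>(Basis::'a set). K)"
    proof (rule sum_mono)
      fix b :: 'a assume b: "b \<in> Basis"
      have "\<bar>v' x b \<bullet> b\<bar> \<le> norm (v' x b)" by (rule Basis_le_norm[OF b])
      also have "\<dots> \<le> K * norm b" by (rule lipschitz_imp_derivative_le[OF v(1) v(3)])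
      finally show "\<bar>v' x b \<bullet> b\<bar> \<le> K" using b by simp
    qed
    finally show ?thesis by simp
  qed
  have div0: "(\<Sum>b\<in>Basis. v' x b \<bullet> b) = 0" if "norm x > R" for x
    using has_derivative_eq_0_outside[OF R v(3) that] by simp
  show divi: "integrable lborel (\<lambda>x. \<Sum>b\<in>Basis. v' x b \<bullet> b)"
    by (rule integrable_bounded_cball[OF divm divb div0])
  show Wdivi: "integrable lborel (\<lambda>x. W x * (\<Sum>b\<in>Basis. v' x b \<bullet> b))"
  proof (rule integrable_bounded_cball)
    show "(\<lambda>x. W x * (\<Sum>b\<in>Basis. v' x b \<bullet> b)) \<in> borel_measurable borel" using divm by measurable
    show "\<bar>W x * (\<Sum>b\<in>Basis. v' x b \<bullet> b)\<bar> \<le> M * (real DIM('a) * K)" for x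
      unfolding abs_mult using W(2)[of x] divb[of x] nn by (intro mult_mono) auto
    show "W x * (\<Sum>b\<in>Basis. v' x b \<bullet> b) = 0" if "norm x > R" for x using div0[OF that] by simp
  qed
  have F: "integrable lborel (\<lambda>x. W' x b * (v x \<bullet> b) + W x * (v' x b \<bullet> b))"
    "(LINT x|lborel. W' x b * (v x \<bullet> b) + W x * (v' x b \<bullet> b)) = 0" if b: "b \<in> Basis" for b
  proof -
    have lipF: "(M * K + L * V)-lipschitz_on UNIV (\<lambda>x. W x * (v x \<bullet> b))"
    proof (rule lipschitz_on_normI)
      show "0 \<le> M * K + L * V" using nn by simp
      fix x y
      have "W x * (v x \<bullet> b) - W y * (v y \<bullet> b) = W x * ((v x - v y) \<bullet> b) + (W x - W y) * (v y \<bullet> b)"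
        by (simp add: algebra_simps)
      then have "norm (W x * (v x \<bullet> b) - W y * (v y \<bullet> b)) \<le> \<bar>W x\<bar> * \<bar>(v x - v y) \<bullet> b\<bar> + \<bar>W x - W y\<bar> * \<bar>v y \<bullet> b\<bar>"
        by (metis abs_mult abs_triangle_ineq real_norm_def)
      also have "\<dots> \<le> M * (K * norm (x - y)) + (L * norm (x - y)) * V"
      proof (intro add_mono mult_mono)
        show "\<bar>(v x - v y) \<bullet> b\<bar> \<le> K * norm (x - y)"
          using Basis_le_norm[OF b, of "v x - v y"] lipschitz_on_normD[OF v(1), of x y] by linarith
        show "\<bar>W x - W y\<bar> \<le> L * norm (x - y)" using lipschitz_on_normD[OF W(1), of x y] by simp
        show "\<bar>v y \<bullet> b\<bar> \<le> V" using Basis_le_norm[OF b, of "v y"] v(2)[of y] by linarith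
      qed (use nn W(2) in auto)
      finally show "norm (W x * (v x \<bullet> b) - W y * (v y \<bullet> b)) \<le> (M * K + L * V) * norm (x - y)"
        by (simp add: algebra_simps)
    qed
    have der: "((\<lambda>x. W x * (v x \<bullet> b)) has_derivative (\<lambda>h. W' x h * (v x \<bullet> b) + W x * (v' x h \<bullet> b))) (at x)" for x
      by (rule derivative_eq_intros W(3) v(3) refl | simp add: fun_eq_iff)+
    have z: "W x * (v x \<bullet> b) = 0" if "norm x > R" for x using R[OF that] by simp
    show "integrable lborel (\<lambda>x. W' x b * (v x \<bullet> b) + W x * (v' x b \<bullet> b))"
      "(LINT x|lborel. W' x b * (v x \<bullet> b) + W x * (v' x b \<bullet> b)) = 0"
      using integral_directional_derivative_eq_0[OF lipF z der] by auto
  qed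
  have "W' x (v x) + W x * (\<Sum>b\<in>Basis. v' x b \<bullet> b) = (\<Sum>b\<in>Basis. W' x b * (v x \<bullet> b) + W x * (v' x b \<bullet> b))" for x
  proof -
    have "W' x (v x) = W' x (\<Sum>b\<in>Basis. (v x \<bullet> b) *\<^sub>R b)" by (simp add: euclidean_representation)
    also have "\<dots> = (\<Sum>b\<in>Basis. (v x \<bullet> b) *\<^sub>R W' x b)"
      by (simp add: linear_sum[OF lin] linear_cmul[OF lin])
    finally show ?thesis by (simp add: sum.distrib sum_distrib_left mult.commute)
  qed
  then have "(LINT x|lborel. W' x (v x) + W x * (\<Sum>b\<in>Basis. v' x b \<bullet> b))
      = (LINT x|lborel. (\<Sum>b\<in>Basis. W' x b * (v x \<bullet> b) + W x * (v' x b \<bullet> b)))" by simp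
  also have "\<dots> = (\<Sum>b\<in>Basis. LINT x|lborel. W' x b * (v x \<bullet> b) + W x * (v' x b \<bullet> b))"
    by (rule Bochner_Integration.integral_sum) (rule F(1))
  also have "\<dots> = 0" using F(2) by simp
  finally show "(LINT x|lborel. W' x (v x)) = - (LINT x|lborel. W x * (\<Sum>b\<in>Basis. v' x b \<bullet> b))"
    using Wi Wdivi by simp
qed

text \<open>This profile makes the square of \<open>max 0 (m^2 - |z|^2)\<close> a compactly
  supported bump that is differentiable everywhere; one derivative is enough for the mollifier
  below.\<close>

lemma has_real_derivative_max_0_square:
  "((\<lambda>s::real. (max 0 s)\<^sup>2) has_real_derivative 2 * max 0 s) (at s)"
proof -
  consider "s < 0" | "s > 0" | "s = 0" by linarith
  then show ?thesis
  proof cases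
    case 1
    have "((\<lambda>s::real. (max 0 s)\<^sup>2) has_real_derivative 0) (at s)"
      by (rule has_field_derivative_transform_within_open[OF DERIV_const[of 0], of "{..<0}"]) (use 1 in auto)
    then show ?thesis using 1 by simp
  next
    case 2
    have "((\<lambda>s::real. s\<^sup>2) has_real_derivative 2 * s) (at s)" by (auto intro!: derivative_eq_intros)
    then have "((\<lambda>s::real. (max 0 s)\<^sup>2) has_real_derivative 2 * s) (at s)"
      by (rule has_field_derivative_transform_within_open[of _ _ _ "{0<..}"]) (use 2 in auto)
    then show ?thesis using 2 by simp
  next
    case 3
    have "((\<lambda>h::real. (max 0 h)\<^sup>2 / h) \<longlongrightarrow> 0) (at 0)"
    proof (rule Lim_null_comparison[where g="\<lambda>h. \<bar>h\<bar>"])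
      show "\<forall>\<^sub>F h::real in at 0. norm ((max 0 h)\<^sup>2 / h) \<le> \<bar>h\<bar>"
        by (rule always_eventually) (auto simp: max_def power2_eq_square)
      show "((\<lambda>h::real. \<bar>h\<bar>) \<longlongrightarrow> 0) (at 0)" using tendsto_rabs[OF tendsto_ident_at, of "0::real"] by simp
    qed
    then show ?thesis using 3 by (simp add: DERIV_def)
  qed
qed

section \<open>Reflection invariance and mollification\<close>

lemma lborel_distr_reflect: "distr lborel borel (\<lambda>z. x - z) = (lborel :: 'a::euclidean_space measure)"
  by (subst (2) lborel_affine[of "-1" x]) (auto simp: density_1 one_ennreal_def[symmetric])

lemma
  fixes f :: "'a::euclidean_space \<Rightarrow> 'b::{banach, second_countable_topology}"
  assumes f[measurable]: "f \<in> borel_measurable borel"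
  shows integral_lborel_reflect: "(LINT z|lborel. f (x - z)) = (LINT z|lborel. f z)"
    and integrable_lborel_reflect: "integrable lborel (\<lambda>z. f (x - z)) \<longleftrightarrow> integrable lborel f"
proof -
  have "(LINT z|lborel. f z) = (LINT z|distr lborel borel (\<lambda>z. x - z). f z)" by (simp add: lborel_distr_reflect)
  also have "\<dots> = (LINT z|lborel. f (x - z))" by (rule integral_distr) auto
  finally show "(LINT z|lborel. f (x - z)) = (LINT z|lborel. f z)" by simp
  have "integrable lborel f \<longleftrightarrow> integrable (distr lborel borel (\<lambda>z. x - z)) f" by (simp add: lborel_distr_reflect)
  also have "\<dots> \<longleftrightarrow> integrable lborel (\<lambda>z. f (x - z))" by (rule integrable_distr_eq) auto
  finally show "integrable lborel (\<lambda>z. f (x - z)) \<longleftrightarrow> integrable lborel f" by simp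
qed

text \<open>\<open>W\<close> averages translates of \<open>w\<close> by vectors of norm at most
  \<open>m\<close>, with the normalised bump \<open>\<phi> / c\<close> as weight. Averaging
  preserves the bound and the Lipschitz constant, and moves each value by at most
  \<open>L * m\<close>.\<close>

lemma lipschitz_mollification:
  fixes w :: "'a::euclidean_space \<Rightarrow> real"
  assumes w: "L-lipschitz_on UNIV w" "\<And>x. \<bar>w x\<bar> \<le> M" and m: "0 < m"
  obtains W W' where "L-lipschitz_on UNIV W" "\<And>x. \<bar>W x\<bar> \<le> M" "\<And>x. (W has_derivative W' x) (at x)"
    "\<And>x. \<bar>W x - w x\<bar> \<le> L * m"
proof -
  define q :: "real \<Rightarrow> real" where "q s = (max 0 s)\<^sup>2" for s
  define \<phi> where "\<phi> z = q (m\<^sup>2 - z \<bullet> z)" for z :: 'a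
  define \<phi>' where "\<phi>' z h = (2 * max 0 (m\<^sup>2 - z \<bullet> z)) * (- 2 * (z \<bullet> h))" for z h :: 'a
  have \<phi>_der: "(\<phi> has_derivative \<phi>' z) (at z)" for z
  proof -
    have "(q has_real_derivative 2 * max 0 (m\<^sup>2 - z \<bullet> z)) (at (m\<^sup>2 - z \<bullet> z))"
      unfolding q_def by (rule has_real_derivative_max_0_square)
    then have "(q has_derivative (\<lambda>s. (2 * max 0 (m\<^sup>2 - z \<bullet> z)) * s)) (at (m\<^sup>2 - z \<bullet> z))"
      by (simp only: has_field_derivative_def)
    moreover have "((\<lambda>z. m\<^sup>2 - z \<bullet> z) has_derivative (\<lambda>h. - 2 * (z \<bullet> h))) (at z)"
      by (auto intro!: derivative_eq_intros simp: inner_commute)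
    ultimately show ?thesis unfolding \<phi>_def \<phi>'_def
      by (rule has_derivative_compose[rotated])
  qed
  have \<phi>0: "\<phi> z = 0" if "norm z > m" for z
    using that m by (simp add: \<phi>_def q_def power2_norm_eq_inner[symmetric] power_mono)
  have \<phi>_nn: "0 \<le> \<phi> z" for z by (simp add: \<phi>_def q_def)
  have \<phi>c: "continuous_on UNIV \<phi>" unfolding \<phi>_def q_def by (intro continuous_intros)
  have \<phi>m[measurable]: "\<phi> \<in> borel_measurable borel" using \<phi>c by (rule borel_measurable_continuous_onI)
  have \<phi>'c: "continuous_on UNIV (\<lambda>z. \<phi>' z h)" for h unfolding \<phi>'_def by (intro continuous_intros)
  have \<phi>'m: "(\<lambda>z. \<phi>' z h) \<in> borel_measurable borel" for h using \<phi>'c by (rule borel_measurable_continuous_onI)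
  have \<phi>'b: "\<bar>\<phi>' z h\<bar> \<le> (4 * m ^ 3) * norm h" for z h
  proof (cases "norm z > m")
    case True
    then have "\<phi>' z = (\<lambda>h. 0)" by (intro has_derivative_eq_0_outside[OF \<phi>0 \<phi>_der])
    then show ?thesis using m by simp
  next
    case False
    have "\<bar>z \<bullet> h\<bar> \<le> norm z * norm h" by (rule Cauchy_Schwarz_ineq2)
    also have "\<dots> \<le> m * norm h" using False by (intro mult_right_mono) auto
    finally have 1: "\<bar>z \<bullet> h\<bar> \<le> m * norm h" .
    have 2: "max 0 (m\<^sup>2 - z \<bullet> z) \<le> m\<^sup>2" by simp
    have "\<bar>\<phi>' z h\<bar> = 4 * (\<bar>z \<bullet> h\<bar> * max 0 (m\<^sup>2 - z \<bullet> z))" by (simp add: \<phi>'_def abs_mult)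
    also have "\<dots> \<le> 4 * ((m * norm h) * m\<^sup>2)" using 1 2 m by (intro mult_left_mono mult_mono) auto
    finally show ?thesis by (simp add: power3_eq_cube power2_eq_square mult_ac)
  qed
  have \<phi>b: "\<bar>\<phi> z\<bar> \<le> (m\<^sup>2)\<^sup>2" for z
  proof -
    have "(max 0 (m\<^sup>2 - z \<bullet> z))\<^sup>2 \<le> (m\<^sup>2)\<^sup>2" by (rule power_mono) auto
    then show ?thesis unfolding \<phi>_def q_def by (simp only: abs_power2)
  qed
  have \<phi>i: "integrable lborel \<phi>" by (rule integrable_bounded_cball[OF \<phi>m \<phi>b \<phi>0])
  define c where "c = (LINT z|lborel. \<phi> z)"
  \<comment> \<open>A vanishing integral would make the nonnegative \<open>\<phi>\<close> zero
    almost everywhere, although it is positive on a ball of positive measure.\<close>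
  have c: "c > 0"
  proof -
    have "c \<noteq> 0"
    proof
      assume "c = 0"
      then have "AE z in lborel. \<phi> z = 0"
        unfolding c_def using integral_nonneg_eq_0_iff_AE[OF \<phi>i] \<phi>_nn by simp
      moreover have "\<phi> z \<noteq> 0" if "z \<in> ball 0 m" for z
      proof -
        have "norm z * norm z < m * m" using that by (intro mult_strict_mono) (auto simp: m)
        then show ?thesis by (simp add: \<phi>_def q_def power2_eq_square dot_square_norm)
      qed
      ultimately have "AE z in lborel. z \<notin> ball (0::'a) m" by (auto elim: eventually_mono)
      then have "ball (0::'a) m \<in> null_sets lborel" by (subst AE_iff_null_sets) auto
      then have "emeasure lborel (ball (0::'a) m) = 0" by auto
      moreover have "0 < unit_ball_vol (real DIM('a)) * m ^ DIM('a)" using m by simp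
      ultimately show False using m by (simp add: emeasure_ball ennreal_eq_0_iff)
    qed
    moreover have "c \<ge> 0" unfolding c_def using \<phi>_nn by simp
    ultimately show ?thesis by simp
  qed
  have wm[measurable]: "w \<in> borel_measurable borel"
    by (intro borel_measurable_continuous_onI lipschitz_on_continuous_on[OF w(1)])
  have L0: "0 \<le> L" using w(1) by (rule lipschitz_on_nonneg)
  have M0: "0 \<le> M" using w(2)[of 0] by linarith
  have wk: "integrable lborel (\<lambda>z. indicator (cball 0 r) z *\<^sub>R w z)" for r
    by (intro borel_integrable_compact continuous_on_subset[OF lipschitz_on_continuous_on[OF w(1)]]) auto
  define I where "I x = (LINT z|lborel. \<phi> (x - z) *\<^sub>R w z)" for x
  have I_der: "(I has_derivative (\<lambda>h. LINT z|lborel. \<phi>' (x - z) h *\<^sub>R w z)) (at x)" for x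
    unfolding I_def by (rule convolution_has_derivative[OF wk wm \<phi>_der \<phi>'m \<phi>'b \<phi>0])
  \<comment> \<open>The first form puts \<open>x\<close> into \<open>\<phi>\<close> and is
    differentiable; this second form puts \<open>x\<close> into \<open>w\<close> and shows the
    Lipschitz bound.\<close>
  have I_eq: "I x = (LINT z|lborel. \<phi> z * w (x - z))" for x
  proof -
    have "I x = (LINT z|lborel. (\<lambda>y. \<phi> y * w (x - y)) (x - z))" by (simp add: I_def)
    also have "\<dots> = (LINT z|lborel. \<phi> z * w (x - z))"
      by (rule integral_lborel_reflect) measurable
    finally show ?thesis .
  qed
  have int: "integrable lborel (\<lambda>z. \<phi> z * w (x - z))" for x
  proof (rule integrable_bounded_cball)
    show "\<bar>\<phi> z * w (x - z)\<bar> \<le> (m\<^sup>2)\<^sup>2 * M" for z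
      unfolding abs_mult using \<phi>b w(2) M0 by (intro mult_mono) auto
    show "\<phi> z * w (x - z) = 0" if "norm z > m" for z using \<phi>0[OF that] by simp
  qed measurable
  have diff: "\<bar>(LINT z|lborel. \<phi> z * f z)\<bar> \<le> c * b" if f: "integrable lborel (\<lambda>z. \<phi> z * f z)" "\<And>z. norm z \<le> m \<Longrightarrow> \<bar>f z\<bar> \<le> b" for f b
  proof -
    have "\<bar>(LINT z|lborel. \<phi> z * f z)\<bar> \<le> (LINT z|lborel. \<bar>\<phi> z * f z\<bar>)" by (rule integral_abs_bound)
    also have "\<dots> \<le> (LINT z|lborel. \<phi> z * b)"
    proof (rule integral_mono)
      show "\<bar>\<phi> z * f z\<bar> \<le> \<phi> z * b" for z
        using f(2)[of z] \<phi>0[of z] \<phi>_nn[of z] by (cases "norm z > m") (auto simp: abs_mult mult_left_mono)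
    qed (use f \<phi>i in auto)
    also have "\<dots> = c * b" by (simp add: c_def)
    finally show ?thesis .
  qed
  show thesis
  proof
    have "norm (I x / c - I y / c) \<le> L * norm (x - y)" for x y
    proof -
      have "I x - I y = (LINT z|lborel. \<phi> z * (w (x - z) - w (y - z)))"
        unfolding I_eq using int by (simp add: right_diff_distrib)
      also have "\<bar>\<dots>\<bar> \<le> c * (L * norm (x - y))"
      proof (rule diff)
        show "integrable lborel (\<lambda>z. \<phi> z * (w (x - z) - w (y - z)))"
          using int[of x] int[of y] by (simp add: right_diff_distrib)
        show "\<bar>w (x - z) - w (y - z)\<bar> \<le> L * norm (x - y)" for z
          using lipschitz_on_normD[OF w(1), of "x - z" "y - z"] by simp
      qed
      finally show ?thesis using c by (simp add: diff_divide_distrib[symmetric] field_simps)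
    qed
    then show "L-lipschitz_on UNIV (\<lambda>x. I x / c)" by (intro lipschitz_on_normI L0)
    show "\<bar>I x / c\<bar> \<le> M" for x
      using diff[OF int[of x] w(2)] c by (simp add: I_eq field_simps)
    show "((\<lambda>x. I x / c) has_derivative (\<lambda>h. (LINT z|lborel. \<phi>' (x - z) h *\<^sub>R w z) / c)) (at x)" for x
      using bounded_linear.has_derivative[OF bounded_linear_divide I_der] by simp
    show "\<bar>I x / c - w x\<bar> \<le> L * m" for x
    proof -
      have "I x - c * w x = (LINT z|lborel. \<phi> z * (w (x - z) - w x))"
        unfolding I_eq c_def using int \<phi>i by (simp add: right_diff_distrib)
      also have "\<bar>\<dots>\<bar> \<le> c * (L * m)"
      proof (rule diff)
        show "integrable lborel (\<lambda>z. \<phi> z * (w (x - z) - w x))"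
          using int[of x] \<phi>i by (simp add: right_diff_distrib)
        show "\<bar>w (x - z) - w x\<bar> \<le> L * m" if "norm z \<le> m" for z
          using lipschitz_on_normD[OF w(1), of "x - z" x] mult_left_mono[OF that L0] by simp
      qed
      finally have "\<bar>c * (I x / c - w x)\<bar> \<le> c * (L * m)" using c by (simp add: right_diff_distrib)
      then show ?thesis using c by (simp add: abs_mult)
    qed
  qed
qed

section \<open>Transport and flows of Lipschitz fields\<close>

text \<open>To first order, moving points to \<open>x + e *\<^sub>R u x\<close> changes the pairing
  with \<open>w\<close> by \<open>- e\<close> times the pairing of \<open>w\<close> with the
  divergence \<open>D\<close> of \<open>\<rho> *\<^sub>R u\<close>. With
  \<open>W t x = w (x + t *\<^sub>R u x)\<close>, the derivative in \<open>t\<close> is integrated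
  by parts against \<open>W t\<close> instead of \<open>w\<close>; the two corrections, from
  \<open>u'\<close> and from \<open>W t - w\<close>, are of order \<open>t\<close>. So
  \<open>w\<close> is differentiated only once, and its derivative enters through the bound
  \<open>L\<close>.\<close>

lemma transport_first_order_differentiable:
  fixes w \<rho> :: "'a::euclidean_space \<Rightarrow> real" and u :: "'a \<Rightarrow> 'a"
  assumes w: "L-lipschitz_on UNIV w" "\<And>x. \<bar>w x\<bar> \<le> M" "\<And>x. (w has_derivative w' x) (at x)"
    and u: "K-lipschitz_on UNIV u" "\<And>x. norm (u x) \<le> U" "\<And>x. (u has_derivative u' x) (at x)"
    and \<rho>: "integrable lborel \<rho>" "\<And>x. 0 \<le> \<rho> x" "(LINT x|lborel. \<rho> x) = 1"
    and R: "\<And>x. norm x > R \<Longrightarrow> \<rho> x = 0"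
    and v: "J-lipschitz_on UNIV (\<lambda>x. \<rho> x *\<^sub>R u x)" "\<And>x. norm (\<rho> x *\<^sub>R u x) \<le> V"
      "\<And>x. ((\<lambda>x. \<rho> x *\<^sub>R u x) has_derivative v' x) (at x)"
    and e: "0 \<le> e"
  defines "D \<equiv> \<lambda>x. \<Sum>b\<in>Basis. v' x b \<bullet> b"
  shows "\<bar>(LINT x|lborel. (w (x + e *\<^sub>R u x) - w x) * \<rho> x) + e * (LINT x|lborel. w x * D x)\<bar>
    \<le> e\<^sup>2 * L * U * (K + (LINT x|lborel. \<bar>D x\<bar>))"
proof -
  have nn: "0 \<le> L" "0 \<le> K" "0 \<le> M" "0 \<le> U" "0 \<le> J"
    using lipschitz_on_nonneg[OF w(1)] lipschitz_on_nonneg[OF u(1)] w(2)[of 0] u(2)[of 0]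
      norm_ge_zero[of "u 0"] lipschitz_on_nonneg[OF v(1)] by linarith+
  have [measurable]: "w \<in> borel_measurable borel" "u \<in> borel_measurable borel" "\<rho> \<in> borel_measurable borel"
    using borel_measurable_integrable[OF \<rho>(1)]
    by (auto intro!: borel_measurable_continuous_onI lipschitz_on_continuous_on[OF w(1)] lipschitz_on_continuous_on[OF u(1)])
  define S where "S t x = x + t *\<^sub>R u x" for t x
  have Sm[measurable]: "S t \<in> borel_measurable borel" for t unfolding S_def by measurable
  have S_lip: "norm (S t x - S t y) \<le> (1 + \<bar>t\<bar> * K) * norm (x - y)" for t x y
  proof -
    have "S t x - S t y = (x - y) + t *\<^sub>R (u x - u y)" by (simp add: S_def algebra_simps)
    then have "norm (S t x - S t y) \<le> norm (x - y) + \<bar>t\<bar> * norm (u x - u y)" using norm_triangle_ineq by (metis norm_scaleR)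
    also have "\<dots> \<le> norm (x - y) + \<bar>t\<bar> * (K * norm (x - y))"
      using lipschitz_on_normD[OF u(1), of x y] by (intro add_left_mono mult_left_mono) auto
    finally show ?thesis by (simp add: algebra_simps)
  qed
  have S_der: "(S t has_derivative (\<lambda>h. h + t *\<^sub>R u' x h)) (at x)" for t x
    unfolding S_def by (rule derivative_eq_intros u(3) refl)+
  define W where "W t x = w (S t x)" for t x
  have Wm[measurable]: "W t \<in> borel_measurable borel" for t unfolding W_def by measurable
  define W' where "W' t x h = w' (S t x) (h + t *\<^sub>R u' x h)" for t x h
  have W_der: "(W t has_derivative W' t x) (at x)" for t x
    unfolding W_def W'_def by (rule has_derivative_compose[OF S_der w(3)])
  have W_lip: "(L * (1 + \<bar>t\<bar> * K))-lipschitz_on UNIV (W t)" for t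
  proof (rule lipschitz_on_normI)
    show "0 \<le> L * (1 + \<bar>t\<bar> * K)" using nn by simp
    fix x y
    have "norm (W t x - W t y) \<le> L * norm (S t x - S t y)" unfolding W_def by (rule lipschitz_on_normD[OF w(1)])
    also have "\<dots> \<le> L * ((1 + \<bar>t\<bar> * K) * norm (x - y))" using S_lip nn by (intro mult_left_mono) auto
    finally show "norm (W t x - W t y) \<le> L * (1 + \<bar>t\<bar> * K) * norm (x - y)" by (simp add: mult_ac)
  qed
  have Wb: "\<bar>W t x\<bar> \<le> M" for t x unfolding W_def by (rule w(2))
  have R': "norm x > R \<Longrightarrow> \<rho> x *\<^sub>R u x = 0" for x using R by simp
  have ibp: "integrable lborel (\<lambda>x. W' t x (\<rho> x *\<^sub>R u x))" "integrable lborel D"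
    "integrable lborel (\<lambda>x. W t x * D x)"
    "(LINT x|lborel. W' t x (\<rho> x *\<^sub>R u x)) = - (LINT x|lborel. W t x * D x)" for t
    unfolding D_def
    by (rule integral_by_parts_divergence[OF W_lip Wb W_der v R'], assumption)+
  have W0: "W 0 = w" by (simp add: W_def S_def fun_eq_iff)
  have lin: "linear (w' x)" for x using w(3) by (meson bounded_linear.linear has_derivative_bounded_linear)
  have w'b: "\<bar>w' x h\<bar> \<le> L * norm h" for x h
    using lipschitz_imp_derivative_le[OF w(1) w(3), of x h] by simp
  have w'm: "(\<lambda>x. w' (S t x) (u x)) \<in> borel_measurable borel" for t
  proof (rule borel_measurable_LIMSEQ_metric)
    show "(\<lambda>n. real (Suc n) *\<^sub>R (w (S t x + (1 / real (Suc n)) *\<^sub>R u x) - w (S t x))) \<longlonglongrightarrow> w' (S t x) (u x)" for x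
      by (rule directional_derivative_LIMSEQ[OF w(3)])
  qed measurable
  have \<rho>W: "integrable lborel (\<lambda>x. W t x * \<rho> x)" for t
  proof (rule Bochner_Integration.integrable_bound)
    show "integrable lborel (\<lambda>x. M * \<rho> x)" using \<rho>(1) by simp
    show "AE x in lborel. norm (W t x * \<rho> x) \<le> norm (M * \<rho> x)"
      using Wb \<rho>(2) nn by (auto simp: abs_mult intro!: mult_right_mono)
  qed measurable
  define f where "f t = (LINT x|lborel. W t x * \<rho> x)" for t
  define f' where "f' t = (LINT x|lborel. w' (S t x) (u x) * \<rho> x)" for t
  have f'i: "integrable lborel (\<lambda>x. w' (S t x) (u x) * \<rho> x)" for t
  proof (rule Bochner_Integration.integrable_bound)
    show "integrable lborel (\<lambda>x. (L * U) * \<rho> x)" using \<rho>(1) by simp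
    show "AE x in lborel. norm (w' (S t x) (u x) * \<rho> x) \<le> norm (L * U * \<rho> x)"
    proof (rule AE_I2)
      fix x
      have "\<bar>w' (S t x) (u x)\<bar> \<le> L * U" using w'b[of "S t x" "u x"] mult_left_mono[OF u(2)[of x] nn(1)] by linarith
      then show "norm (w' (S t x) (u x) * \<rho> x) \<le> norm (L * U * \<rho> x)"
        using \<rho>(2)[of x] nn by (simp add: abs_mult mult_right_mono)
    qed
  qed (use w'm in measurable)
  have f_der: "(f has_vector_derivative f' t) (at t)" for t
    unfolding f_def f'_def
  proof (rule has_vector_derivative_lebesgue_integral[where r=1 and B="\<lambda>x. L * U * \<rho> x"])
    show "AE x in lborel. ((\<lambda>s. W s x * \<rho> x) has_vector_derivative w' (S t x) (u x) * \<rho> x) (at t)"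
    proof (rule AE_I2)
      fix x
      have "((\<lambda>s. W s x) has_derivative (\<lambda>s. w' (S t x) (s *\<^sub>R u x))) (at t)"
        unfolding W_def
      proof (rule has_derivative_compose[OF _ w(3)])
        show "((\<lambda>s. S s x) has_derivative (\<lambda>s. s *\<^sub>R u x)) (at t)"
          unfolding S_def by (auto intro!: derivative_eq_intros)
      qed
      then have "((\<lambda>s. W s x) has_real_derivative w' (S t x) (u x)) (at t)"
        using lin by (simp add: has_field_derivative_def linear_cmul mult.commute[of _ "w' (S t x) (u x)"])
      then have "((\<lambda>s. W s x * \<rho> x) has_real_derivative w' (S t x) (u x) * \<rho> x) (at t)"
        by (rule DERIV_cmult_right)
      then show "((\<lambda>s. W s x * \<rho> x) has_vector_derivative w' (S t x) (u x) * \<rho> x) (at t)"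
        by (simp add: has_real_derivative_iff_has_vector_derivative)
    qed
    have "\<bar>W s x - W t x\<bar> \<le> L * U * \<bar>s - t\<bar>" for s x
    proof -
      have "\<bar>W s x - W t x\<bar> \<le> L * norm (S s x - S t x)"
        unfolding W_def using lipschitz_on_normD[OF w(1)] by (metis real_norm_def)
      also have "S s x - S t x = (s - t) *\<^sub>R u x" by (simp add: S_def algebra_simps)
      also have "L * norm \<dots> \<le> L * (\<bar>s - t\<bar> * U)"
        using u(2)[of x] nn by (auto intro!: mult_left_mono)
      finally show ?thesis by (simp add: mult_ac)
    qed
    then have "\<bar>W s x - W t x\<bar> * \<rho> x \<le> L * U * \<bar>s - t\<bar> * \<rho> x" for s x
      using \<rho>(2) by (intro mult_right_mono) auto
    then show "AE x in lborel. \<forall>s\<in>UNIV. dist s t < 1 \<longrightarrow> norm (W s x * \<rho> x - W t x * \<rho> x) \<le> L * U * \<rho> x * \<bar>s - t\<bar>"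
    proof (intro AE_I2 ballI impI)
      fix x s
      have "norm (W s x * \<rho> x - W t x * \<rho> x) = \<bar>W s x - W t x\<bar> * \<rho> x"
        using \<rho>(2)[of x] by (metis abs_mult abs_of_nonneg left_diff_distrib real_norm_def)
      also have "\<dots> \<le> L * U * \<bar>s - t\<bar> * \<rho> x" by fact
      finally show "norm (W s x * \<rho> x - W t x * \<rho> x) \<le> L * U * \<rho> x * \<bar>s - t\<bar>" by (simp add: mult_ac)
    qed
    show "AE x in lborel. norm (w' (S t x) (u x) * \<rho> x) \<le> L * U * \<rho> x"
    proof (rule AE_I2)
      fix x
      have "\<bar>w' (S t x) (u x)\<bar> \<le> L * U" using w'b[of "S t x" "u x"] mult_left_mono[OF u(2)[of x] nn(1)] by linarith
      then show "norm (w' (S t x) (u x) * \<rho> x) \<le> L * U * \<rho> x"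
        using \<rho>(2)[of x] nn by (simp add: abs_mult mult_right_mono)
    qed
  qed (use \<rho>W \<rho>(1) f'i in auto)
  \<comment> \<open>Adding the expected first-order term leaves a function whose derivative is of
    order \<open>e\<close> on \<open>{0..e}\<close>, so its increment is of order
    \<open>e^2\<close>.\<close>
  define g where "g t = f t + t * (LINT x|lborel. w x * D x)" for t
  have g_der: "(g has_vector_derivative (f' t + (LINT x|lborel. w x * D x))) (at t within {0..e})" for t
    unfolding g_def
    by (rule derivative_eq_intros has_vector_derivative_at_within[OF f_der] refl | simp)+
  have g'b: "norm (f' t + (LINT x|lborel. w x * D x)) \<le> e * L * U * (K + (LINT x|lborel. \<bar>D x\<bar>))"
    if t: "0 \<le> t" "t \<le> e" for t
  proof -
    have i1: "integrable lborel (\<lambda>x. W' t x (\<rho> x *\<^sub>R u x))" by (rule ibp(1))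
    \<comment> \<open>The chain rule gives
      \<open>W' t x h = w' (S t x) (h + t *\<^sub>R u' x h)\<close>; taking
      \<open>h = \<rho> x *\<^sub>R u x\<close> isolates the wanted term up to a remainder with
      factor \<open>t\<close>.\<close>
    have eq: "w' (S t x) (u x) * \<rho> x = W' t x (\<rho> x *\<^sub>R u x) - t * (w' (S t x) (u' x (u x)) * \<rho> x)" for x
    proof -
      have "linear (u' x)" using u(3) by (meson bounded_linear.linear has_derivative_bounded_linear)
      then show ?thesis unfolding W'_def
        by (simp add: linear_cmul linear_add[OF lin] linear_cmul[OF lin] algebra_simps)
    qed
    define Q where "Q x = w' (S t x) (u' x (u x)) * \<rho> x" for x
    \<comment> \<open>Integrability is read off from a difference of two integrable functions, which
      also settles measurability.\<close>
    have tQ: "integrable lborel (\<lambda>x. t * Q x)"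
    proof -
      have "integrable lborel (\<lambda>x. W' t x (\<rho> x *\<^sub>R u x) - w' (S t x) (u x) * \<rho> x)" using i1 f'i by auto
      then show ?thesis unfolding Q_def eq by simp
    qed
    have Qb: "\<bar>t * Q x\<bar> \<le> (e * (L * (K * U))) * \<rho> x" for x
    proof -
      have "\<bar>w' (S t x) (u' x (u x))\<bar> \<le> L * norm (u' x (u x))" by (rule w'b)
      also have "\<dots> \<le> L * (K * norm (u x))"
        using lipschitz_imp_derivative_le[OF u(1) u(3)] nn by (intro mult_left_mono) auto
      also have "\<dots> \<le> L * (K * U)" using u(2) nn by (intro mult_left_mono) auto
      finally have "\<bar>w' (S t x) (u' x (u x))\<bar> * \<rho> x \<le> L * (K * U) * \<rho> x"
        using \<rho>(2) by (intro mult_right_mono) auto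
      then have "t * (\<bar>w' (S t x) (u' x (u x))\<bar> * \<rho> x) \<le> e * (L * (K * U) * \<rho> x)"
        by (rule mult_mono[OF t(2)]) (use e \<rho>(2)[of x] in auto)
      then show ?thesis using t \<rho>(2)[of x] by (simp add: Q_def abs_mult mult_ac)
    qed
    have "f' t = (LINT x|lborel. W' t x (\<rho> x *\<^sub>R u x) - t * Q x)"
      unfolding f'_def eq Q_def ..
    also have "\<dots> = - (LINT x|lborel. W t x * D x) - (LINT x|lborel. t * Q x)"
      using i1 tQ ibp(4)[of t] by simp
    finally have "f' t + (LINT x|lborel. w x * D x)
      = (LINT x|lborel. (w x - W t x) * D x) - (LINT x|lborel. t * Q x)"
      using ibp(3)[of t] ibp(3)[of 0] by (simp add: W0 left_diff_distrib)
    moreover have "\<bar>LINT x|lborel. t * Q x\<bar> \<le> e * (L * (K * U))"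
    proof -
      have "\<bar>LINT x|lborel. t * Q x\<bar> \<le> (LINT x|lborel. \<bar>t * Q x\<bar>)" by (rule integral_abs_bound)
      also have "\<dots> \<le> (LINT x|lborel. (e * (L * (K * U))) * \<rho> x)"
        using tQ \<rho>(1) Qb by (intro integral_mono) auto
      finally show ?thesis using \<rho>(3) by simp
    qed
    moreover have "\<bar>LINT x|lborel. (w x - W t x) * D x\<bar> \<le> e * L * U * (LINT x|lborel. \<bar>D x\<bar>)"
    proof -
      have Di: "integrable lborel D" by (rule ibp(2))
      have i: "integrable lborel (\<lambda>x. (w x - W t x) * D x)"
        using ibp(3)[of t] ibp(3)[of 0] by (simp add: W0 left_diff_distrib)
      have "\<bar>LINT x|lborel. (w x - W t x) * D x\<bar> \<le> (LINT x|lborel. \<bar>(w x - W t x) * D x\<bar>)" by (rule integral_abs_bound)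
      also have "\<dots> \<le> (LINT x|lborel. (e * L * U) * \<bar>D x\<bar>)"
      proof (rule integral_mono)
        fix x
        have "\<bar>w x - W t x\<bar> \<le> L * norm (x - S t x)" unfolding W_def
          using lipschitz_on_normD[OF w(1)] by (metis real_norm_def)
        also have "x - S t x = - (t *\<^sub>R u x)" by (simp add: S_def)
        also have "L * norm \<dots> \<le> L * (e * U)" using t u(2)[of x] nn e
          by (auto intro!: mult_left_mono mult_mono)
        finally show "\<bar>(w x - W t x) * D x\<bar> \<le> (e * L * U) * \<bar>D x\<bar>"
          unfolding abs_mult by (intro mult_right_mono) (auto simp: mult_ac)
      qed (use i Di in auto)
      finally show ?thesis by simp
    qed
    ultimately show ?thesis by (simp add: algebra_simps)
  qed
  have "norm (g e - g 0) \<le> (e * L * U * (K + (LINT x|lborel. \<bar>D x\<bar>))) * norm (e - 0)"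
  proof (rule differentiable_bound[where f'="\<lambda>t s. s *\<^sub>R (f' t + (LINT x|lborel. w x * D x))"])
    show "convex {0..e}" by simp
    show "(g has_derivative (\<lambda>s. s *\<^sub>R (f' t + (LINT x|lborel. w x * D x)))) (at t within {0..e})" for t
      using g_der unfolding has_vector_derivative_def .
    show "onorm (\<lambda>s. s *\<^sub>R (f' t + (LINT x|lborel. w x * D x))) \<le> e * L * U * (K + (LINT x|lborel. \<bar>D x\<bar>))"
      if "t \<in> {0..e}" for t
    proof (rule onorm_le)
      show "norm (s *\<^sub>R (f' t + (LINT x|lborel. w x * D x))) \<le> e * L * U * (K + (LINT x|lborel. \<bar>D x\<bar>)) * norm s" for s :: real
        using mult_left_mono[OF g'b[of t], of "\<bar>s\<bar>"] that by (simp add: abs_mult mult_ac)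
    qed
  qed (use e in auto)
  moreover have "g e - g 0 = (LINT x|lborel. (w (x + e *\<^sub>R u x) - w x) * \<rho> x) + e * (LINT x|lborel. w x * D x)"
    using \<rho>W[of e] \<rho>W[of 0] by (simp add: g_def f_def W_def S_def left_diff_distrib)
  ultimately show ?thesis using e by (simp add: power2_eq_square mult_ac)
qed

text \<open>The error depends on \<open>w\<close> only through its Lipschitz constant; this makes the estimate
  usable for \<open>w = f \<circ> flow\<close>, which is not differentiable when \<open>f\<close> is not.\<close>

lemma transport_first_order:
  fixes w \<rho> :: "'a::euclidean_space \<Rightarrow> real" and u :: "'a \<Rightarrow> 'a"
  assumes w: "L-lipschitz_on UNIV w" "\<And>x. \<bar>w x\<bar> \<le> M"
    and u: "K-lipschitz_on UNIV u" "\<And>x. norm (u x) \<le> U" "\<And>x. (u has_derivative u' x) (at x)"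
    and \<rho>: "integrable lborel \<rho>" "\<And>x. 0 \<le> \<rho> x" "(LINT x|lborel. \<rho> x) = 1"
    and R: "\<And>x. norm x > R \<Longrightarrow> \<rho> x = 0"
    and v: "J-lipschitz_on UNIV (\<lambda>x. \<rho> x *\<^sub>R u x)" "\<And>x. norm (\<rho> x *\<^sub>R u x) \<le> V"
      "\<And>x. ((\<lambda>x. \<rho> x *\<^sub>R u x) has_derivative v' x) (at x)"
    and e: "0 \<le> e"
  defines "D \<equiv> \<lambda>x. \<Sum>b\<in>Basis. v' x b \<bullet> b"
  shows "\<bar>(LINT x|lborel. (w (x + e *\<^sub>R u x) - w x) * \<rho> x) + e * (LINT x|lborel. w x * D x)\<bar>
    \<le> e\<^sup>2 * L * U * (K + (LINT x|lborel. \<bar>D x\<bar>))" (is "?A \<le> ?B")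
proof -
  have L0: "0 \<le> L" using w(1) by (rule lipschitz_on_nonneg)
  have M0: "0 \<le> M" using w(2)[of 0] by linarith
  have wm[measurable]: "w \<in> borel_measurable borel"
    by (intro borel_measurable_continuous_onI lipschitz_on_continuous_on[OF w(1)])
  have um[measurable]: "u \<in> borel_measurable borel"
    by (intro borel_measurable_continuous_onI lipschitz_on_continuous_on[OF u(1)])
  have \<rho>m[measurable]: "\<rho> \<in> borel_measurable borel" using borel_measurable_integrable[OF \<rho>(1)] by simp
  have Di: "integrable lborel D"
  proof -
    have "0-lipschitz_on UNIV (\<lambda>x::'a. 0::real)" by (simp add: lipschitz_on_def)
    moreover have "((\<lambda>x::'a. 0::real) has_derivative (\<lambda>h. 0)) (at x)" for x by simp
    ultimately show ?thesis unfolding D_def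
      by (intro integral_by_parts_divergence(2)[where W="\<lambda>x. 0" and W'="\<lambda>x h. 0" and M=0 and R=R, OF _ _ _ v]) (auto simp: R)
  qed
  have mult_i: "integrable lborel (\<lambda>x. f x * g x)"
    if "integrable lborel g" "f \<in> borel_measurable borel" "\<And>x. \<bar>f x\<bar> \<le> b" for f g :: "'a \<Rightarrow> real" and b
  proof (rule Bochner_Integration.integrable_bound)
    show "integrable lborel (\<lambda>x. b * g x)" using that by simp
    have "0 \<le> b" using that(3)[of 0] by linarith
    then show "AE x in lborel. norm (f x * g x) \<le> norm (b * g x)"
      using that(3) by (auto simp: abs_mult intro!: mult_right_mono)
    have [measurable]: "g \<in> borel_measurable borel" using borel_measurable_integrable[OF that(1)] by simp
    note that(2)[measurable]
    show "(\<lambda>x. f x * g x) \<in> borel_measurable lborel" by measurable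
  qed
  \<comment> \<open>Replacing \<open>w\<close> by its mollification at scale \<open>m\<close> costs
    \<open>2 * L * m\<close> in the transported difference and \<open>e * L * m\<close> times the
    integral of \<open>|D x|\<close> in the divergence term; \<open>C\<close> is the total per unit
    of \<open>m\<close>.\<close>
  define C where "C = 2 * L + e * L * (LINT x|lborel. \<bar>D x\<bar>)"
  have C0: "C \<ge> 0" using L0 e by (simp add: C_def)
  have "?A \<le> ?B + m * C" if m: "m > 0" for m
  proof -
    obtain W W' where W: "L-lipschitz_on UNIV W" "\<And>x. \<bar>W x\<bar> \<le> M" "\<And>x. (W has_derivative W' x) (at x)"
      "\<And>x. \<bar>W x - w x\<bar> \<le> L * m"
      using lipschitz_mollification[OF w m] by blast
    have Wm[measurable]: "W \<in> borel_measurable borel"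
      by (intro borel_measurable_continuous_onI lipschitz_on_continuous_on[OF W(1)])
    have i: "integrable lborel (\<lambda>x. (f (x + e *\<^sub>R u x) - f x) * \<rho> x)"
      if [measurable]: "f \<in> borel_measurable borel" and b: "\<And>x. \<bar>f x\<bar> \<le> b" for f :: "'a \<Rightarrow> real" and b
    proof (rule mult_i[OF \<rho>(1)])
      show "\<bar>f (x + e *\<^sub>R u x) - f x\<bar> \<le> 2 * b" for x
        using b[of "x + e *\<^sub>R u x"] b[of x] by linarith
    qed measurable
    have 1: "\<bar>(LINT x|lborel. (W (x + e *\<^sub>R u x) - W x) * \<rho> x) + e * (LINT x|lborel. W x * D x)\<bar> \<le> ?B"
      unfolding D_def by (rule transport_first_order_differentiable[OF W(1-3) u \<rho> R v e])
    have 2: "\<bar>(LINT x|lborel. (W (x + e *\<^sub>R u x) - W x) * \<rho> x) - (LINT x|lborel. (w (x + e *\<^sub>R u x) - w x) * \<rho> x)\<bar> \<le> 2 * L * m"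
    proof -
      have "(LINT x|lborel. (W (x + e *\<^sub>R u x) - W x) * \<rho> x) - (LINT x|lborel. (w (x + e *\<^sub>R u x) - w x) * \<rho> x)
        = (LINT x|lborel. (W (x + e *\<^sub>R u x) - W x) * \<rho> x - (w (x + e *\<^sub>R u x) - w x) * \<rho> x)"
        using i[OF Wm W(2)] i[OF wm w(2)] by simp
      also have "\<bar>\<dots>\<bar> \<le> (LINT x|lborel. \<bar>(W (x + e *\<^sub>R u x) - W x) * \<rho> x - (w (x + e *\<^sub>R u x) - w x) * \<rho> x\<bar>)"
        by (rule integral_abs_bound)
      also have "\<dots> \<le> (LINT x|lborel. 2 * L * m * \<rho> x)"
      proof (rule integral_mono)
        fix x
        have "(W (x + e *\<^sub>R u x) - W x) * \<rho> x - (w (x + e *\<^sub>R u x) - w x) * \<rho> x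
          = ((W (x + e *\<^sub>R u x) - w (x + e *\<^sub>R u x)) - (W x - w x)) * \<rho> x" by (simp add: algebra_simps)
        also have "\<bar>\<dots>\<bar> = \<bar>(W (x + e *\<^sub>R u x) - w (x + e *\<^sub>R u x)) - (W x - w x)\<bar> * \<rho> x"
          using \<rho>(2)[of x] by (simp add: abs_mult)
        also have "\<dots> \<le> (2 * L * m) * \<rho> x"
          using W(4)[of x] W(4)[of "x + e *\<^sub>R u x"] \<rho>(2)[of x] by (intro mult_right_mono) linarith+
        finally show "\<bar>(W (x + e *\<^sub>R u x) - W x) * \<rho> x - (w (x + e *\<^sub>R u x) - w x) * \<rho> x\<bar> \<le> 2 * L * m * \<rho> x" .
      qed (use i[OF Wm W(2)] i[OF wm w(2)] \<rho>(1) in auto)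
      finally show ?thesis using \<rho>(3) by simp
    qed
    have 3: "\<bar>(LINT x|lborel. W x * D x) - (LINT x|lborel. w x * D x)\<bar> \<le> L * m * (LINT x|lborel. \<bar>D x\<bar>)"
    proof -
      have "(LINT x|lborel. W x * D x) - (LINT x|lborel. w x * D x) = (LINT x|lborel. (W x - w x) * D x)"
        using mult_i[OF Di Wm W(2)] mult_i[OF Di wm w(2)] by (simp add: left_diff_distrib)
      also have "\<bar>\<dots>\<bar> \<le> (LINT x|lborel. \<bar>(W x - w x) * D x\<bar>)" by (rule integral_abs_bound)
      also have "\<dots> \<le> (LINT x|lborel. L * m * \<bar>D x\<bar>)"
      proof (rule integral_mono)
        show "\<bar>(W x - w x) * D x\<bar> \<le> L * m * \<bar>D x\<bar>" for x
          unfolding abs_mult using W(4)[of x] by (intro mult_right_mono) auto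
      qed (use mult_i[OF Di, of "\<lambda>x. W x - w x" "L * m"] W(4) Di in auto)
      finally show ?thesis by simp
    qed
    have "\<bar>e * (LINT x|lborel. W x * D x) - e * (LINT x|lborel. w x * D x)\<bar> \<le> e * (L * m * (LINT x|lborel. \<bar>D x\<bar>))"
      using mult_left_mono[OF 3 e] e by (simp add: abs_mult right_diff_distrib[symmetric])
    then have "?A \<le> ?B + 2 * L * m + e * (L * m * (LINT x|lborel. \<bar>D x\<bar>))" using 1 2 by linarith
    then show ?thesis by (simp add: C_def algebra_simps)
  qed note * = this
  show ?thesis
  proof (rule field_le_epsilon)
    fix \<epsilon> :: real assume \<epsilon>: "\<epsilon> > 0"
    have "?A \<le> ?B + \<epsilon> / (C + 1) * C" using \<epsilon> C0 by (intro *) simp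
    also have "\<epsilon> / (C + 1) * C \<le> \<epsilon>" using \<epsilon> C0 by (simp add: field_simps)
    finally show "?A \<le> ?B + \<epsilon>" by simp
  qed
qed

section \<open>Gronwall's inequality and global flows\<close>

lemma DERIV_within_nonpos_antimono:
  fixes f :: "real \<Rightarrow> real"
  assumes "0 \<le> t" and f: "\<And>s. 0 \<le> s \<Longrightarrow> s \<le> t \<Longrightarrow> (f has_real_derivative f' s) (at s within {0..t})"
    and "\<And>s. 0 \<le> s \<Longrightarrow> s \<le> t \<Longrightarrow> f' s \<le> 0"
  shows "f t \<le> f 0"
proof -
  obtain s where "s \<in> {0..t}" "f t - f 0 = f' s * (t - 0)"
    using mvt_very_simple[of 0 t f "\<lambda>s h. f' s * h"] assms unfolding has_field_derivative_def by auto
  then show ?thesis using assms(1) assms(3)[of s] mult_nonpos_nonneg[of "f' s" t] by auto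
qed

text \<open>The function \<open>exp (- a * s) * Z s - B s\<close> is nonincreasing, since
  \<open>b\<close> is nonnegative and the exponential is at most 1. The source enters through its
  primitive \<open>B\<close>, the form in which the accumulated dissipation appears later.\<close>

lemma gronwall:
  fixes Z b B :: "real \<Rightarrow> real"
  assumes t: "0 \<le> t"
    and Z: "\<And>s. 0 \<le> s \<Longrightarrow> s \<le> t \<Longrightarrow> (Z has_real_derivative Z' s) (at s within {0..t})"
    and le: "\<And>s. 0 \<le> s \<Longrightarrow> s \<le> t \<Longrightarrow> Z' s \<le> a * Z s + b s"
    and B: "\<And>s. 0 \<le> s \<Longrightarrow> s \<le> t \<Longrightarrow> (B has_real_derivative b s) (at s within {0..t})"
    and b: "\<And>s. 0 \<le> s \<Longrightarrow> s \<le> t \<Longrightarrow> 0 \<le> b s" and a: "0 \<le> a" and B0: "B 0 = 0"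
  shows "Z t \<le> exp (a * t) * (Z 0 + B t)"
proof -
  let ?f = "\<lambda>s. exp (- a * s) * Z s - B s"
  have "?f t \<le> ?f 0"
  proof (rule DERIV_within_nonpos_antimono[OF t])
    fix s assume s: "0 \<le> s" "s \<le> t"
    show "(?f has_real_derivative (exp (- a * s) * Z' s + (exp (- a * s) * (- a)) * Z s - b s)) (at s within {0..t})"
      by (rule derivative_eq_intros Z[OF s] B[OF s] refl | simp)+
    have "exp (- a * s) * (Z' s - a * Z s) \<le> exp (- a * s) * b s"
      using le[OF s] by (intro mult_left_mono) auto
    also have "\<dots> \<le> 1 * b s" using a s b[OF s] by (intro mult_right_mono) auto
    finally show "exp (- a * s) * Z' s + (exp (- a * s) * (- a)) * Z s - b s \<le> 0" by (simp add: algebra_simps)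
  qed
  then have "exp (- a * t) * Z t \<le> Z 0 + B t" using B0 by simp
  then have "exp (a * t) * (exp (- a * t) * Z t) \<le> exp (a * t) * (Z 0 + B t)" by (rule mult_left_mono) simp
  then show ?thesis by (simp add: mult.assoc[symmetric] exp_add[symmetric])
qed

lemma has_real_derivative_norm_square:
  fixes x :: "real \<Rightarrow> 'a::real_inner"
  assumes "(x has_vector_derivative x') (at t within S)"
  shows "((\<lambda>s. (norm (x s))\<^sup>2) has_real_derivative 2 * (x t \<bullet> x')) (at t within S)"
proof -
  have "((\<lambda>s. x s \<bullet> x s) has_derivative (\<lambda>h. x t \<bullet> (h *\<^sub>R x') + (h *\<^sub>R x') \<bullet> x t)) (at t within S)"
    by (rule has_derivative_inner[OF assms[unfolded has_vector_derivative_def] assms[unfolded has_vector_derivative_def]])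
  moreover have "(\<lambda>h. x t \<bullet> (h *\<^sub>R x') + (h *\<^sub>R x') \<bullet> x t) = (*) (2 * (x t \<bullet> x'))"
    by (auto simp: fun_eq_iff inner_commute)
  ultimately show ?thesis by (simp add: has_field_derivative_def power2_norm_eq_inner)
qed

text \<open>Gronwall is applied to the squared distance, which is differentiable even where the two
  curves meet. For equal initial values the conclusion is uniqueness.\<close>

lemma lipschitz_flow_contraction:
  fixes V :: "'a::euclidean_space \<Rightarrow> 'a"
  assumes V: "K-lipschitz_on UNIV V" and t: "0 \<le> t"
    and x: "\<And>s. 0 \<le> s \<Longrightarrow> s \<le> t \<Longrightarrow> (x has_vector_derivative V (x s)) (at s within {0..t})"
    and y: "\<And>s. 0 \<le> s \<Longrightarrow> s \<le> t \<Longrightarrow> (y has_vector_derivative V (y s)) (at s within {0..t})"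
  shows "norm (x t - y t) \<le> exp (K * t) * norm (x 0 - y 0)"
proof -
  have K: "0 \<le> K" using V by (rule lipschitz_on_nonneg)
  have "(norm (x t - y t))\<^sup>2 \<le> exp ((2 * K) * t) * ((norm (x 0 - y 0))\<^sup>2 + 0)"
  proof (rule gronwall[where b="\<lambda>_. 0" and B="\<lambda>_. 0" and Z="\<lambda>s. (norm (x s - y s))\<^sup>2" and
        Z'="\<lambda>s. 2 * ((x s - y s) \<bullet> (V (x s) - V (y s)))", OF t])
    fix s assume s: "0 \<le> s" "s \<le> t"
    show "((\<lambda>s. (norm (x s - y s))\<^sup>2) has_real_derivative 2 * ((x s - y s) \<bullet> (V (x s) - V (y s)))) (at s within {0..t})"
      by (rule has_real_derivative_norm_square[OF has_vector_derivative_diff[OF x[OF s] y[OF s]]])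
    have "(x s - y s) \<bullet> (V (x s) - V (y s)) \<le> norm (x s - y s) * norm (V (x s) - V (y s))" by (rule norm_cauchy_schwarz)
    also have "\<dots> \<le> norm (x s - y s) * (K * norm (x s - y s))"
      by (intro mult_left_mono lipschitz_on_normD[OF V]) auto
    finally show "2 * ((x s - y s) \<bullet> (V (x s) - V (y s))) \<le> 2 * K * (norm (x s - y s))\<^sup>2 + 0"
      by (simp add: power2_eq_square mult_ac)
  qed (use K in auto)
  also have "\<dots> = (exp (K * t) * norm (x 0 - y 0))\<^sup>2"
    by (simp add: power_mult_distrib exp_double[symmetric] mult_ac)
  finally show ?thesis by (rule power2_le_imp_le) simp
qed

text \<open>The weight \<open>exp (- (2 * K * s))\<close> makes integration over arbitrarily long
  intervals a bounded operation: the part of \<open>h\<close> that grows like the inverse weight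
  gains the factor \<open>1 / (2 * K)\<close>, and for the constant part
  \<open>exp (- (2 * K * s)) * s\<close> is at most \<open>1 / (2 * K)\<close>.\<close>

lemma weighted_integral_bound:
  fixes h :: "real \<Rightarrow> 'a::euclidean_space"
  assumes K: "0 < K" and s: "0 \<le> s" and A: "0 \<le> A" and B: "0 \<le> B"
    and h: "continuous_on {0..s} h" "\<And>r. 0 \<le> r \<Longrightarrow> r \<le> s \<Longrightarrow> norm (h r) \<le> A + B * exp (2 * K * r)"
  shows "exp (- (2 * K * s)) * norm (integral {0..s} h) \<le> A / (2 * K) + B / (2 * K)"
proof -
  have i: "((\<lambda>r. A + B * exp (2 * K * r)) has_integral (A * s + B * exp (2 * K * s) / (2 * K)) - (A * 0 + B * exp (2 * K * 0) / (2 * K))) {0..s}"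
    using K by (intro fundamental_theorem_of_calculus s)
      (auto intro!: derivative_eq_intros simp: has_real_derivative_iff_has_vector_derivative[symmetric])
  have "norm (integral {0..s} h) \<le> integral {0..s} (\<lambda>r. A + B * exp (2 * K * r))"
    using h i by (intro integral_norm_bound_integral integrable_continuous_real) (auto intro!: continuous_intros)
  also have "\<dots> \<le> A * s + B * exp (2 * K * s) / (2 * K)"
    unfolding integral_unique[OF i] using B K by simp
  finally have "exp (- (2 * K * s)) * norm (integral {0..s} h) \<le> exp (- (2 * K * s)) * (A * s + B * exp (2 * K * s) / (2 * K))"
    by (rule mult_left_mono) simp
  also have "\<dots> = A * (exp (- (2 * K * s)) * s) + B / (2 * K)"
    by (simp add: algebra_simps exp_minus)
  also have "exp (- (2 * K * s)) * s \<le> 1 / (2 * K)"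
  proof -
    have "2 * K * s \<le> exp (2 * K * s)" using exp_ge_add_one_self[of "2 * K * s"] by linarith
    then show ?thesis using K by (simp add: exp_minus field_simps)
  qed
  finally show ?thesis using A by (simp add: mult_left_mono)
qed

text \<open>Picard iteration in a weighted supremum norm: a solution is sought as
  \<open>x + exp (2 * k * r) *\<^sub>R z r\<close> with \<open>z\<close> bounded and continuous. The
  weight makes the integral operator a contraction with factor 1/2 on the whole half-line, so a
  single fixed point is a global solution.\<close>

lemma lipschitz_ode_exists:
  fixes V :: "'a::euclidean_space \<Rightarrow> 'a"
  assumes V: "K-lipschitz_on UNIV V"
  obtains X where "X 0 = x" "\<And>t. 0 \<le> t \<Longrightarrow> (X has_vector_derivative V (X t)) (at t within {0..})"
proof -
  \<comment> \<open>A strictly positive Lipschitz constant, since the weighted bound divides by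
    \<open>2 * k\<close>.\<close>
  define k where "k = K + 1"
  have k: "0 < k" "K \<le> k" using lipschitz_on_nonneg[OF V] by (auto simp: k_def)
  have Vk: "norm (V a - V b) \<le> k * norm (a - b)" for a b
    using lipschitz_on_normD[OF V, of a b] mult_right_mono[OF k(2) norm_ge_zero[of "a - b"]] by linarith
  have Vc: "continuous_on S V" for S using lipschitz_on_continuous_on[OF V] continuous_on_subset by blast
  define Y where "Y z r = x + exp (2 * k * r) *\<^sub>R apply_bcontfun z r" for z :: "real \<Rightarrow>\<^sub>C 'a" and r
  have Yc: "continuous_on S (Y z)" for S z unfolding Y_def by (intro continuous_intros continuous_on_apply_bcontfun)
  have VYc: "continuous_on S (\<lambda>r. V (Y z r))" for S z
    by (rule continuous_on_compose2[OF Vc Yc]) auto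
  \<comment> \<open>The operator is extended constantly to negative times by \<open>max 0 t\<close>,
    because bounded continuous functions are defined on all of \<open>real\<close>.\<close>
  define P where "P z t = exp (- (2 * k * max 0 t)) *\<^sub>R integral {0..max 0 t} (\<lambda>r. V (Y z r))" for z t
  have Pnorm: "norm (P z t) = exp (- (2 * k * max 0 t)) * norm (integral {0..max 0 t} (\<lambda>r. V (Y z r)))" for z t
    by (simp add: P_def)
  have Pb: "norm (P z t) \<le> norm (V x) / (2 * k) + k * norm z / (2 * k)" for z t
    unfolding Pnorm
  proof (rule weighted_integral_bound)
    fix r :: real
    have "norm (V (Y z r)) \<le> norm (V x) + norm (V (Y z r) - V x)" by (rule norm_triangle_sub)
    also have "norm (V (Y z r) - V x) \<le> k * norm (Y z r - x)" by (rule Vk)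
    also have "norm (Y z r - x) = exp (2 * k * r) * norm (apply_bcontfun z r)" by (simp add: Y_def)
    also have "\<dots> \<le> exp (2 * k * r) * norm z" by (intro mult_left_mono norm_bounded) auto
    finally show "norm (V (Y z r)) \<le> norm (V x) + k * norm z * exp (2 * k * r)"
      using k by (simp add: mult_ac)
  qed (use k VYc in auto)
  have Pc: "continuous_on UNIV (P z)" for z
  proof -
    have I: "continuous_on {0..} (\<lambda>t. integral {0..t} (\<lambda>r. V (Y z r)))"
      unfolding continuous_on_eq_continuous_within
    proof
      fix t :: real assume t: "t \<in> {0..}"
      have "continuous_on {0..t+1} (\<lambda>t. integral {0..t} (\<lambda>r. V (Y z r)))"
        by (intro indefinite_integral_continuous_1 integrable_continuous_real VYc)
      then have "continuous (at t within {0..t+1}) (\<lambda>t. integral {0..t} (\<lambda>r. V (Y z r)))"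
        using t by (simp add: continuous_on_eq_continuous_within)
      moreover have "at t within {0..t+1} = at t within {0..}"
        by (rule at_within_nhd[of _ "{..<t+1}"]) auto
      ultimately show "continuous (at t within {0..}) (\<lambda>t. integral {0..t} (\<lambda>r. V (Y z r)))" by simp
    qed
    have "continuous_on UNIV (\<lambda>t. integral {0..max 0 t} (\<lambda>r. V (Y z r)))"
      by (rule continuous_on_compose2[OF I]) (auto intro!: continuous_intros)
    then show ?thesis unfolding P_def by (intro continuous_intros)
  qed
  define F where "F z = Bcontfun (P z)" for z
  have F: "apply_bcontfun (F z) = P z" for z
    unfolding F_def by (intro Bcontfun_inverse bcontfun_normI[OF Pc Pb])
  have "\<exists>!z. F z = z"
  proof (rule banach_fix_type)
    show "\<forall>y z. dist (F y) (F z) \<le> 1/2 * dist y z"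
    proof (intro allI dist_bound)
      fix y z :: "real \<Rightarrow>\<^sub>C 'a" and t :: real
      let ?s = "max 0 t"
      have "P y t - P z t = exp (- (2 * k * ?s)) *\<^sub>R integral {0..?s} (\<lambda>r. V (Y y r) - V (Y z r))"
        unfolding P_def by (subst Henstock_Kurzweil_Integration.integral_diff)
          (auto intro!: integrable_continuous_real VYc simp: scaleR_diff_right)
      then have "norm (P y t - P z t) = exp (- (2 * k * ?s)) * norm (integral {0..?s} (\<lambda>r. V (Y y r) - V (Y z r)))" by simp
      also have "\<dots> \<le> 0 / (2 * k) + k * dist y z / (2 * k)"
      proof (rule weighted_integral_bound)
        fix r :: real
        have "norm (V (Y y r) - V (Y z r)) \<le> k * norm (Y y r - Y z r)" by (rule Vk)
        also have "Y y r - Y z r = exp (2 * k * r) *\<^sub>R (apply_bcontfun y r - apply_bcontfun z r)"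
          by (simp add: Y_def scaleR_diff_right)
        also have "k * norm \<dots> \<le> k * (exp (2 * k * r) * dist y z)"
          using k dist_bounded[of y r z] by (auto intro!: mult_left_mono simp: dist_norm)
        finally show "norm (V (Y y r) - V (Y z r)) \<le> 0 + k * dist y z * exp (2 * k * r)" by (simp add: mult_ac)
      qed (use k VYc in \<open>auto intro!: continuous_on_diff\<close>)
      finally show "dist (apply_bcontfun (F y) t) (apply_bcontfun (F z) t) \<le> 1/2 * dist y z"
        using k by (simp add: F dist_norm)
    qed
  qed auto
  then obtain z where z: "F z = z" by blast
  define X where "X t = x + integral {0..t} (\<lambda>r. V (Y z r))" for t
  have XY: "X t = Y z t" if "0 \<le> t" for t
  proof -
    have "apply_bcontfun z t = P z t" using F[of z] z by simp
    then show ?thesis using that by (simp add: X_def Y_def P_def exp_minus)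
  qed
  show thesis
  proof
    show "X 0 = x" by (simp add: X_def)
    fix t :: real assume t: "0 \<le> t"
    have "((\<lambda>u. integral {0..u} (\<lambda>r. V (Y z r))) has_vector_derivative V (Y z t)) (at t within {0..t+1})"
      using t by (intro integral_has_vector_derivative VYc) auto
    then have "(X has_vector_derivative V (X t)) (at t within {0..t+1})"
      unfolding XY[OF t] unfolding X_def by (auto intro!: derivative_eq_intros)
    moreover have "at t within {0..t+1} = at t within {0..}"
      by (rule at_within_nhd[of _ "{..<t+1}"]) (use t in auto)
    ultimately show "(X has_vector_derivative V (X t)) (at t within {0..})" by simp
  qed
qed

lemma lipschitz_flow_exists:
  fixes V :: "'a::euclidean_space \<Rightarrow> 'a"
  assumes V: "K-lipschitz_on UNIV V"
  obtains \<phi> where "\<And>x. \<phi> 0 x = x"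
    "\<And>x t. 0 \<le> t \<Longrightarrow> ((\<lambda>t. \<phi> t x) has_vector_derivative V (\<phi> t x)) (at t within {0..})"
    "\<And>x y t. 0 \<le> t \<Longrightarrow> norm (\<phi> t x - \<phi> t y) \<le> exp (K * t) * norm (x - y)"
    "\<And>x s t. 0 \<le> s \<Longrightarrow> 0 \<le> t \<Longrightarrow> \<phi> (s + t) x = \<phi> t (\<phi> s x)"
proof -
  have "\<exists>X. X 0 = x \<and> (\<forall>t\<ge>0. (X has_vector_derivative V (X t)) (at t within {0..}))" for x
    using lipschitz_ode_exists[OF V, of x] by metis
  then obtain X where X: "\<And>x. X x 0 = x"
    "\<And>x t. 0 \<le> t \<Longrightarrow> (X x has_vector_derivative V (X x t)) (at t within {0..})" by metis
  have unique: "norm (Y t - Z t) \<le> exp (K * t) * norm (Y 0 - Z 0)"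
    if "0 \<le> t" "\<And>t. 0 \<le> t \<Longrightarrow> (Y has_vector_derivative V (Y t)) (at t within {0..})"
      "\<And>t. 0 \<le> t \<Longrightarrow> (Z has_vector_derivative V (Z t)) (at t within {0..})" for Y Z t
    by (rule lipschitz_flow_contraction[OF V that(1)])
      (rule has_vector_derivative_within_subset[OF that(2)] has_vector_derivative_within_subset[OF that(3)]; force)+
  show thesis
  proof
    show "X x 0 = x" for x by (rule X)
    show "((\<lambda>t. X x t) has_vector_derivative V (X x t)) (at t within {0..})" if "0 \<le> t" for x t
      using X(2)[OF that] .
    show "norm (X x t - X y t) \<le> exp (K * t) * norm (x - y)" if "0 \<le> t" for x y t
      using unique[OF that X(2) X(2), of x y] X(1) by simp
    \<comment> \<open>Both sides solve the autonomous equation in \<open>t\<close> with value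
      \<open>X x s\<close> at time 0, so the contraction estimate identifies them.\<close>
    show "X x (s + t) = X (X x s) t" if st: "0 \<le> s" "0 \<le> t" for x s t
    proof -
      have "((\<lambda>t. X x (s + t)) has_vector_derivative V (X x (s + r))) (at r within {0..})" if r: "0 \<le> r" for r
      proof -
        have "((X x \<circ> (\<lambda>t. s + t)) has_vector_derivative 1 *\<^sub>R V (X x (s + r))) (at r within {0..})"
        proof (rule vector_diff_chain_within)
          show "((\<lambda>t. s + t) has_vector_derivative 1) (at r within {0..})" by (auto intro!: derivative_eq_intros)
          show "(X x has_vector_derivative V (X x (s + r))) (at (s + r) within (\<lambda>t. s + t) ` {0..})"
            by (rule has_vector_derivative_within_subset[OF X(2)]) (use r st in auto)
        qed
        then show ?thesis by (simp add: o_def)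
      qed
      from unique[OF st(2) this X(2), of "X x s"] show ?thesis using X(1) by simp
    qed
  qed
qed

text \<open>The functions \<open>max 0 (1 - real n * infdist x C)\<close> are Lipschitz with values
  in the unit interval and decrease to the indicator of a nonempty closed set \<open>C\<close>.
  Dominated convergence gives equality on closed sets, an intersection-stable generator of the Borel
  sets.\<close>

lemma finite_measure_eqI_lipschitz:
  fixes M N :: "'a::metric_space measure"
  assumes M: "finite_measure M" "sets M = sets borel" and N: "finite_measure N" "sets N = sets borel"
    and eq: "\<And>f L. (L-lipschitz_on UNIV f) \<Longrightarrow> (\<And>x. 0 \<le> f x \<and> f x \<le> 1) \<Longrightarrow> (LINT x|M. f x) = (LINT x|N. f x :: real)"
  shows "M = N"
proof -
  interpret M: finite_measure M by fact
  interpret N: finite_measure N by fact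
  have spM: "space M = UNIV" "space N = UNIV" using M(2) N(2) by (metis sets_eq_imp_space_eq space_borel)+
  have key: "measure M C = measure N C" if C: "closed C" "C \<noteq> {}" for C
  proof -
    define f where "f n x = max 0 (1 - real n * infdist x C)" for n x
    have flip: "(real n)-lipschitz_on UNIV (f n)" for n
    proof (rule lipschitz_onI)
      fix x y
      have "\<bar>f n x - f n y\<bar> \<le> \<bar>real n * (infdist x C - infdist y C)\<bar>"
        unfolding f_def right_diff_distrib by linarith
      also have "\<dots> \<le> real n * dist x y" unfolding abs_mult using infdist_triangle_abs[of x C y] by (auto intro!: mult_left_mono)
      finally show "dist (f n x) (f n y) \<le> real n * dist x y" by (simp add: dist_real_def)
    qed simp
    have f01: "0 \<le> f n x \<and> f n x \<le> 1" for n x unfolding f_def using infdist_nonneg[of x C] by simp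
    have fm: "f n \<in> borel_measurable borel" for n
      by (intro borel_measurable_continuous_onI lipschitz_on_continuous_on[OF flip])
    have lim: "(\<lambda>n. f n x) \<longlonglongrightarrow> indicator C x" for x
    proof (cases "x \<in> C")
      case True
      then show ?thesis by (simp add: f_def)
    next
      case False
      then have p: "infdist x C > 0" using C by (metis in_closed_iff_infdist_zero infdist_nonneg less_eq_real_def)
      obtain n0 where n0: "1 < real n0 * infdist x C" using p by (metis reals_Archimedean3)
      have "\<forall>\<^sub>F n in sequentially. f n x = 0"
      proof (rule eventually_sequentiallyI)
        fix n assume "n0 \<le> n"
        then have "real n0 * infdist x C \<le> real n * infdist x C" using p by (intro mult_right_mono) auto
        then show "f n x = 0" using n0 by (simp add: f_def)
      qed
      then show ?thesis using False by (simp add: tendsto_eventually)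
    qed
    have L: "(\<lambda>n. LINT x|Q. f n x) \<longlonglongrightarrow> measure Q C" if Q: "finite_measure Q" "sets Q = sets borel" for Q
    proof -
      interpret Q: finite_measure Q by fact
      have spQ: "space Q = UNIV" using Q(2) by (metis sets_eq_imp_space_eq space_borel)
      have Cs: "C \<in> sets Q" using C Q by simp
      have fmQ: "f n \<in> borel_measurable Q" for n using fm[of n] measurable_cong_sets[OF Q(2) refl] by blast
      have "(\<lambda>n. LINT x|Q. f n x) \<longlonglongrightarrow> (LINT x|Q. indicator C x)"
        by (rule integral_dominated_convergence[where w="\<lambda>_. 1"]) (use f01 lim fmQ Cs in auto)
      then show ?thesis using Cs spQ by simp
    qed
    have "(\<lambda>n. LINT x|M. f n x) = (\<lambda>n. LINT x|N. f n x)" using eq[OF flip] f01 by blast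
    then show ?thesis using L[OF M] L[OF N] LIMSEQ_unique by metis
  qed
  show ?thesis
  proof (rule measure_eqI_generator_eq[where \<Omega>=UNIV and E="Collect closed" and A="\<lambda>_. UNIV"])
    show "Int_stable (Collect closed :: 'a set set)" by (auto simp: Int_stable_def)
    show "emeasure M X = emeasure N X" if "X \<in> Collect closed" for X
      using key[of X] that by (cases "X = {}") (auto simp: M.emeasure_eq_measure N.emeasure_eq_measure)
    show "sets M = sigma_sets UNIV (Collect closed)" "sets N = sigma_sets UNIV (Collect closed)"
      using M(2) N(2) by (simp_all add: borel_eq_closed)
  qed (use M.emeasure_finite in auto)
qed

section \<open>The Yukawa kernel\<close>

text \<open>For negative \<open>t\<close> the factor \<open>exp (p * t)\<close> decays; for
  \<open>t \<ge> 0\<close> the double exponential wins, and a multiple of \<open>exp (- t)\<close>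
  is a majorant.\<close>

lemma integrable_exp_minus_exp:
  fixes p :: real
  assumes p: "0 < p"
  shows "integrable lborel (\<lambda>t::real. exp (- exp t / 2) * exp (p * t))"
proof -
  have E: "integrable lborel (\<lambda>t::real. indicator {0..} t * exp (- t))"
  proof -
    have 1: "integrable lborel (\<lambda>t::real. exp (- t) * indicator {0<..} t)"
      using has_bochner_integral_I0i_power_exp_m[of 0] by (simp add: has_bochner_integral_iff)
    have "AE t::real in lborel. t \<noteq> 0" by (rule AE_lborel_singleton)
    then have 2: "AE t::real in lborel. exp (- t) * indicator {0<..} t = indicator {0..} t * exp (- t)"
      by eventually_elim (simp add: indicator_def)
    show ?thesis by (rule integrable_cong_AE_imp[OF 1 _ 2]) measurable
  qed
  have "integrable lborel (\<lambda>t::real. indicator {0..} (0 + (- p) * t) * exp (- (0 + (- p) * t)))"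
    using p by (intro lborel_integrable_real_affine[OF E]) auto
  then have E': "integrable lborel (\<lambda>t::real. indicator {0..} (- (p * t)) * exp (p * t))" by simp
  \<comment> \<open>From \<open>exp t \<ge> t^2 / 2\<close> the exponent is at most
    \<open>p * t - t^2 / 4\<close>; completing the square bounds this by
    \<open>(p + 1)^2 - t\<close>.\<close>
  define C where "C = exp ((p + 1)\<^sup>2)"
  have "integrable lborel (\<lambda>t::real. C * (indicator {0..} t * exp (- t)) + indicator {0..} (- (p * t)) * exp (p * t))"
    using E E' by simp
  then show ?thesis
  proof (rule Bochner_Integration.integrable_bound)
    show "AE t in lborel. norm (exp (- exp t / 2) * exp (p * t))
      \<le> norm (C * (indicator {0..} t * exp (- t)) + indicator {0..} (- (p * t)) * exp (p * t))"
    proof (rule AE_I2)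
      fix t :: real
      show "norm (exp (- exp t / 2) * exp (p * t))
        \<le> norm (C * (indicator {0..} t * exp (- t)) + indicator {0..} (- (p * t)) * exp (p * t))"
      proof (cases "0 \<le> t")
        case True
        have "1 + t + t\<^sup>2 / 2 \<le> exp t" using exp_lower_Taylor_quadratic[OF True] by simp
        then have "t\<^sup>2 / 2 \<le> exp t" using True by linarith
        moreover have "0 \<le> (t / 2 - (p + 1))\<^sup>2" by simp
        ultimately have "- exp t / 2 + p * t \<le> (p + 1)\<^sup>2 + - t" by (simp add: power2_eq_square algebra_simps)
        then have "exp (- exp t / 2) * exp (p * t) \<le> C * exp (- t)"
          unfolding C_def exp_add[symmetric] by simp
        moreover have "0 \<le> indicator {0..} (- (p * t)) * exp (p * t)" by simp
        ultimately have "exp (- exp t / 2) * exp (p * t) \<le> C * exp (- t) + indicator {0..} (- (p * t)) * exp (p * t)" by linarith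
        then show ?thesis using True by simp
      next
        case False
        then have "- (p * t) \<ge> 0" using p by (simp add: mult_nonneg_nonpos)
        then have i: "indicator {0..} (- (p * t)) = (1::real)" by simp
        have "exp (- exp t / 2) * exp (p * t) \<le> 1 * exp (p * t)" by (intro mult_right_mono) auto
        then show ?thesis unfolding i using False by simp
      qed
    qed
  qed measurable
qed

text \<open>The translation of \<open>t\<close> by \<open>ln z\<close> absorbs \<open>z\<close> into
  the exponential and leaves the factor \<open>z powr (- p)\<close>. This is the source of the power
  laws of the kernel at the origin.\<close>

lemma
  fixes p z :: real
  assumes p: "0 < p" and z: "0 < z"
  shows integrable_exp_minus_scaled_exp: "integrable lborel (\<lambda>t::real. exp (- (z * exp t) / 2) * exp (p * t))"
    and integral_exp_minus_scaled_exp: "(LINT t|lborel. exp (- (z * exp t) / 2) * exp (p * t))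
      = z powr (- p) * (LINT t|lborel. exp (- exp t / 2) * exp (p * t))"
proof -
  let ?f = "\<lambda>t::real. exp (- exp t / 2) * exp (p * t)"
  have eq: "exp (- (z * exp t) / 2) * exp (p * t) = z powr (- p) * ?f (ln z + 1 * t)" for t
    using z by (simp add: exp_add powr_def distrib_left exp_minus field_simps)
  show "integrable lborel (\<lambda>t::real. exp (- (z * exp t) / 2) * exp (p * t))"
    unfolding eq by (intro integrable_mult_right lborel_integrable_real_affine integrable_exp_minus_exp p) simp
  show "(LINT t|lborel. exp (- (z * exp t) / 2) * exp (p * t)) = z powr (- p) * (LINT t|lborel. ?f t)"
    unfolding eq using lborel_integral_real_affine[of 1 ?f "ln z"] by simp
qed

text \<open>Up to the sign \<open>(-1) ^ m\<close> this is the \<open>m\<close>-th derivative of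
  \<open>bessel_K \<nu>\<close> at \<open>z\<close>.\<close>

definition bessel_moment :: "nat \<Rightarrow> real \<Rightarrow> real \<Rightarrow> real" where
  "bessel_moment m \<nu> z = (LINT t|lborel. indicator {0<..} t * (exp (- z * cosh t) * (cosh (\<nu> * t) * cosh t ^ m)))"

lemma bessel_K_eq_moment: "bessel_K \<nu> z = bessel_moment 0 \<nu> z"
  by (simp add: bessel_K_def bessel_moment_def set_lebesgue_integral_def)

lemma cosh_le_exp: "0 \<le> t \<Longrightarrow> cosh t \<le> exp (t::real)"
  by (simp add: cosh_def field_simps)

lemma exp_le_cosh: "exp t / 2 \<le> cosh (t::real)"
  by (simp add: cosh_def)

text \<open>For \<open>t > 0\<close> the hyperbolic cosine lies between \<open>exp t / 2\<close> and
  \<open>exp t\<close>. The integral of the resulting majorant depends on \<open>z\<close> through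
  an explicit power.\<close>

lemma bessel_moment_integrand_le:
  assumes "0 \<le> \<nu>" "0 < z"
  shows "indicator {0<..} t * (exp (- z * cosh t) * (cosh (\<nu> * t) * cosh t ^ m))
    \<le> exp (- (z * exp t) / 2) * exp ((\<nu> + real m) * t)"
proof (cases "t > 0")
  case True
  have "exp (- z * cosh t) \<le> exp (- (z * exp t) / 2)"
    using mult_left_mono[OF exp_le_cosh[of t], of z] assms by simp
  moreover have "cosh (\<nu> * t) * cosh t ^ m \<le> exp (\<nu> * t) * exp t ^ m"
    using True assms by (intro mult_mono power_mono cosh_le_exp) (auto simp: cosh_real_nonneg)
  ultimately have "exp (- z * cosh t) * (cosh (\<nu> * t) * cosh t ^ m)
      \<le> exp (- (z * exp t) / 2) * (exp (\<nu> * t) * exp t ^ m)"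
    by (rule mult_mono) (simp_all add: cosh_real_nonneg del: mult_le_cancel_left mult_le_cancel_right)
  also have "exp (\<nu> * t) * exp t ^ m = exp ((\<nu> + real m) * t)"
    by (simp add: exp_of_nat_mult[symmetric] exp_add[symmetric] distrib_right)
  finally show ?thesis using True by simp
qed simp

lemma bessel_moment_integrand_nonneg:
  "0 \<le> indicator {0<..} t * (exp (- z * cosh t) * (cosh (\<nu> * t) * cosh t ^ m))" for t :: real
  by (simp add: cosh_real_nonneg)

lemma borel_measurable_cosh[measurable]: "(cosh :: real \<Rightarrow> real) \<in> borel_measurable borel"
  by (intro borel_measurable_continuous_onI continuous_intros)

lemma integrable_bessel_moment_pos:
  assumes "0 \<le> \<nu>" "0 < z" "0 < \<nu> + real m"
  shows "integrable lborel (\<lambda>t::real. indicator {0<..} t * (exp (- z * cosh t) * (cosh (\<nu> * t) * cosh t ^ m)))"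
proof (rule Bochner_Integration.integrable_bound[OF integrable_exp_minus_scaled_exp[OF assms(3,2)]])
  show "AE t in lborel. norm (indicator {0<..} t * (exp (- z * cosh t) * (cosh (\<nu> * t) * cosh t ^ m)))
      \<le> norm (exp (- (z * exp t) / 2) * exp ((\<nu> + real m) * t))"
    using bessel_moment_integrand_le[OF assms(1,2)] bessel_moment_integrand_nonneg by (intro AE_I2) (simp only: real_norm_def abs_of_nonneg, simp)
qed measurable

text \<open>In dimension two the zeroth moment has \<open>\<nu> + real m = 0\<close>, where the
  exponential majorant is not integrable. As \<open>cosh t \<ge> 1\<close>, the integrand of the
  next moment serves as majorant in all cases.\<close>

lemma integrable_bessel_moment:
  assumes "0 \<le> \<nu>" "0 < z"
  shows "integrable lborel (\<lambda>t::real. indicator {0<..} t * (exp (- z * cosh t) * (cosh (\<nu> * t) * cosh t ^ m)))"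
proof (rule Bochner_Integration.integrable_bound[OF integrable_bessel_moment_pos[OF assms, of "Suc m"]])
  show "AE t in lborel. norm (indicator {0<..} t * (exp (- z * cosh t) * (cosh (\<nu> * t) * cosh t ^ m)))
      \<le> norm (indicator {0<..} t * (exp (- z * cosh t) * (cosh (\<nu> * t) * cosh t ^ Suc m)))"
  proof (rule AE_I2)
    fix t :: real
    have "indicator {0<..} t * (exp (- z * cosh t) * (cosh (\<nu> * t) * cosh t ^ m)) * 1
      \<le> indicator {0<..} t * (exp (- z * cosh t) * (cosh (\<nu> * t) * cosh t ^ m)) * cosh t"
      by (intro mult_left_mono bessel_moment_integrand_nonneg cosh_real_ge_1)
    then show "norm (indicator {0<..} t * (exp (- z * cosh t) * (cosh (\<nu> * t) * cosh t ^ m)))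
      \<le> norm (indicator {0<..} t * (exp (- z * cosh t) * (cosh (\<nu> * t) * cosh t ^ Suc m)))"
      unfolding real_norm_def abs_of_nonneg[OF bessel_moment_integrand_nonneg] by (simp add: mult_ac)
  qed
qed (use assms in \<open>auto\<close>)

lemma bessel_moment_nonneg: "0 \<le> bessel_moment m \<nu> z"
  unfolding bessel_moment_def by (intro Bochner_Integration.integral_nonneg bessel_moment_integrand_nonneg)

lemma bessel_moment_le_Suc:
  assumes "0 \<le> \<nu>" "0 < z"
  shows "bessel_moment m \<nu> z \<le> bessel_moment (Suc m) \<nu> z"
  unfolding bessel_moment_def
proof (rule integral_mono[OF integrable_bessel_moment[OF assms] integrable_bessel_moment[OF assms]])
  fix t :: real
  have "indicator {0<..} t * (exp (- z * cosh t) * (cosh (\<nu> * t) * cosh t ^ m)) * 1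
    \<le> indicator {0<..} t * (exp (- z * cosh t) * (cosh (\<nu> * t) * cosh t ^ m)) * cosh t"
    by (intro mult_left_mono bessel_moment_integrand_nonneg cosh_real_ge_1)
  then show "indicator {0<..} t * (exp (- z * cosh t) * (cosh (\<nu> * t) * cosh t ^ m))
    \<le> indicator {0<..} t * (exp (- z * cosh t) * (cosh (\<nu> * t) * cosh t ^ Suc m))"
    by (simp add: mult_ac)
qed

lemma bessel_moment_bound:
  assumes "0 \<le> \<nu>" "0 < \<nu> + real m"
  obtains C where "0 \<le> C" "\<And>z. 0 < z \<Longrightarrow> bessel_moment m \<nu> z \<le> C * z powr (- (\<nu> + real m))"
proof
  let ?p = "\<nu> + real m"
  show "0 \<le> (LINT t|lborel. exp (- exp t / 2) * exp (?p * t))" by (rule Bochner_Integration.integral_nonneg) simp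
  fix z :: real assume z: "0 < z"
  have "bessel_moment m \<nu> z \<le> (LINT t|lborel. exp (- (z * exp t) / 2) * exp (?p * t))"
    unfolding bessel_moment_def
    by (rule integral_mono[OF integrable_bessel_moment[OF assms(1) z] integrable_exp_minus_scaled_exp[OF assms(2) z]])
      (rule bessel_moment_integrand_le[OF assms(1) z])
  then show "bessel_moment m \<nu> z \<le> (LINT t|lborel. exp (- exp t / 2) * exp (?p * t)) * z powr (- ?p)"
    using integral_exp_minus_scaled_exp[OF assms(2) z] by (simp add: mult.commute)
qed

text \<open>Each derivative in \<open>z\<close> brings down a factor \<open>- cosh t\<close>, so
  moments differentiate into moments. For \<open>y\<close> within \<open>z / 2\<close> of
  \<open>z\<close> these derivatives are dominated by the integrand of the next moment at
  \<open>z / 2\<close>.\<close>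

lemma has_real_derivative_bessel_moment:
  assumes \<nu>: "0 \<le> \<nu>" and z: "0 < z"
  shows "(bessel_moment m \<nu> has_real_derivative - bessel_moment (Suc m) \<nu> z) (at z)"
proof -
  define b where "b t = indicator {0<..} t * (cosh (\<nu> * t) * cosh t ^ m)" for t :: real
  have b0: "0 \<le> b t" for t by (simp add: b_def cosh_real_nonneg)
  have [measurable]: "b \<in> borel_measurable borel" unfolding b_def by measurable
  have eq: "bessel_moment m \<nu> = (\<lambda>z. LINT t|lborel. exp (- z * cosh t) * b t)"
    unfolding bessel_moment_def b_def by (simp add: mult_ac)
  have int: "integrable lborel (\<lambda>t. exp (- z * cosh t) * b t)" if "0 < z" for z
    using integrable_bessel_moment[OF \<nu> that, of m] by (simp add: b_def mult_ac)
  have intS: "integrable lborel (\<lambda>t. exp (- z * cosh t) * (cosh t * b t))" if "0 < z" for z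
    using integrable_bessel_moment[OF \<nu> that, of "Suc m"] by (simp add: b_def mult_ac)
  have der: "((\<lambda>z. exp (- z * cosh t) * b t) has_real_derivative - (exp (- z * cosh t) * (cosh t * b t))) (at z)" for z t
    by (auto intro!: derivative_eq_intros)
  have "((\<lambda>z. LINT t|lborel. exp (- z * cosh t) * b t) has_vector_derivative
      (LINT t|lborel. - (exp (- z * cosh t) * (cosh t * b t)))) (at z)"
  proof (rule has_vector_derivative_lebesgue_integral[where r="z/2" and B="\<lambda>t. exp (- (z/2) * cosh t) * (cosh t * b t)"])
    show "AE t in lborel. ((\<lambda>z. exp (- z * cosh t) * b t) has_vector_derivative - (exp (- z * cosh t) * (cosh t * b t))) (at z)"
      using der by (auto simp: has_real_derivative_iff_has_vector_derivative[symmetric])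
    have le: "exp (- y * cosh t) * (cosh t * b t) \<le> exp (- (z/2) * cosh t) * (cosh t * b t)" if "z / 2 \<le> y" for y t
    proof (rule mult_right_mono)
      show "exp (- y * cosh t) \<le> exp (- (z/2) * cosh t)"
        using mult_right_mono[OF that, of "cosh t"] by (simp add: cosh_real_nonneg)
    qed (simp add: b0 cosh_real_nonneg)
    show "AE t in lborel. norm (- (exp (- z * cosh t) * (cosh t * b t))) \<le> exp (- (z/2) * cosh t) * (cosh t * b t)"
      using le[of z] z b0 by (auto simp: abs_mult cosh_real_nonneg)
    show "AE t in lborel. \<forall>y\<in>UNIV. dist y z < z / 2 \<longrightarrow>
        norm (exp (- y * cosh t) * b t - exp (- z * cosh t) * b t) \<le> exp (- (z/2) * cosh t) * (cosh t * b t) * \<bar>y - z\<bar>"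
    proof (intro AE_I2 ballI impI)
      fix t y :: real assume y: "dist y z < z / 2"
      have "norm (exp (- y * cosh t) * b t - exp (- z * cosh t) * b t) \<le> exp (- (z/2) * cosh t) * (cosh t * b t) * norm (y - z)"
      proof (rule field_differentiable_bound[where S="{z/2..3*z/2}" and f'="\<lambda>y. - (exp (- y * cosh t) * (cosh t * b t))"])
        show "((\<lambda>z. exp (- z * cosh t) * b t) has_real_derivative - (exp (- x * cosh t) * (cosh t * b t))) (at x within {z/2..3*z/2})" for x
          by (rule has_field_derivative_at_within[OF der])
        show "norm (- (exp (- x * cosh t) * (cosh t * b t))) \<le> exp (- (z/2) * cosh t) * (cosh t * b t)" if "x \<in> {z/2..3*z/2}" for x
          using le[of x] that b0 by (auto simp: abs_mult cosh_real_nonneg)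
      qed (use y z in \<open>auto simp: dist_real_def abs_if split: if_splits\<close>)
      then show "norm (exp (- y * cosh t) * b t - exp (- z * cosh t) * b t) \<le> exp (- (z/2) * cosh t) * (cosh t * b t) * \<bar>y - z\<bar>" by simp
    qed
    show "integrable lborel (\<lambda>t. exp (- y * cosh t) * b t)" if "dist y z < z / 2" for y
      using that z by (intro int) (auto simp: dist_real_def abs_if split: if_splits)
    show "integrable lborel (\<lambda>t. exp (- (z/2) * cosh t) * (cosh t * b t))" using z by (intro intS) simp
  qed (use z in \<open>auto\<close>)
  also have "(LINT t|lborel. - (exp (- z * cosh t) * (cosh t * b t))) = - bessel_moment (Suc m) \<nu> z"
    by (simp add: bessel_moment_def b_def mult_ac)
  finally show ?thesis by (simp add: eq has_real_derivative_iff_has_vector_derivative)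
qed

text \<open>For \<open>z < 1\<close> the integral is restricted to \<open>t\<close> between 0 and
  \<open>- ln z\<close>, where \<open>exp (- z * cosh t)\<close> is at least
  \<open>1 - z * exp t\<close>; this integrates to \<open>- ln z - 1 + z\<close>. For
  \<open>z \<ge> 1\<close> the left side is nonpositive.\<close>

lemma bessel_K_0_ge:
  assumes z: "0 < z"
  shows "- ln z - 1 \<le> bessel_K 0 z"
proof (cases "z < 1")
  case False
  then have "- ln z - 1 \<le> 0" using ln_ge_zero[of z] by linarith
  also have "0 \<le> bessel_K 0 z" unfolding bessel_K_eq_moment by (rule bessel_moment_nonneg)
  finally show ?thesis .
next
  case True
  define a where "a = - ln z"
  have a: "0 < a" "exp a = 1 / z" "a = - ln z" using True z by (auto simp: a_def exp_minus inverse_eq_divide)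
  have hi: "((\<lambda>t. 1 - z * exp t) has_integral (a - z * exp a) - (0 - z * exp 0)) {0..a}"
    using a by (intro fundamental_theorem_of_calculus)
      (auto intro!: derivative_eq_intros simp: has_real_derivative_iff_has_vector_derivative[symmetric])
  have si: "integrable lborel (\<lambda>t. indicator {0..a} t *\<^sub>R (1 - z * exp t))"
    by (intro borel_integrable_compact continuous_intros) auto
  have "(LINT t|lborel. indicator {0..a} t *\<^sub>R (1 - z * exp t)) = integral {0..a} (\<lambda>t. 1 - z * exp t)"
    using set_borel_integral_eq_integral(2)[of "{0..a}" "\<lambda>t. 1 - z * exp t"] si
    by (simp add: set_integrable_def set_lebesgue_integral_def)
  also have "\<dots> = a - 1 + z" using integral_unique[OF hi] a z by simp
  finally have I: "(LINT t|lborel. indicator {0..a} t *\<^sub>R (1 - z * exp t)) = a - 1 + z" .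
  have "a - 1 + z \<le> bessel_moment 0 0 z"
    unfolding I[symmetric] bessel_moment_def
  proof (rule integral_mono_AE[OF si integrable_bessel_moment])
    have "AE t::real in lborel. t \<noteq> 0" by (rule AE_lborel_singleton)
    then show "AE t in lborel. indicator {0..a} t *\<^sub>R (1 - z * exp t)
        \<le> indicator {0<..} t * (exp (- z * cosh t) * (cosh (0 * t) * cosh t ^ 0))"
    proof eventually_elim
      fix t :: real assume t: "t \<noteq> 0"
      show "indicator {0..a} t *\<^sub>R (1 - z * exp t)
        \<le> indicator {0<..} t * (exp (- z * cosh t) * (cosh (0 * t) * cosh t ^ 0))"
      proof (cases "t \<in> {0..a}")
        case True
        then have tp: "t > 0" using t by auto
        have "1 - z * exp t \<le> 1 + (- z * cosh t)" using cosh_le_exp[of t] tp z by simp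
        also have "\<dots> \<le> exp (- z * cosh t)" by (rule exp_ge_add_one_self)
        finally show ?thesis using True tp by simp
      qed (simp add: cosh_real_nonneg)
    qed
  qed (use z in auto)
  then show ?thesis using a z by (simp add: bessel_K_eq_moment)
qed

text \<open>Continuous differentiability on the positive half-line with the derivative hidden, so
  that the property passes through products and differences. Applied to the derivative of the
  profile, it makes the force locally Lipschitz away from collisions.\<close>

definition C1_pos :: "(real \<Rightarrow> real) \<Rightarrow> bool" where
  "C1_pos f \<longleftrightarrow> (\<exists>f'. (\<forall>s>0. (f has_real_derivative f' s) (at s)) \<and> continuous_on {0<..} f')"

lemma C1_pos_continuous_on: "C1_pos f \<Longrightarrow> continuous_on {0<..} f"
  unfolding C1_pos_def by (metis DERIV_isCont continuous_at_imp_continuous_on greaterThan_iff)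

lemma C1_pos_mult:
  assumes "C1_pos f" "C1_pos g" shows "C1_pos (\<lambda>s. f s * g s)"
proof -
  obtain f' g' where f: "\<And>s. s > 0 \<Longrightarrow> (f has_real_derivative f' s) (at s)" "continuous_on {0<..} f'"
    and g: "\<And>s. s > 0 \<Longrightarrow> (g has_real_derivative g' s) (at s)" "continuous_on {0<..} g'"
    using assms unfolding C1_pos_def by blast
  have "((\<lambda>s. f s * g s) has_real_derivative f' s * g s + g' s * f s) (at s)" if "s > 0" for s
    by (rule DERIV_mult[OF f(1)[OF that] g(1)[OF that]])
  moreover have "continuous_on {0<..} (\<lambda>s. f' s * g s + g' s * f s)"
    by (intro continuous_intros f(2) g(2) C1_pos_continuous_on assms)
  ultimately show ?thesis unfolding C1_pos_def by (intro exI[of _ "\<lambda>s. f' s * g s + g' s * f s"] conjI allI impI)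
qed

lemma C1_pos_diff:
  assumes "C1_pos f" "C1_pos g" shows "C1_pos (\<lambda>s. f s - g s)"
proof -
  obtain f' g' where f: "\<And>s. s > 0 \<Longrightarrow> (f has_real_derivative f' s) (at s)" "continuous_on {0<..} f'"
    and g: "\<And>s. s > 0 \<Longrightarrow> (g has_real_derivative g' s) (at s)" "continuous_on {0<..} g'"
    using assms unfolding C1_pos_def by blast
  have "((\<lambda>s. f s - g s) has_real_derivative f' s - g' s) (at s)" if "s > 0" for s
    by (rule DERIV_diff[OF f(1)[OF that] g(1)[OF that]])
  moreover have "continuous_on {0<..} (\<lambda>s. f' s - g' s)"
    by (intro continuous_intros f(2) g(2))
  ultimately show ?thesis unfolding C1_pos_def by (intro exI[of _ "\<lambda>s. f' s - g' s"] conjI allI impI)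
qed

lemma C1_pos_const: "C1_pos (\<lambda>s. c)"
  unfolding C1_pos_def by (rule exI[of _ "\<lambda>_. 0"]) auto

lemma C1_pos_powr: "C1_pos (\<lambda>s. s powr a)"
  unfolding C1_pos_def
  by (rule exI[of _ "\<lambda>s. a * s powr (a - 1)"])
    (auto intro!: has_real_derivative_powr continuous_on_mult continuous_on_const continuous_on_powr continuous_on_id)

lemma sqrt_eq_powr_half: "0 \<le> s \<Longrightarrow> sqrt s = s powr (1 / 2)"
  by (simp add: powr_half_sqrt)

lemma has_real_derivative_bessel_moment_sqrt:
  assumes \<nu>: "0 \<le> \<nu>" and \<kappa>: "0 < \<kappa>" and s: "0 < s"
  shows "((\<lambda>s. bessel_moment m \<nu> (\<kappa> * sqrt s)) has_real_derivative
    - bessel_moment (Suc m) \<nu> (\<kappa> * sqrt s) * (\<kappa> / 2 * s powr (- 1 / 2))) (at s)"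
proof -
  have "((\<lambda>s. \<kappa> * sqrt s) has_real_derivative \<kappa> / 2 * s powr (- 1 / 2)) (at s)"
    using s by (auto intro!: derivative_eq_intros simp: powr_minus powr_half_sqrt field_simps)
  then show ?thesis
    by (rule DERIV_chain2[OF has_real_derivative_bessel_moment[OF \<nu>], rotated]) (use \<kappa> s in simp)
qed

lemma C1_pos_bessel_moment_sqrt:
  assumes \<nu>: "0 \<le> \<nu>" and \<kappa>: "0 < \<kappa>"
  shows "C1_pos (\<lambda>s. bessel_moment m \<nu> (\<kappa> * sqrt s))"
proof -
  have "continuous_on {0<..} (\<lambda>s. bessel_moment (Suc m) \<nu> (\<kappa> * sqrt s))"
    using has_real_derivative_bessel_moment_sqrt[OF assms, of _ "Suc m"]
    by (intro continuous_at_imp_continuous_on) (auto intro: DERIV_isCont)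
  then have "continuous_on {0<..} (\<lambda>s. - bessel_moment (Suc m) \<nu> (\<kappa> * sqrt s) * (\<kappa> / 2 * s powr (- 1 / 2)))"
    by (intro continuous_on_mult continuous_on_minus continuous_on_const continuous_on_powr continuous_on_id) auto
  then show ?thesis unfolding C1_pos_def
    using has_real_derivative_bessel_moment_sqrt[OF assms, of _ m]
    by (intro exI[of _ "\<lambda>s. - bessel_moment (Suc m) \<nu> (\<kappa> * sqrt s) * (\<kappa> / 2 * s powr (- 1 / 2))"] conjI allI impI)
qed

text \<open>The Yukawa kernel is the function \<open>gprof \<kappa> (|x|^2)\<close>; working with the squared norm
  makes the regularisation \<open>gprof \<kappa> (|x|^2 + \<delta>)\<close> smooth.\<close>

definition gprof :: "'n::finite itself \<Rightarrow> real \<Rightarrow> real \<Rightarrow> real" where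
  "gprof _ \<kappa> s = (let \<nu> = real CARD('n) / 2 - 1 in
     (2 * pi) powr (- real CARD('n) / 2) * \<kappa> powr \<nu> * (s powr (- \<nu> / 2) * bessel_moment 0 \<nu> (\<kappa> * sqrt s)))"

definition gprof' :: "'n::finite itself \<Rightarrow> real \<Rightarrow> real \<Rightarrow> real" where
  "gprof' _ \<kappa> s = (let \<nu> = real CARD('n) / 2 - 1 in
     (2 * pi) powr (- real CARD('n) / 2) * \<kappa> powr \<nu> *
       ((- \<nu> / 2) * (s powr (- \<nu> / 2 - 1) * bessel_moment 0 \<nu> (\<kappa> * sqrt s))
         - s powr (- \<nu> / 2) * (bessel_moment 1 \<nu> (\<kappa> * sqrt s) * (\<kappa> / 2 * s powr (- 1 / 2)))))"

lemma power2_powr: "0 < r \<Longrightarrow> (r\<^sup>2) powr a = r powr (2 * a)" for r :: real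
  by (simp add: powr_powr flip: powr_numeral)

lemma gker_eq_gprof:
  fixes x :: "real ^ 'n"
  assumes "0 < \<kappa>" "x \<noteq> 0"
  shows "gker \<kappa> x = gprof TYPE('n) \<kappa> ((norm x)\<^sup>2)"
proof -
  have "((norm x)\<^sup>2) powr (- (real CARD('n) / 2 - 1) / 2) = norm x powr (- (real CARD('n) / 2 - 1))"
    proof -
    have "((norm x)\<^sup>2) powr (- (real CARD('n) / 2 - 1) / 2) = norm x powr (2 * (- (real CARD('n) / 2 - 1) / 2))"
      using assms by (intro power2_powr) simp
    also have "2 * (- (real CARD('n) / 2 - 1) / 2) = - (real CARD('n) / 2 - 1)" by simp
    finally show ?thesis .
  qed
  moreover have "(\<kappa> / norm x) powr (real CARD('n) / 2 - 1)
      = \<kappa> powr (real CARD('n) / 2 - 1) * norm x powr (- (real CARD('n) / 2 - 1))"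
    unfolding powr_divide powr_minus divide_inverse[of "\<kappa> powr _"] ..
  ultimately show ?thesis
    unfolding gker_def gprof_def Let_def bessel_K_eq_moment if_P[OF assms(1)]
    by (simp only: real_sqrt_abs abs_norm_cancel mult_ac)
qed

lemma has_real_derivative_gprof:
  assumes d: "2 \<le> CARD('n::finite)" and \<kappa>: "0 < \<kappa>" and s: "0 < s"
  shows "(gprof TYPE('n) \<kappa> has_real_derivative gprof' TYPE('n) \<kappa> s) (at s)"
proof -
  define \<nu> where "\<nu> = real CARD('n) / 2 - 1"
  have \<nu>: "0 \<le> \<nu>" using d by (simp add: \<nu>_def)
  note D = has_real_derivative_bessel_moment_sqrt[OF \<nu> \<kappa> s, of 0] has_real_derivative_powr[OF s, of "- \<nu> / 2"]
  have "((\<lambda>s. (2 * pi) powr (- real CARD('n) / 2) * \<kappa> powr \<nu> * (s powr (- \<nu> / 2) * bessel_moment 0 \<nu> (\<kappa> * sqrt s)))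
     has_real_derivative gprof' TYPE('n) \<kappa> s) (at s)"
    unfolding gprof'_def Let_def \<nu>_def[symmetric]
    by (rule derivative_eq_intros D refl)+ (simp add: algebra_simps)
  then show ?thesis
    by (simp only: gprof_def[abs_def] \<nu>_def Let_def)
qed

lemma C1_pos_gprof':
  assumes d: "2 \<le> CARD('n::finite)" and \<kappa>: "0 < \<kappa>"
  shows "C1_pos (gprof' TYPE('n) \<kappa>)"
proof -
  have \<nu>: "0 \<le> real CARD('n) / 2 - 1" using d by simp
  show ?thesis
    unfolding gprof'_def[abs_def] Let_def
    by (intro C1_pos_mult C1_pos_diff C1_pos_const C1_pos_powr C1_pos_bessel_moment_sqrt \<nu> \<kappa>)
qed

lemma gprof_nonneg: "0 \<le> gprof TYPE('n::finite) \<kappa> s"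
  by (simp add: gprof_def Let_def bessel_moment_nonneg)

text \<open>The zeroth moment is of order \<open>z powr (- \<nu>)\<close> for
  \<open>\<nu> > 0\<close> but logarithmic for \<open>\<nu> = 0\<close>. The bound for
  \<open>gprof\<close> therefore passes to the first moment, at the cost of one power of
  \<open>z\<close>; in \<open>gprof'\<close> the zeroth moment carries the factor
  \<open>\<nu>\<close>, which vanishes in the logarithmic case.\<close>

lemma gprof_bounds:
  assumes d: "2 \<le> CARD('n::finite)" and \<kappa>: "0 < \<kappa>"
  obtains C where "0 \<le> C" "\<And>s. 0 < s \<Longrightarrow> gprof TYPE('n) \<kappa> s \<le> C * s powr ((1 - real CARD('n)) / 2)"
    "\<And>s. 0 < s \<Longrightarrow> \<bar>gprof' TYPE('n) \<kappa> s\<bar> \<le> C * s powr (- real CARD('n) / 2)"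
proof -
  define d where "d = real CARD('n)"
  define \<nu> where "\<nu> = real CARD('n) / 2 - 1"
  define A where "A = (2 * pi) powr (- real CARD('n) / 2) * \<kappa> powr \<nu>"
  have \<nu>: "0 \<le> \<nu>" using d by (simp add: \<nu>_def)
  have A: "0 \<le> A" by (simp add: A_def)
  obtain C1 where C1: "0 \<le> C1" "\<And>z. 0 < z \<Longrightarrow> bessel_moment 1 \<nu> z \<le> C1 * z powr (- (\<nu> + real 1))"
    using bessel_moment_bound[of \<nu> 1] \<nu> by auto
  have "\<exists>C0\<ge>0. \<forall>z>0. \<nu> * bessel_moment 0 \<nu> z \<le> C0 * z powr (- \<nu>)"
  proof (cases "\<nu> = 0")
    case True
    then show ?thesis by (intro exI[of _ 0]) auto
  next
    case False
    then obtain C where "0 \<le> C" "\<And>z. 0 < z \<Longrightarrow> bessel_moment 0 \<nu> z \<le> C * z powr (- (\<nu> + real 0))"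
      using bessel_moment_bound[of \<nu> 0] \<nu> by auto
    then show ?thesis using \<nu> by (intro exI[of _ "\<nu> * C"]) (auto simp: mult.assoc intro!: mult_left_mono)
  qed
  then obtain C0 where C0: "0 \<le> C0" "\<And>z. 0 < z \<Longrightarrow> \<nu> * bessel_moment 0 \<nu> z \<le> C0 * z powr (- \<nu>)" by blast
  have pw: "(\<kappa> * sqrt s) powr a = \<kappa> powr a * s powr (a / 2)" if "0 < s" for s a
    unfolding powr_mult sqrt_eq_powr_half[OF less_imp_le[OF that]] powr_powr by simp
  define D1 where "D1 = A * (C1 * \<kappa> powr (- (\<nu> + 1)))"
  define D2 where "D2 = A * (1/2 * (C0 * \<kappa> powr (- \<nu>)) + C1 * \<kappa> powr (- (\<nu> + 1)) * (\<kappa> / 2))"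
  have D: "0 \<le> D1" "0 \<le> D2" using A C0 C1 \<kappa> by (auto simp: D1_def D2_def)
  have b1: "gprof TYPE('n) \<kappa> s \<le> D1 * s powr ((1 - d) / 2)" if s: "0 < s" for s
  proof -
    have z: "0 < \<kappa> * sqrt s" using s \<kappa> by simp
    have "bessel_moment 0 \<nu> (\<kappa> * sqrt s) \<le> bessel_moment (Suc 0) \<nu> (\<kappa> * sqrt s)"
      by (rule bessel_moment_le_Suc[OF \<nu> z])
    also have "\<dots> \<le> C1 * (\<kappa> powr (- (\<nu> + 1)) * s powr (- (\<nu> + 1) / 2))"
      using C1(2)[OF z] pw[OF s, of "- (\<nu> + 1)"] by simp
    finally have "A * (s powr (- \<nu> / 2) * bessel_moment 0 \<nu> (\<kappa> * sqrt s))
        \<le> A * (s powr (- \<nu> / 2) * (C1 * (\<kappa> powr (- (\<nu> + 1)) * s powr (- (\<nu> + 1) / 2))))"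
      using A by (intro mult_left_mono) auto
    also have "\<dots> = D1 * (s powr (- \<nu> / 2) * s powr (- (\<nu> + 1) / 2))" by (simp add: D1_def mult_ac)
    also have "s powr (- \<nu> / 2) * s powr (- (\<nu> + 1) / 2) = s powr ((1 - d) / 2)"
      unfolding powr_add[symmetric] by (rule arg_cong[where f="\<lambda>a. s powr a"]) (simp add: \<nu>_def d_def field_simps)
    finally show ?thesis by (simp only: gprof_def A_def \<nu>_def Let_def)
  qed
  have b2: "\<bar>gprof' TYPE('n) \<kappa> s\<bar> \<le> D2 * s powr (- d / 2)" if s: "0 < s" for s
  proof -
    have z: "0 < \<kappa> * sqrt s" using s \<kappa> by simp
    define K0 where "K0 = bessel_moment 0 \<nu> (\<kappa> * sqrt s)"
    define K1 where "K1 = bessel_moment 1 \<nu> (\<kappa> * sqrt s)"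
    have K: "0 \<le> K0" "0 \<le> K1" by (simp_all add: K0_def K1_def bessel_moment_nonneg)
    have k0: "\<nu> * K0 \<le> C0 * (\<kappa> powr (- \<nu>) * s powr (- \<nu> / 2))"
      using C0(2)[OF z] pw[OF s, of "- \<nu>"] by (simp add: K0_def)
    have k1: "K1 \<le> C1 * (\<kappa> powr (- (\<nu> + 1)) * s powr (- (\<nu> + 1) / 2))"
      using C1(2)[OF z] pw[OF s, of "- (\<nu> + 1)"] by (simp add: K1_def)
    have "gprof' TYPE('n) \<kappa> s = - (A * (1/2 * (s powr (- \<nu> / 2 - 1) * (\<nu> * K0)) + s powr (- \<nu> / 2) * (K1 * (\<kappa> / 2 * s powr (- 1 / 2)))))"
      unfolding gprof'_def Let_def A_def \<nu>_def[symmetric] K0_def[symmetric] K1_def[symmetric] by (simp add: algebra_simps)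
    then have "\<bar>gprof' TYPE('n) \<kappa> s\<bar> = A * (1/2 * (s powr (- \<nu> / 2 - 1) * (\<nu> * K0)) + s powr (- \<nu> / 2) * (K1 * (\<kappa> / 2 * s powr (- 1 / 2))))"
      using A K \<nu> \<kappa> by (simp only: abs_minus_cancel) (simp add: abs_of_nonneg)
    also have "\<dots> \<le> A * (1/2 * (s powr (- \<nu> / 2 - 1) * (C0 * (\<kappa> powr (- \<nu>) * s powr (- \<nu> / 2))))
        + s powr (- \<nu> / 2) * ((C1 * (\<kappa> powr (- (\<nu> + 1)) * s powr (- (\<nu> + 1) / 2))) * (\<kappa> / 2 * s powr (- 1 / 2))))"
      using k0 k1 A \<kappa> by (intro mult_left_mono add_mono mult_right_mono) auto
    also have "\<dots> = A * (1/2 * (C0 * \<kappa> powr (- \<nu>)) * (s powr (- \<nu> / 2 - 1) * s powr (- \<nu> / 2))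
        + C1 * \<kappa> powr (- (\<nu> + 1)) * (\<kappa> / 2) * (s powr (- \<nu> / 2) * s powr (- (\<nu> + 1) / 2) * s powr (- 1 / 2)))"
      by (simp add: algebra_simps)
    also have "s powr (- \<nu> / 2 - 1) * s powr (- \<nu> / 2) = s powr (- d / 2)"
      unfolding powr_add[symmetric] by (rule arg_cong[where f="\<lambda>a. s powr a"]) (simp add: \<nu>_def d_def field_simps)
    also have "s powr (- \<nu> / 2) * s powr (- (\<nu> + 1) / 2) * s powr (- 1 / 2) = s powr (- d / 2)"
      unfolding powr_add[symmetric] by (rule arg_cong[where f="\<lambda>a. s powr a"]) (simp add: \<nu>_def d_def field_simps)
    finally show ?thesis by (simp add: D2_def algebra_simps)
  qed
  show thesis
  proof
    show "0 \<le> max D1 D2" using D by simp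
    show "gprof TYPE('n) \<kappa> s \<le> max D1 D2 * s powr ((1 - real CARD('n)) / 2)" if "0 < s" for s
      using b1[OF that] mult_right_mono[of D1 "max D1 D2" "s powr ((1 - d) / 2)"] by (simp add: d_def)
    show "\<bar>gprof' TYPE('n) \<kappa> s\<bar> \<le> max D1 D2 * s powr (- real CARD('n) / 2)" if "0 < s" for s
      using b2[OF that] mult_right_mono[of D2 "max D1 D2" "s powr (- d / 2)"] by (simp add: d_def)
  qed
qed

section \<open>The continuity equation\<close>

lemma onorm_scaleR_const_le:
  fixes c :: "'a::real_normed_vector"
  shows "norm c \<le> b \<Longrightarrow> onorm (\<lambda>s::real. s *\<^sub>R c) \<le> b"
  by (rule onorm_le) (metis abs_ge_zero mult.commute mult_left_mono norm_scaleR real_norm_def)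

text \<open>The quantitative content of a classical solution on \<open>{0..T}\<close>, expressed by
  pointwise bounds. \<open>v_der\<close> is the continuity equation, while
  \<open>\<rho>_time\<close> and \<open>\<rho>'_time\<close> give differentiability in time
  uniformly in space. Of the constants, \<open>K\<close> governs the final coupling estimate;
  \<open>R\<close>, \<open>U\<close>, \<open>J\<close> and \<open>M\<close> control errors that
  disappear in a limit.\<close>

locale transport =
  fixes T R U K J M :: real and \<rho> \<rho>' :: "real \<Rightarrow> 'a::euclidean_space \<Rightarrow> real" and u :: "real \<Rightarrow> 'a \<Rightarrow> 'a"
  assumes T: "0 \<le> T"
    and nonneg: "0 \<le> K" "0 \<le> J" "0 \<le> U"
    and u_bd: "\<And>t x. t \<in> {0..T} \<Longrightarrow> norm (u t x) \<le> U"
    and u_lip: "\<And>t. t \<in> {0..T} \<Longrightarrow> K-lipschitz_on UNIV (u t)"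
    and u_diff: "\<And>t x. t \<in> {0..T} \<Longrightarrow> u t differentiable (at x)"
    and u_time: "\<And>s t x. s \<in> {0..T} \<Longrightarrow> t \<in> {0..T} \<Longrightarrow> norm (u s x - u t x) \<le> J * \<bar>s - t\<bar>"
    and \<rho>_nn: "\<And>t x. t \<in> {0..T} \<Longrightarrow> 0 \<le> \<rho> t x"
    and \<rho>_int: "\<And>t. t \<in> {0..T} \<Longrightarrow> integrable lborel (\<rho> t)"
    and \<rho>_mass: "\<And>t. t \<in> {0..T} \<Longrightarrow> (LINT x|lborel. \<rho> t x) = 1"
    and \<rho>_supp: "\<And>t x. t \<in> {0..T} \<Longrightarrow> norm x > R \<Longrightarrow> \<rho> t x = 0"
    and v_lip: "\<And>t. t \<in> {0..T} \<Longrightarrow> \<exists>L. L-lipschitz_on UNIV (\<lambda>x. \<rho> t x *\<^sub>R u t x)"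
    and v_der: "\<And>t. t \<in> {0..T} \<Longrightarrow>
      \<exists>v'. \<forall>x. ((\<lambda>x. \<rho> t x *\<^sub>R u t x) has_derivative v' x) (at x) \<and> (\<Sum>b\<in>Basis. v' x b \<bullet> b) = - \<rho>' t x"
    and \<rho>'_bd: "\<And>t x. t \<in> {0..T} \<Longrightarrow> \<bar>\<rho>' t x\<bar> \<le> M"
    and \<rho>_time: "\<And>t e. t \<in> {0..T} \<Longrightarrow> 0 < e \<Longrightarrow> \<forall>\<^sub>F s in at t within {0..T}.
      \<forall>x. \<bar>\<rho> s x - \<rho> t x - (s - t) * \<rho>' t x\<bar> \<le> e * \<bar>s - t\<bar>"
    and \<rho>'_time: "\<And>t e. t \<in> {0..T} \<Longrightarrow> 0 < e \<Longrightarrow> \<forall>\<^sub>F s in at t within {0..T}. \<forall>x. \<bar>\<rho>' s x - \<rho>' t x\<bar> \<le> e"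
begin

text \<open>Freezing the field outside \<open>{0..T}\<close> keeps its Lipschitz constants and
  defines it for all times, so that the theorem on global flows applies.\<close>

definition clamp :: "real \<Rightarrow> real" where "clamp t = max 0 (min T t)"

lemma clamp_in: "clamp t \<in> {0..T}" using T by (auto simp: clamp_def)

lemma clamp_id: "t \<in> {0..T} \<Longrightarrow> clamp t = t" by (auto simp: clamp_def)

lemma clamp_lip: "\<bar>clamp s - clamp t\<bar> \<le> \<bar>s - t\<bar>" by (auto simp: clamp_def)

definition field :: "real \<times> 'a \<Rightarrow> real \<times> 'a" where "field p = (1, u (clamp (fst p)) (snd p))"

lemma field_lip: "(J + K)-lipschitz_on UNIV field"
proof (rule lipschitz_on_normI)
  show "0 \<le> J + K" using nonneg by simp
  fix p q :: "real \<times> 'a"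
  have "norm (field p - field q) = norm (u (clamp (fst p)) (snd p) - u (clamp (fst q)) (snd q))"
    by (simp add: field_def norm_prod_def)
  also have "\<dots> \<le> norm (u (clamp (fst p)) (snd p) - u (clamp (fst q)) (snd p)) + norm (u (clamp (fst q)) (snd p) - u (clamp (fst q)) (snd q))"
    by (metis add_diff_eq diff_add_cancel norm_triangle_ineq)
  also have "\<dots> \<le> J * \<bar>clamp (fst p) - clamp (fst q)\<bar> + K * norm (snd p - snd q)"
    by (intro add_mono u_time clamp_in lipschitz_on_normD[OF u_lip])
  also have "\<dots> \<le> J * norm (p - q) + K * norm (p - q)"
  proof (intro add_mono mult_left_mono nonneg)
    have "\<bar>fst p - fst q\<bar> \<le> norm (p - q)" using dist_fst_le[of p q] by (simp add: dist_norm)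
    then show "\<bar>clamp (fst p) - clamp (fst q)\<bar> \<le> norm (p - q)" using clamp_lip[of "fst p" "fst q"] by linarith
    show "norm (snd p - snd q) \<le> norm (p - q)" using dist_snd_le[of p q] by (simp add: dist_norm)
  qed
  finally show "norm (field p - field q) \<le> (J + K) * norm (p - q)" by (simp add: distrib_right)
qed

definition is_semiflow :: "(real \<Rightarrow> real \<times> 'a \<Rightarrow> real \<times> 'a) \<Rightarrow> bool" where
  "is_semiflow \<phi> \<longleftrightarrow> (\<forall>p. \<phi> 0 p = p) \<and>
     (\<forall>p t. 0 \<le> t \<longrightarrow> ((\<lambda>t. \<phi> t p) has_vector_derivative field (\<phi> t p)) (at t within {0..})) \<and>
     (\<forall>p q t. 0 \<le> t \<longrightarrow> norm (\<phi> t p - \<phi> t q) \<le> exp ((J + K) * t) * norm (p - q)) \<and>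
     (\<forall>p s t. 0 \<le> s \<longrightarrow> 0 \<le> t \<longrightarrow> \<phi> (s + t) p = \<phi> t (\<phi> s p))"

text \<open>The time variable is part of the state, so that one autonomous flow provides the solutions
  from every starting time.\<close>

definition aflow :: "real \<Rightarrow> real \<times> 'a \<Rightarrow> real \<times> 'a" where
  "aflow = (SOME \<phi>. is_semiflow \<phi>)"

lemma is_semiflow_aflow: "is_semiflow aflow"
proof -
  obtain \<phi> where "\<And>p. \<phi> 0 p = p"
    "\<And>p t. 0 \<le> t \<Longrightarrow> ((\<lambda>t. \<phi> t p) has_vector_derivative field (\<phi> t p)) (at t within {0..})"
    "\<And>p q t. 0 \<le> t \<Longrightarrow> norm (\<phi> t p - \<phi> t q) \<le> exp ((J + K) * t) * norm (p - q)"
    "\<And>p s t. 0 \<le> s \<Longrightarrow> 0 \<le> t \<Longrightarrow> \<phi> (s + t) p = \<phi> t (\<phi> s p)"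
    using lipschitz_flow_exists[OF field_lip] by blast
  then have "is_semiflow \<phi>" unfolding is_semiflow_def by blast
  then show ?thesis unfolding aflow_def by (rule someI[where P=is_semiflow])
qed

lemma aflow_0: "aflow 0 p = p"
  and aflow_der: "0 \<le> t \<Longrightarrow> ((\<lambda>t. aflow t p) has_vector_derivative field (aflow t p)) (at t within {0..})"
  and aflow_lip: "0 \<le> t \<Longrightarrow> norm (aflow t p - aflow t q) \<le> exp ((J + K) * t) * norm (p - q)"
  and aflow_add: "0 \<le> s \<Longrightarrow> 0 \<le> t \<Longrightarrow> aflow (s + t) p = aflow t (aflow s p)"
  using is_semiflow_aflow unfolding is_semiflow_def by blast+

text \<open>The time component solves an equation with constant right-hand side, and the contraction
  estimate with Lipschitz constant 0 identifies the solution.\<close>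

lemma fst_aflow: "0 \<le> t \<Longrightarrow> fst (aflow t p) = fst p + t"
proof -
  assume t: "0 \<le> t"
  have "norm (fst (aflow t p) - (fst p + t)) \<le> exp (0 * t) * norm (fst (aflow 0 p) - (fst p + 0))"
  proof (rule lipschitz_flow_contraction[where V="\<lambda>_. 1"])
    show "0-lipschitz_on UNIV (\<lambda>_::real. 1::real)" by (simp add: lipschitz_on_def)
    show "((\<lambda>t. fst (aflow t p)) has_vector_derivative 1) (at s within {0..t})" if "0 \<le> s" for s
    proof -
      have "((\<lambda>t. fst (aflow t p)) has_vector_derivative fst (field (aflow s p))) (at s within {0..t})"
        by (rule bounded_linear.has_vector_derivative[OF bounded_linear_fst has_vector_derivative_within_subset[OF aflow_der[OF that]]]) auto
      then show ?thesis by (simp add: field_def)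
    qed
    show "((\<lambda>t. fst p + t) has_vector_derivative 1) (at s within {0..t})" for s
      by (auto intro!: derivative_eq_intros)
  qed (rule t)
  then show ?thesis by (simp add: aflow_0)
qed

lemma snd_aflow_der:
  assumes "0 \<le> t"
  shows "((\<lambda>t. snd (aflow t p)) has_vector_derivative u (clamp (fst p + t)) (snd (aflow t p))) (at t within {0..})"
  using bounded_linear.has_vector_derivative[OF bounded_linear_snd aflow_der[OF assms], of p]
  by (simp add: field_def fst_aflow[OF assms])

lemma snd_aflow_lip:
  assumes "0 \<le> t"
  shows "norm (snd (aflow t (s, x)) - snd (aflow t (s, y))) \<le> exp ((J + K) * t) * norm (x - y)"
proof -
  have "norm (snd (aflow t (s, x)) - snd (aflow t (s, y))) \<le> norm (aflow t (s, x) - aflow t (s, y))"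
    using dist_snd_le[of "aflow t (s, x)" "aflow t (s, y)"] by (simp add: dist_norm)
  also have "\<dots> \<le> exp ((J + K) * t) * norm ((s, x) - (s, y))" by (rule aflow_lip[OF assms])
  finally show ?thesis by (simp add: norm_prod_def)
qed

text \<open>Local error of one Euler step: within time \<open>h\<close> the point moves by at most
  \<open>U * h\<close>, so the velocity it sees changes by at most
  \<open>(J + K * U) * h\<close>.\<close>

lemma aflow_euler:
  assumes a: "0 \<le> a" "a \<le> T" "0 \<le> h" "a + h \<le> T"
  shows "norm (snd (aflow h (a, x)) - (x + h *\<^sub>R u a x)) \<le> (J + K * U) * h\<^sup>2"
proof -
  define y where "y r = snd (aflow r (a, x))" for r
  have yd: "(y has_vector_derivative u (a + r) (y r)) (at r within {0..h})" if "r \<in> {0..h}" for r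
    using has_vector_derivative_within_subset[OF snd_aflow_der[of r "(a, x)"], of "{0..h}"] that a
    by (simp add: y_def[abs_def] clamp_id)
  have y0: "y 0 = x" by (simp add: y_def aflow_0)
  have ydist: "norm (y r - x) \<le> U * r" if r: "r \<in> {0..h}" for r
  proof -
    have "norm (y r - y 0) \<le> U * norm (r - 0)"
    proof (rule differentiable_bound[where S="{0..h}" and f'="\<lambda>r s. s *\<^sub>R u (a + r) (y r)"])
      show "(y has_derivative (\<lambda>s. s *\<^sub>R u (a + r) (y r))) (at r within {0..h})" if "r \<in> {0..h}" for r
        using yd[OF that] by (simp add: has_vector_derivative_def)
      show "onorm (\<lambda>s. s *\<^sub>R u (a + r) (y r)) \<le> U" if "r \<in> {0..h}" for r
        by (rule onorm_scaleR_const_le[OF u_bd]) (use that a in auto)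
    qed (use r in auto)
    then show ?thesis using r y0 by simp
  qed
  have "norm ((y h - h *\<^sub>R u a x) - (y 0 - 0 *\<^sub>R u a x)) \<le> ((J + K * U) * h) * norm (h - 0)"
  proof (rule differentiable_bound[where S="{0..h}" and f'="\<lambda>r s. s *\<^sub>R (u (a + r) (y r) - u a x)"])
    show "((\<lambda>r. y r - r *\<^sub>R u a x) has_derivative (\<lambda>s. s *\<^sub>R (u (a + r) (y r) - u a x))) (at r within {0..h})"
      if "r \<in> {0..h}" for r
    proof -
      have "((\<lambda>r. y r - r *\<^sub>R u a x) has_vector_derivative (u (a + r) (y r) - u a x)) (at r within {0..h})"
        by (rule derivative_eq_intros yd[OF that] refl | simp)+
      then show ?thesis by (simp add: has_vector_derivative_def)
    qed
    show "onorm (\<lambda>s. s *\<^sub>R (u (a + r) (y r) - u a x)) \<le> (J + K * U) * h" if r: "r \<in> {0..h}" for r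
    proof (rule onorm_scaleR_const_le)
      have "norm (u (a + r) (y r) - u a x) \<le> norm (u (a + r) (y r) - u a (y r)) + norm (u a (y r) - u a x)"
        by (metis add_diff_eq diff_add_cancel norm_triangle_ineq)
      also have "\<dots> \<le> J * \<bar>(a + r) - a\<bar> + K * norm (y r - x)"
        using r a by (intro add_mono u_time lipschitz_on_normD[OF u_lip]) auto
      also have "\<dots> \<le> J * h + K * (U * h)"
        using ydist[OF r] r nonneg mult_left_mono[of r h U] by (intro add_mono mult_left_mono) auto
      finally show "norm (u (a + r) (y r) - u a x) \<le> (J + K * U) * h" by (simp add: algebra_simps)
    qed
  qed (use a in auto)
  then show ?thesis using a y0 by (simp add: y_def[symmetric] power2_eq_square algebra_simps)
qed

definition Y :: "real \<Rightarrow> 'a \<Rightarrow> 'a" where "Y t x = snd (aflow t (0, x))"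

lemma Y_0: "Y 0 x = x" by (simp add: Y_def aflow_0)

lemma Y_der: "t \<in> {0..T} \<Longrightarrow> ((\<lambda>t. Y t x) has_vector_derivative u t (Y t x)) (at t within {0..T})"
  using has_vector_derivative_within_subset[OF snd_aflow_der[of t "(0, x)"], of "{0..T}"]
  by (simp add: Y_def clamp_id)

lemma Y_lip: "0 \<le> t \<Longrightarrow> (exp ((J + K) * t))-lipschitz_on UNIV (Y t)"
  unfolding Y_def by (intro lipschitz_on_normI snd_aflow_lip) auto

lemma Y_measurable: "0 \<le> t \<Longrightarrow> Y t \<in> borel_measurable borel"
  by (intro borel_measurable_continuous_onI lipschitz_on_continuous_on[OF Y_lip])

text \<open>Outside the ball the flux vanishes identically, hence so does its divergence, which is
  \<open>- \<rho>'\<close>.\<close>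

lemma \<rho>'_supp:
  assumes "t \<in> {0..T}" "norm x > R"
  shows "\<rho>' t x = 0"
proof -
  obtain v' where v': "\<And>x. ((\<lambda>x. \<rho> t x *\<^sub>R u t x) has_derivative v' x) (at x)" "\<And>x. (\<Sum>b\<in>Basis. v' x b \<bullet> b) = - \<rho>' t x"
    using v_der[OF assms(1)] by blast
  have "v' x = (\<lambda>h. 0)"
    by (rule has_derivative_eq_0_outside[OF _ v'(1) assms(2)]) (use \<rho>_supp[OF assms(1)] in simp)
  then show ?thesis using v'(2)[of x] by simp
qed

lemma \<rho>'_meas: "t \<in> {0..T} \<Longrightarrow> \<rho>' t \<in> borel_measurable borel"
proof -
  assume t: "t \<in> {0..T}"
  obtain v' where v': "\<And>x. ((\<lambda>x. \<rho> t x *\<^sub>R u t x) has_derivative v' x) (at x)" "\<And>x. (\<Sum>b\<in>Basis. v' x b \<bullet> b) = - \<rho>' t x"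
    using v_der[OF t] by blast
  have "(\<lambda>x. v' x b) \<in> borel_measurable borel" for b
    by (rule borel_measurable_directional_derivative[OF v'(1) measurable_const]) simp
  then have "(\<lambda>x. - (\<Sum>b\<in>Basis. v' x b \<bullet> b)) \<in> borel_measurable borel" by measurable
  then show ?thesis using v'(2) by simp
qed

lemma \<rho>_meas: "t \<in> {0..T} \<Longrightarrow> \<rho> t \<in> borel_measurable borel"
  using borel_measurable_integrable[OF \<rho>_int] by simp

end

section \<open>Transport of the density along the flow\<close>

lemma abs_integral_diff_le:
  fixes f g b :: "'a \<Rightarrow> real"
  assumes "integrable M f" "integrable M g" "integrable M b" and le: "\<And>x. \<bar>f x - g x\<bar> \<le> b x"
  shows "\<bar>(LINT x|M. f x) - (LINT x|M. g x)\<bar> \<le> (LINT x|M. b x)"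
proof -
  have "(LINT x|M. f x) - (LINT x|M. g x) = (LINT x|M. f x - g x)" using assms by simp
  moreover have "\<bar>LINT x|M. f x - g x\<bar> \<le> (LINT x|M. \<bar>f x - g x\<bar>)" by (rule integral_abs_bound)
  moreover have "(LINT x|M. \<bar>f x - g x\<bar>) \<le> (LINT x|M. b x)" using assms by (intro integral_mono) auto
  ultimately show ?thesis by linarith
qed

context transport begin

text \<open>To first order in \<open>h = b - a\<close>, the change of \<open>\<rho>\<close>
  contributes \<open>h\<close> times the pairing of \<open>w\<close> with \<open>\<rho>' a\<close>,
  and moving the points contributes \<open>- h\<close> times its pairing with the divergence of the
  flux; the continuity equation makes the two equal. What remains is the Taylor error
  \<open>m\<close> on the support ball and terms of order \<open>h^2\<close>.\<close>

lemma increment_bound: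
  assumes ab: "0 \<le> a" "a \<le> b" "b \<le> T" and w: "L-lipschitz_on UNIV w" "\<And>x. \<bar>w x\<bar> \<le> 1"
    and m: "\<And>x. \<bar>\<rho> b x - \<rho> a x - (b - a) * \<rho>' a x\<bar> \<le> m"
  defines "V \<equiv> measure lborel (cball (0::'a) R)"
  shows "\<bar>(LINT x|lborel. w x * \<rho> b x) - (LINT x|lborel. w (snd (aflow (b - a) (a, x))) * \<rho> a x)\<bar>
     \<le> m * V + (b - a)\<^sup>2 * (L * U * (K + M * V) + L * (J + K * U))"
proof -
  define h where "h = b - a"
  have h: "0 \<le> h" using ab by (simp add: h_def)
  have a: "a \<in> {0..T}" and b: "b \<in> {0..T}" using ab by auto
  have L: "0 \<le> L" using w(1) by (rule lipschitz_on_nonneg)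
  obtain v' where v': "\<And>x. ((\<lambda>x. \<rho> a x *\<^sub>R u a x) has_derivative v' x) (at x)" "\<And>x. (\<Sum>b\<in>Basis. v' x b \<bullet> b) = - \<rho>' a x"
    using v_der[OF a] by blast
  obtain Lv where Lv: "Lv-lipschitz_on UNIV (\<lambda>x. \<rho> a x *\<^sub>R u a x)" using v_lip[OF a] by blast
  have "\<forall>x. \<exists>D. (u a has_derivative D) (at x)" using u_diff[OF a] by (simp add: differentiable_def)
  then obtain u' where u': "\<And>x. (u a has_derivative u' x) (at x)" by metis
  have um[measurable]: "u a \<in> borel_measurable borel"
    by (intro borel_measurable_continuous_onI lipschitz_on_continuous_on[OF u_lip[OF a]])
  have vb: "\<exists>Vb. \<forall>x. norm (\<rho> a x *\<^sub>R u a x) \<le> Vb"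
  proof -
    have "compact ((\<lambda>x. \<rho> a x *\<^sub>R u a x) ` cball 0 R)"
      by (intro compact_continuous_image continuous_on_subset[OF lipschitz_on_continuous_on[OF Lv]]) auto
    then have "bounded ((\<lambda>x. \<rho> a x *\<^sub>R u a x) ` cball 0 R)" by (rule compact_imp_bounded)
    then obtain B where B: "\<And>x. x \<in> cball 0 R \<Longrightarrow> norm (\<rho> a x *\<^sub>R u a x) \<le> B" unfolding bounded_iff by blast
    have "norm (\<rho> a x *\<^sub>R u a x) \<le> \<bar>B\<bar>" for x
    proof (cases "norm x \<le> R")
      case True then show ?thesis using B[of x] by simp
    next
      case False then show ?thesis using \<rho>_supp[OF a, of x] by simp
    qed
    then show ?thesis by blast
  qed
  then obtain Vb where Vb: "\<And>x. norm (\<rho> a x *\<^sub>R u a x) \<le> Vb" by blast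
  have wm[measurable]: "w \<in> borel_measurable borel"
    by (intro borel_measurable_continuous_onI lipschitz_on_continuous_on[OF w(1)])
  have m0: "0 \<le> m" using m[of 0] by linarith
  have [measurable]: "\<rho> a \<in> borel_measurable borel" "\<rho> b \<in> borel_measurable borel" "\<rho>' a \<in> borel_measurable borel"
    using \<rho>_meas[OF a] \<rho>_meas[OF b] \<rho>'_meas[OF a] by auto
  have \<psi>m[measurable]: "(\<lambda>x. snd (aflow h (a, x))) \<in> borel_measurable borel"
    using snd_aflow_lip[OF h, of a]
    by (intro borel_measurable_continuous_onI lipschitz_on_continuous_on[OF lipschitz_on_normI[of "exp ((J + K) * h)"]]) auto
  have wi: "integrable lborel (\<lambda>x. f x * r x)" if "integrable lborel r" "f \<in> borel_measurable borel" "\<And>x. \<bar>f x\<bar> \<le> c" for f r :: "'a \<Rightarrow> real" and c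
  proof (rule Bochner_Integration.integrable_bound)
    show "integrable lborel (\<lambda>x. c * r x)" using that by simp
    have "0 \<le> c" using that(3)[of 0] by linarith
    then show "AE x in lborel. norm (f x * r x) \<le> norm (c * r x)"
      using that(3) by (auto simp: abs_mult intro!: mult_right_mono)
    have [measurable]: "r \<in> borel_measurable borel" using borel_measurable_integrable[OF that(1)] by simp
    note that(2)[measurable]
    show "(\<lambda>x. f x * r x) \<in> borel_measurable lborel" by measurable
  qed
  have M0: "0 \<le> M" using \<rho>'_bd[OF a, of 0] by linarith
  have \<rho>'i: "integrable lborel (\<rho>' a)"
    by (rule integrable_bounded_cball[OF _ \<rho>'_bd[OF a] \<rho>'_supp[OF a]]) simp
  have \<rho>'I: "(LINT x|lborel. \<bar>- \<rho>' a x\<bar>) \<le> M * V"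
  proof -
    have "(LINT x|lborel. \<bar>- \<rho>' a x\<bar>) \<le> (LINT x|lborel. M * indicator (cball (0::'a) R) x)"
    proof (rule integral_mono)
      show "\<bar>- \<rho>' a x\<bar> \<le> M * indicator (cball (0::'a) R) x" for x
        using \<rho>'_bd[OF a, of x] \<rho>'_supp[OF a, of x] by (cases "norm x > R") (auto simp: indicator_def)
      show "integrable lborel (\<lambda>x. M * indicator (cball (0::'a) R) x)"
        by (intro integrable_mult_right integrable_real_indicator) (auto simp: emeasure_lborel_cball_finite[unfolded infinity_ennreal_def])
    qed (use \<rho>'i in auto)
    then show ?thesis by (simp add: V_def)
  qed
  have 1: "\<bar>(LINT x|lborel. (w (x + h *\<^sub>R u a x) - w x) * \<rho> a x) + h * (LINT x|lborel. w x * - \<rho>' a x)\<bar>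
      \<le> h\<^sup>2 * L * U * (K + (LINT x|lborel. \<bar>- \<rho>' a x\<bar>))"
    using transport_first_order[OF w u_lip[OF a] u_bd[OF a] u' \<rho>_int[OF a] \<rho>_nn[OF a] \<rho>_mass[OF a] \<rho>_supp[OF a] Lv Vb v'(1) h]
    unfolding v'(2) by simp
  have "h\<^sup>2 * L * U * (K + (LINT x|lborel. \<bar>- \<rho>' a x\<bar>)) \<le> h\<^sup>2 * L * U * (K + M * V)"
    using \<rho>'I L nonneg by (intro mult_left_mono add_left_mono) auto
  with 1 have 1: "\<bar>(LINT x|lborel. (w (x + h *\<^sub>R u a x) - w x) * \<rho> a x) - h * (LINT x|lborel. w x * \<rho>' a x)\<bar>
      \<le> h\<^sup>2 * L * U * (K + M * V)" by simp
  have i0: "integrable lborel (\<lambda>x. w (x + h *\<^sub>R u a x) * \<rho> a x)" "integrable lborel (\<lambda>x. w x * \<rho> a x)"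
    "integrable lborel (\<lambda>x. w x * \<rho> b x)" "integrable lborel (\<lambda>x. w x * \<rho>' a x)"
    "integrable lborel (\<lambda>x. w (snd (aflow h (a, x))) * \<rho> a x)"
    using w(2) by (auto intro!: wi[where c=1] \<rho>_int a b \<rho>'i)
  have 2: "\<bar>(LINT x|lborel. w (snd (aflow h (a, x))) * \<rho> a x) - (LINT x|lborel. w (x + h *\<^sub>R u a x) * \<rho> a x)\<bar>
      \<le> L * ((J + K * U) * h\<^sup>2)"
  proof -
    have "\<bar>(LINT x|lborel. w (snd (aflow h (a, x))) * \<rho> a x) - (LINT x|lborel. w (x + h *\<^sub>R u a x) * \<rho> a x)\<bar>
        \<le> (LINT x|lborel. L * ((J + K * U) * h\<^sup>2) * \<rho> a x)"
    proof (rule abs_integral_diff_le[OF i0(5) i0(1) integrable_mult_right[OF \<rho>_int[OF a]]])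
      fix x
      have "\<bar>w (snd (aflow h (a, x))) - w (x + h *\<^sub>R u a x)\<bar> \<le> L * norm (snd (aflow h (a, x)) - (x + h *\<^sub>R u a x))"
        using lipschitz_on_normD[OF w(1)] by (metis real_norm_def)
      also have "\<dots> \<le> L * ((J + K * U) * h\<^sup>2)"
        using aflow_euler[of a h x] ab h L by (intro mult_left_mono) (auto simp: h_def)
      finally have "\<bar>w (snd (aflow h (a, x))) - w (x + h *\<^sub>R u a x)\<bar> * \<rho> a x \<le> L * ((J + K * U) * h\<^sup>2) * \<rho> a x"
        using \<rho>_nn[OF a] by (intro mult_right_mono) auto
      moreover have "\<bar>w (snd (aflow h (a, x))) * \<rho> a x - w (x + h *\<^sub>R u a x) * \<rho> a x\<bar>
        = \<bar>w (snd (aflow h (a, x))) - w (x + h *\<^sub>R u a x)\<bar> * \<rho> a x"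
        using \<rho>_nn[OF a, of x] by (metis abs_mult abs_of_nonneg left_diff_distrib)
      ultimately show "\<bar>w (snd (aflow h (a, x))) * \<rho> a x - w (x + h *\<^sub>R u a x) * \<rho> a x\<bar> \<le> L * ((J + K * U) * h\<^sup>2) * \<rho> a x" by simp
    qed
    then show ?thesis using \<rho>_mass[OF a] by simp
  qed
  have 3: "\<bar>LINT x|lborel. w x * (\<rho> b x - \<rho> a x - h * \<rho>' a x)\<bar> \<le> m * V"
  proof -
    have "\<bar>LINT x|lborel. w x * (\<rho> b x - \<rho> a x - h * \<rho>' a x)\<bar> \<le> (LINT x|lborel. \<bar>w x * (\<rho> b x - \<rho> a x - h * \<rho>' a x)\<bar>)"
      by (rule integral_abs_bound)
    also have "\<dots> \<le> (LINT x|lborel. m * indicator (cball (0::'a) R) x)"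
    proof (rule integral_mono)
      show "\<bar>w x * (\<rho> b x - \<rho> a x - h * \<rho>' a x)\<bar> \<le> m * indicator (cball (0::'a) R) x" for x
      proof (cases "norm x > R")
        case True
        then show ?thesis using \<rho>_supp[OF a True] \<rho>_supp[OF b True] \<rho>'_supp[OF a True] m0 by simp
      next
        case False
        have "\<bar>w x * (\<rho> b x - \<rho> a x - h * \<rho>' a x)\<bar> \<le> 1 * m"
          unfolding abs_mult using w(2)[of x] m[of x] by (intro mult_mono) (auto simp: h_def)
        then show ?thesis using False by (simp add: indicator_def)
      qed
      show "integrable lborel (\<lambda>x. m * indicator (cball (0::'a) R) x)"
        by (intro integrable_mult_right integrable_real_indicator) (auto simp: emeasure_lborel_cball_finite[unfolded infinity_ennreal_def])
      have "integrable lborel (\<lambda>x. w x * (\<rho> b x - \<rho> a x - h * \<rho>' a x))"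
        using w(2) by (auto intro!: wi[where c=1] Bochner_Integration.integrable_diff integrable_mult_right \<rho>_int a b \<rho>'i)
      then show "integrable lborel (\<lambda>x. \<bar>w x * (\<rho> b x - \<rho> a x - h * \<rho>' a x)\<bar>)" by (rule integrable_abs)
    qed
    finally show ?thesis by (simp add: V_def)
  qed
  have "(LINT x|lborel. w x * (\<rho> b x - \<rho> a x - h * \<rho>' a x)) = (LINT x|lborel. w x * \<rho> b x - w x * \<rho> a x - h * (w x * \<rho>' a x))"
    by (simp add: algebra_simps)
  also have "\<dots> = (LINT x|lborel. w x * \<rho> b x) - (LINT x|lborel. w x * \<rho> a x) - h * (LINT x|lborel. w x * \<rho>' a x)"
    unfolding Bochner_Integration.integral_diff[OF Bochner_Integration.integrable_diff[OF i0(3,2)] integrable_mult_right[OF i0(4)]]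
      Bochner_Integration.integral_diff[OF i0(3,2)] integral_mult_right_zero ..
  finally have 4: "(LINT x|lborel. w x * (\<rho> b x - \<rho> a x - h * \<rho>' a x))
    = (LINT x|lborel. w x * \<rho> b x) - (LINT x|lborel. w x * \<rho> a x) - h * (LINT x|lborel. w x * \<rho>' a x)" .
  have 5: "(LINT x|lborel. (w (x + h *\<^sub>R u a x) - w x) * \<rho> a x)
    = (LINT x|lborel. w (x + h *\<^sub>R u a x) * \<rho> a x) - (LINT x|lborel. w x * \<rho> a x)"
    unfolding left_diff_distrib by (rule Bochner_Integration.integral_diff) (rule i0)+
  have "\<bar>(LINT x|lborel. w x * \<rho> b x) - (LINT x|lborel. w (snd (aflow h (a, x))) * \<rho> a x)\<bar>
      \<le> m * V + h\<^sup>2 * L * U * (K + M * V) + L * ((J + K * U) * h\<^sup>2)"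
    using 1 2 3 4 5 by linarith
  then show ?thesis by (simp add: h_def[symmetric] algebra_simps)
qed

end

lemma integral_density_mult:
  fixes f r :: "'a \<Rightarrow> real"
  assumes "f \<in> borel_measurable M" "r \<in> borel_measurable M" "\<And>x. 0 \<le> r x"
  shows "(LINT x|density M (\<lambda>x. ennreal (r x)). f x) = (LINT x|M. f x * r x)"
  using integral_real_density[of r M f] assms by (simp add: mult.commute)

lemma prob_space_density:
  fixes r :: "'a \<Rightarrow> real"
  assumes r: "integrable M r" "\<And>x. 0 \<le> r x" "(LINT x|M. r x) = 1"
  shows "prob_space (density M (\<lambda>x. ennreal (r x)))"
proof (rule prob_spaceI)
  have "emeasure (density M (\<lambda>x. ennreal (r x))) (space M) = (\<integral>\<^sup>+x. ennreal (r x) * indicator (space M) x \<partial>M)"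
    using r by (subst emeasure_density) auto
  also have "\<dots> = (\<integral>\<^sup>+x. ennreal (r x) \<partial>M)" by (rule nn_integral_cong) simp
  also have "\<dots> = ennreal (LINT x|M. r x)" by (rule nn_integral_eq_integral[OF r(1)]) (simp add: r)
  finally show "emeasure (density M (\<lambda>x. ennreal (r x))) (space (density M (\<lambda>x. ennreal (r x)))) = 1" by (simp add: r)
qed

context transport begin

text \<open>The function \<open>w s\<close> is the backward transport of the terminal value
  \<open>f\<close> at time \<open>t\<close>, so its pairing \<open>A s\<close> with
  \<open>\<rho> s\<close> should be constant. As \<open>w s\<close> is only Lipschitz in space, the
  derivative of \<open>A\<close> is shown to vanish directly from
  \<open>increment_bound\<close>.\<close>

lemma integral_along_flow:
  assumes t: "t \<in> {0..T}" and f: "L-lipschitz_on UNIV f" "\<And>x. \<bar>f x\<bar> \<le> 1"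
  shows "(LINT x|lborel. f x * \<rho> t x) = (LINT x|lborel. f (Y t x) * \<rho> 0 x)"
proof -
  define w where "w s x = f (snd (aflow (t - s) (s, x)))" for s x
  define A where "A s = (LINT x|lborel. w s x * \<rho> s x)" for s
  define L1 where "L1 = L * exp ((J + K) * t)"
  define V where "V = measure lborel (cball (0::'a) R)"
  define C where "C = L1 * U * (K + M * V) + L1 * (J + K * U)"
  have L: "0 \<le> L" using f(1) by (rule lipschitz_on_nonneg)
  have V: "0 \<le> V" by (simp add: V_def)
  have M: "0 \<le> M" using \<rho>'_bd[OF t, of 0] by linarith
  have L1: "0 \<le> L1" using L by (simp add: L1_def)
  have C: "0 \<le> C" using nonneg L1 M V unfolding C_def by (intro add_nonneg_nonneg mult_nonneg_nonneg) auto
  have w_lip: "L1-lipschitz_on UNIV (w s)" if s: "s \<in> {0..t}" for s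
  proof (rule lipschitz_on_normI[OF L1])
    fix x y
    have "norm (w s x - w s y) \<le> L * norm (snd (aflow (t - s) (s, x)) - snd (aflow (t - s) (s, y)))"
      unfolding w_def by (rule lipschitz_on_normD[OF f(1)])
    also have "\<dots> \<le> L * (exp ((J + K) * (t - s)) * norm (x - y))"
      using s L by (intro mult_left_mono snd_aflow_lip) auto
    also have "\<dots> \<le> L * (exp ((J + K) * t) * norm (x - y))"
      using s L nonneg by (intro mult_left_mono mult_right_mono) (auto intro!: mult_left_mono)
    finally show "norm (w s x - w s y) \<le> L1 * norm (x - y)" by (simp add: L1_def mult_ac)
  qed
  \<comment> \<open>By the semigroup law \<open>w a\<close> is \<open>w b\<close> composed with the
    flow from \<open>a\<close> to \<open>b\<close>; the increment of \<open>A\<close> thus has the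
    form that \<open>increment_bound\<close> controls.\<close>
  have w_flow: "w a x = w b (snd (aflow (b - a) (a, x)))" if ab: "0 \<le> a" "a \<le> b" "b \<le> t" for a b x
  proof -
    have "aflow (t - a) (a, x) = aflow ((b - a) + (t - b)) (a, x)" by simp
    also have "\<dots> = aflow (t - b) (aflow (b - a) (a, x))" using ab by (intro aflow_add) auto
    also have "aflow (b - a) (a, x) = (b, snd (aflow (b - a) (a, x)))"
      using fst_aflow[of "b - a" "(a, x)"] ab by (simp add: prod_eq_iff)
    finally show ?thesis by (simp add: w_def)
  qed
  have incr: "\<bar>A b - A a\<bar> \<le> m * V + (b - a)\<^sup>2 * C"
    if ab: "0 \<le> a" "a \<le> b" "b \<le> t" and m: "\<And>x. \<bar>\<rho> b x - \<rho> a x - (b - a) * \<rho>' a x\<bar> \<le> m" for a b m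
    unfolding A_def w_flow[OF ab] V_def C_def
    by (rule increment_bound[OF ab(1,2)]) (use ab t w_lip f m in \<open>auto simp: w_def\<close>)
  have der: "(A has_derivative (\<lambda>h. 0)) (at s within {0..t})" if s: "s \<in> {0..t}" for s
    unfolding has_derivative_within_alt
  proof (intro conjI allI impI)
    show "bounded_linear (\<lambda>h::real. 0::real)" by simp
    fix e :: real assume e: "0 < e"
    \<comment> \<open>Together with the choice of \<open>d\<close> below, this keeps the Taylor
      error and the quadratic error each below \<open>e / 2\<close> per unit of time.\<close>
    define e' where "e' = e / (4 * (V + 1))"
    have e': "0 < e'" using e V by (simp add: e'_def)
    have "2 * e' * V = e / 2 * (V / (V + 1))" using V by (simp add: e'_def field_simps)
    also have "\<dots> \<le> e / 2 * 1" using e V by (intro mult_left_mono) auto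
    finally have e'V: "2 * e' * V \<le> e / 2" by simp
    have sT: "s \<in> {0..T}" using s t by auto
    obtain d1 where d1: "d1 > 0" "\<And>y x. y \<in> {0..T} \<Longrightarrow> y \<noteq> s \<Longrightarrow> dist y s < d1 \<Longrightarrow> \<bar>\<rho> y x - \<rho> s x - (y - s) * \<rho>' s x\<bar> \<le> e' * \<bar>y - s\<bar>"
      using \<rho>_time[OF sT e'] unfolding eventually_at by auto
    obtain d2 where d2: "d2 > 0" "\<And>y x. y \<in> {0..T} \<Longrightarrow> y \<noteq> s \<Longrightarrow> dist y s < d2 \<Longrightarrow> \<bar>\<rho>' y x - \<rho>' s x\<bar> \<le> e'"
      using \<rho>'_time[OF sT e'] unfolding eventually_at by auto
    define d where "d = min (min d1 d2) (e / (2 * (C + 1)))"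
    have d: "d > 0" using d1 d2 e C by (simp add: d_def)
    show "\<exists>d>0. \<forall>y\<in>{0..t}. norm (y - s) < d \<longrightarrow> norm (A y - A s - 0) \<le> e * norm (y - s)"
    proof (intro exI[of _ d] conjI d ballI impI)
      fix y assume y: "y \<in> {0..t}" and ys: "norm (y - s) < d"
      show "norm (A y - A s - 0) \<le> e * norm (y - s)"
      proof (cases "y = s")
        case False
        define h where "h = \<bar>y - s\<bar>"
        have h: "0 < h" "h < d1" "h < d2" "h \<le> e / (2 * (C + 1))" using False ys by (auto simp: h_def d_def)
        have yT: "y \<in> {0..T}" using y t by auto
        have b1: "\<bar>\<rho> y x - \<rho> s x - (y - s) * \<rho>' s x\<bar> \<le> e' * h" for x
          using d1(2)[OF yT False] h by (simp add: h_def dist_real_def)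
        have b2: "\<bar>\<rho>' y x - \<rho>' s x\<bar> \<le> e'" for x
          using d2(2)[OF yT False] h by (simp add: h_def dist_real_def)
        have key: "\<bar>A y - A s\<bar> \<le> (2 * e' * h) * V + h\<^sup>2 * C"
        proof (cases "s \<le> y")
          case True
          have "\<bar>A y - A s\<bar> \<le> (2 * e' * h) * V + (y - s)\<^sup>2 * C"
          proof (rule incr)
            show "\<bar>\<rho> y x - \<rho> s x - (y - s) * \<rho>' s x\<bar> \<le> 2 * e' * h" for x
              using b1[of x] mult_pos_pos[OF e' h(1)] by linarith
          qed (use True s y in auto)
          then show ?thesis by (simp add: h_def)
        next
          case False
          \<comment> \<open>To the left of \<open>s\<close> the expansion starts at the earlier time
            \<open>y\<close>; continuity of \<open>\<rho>'\<close> in time replaces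
            \<open>\<rho>' y\<close> by \<open>\<rho>' s\<close>, which doubles the error
            \<open>e'\<close>.\<close>
          have "\<bar>A s - A y\<bar> \<le> (2 * e' * h) * V + (s - y)\<^sup>2 * C"
          proof (rule incr)
            fix x
            have "\<rho> s x - \<rho> y x - (s - y) * \<rho>' y x
                = - (\<rho> y x - \<rho> s x - (y - s) * \<rho>' s x) + (y - s) * (\<rho>' y x - \<rho>' s x)"
              by (simp add: algebra_simps)
            moreover have "\<bar>(y - s) * (\<rho>' y x - \<rho>' s x)\<bar> \<le> h * e'"
              unfolding abs_mult h_def using b2[of x] by (intro mult_left_mono) auto
            ultimately show "\<bar>\<rho> s x - \<rho> y x - (s - y) * \<rho>' y x\<bar> \<le> 2 * e' * h"
              using b1[of x] mult.commute[of h e'] by linarith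
          qed (use False s y in auto)
          then show ?thesis using power2_commute[of s y] by (simp add: h_def abs_minus_commute)
        qed
        have "h * C \<le> e / (2 * (C + 1)) * C" using h C by (intro mult_right_mono) auto
        also have "\<dots> = e / 2 * (C / (C + 1))" using C by (simp add: field_simps)
        also have "\<dots> \<le> e / 2 * 1" using e C by (intro mult_left_mono) auto
        finally have hC: "h * C \<le> e / 2" by simp
        have "(2 * e' * h) * V + h\<^sup>2 * C = h * (2 * e' * V + h * C)" by (simp add: power2_eq_square algebra_simps)
        also have "\<dots> \<le> h * (e / 2 + e / 2)" using e'V hC h by (intro mult_left_mono add_mono) auto
        finally have "\<bar>A y - A s\<bar> \<le> e * h" using key by (simp add: mult.commute)
        then show ?thesis by (simp add: h_def)
      qed simp
    qed
  qed
  obtain c where "\<And>s. s \<in> {0..t} \<Longrightarrow> A s = c"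
    using has_derivative_zero_constant[of "{0..t}" A] der by auto
  then have "A t = A 0" using t by simp
  then show ?thesis by (simp add: A_def w_def Y_def aflow_0)
qed

definition law_at :: "real \<Rightarrow> 'a measure" where
  "law_at t = density lborel (\<lambda>x. ennreal (\<rho> t x))"

lemma prob_space_law_at: "t \<in> {0..T} \<Longrightarrow> prob_space (law_at t)"
  unfolding law_at_def by (rule prob_space_density[OF \<rho>_int \<rho>_nn \<rho>_mass])

lemma sets_law_at[measurable_cong]: "sets (law_at t) = sets borel"
  by (simp add: law_at_def)

lemma distr_Y:
  assumes t: "t \<in> {0..T}"
  shows "distr (law_at 0) borel (Y t) = law_at t"
proof (rule finite_measure_eqI_lipschitz)
  have z: "0 \<in> {0..T}" using T by simp
  interpret P0: prob_space "law_at 0" by (rule prob_space_law_at[OF z])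
  interpret Pt: prob_space "law_at t" by (rule prob_space_law_at[OF t])
  have Ym[measurable]: "Y t \<in> borel_measurable borel" using t by (intro Y_measurable) auto
  have [measurable]: "Y t \<in> measurable (law_at 0) borel" by (simp add: law_at_def)
  show "finite_measure (distr (law_at 0) borel (Y t))"
    by (intro prob_space.finite_measure P0.prob_space_distr) measurable
  show "finite_measure (law_at t)" by unfold_locales
  show "sets (distr (law_at 0) borel (Y t)) = sets borel" "sets (law_at t) = sets borel" by (simp_all add: sets_law_at)
  fix f L assume f: "L-lipschitz_on UNIV f" "\<And>x::'a. 0 \<le> f x \<and> f x \<le> (1::real)"
  have fm[measurable]: "f \<in> borel_measurable borel"
    by (intro borel_measurable_continuous_onI lipschitz_on_continuous_on[OF f(1)])
  have "(LINT x|distr (law_at 0) borel (Y t). f x) = (LINT x|law_at 0. f (Y t x))"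
    by (rule integral_distr) measurable
  also have "\<dots> = (LINT x|lborel. f (Y t x) * \<rho> 0 x)"
    unfolding law_at_def by (rule integral_density_mult) (use \<rho>_meas[OF z] \<rho>_nn[OF z] in auto)
  also have "\<dots> = (LINT x|lborel. f x * \<rho> t x)"
    using integral_along_flow[OF t f(1)] f(2) by (simp add: abs_le_iff order_trans[OF _ zero_le_one])
  also have "\<dots> = (LINT x|law_at t. f x)"
    unfolding law_at_def by (rule integral_density_mult[symmetric]) (use \<rho>_meas[OF t] \<rho>_nn[OF t] in auto)
  finally show "(LINT x|distr (law_at 0) borel (Y t). f x) = (LINT x|law_at t. f x)" .
qed

end

section \<open>Singular kernels\<close>

text \<open>The bounds say that the kernel and its gradient are \<open>O(|x| powr (1 - d))\<close>, hence locally integrable.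
  The bound for the kernel is not sharp, but it allows a single majorant \<open>sing\<close> for both.\<close>

locale singular_kernel =
  fixes g :: "real ^ 'n \<Rightarrow> real" and G G' :: "real \<Rightarrow> real" and C :: real
  assumes dim: "2 \<le> CARD('n)"
    and g_eq: "\<And>x. x \<noteq> 0 \<Longrightarrow> g x = G ((norm x)\<^sup>2)"
    and G_der: "\<And>s. 0 < s \<Longrightarrow> (G has_real_derivative G' s) (at s)"
    and G'_C1: "C1_pos G'"
    and C: "0 \<le> C"
    and G_nn: "\<And>s. 0 < s \<Longrightarrow> 0 \<le> G s"
    and G_bd: "\<And>s. 0 < s \<Longrightarrow> G s \<le> C * s powr ((1 - real CARD('n)) / 2)"
    and G'_bd: "\<And>s. 0 < s \<Longrightarrow> \<bar>G' s\<bar> \<le> C * s powr (- real CARD('n) / 2)"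
begin

definition sing :: "real ^ 'n \<Rightarrow> real" where "sing x = norm x powr (1 - real CARD('n))"

definition reg :: "real \<Rightarrow> real ^ 'n \<Rightarrow> real" where "reg \<delta> x = G ((norm x)\<^sup>2 + \<delta>)"

text \<open>The gradient of \<open>reg \<delta>\<close>. The case \<open>\<delta> = 0\<close> is the
  gradient of \<open>g\<close> off the origin, so that singular and regularised kernels are
  estimated together.\<close>

definition reg' :: "real \<Rightarrow> real ^ 'n \<Rightarrow> real ^ 'n" where "reg' \<delta> x = (2 * G' ((norm x)\<^sup>2 + \<delta>)) *\<^sub>R x"

lemma sing_nn: "0 \<le> sing x" by (simp add: sing_def)

lemma sing_measurable[measurable]: "sing \<in> borel_measurable borel"
  unfolding sing_def by measurable

lemma G_C1: "C1_pos G"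
  unfolding C1_pos_def by (intro exI[of _ G'] conjI allI impI G_der C1_pos_continuous_on[OF G'_C1])

lemma reg_has_derivative_pos:
  assumes "0 < (norm x)\<^sup>2 + \<delta>"
  shows "(reg \<delta> has_derivative (\<lambda>h. reg' \<delta> x \<bullet> h)) (at x)"
proof -
  have 1: "((\<lambda>x::real^'n. (norm x)\<^sup>2 + \<delta>) has_derivative (\<lambda>h. 2 * (x \<bullet> h))) (at x)"
    unfolding power2_norm_eq_inner by (auto intro!: derivative_eq_intros simp: inner_commute)
  have 2: "(G has_derivative (\<lambda>h. G' ((norm x)\<^sup>2 + \<delta>) * h)) (at ((norm x)\<^sup>2 + \<delta>))"
    using G_der[OF assms] by (simp add: has_field_derivative_def)
  have "(reg \<delta> has_derivative (\<lambda>h. G' ((norm x)\<^sup>2 + \<delta>) * (2 * (x \<bullet> h)))) (at x)"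
    unfolding reg_def by (rule has_derivative_compose[OF 1 2])
  then show ?thesis by (simp add: reg'_def mult_ac)
qed

lemma g_has_derivative_reg':
  assumes "x \<noteq> 0"
  shows "(g has_derivative (\<lambda>h. reg' 0 x \<bullet> h)) (at x)"
proof (rule has_derivative_transform_within_open[of "reg 0"])
  show "(reg 0 has_derivative (\<lambda>h. reg' 0 x \<bullet> h)) (at x)"
    by (rule reg_has_derivative_pos) (use assms in simp)
  show "open (- {0::real^'n})" by (rule open_Compl[OF closed_singleton])
qed (use assms in \<open>auto simp: reg_def g_eq\<close>)

lemma grad_eq_reg': "x \<noteq> 0 \<Longrightarrow> grad g x = reg' 0 x"
proof -
  assume "x \<noteq> 0"
  then have "frechet_derivative g (at x) = (\<lambda>h. reg' 0 x \<bullet> h)"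
    using frechet_derivative_at[OF g_has_derivative_reg'] by metis
  then show ?thesis by (simp add: grad_def vec_eq_iff inner_axis)
qed

lemma g_has_derivative: "x \<noteq> 0 \<Longrightarrow> (g has_derivative (\<lambda>h. grad g x \<bullet> h)) (at x)"
  using g_has_derivative_reg' grad_eq_reg' by simp

lemma grad_minus: "x \<noteq> 0 \<Longrightarrow> grad g (- x) = - grad g x"
  by (simp add: grad_eq_reg' reg'_def)

lemma powr_square: "0 < r \<Longrightarrow> (r\<^sup>2) powr (a / 2) = r powr a" for r :: real
  using power2_powr[of r "a / 2"] by simp

lemma powr_shift_le_sing:
  assumes "x \<noteq> 0" "0 \<le> \<delta>"
  shows "((norm x)\<^sup>2 + \<delta>) powr ((1 - real CARD('n)) / 2) \<le> sing x"
proof -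
  have "((norm x)\<^sup>2 + \<delta>) powr ((1 - real CARD('n)) / 2) \<le> ((norm x)\<^sup>2) powr ((1 - real CARD('n)) / 2)"
    using assms dim by (intro powr_mono2') auto
  moreover have "((norm x)\<^sup>2) powr ((1 - real CARD('n)) / 2) = sing x"
    unfolding sing_def using assms by (intro powr_square) simp
  ultimately show ?thesis by simp
qed

text \<open>The factor \<open>x\<close> in the gradient is at most the square root of
  \<open>(norm x)\<^sup>2 + \<delta>\<close>, which lifts the exponent \<open>- d / 2\<close> to
  \<open>(1 - d) / 2\<close>. Keeping \<open>\<delta>\<close> in the bound yields both the estimate
  by \<open>sing\<close>, uniform in \<open>\<delta>\<close>, and a global bound for fixed
  \<open>\<delta>\<close>.\<close>

lemma reg_le_shift:
  assumes "x \<noteq> 0 \<or> 0 < \<delta>" "0 \<le> \<delta>"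
  shows "\<bar>reg \<delta> x\<bar> \<le> C * ((norm x)\<^sup>2 + \<delta>) powr ((1 - real CARD('n)) / 2)"
    and "norm (reg' \<delta> x) \<le> 2 * C * ((norm x)\<^sup>2 + \<delta>) powr ((1 - real CARD('n)) / 2)"
proof -
  define s where "s = (norm x)\<^sup>2 + \<delta>"
  have s: "0 < s" unfolding s_def using assms by (auto intro: add_pos_nonneg add_nonneg_pos)
  show "\<bar>reg \<delta> x\<bar> \<le> C * ((norm x)\<^sup>2 + \<delta>) powr ((1 - real CARD('n)) / 2)"
    using G_bd[OF s] G_nn[OF s] by (simp add: reg_def s_def)
  have "norm x \<le> sqrt s" unfolding s_def using assms(2) by (intro real_le_rsqrt) simp
  then have xs: "norm x \<le> s powr (1 / 2)" using s by (simp add: powr_half_sqrt)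
  have "norm (reg' \<delta> x) = 2 * (\<bar>G' s\<bar> * norm x)" by (simp add: reg'_def s_def abs_mult)
  also have "\<dots> \<le> 2 * ((C * s powr (- real CARD('n) / 2)) * s powr (1 / 2))"
    using G'_bd[OF s] xs C by (intro mult_left_mono mult_mono) auto
  also have "\<dots> = 2 * C * (s powr (- real CARD('n) / 2) * s powr (1 / 2))" by (simp only: mult_ac)
  also have "s powr (- real CARD('n) / 2) * s powr (1 / 2) = s powr ((1 - real CARD('n)) / 2)"
    unfolding powr_add[symmetric] by (rule arg_cong[where f="\<lambda>a. s powr a"]) (simp add: field_simps)
  finally show "norm (reg' \<delta> x) \<le> 2 * C * ((norm x)\<^sup>2 + \<delta>) powr ((1 - real CARD('n)) / 2)" by (simp add: s_def)
qed

lemma reg_le_sing: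
  assumes "x \<noteq> 0" "0 \<le> \<delta>"
  shows "\<bar>reg \<delta> x\<bar> \<le> C * sing x" "norm (reg' \<delta> x) \<le> 2 * C * sing x"
  using order_trans[OF reg_le_shift(1) mult_left_mono[OF powr_shift_le_sing[OF assms], of C]]
    order_trans[OF reg_le_shift(2) mult_left_mono[OF powr_shift_le_sing[OF assms], of "2 * C"]] assms C by auto

lemma g_le_sing: "x \<noteq> 0 \<Longrightarrow> \<bar>g x\<bar> \<le> C * sing x"
  using reg_le_sing(1)[of x 0] by (simp add: reg_def g_eq)

lemma grad_le_sing: "x \<noteq> 0 \<Longrightarrow> norm (grad g x) \<le> 2 * C * sing x"
  using reg_le_sing(2)[of x 0] by (simp add: grad_eq_reg')

lemma reg_bounded:
  assumes "0 < \<delta>"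
  shows "\<bar>reg \<delta> x\<bar> \<le> C * \<delta> powr ((1 - real CARD('n)) / 2)" "norm (reg' \<delta> x) \<le> 2 * C * \<delta> powr ((1 - real CARD('n)) / 2)"
proof -
  have "((norm x)\<^sup>2 + \<delta>) powr ((1 - real CARD('n)) / 2) \<le> \<delta> powr ((1 - real CARD('n)) / 2)"
    using assms dim by (intro powr_mono2') auto
  note le = mult_left_mono[OF this]
  show "\<bar>reg \<delta> x\<bar> \<le> C * \<delta> powr ((1 - real CARD('n)) / 2)"
    using reg_le_shift(1)[of x \<delta>] le[OF C] assms by linarith
  show "norm (reg' \<delta> x) \<le> 2 * C * \<delta> powr ((1 - real CARD('n)) / 2)"
    using reg_le_shift(2)[of x \<delta>] le[of "2 * C"] C assms by linarith
qed

lemma reg_lipschitz: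
  assumes "0 < \<delta>"
  shows "\<bar>reg \<delta> x - reg \<delta> y\<bar> \<le> 2 * C * \<delta> powr ((1 - real CARD('n)) / 2) * norm (x - y)"
proof -
  have "norm (reg \<delta> x - reg \<delta> y) \<le> 2 * C * \<delta> powr ((1 - real CARD('n)) / 2) * norm (x - y)"
  proof (rule differentiable_bound[of UNIV _ "\<lambda>x h. reg' \<delta> x \<bullet> h"])
    show "(reg \<delta> has_derivative (\<lambda>h. reg' \<delta> x \<bullet> h)) (at x within UNIV)" for x
      using assms by (intro reg_has_derivative_pos add_nonneg_pos) auto
    show "onorm (\<lambda>h. reg' \<delta> x \<bullet> h) \<le> 2 * C * \<delta> powr ((1 - real CARD('n)) / 2)" for x
    proof (rule onorm_le)
      fix h
      have "norm (reg' \<delta> x \<bullet> h) \<le> norm (reg' \<delta> x) * norm h" by (rule Cauchy_Schwarz_ineq2[folded real_norm_def])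
      also have "\<dots> \<le> 2 * C * \<delta> powr ((1 - real CARD('n)) / 2) * norm h"
        by (intro mult_right_mono reg_bounded assms) auto
      finally show "norm (reg' \<delta> x \<bullet> h) \<le> 2 * C * \<delta> powr ((1 - real CARD('n)) / 2) * norm h" .
    qed
  qed auto
  then show ?thesis by simp
qed

lemma reg'_continuous_on:
  assumes "\<And>x. x \<in> S \<Longrightarrow> 0 < (norm x)\<^sup>2 + \<delta>"
  shows "continuous_on S (reg' \<delta>)"
  unfolding reg'_def
  by (intro continuous_intros continuous_on_compose2[OF C1_pos_continuous_on[OF G'_C1]]) (use assms in auto)

lemma reg_continuous_on:
  assumes "\<And>x. x \<in> S \<Longrightarrow> 0 < (norm x)\<^sup>2 + \<delta>"
  shows "continuous_on S (reg \<delta>)"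
  unfolding reg_def
  by (intro continuous_intros continuous_on_compose2[OF C1_pos_continuous_on[OF G_C1]]) (use assms in auto)

lemma grad_continuous_on: "continuous_on (- {0}) (grad g)"
proof -
  have "continuous_on (- {0}) (reg' 0)" by (rule reg'_continuous_on) simp
  then show ?thesis by (subst continuous_on_cong[OF refl]) (auto simp: grad_eq_reg')
qed

lemma g_continuous_on: "continuous_on (- {0}) g"
proof -
  have "continuous_on (- {0}) (reg 0)" by (rule reg_continuous_on) simp
  then show ?thesis by (subst continuous_on_cong[OF refl]) (auto simp: g_eq reg_def)
qed

lemma grad_measurable[measurable]: "grad g \<in> borel_measurable borel"
  by (rule borel_measurable_continuous_countable_exceptions[of "{0}"]) (simp_all add: grad_continuous_on)

lemma g_measurable[measurable]: "g \<in> borel_measurable borel"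
  by (rule borel_measurable_continuous_countable_exceptions[of "{0}"]) (simp_all add: g_continuous_on)

lemma reg_measurable[measurable]: "0 < \<delta> \<Longrightarrow> reg \<delta> \<in> borel_measurable borel"
  by (intro borel_measurable_continuous_onI reg_continuous_on add_nonneg_pos) auto

lemma reg'_measurable[measurable]: "0 < \<delta> \<Longrightarrow> reg' \<delta> \<in> borel_measurable borel"
  by (intro borel_measurable_continuous_onI reg'_continuous_on add_nonneg_pos) auto

lemma reg_tendsto:
  assumes x: "x \<noteq> 0"
  shows "(\<lambda>n. reg (1 / real (Suc n)) x) \<longlonglongrightarrow> g x" "(\<lambda>n. reg' (1 / real (Suc n)) x) \<longlonglongrightarrow> grad g x"
proof -
  have p: "(norm x)\<^sup>2 > 0" using x by simp
  have "(\<lambda>n. (norm x)\<^sup>2 + 1 / real (Suc n)) \<longlonglongrightarrow> (norm x)\<^sup>2 + 0"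
    by (rule tendsto_add[OF tendsto_const LIMSEQ_Suc[OF lim_1_over_n]])
  then have l: "(\<lambda>n. (norm x)\<^sup>2 + 1 / real (Suc n)) \<longlonglongrightarrow> (norm x)\<^sup>2" by simp
  have c: "isCont G ((norm x)\<^sup>2)" "isCont G' ((norm x)\<^sup>2)"
    using C1_pos_continuous_on[OF G_C1] C1_pos_continuous_on[OF G'_C1] p
    by (auto simp: continuous_on_eq_continuous_at)
  show "(\<lambda>n. reg (1 / real (Suc n)) x) \<longlonglongrightarrow> g x"
    unfolding reg_def g_eq[OF x] by (rule isCont_tendsto_compose[OF c(1) l])
  have "(\<lambda>n. reg' (1 / real (Suc n)) x) \<longlonglongrightarrow> (2 * G' ((norm x)\<^sup>2)) *\<^sub>R x"
    unfolding reg'_def by (intro tendsto_intros isCont_tendsto_compose[OF c(2) l])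
  then show "(\<lambda>n. reg' (1 / real (Suc n)) x) \<longlonglongrightarrow> grad g x" using grad_eq_reg'[OF x] by (simp add: reg'_def)
qed

definition sing_mass :: real where "sing_mass = (LINT x|lborel. indicator (cball 0 1) x * sing x)"

lemma sing_integrable: "integrable lborel (\<lambda>x. indicator (cball 0 r) x * sing x)"
  using set_integrable_norm_powr_cball[where 'a="real^'n" and R=r] by (simp add: sing_def DIM_cart)

lemma sing_mass_nn: "0 \<le> sing_mass"
  unfolding sing_mass_def by (intro Bochner_Integration.integral_nonneg) (simp add: sing_nn)

lemma sing_le: "sing x \<le> indicator (cball 0 1) x * sing x + 1"
proof (cases "norm x \<le> 1")
  case False
  have "sing x \<le> 1 powr (1 - real CARD('n))"
    unfolding sing_def using False dim by (intro powr_mono2') auto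
  moreover have "0 \<le> indicator (cball 0 1) x * sing x" by (simp add: sing_nn)
  ultimately show ?thesis by simp
qed (simp add: sing_nn)

text \<open>Splitting \<open>sing\<close> into its part on the unit ball and the constant 1 makes
  the bound independent of \<open>x\<close>: the first part integrates to \<open>sing_mass\<close>
  by invariance of Lebesgue measure, the second sees only the support of
  \<open>\<phi>\<close>.\<close>

lemma sing_convolution:
  fixes h :: "real ^ 'n \<Rightarrow> 'b::{banach, second_countable_topology}" and \<phi> :: "real ^ 'n \<Rightarrow> real"
  assumes h[measurable]: "h \<in> borel_measurable borel" and hb: "\<And>x. x \<noteq> 0 \<Longrightarrow> norm (h x) \<le> c * sing x" and c: "0 \<le> c"
    and \<phi>[measurable]: "\<phi> \<in> borel_measurable borel" and \<phi>b: "\<And>y. \<bar>\<phi> y\<bar> \<le> m" "\<And>y. norm y > R \<Longrightarrow> \<phi> y = 0"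
  shows "integrable lborel (\<lambda>y. \<phi> y *\<^sub>R h (x - y))" (is ?A)
    and "norm (LINT y|lborel. \<phi> y *\<^sub>R h (x - y)) \<le> m * (c * (sing_mass + measure lborel (cball (0::real^'n) R)))" (is ?B)
proof -
  have m: "0 \<le> m" using \<phi>b(1)[of 0] by linarith
  define w where "w y = m * (c * (indicator (cball 0 1) (x - y) * sing (x - y) + indicator (cball 0 R) y))" for y :: "real^'n"
  have s1: "integrable lborel (\<lambda>y. indicator (cball 0 1) (x - y) * sing (x - y))"
    "(LINT y|lborel. indicator (cball 0 1) (x - y) * sing (x - y)) = sing_mass"
  proof -
    have m: "(\<lambda>y. indicator (cball 0 1) y * sing y) \<in> borel_measurable borel"
      by (intro borel_measurable_times borel_measurable_indicator) simp_all
    show "integrable lborel (\<lambda>y. indicator (cball 0 1) (x - y) * sing (x - y))"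
      using integrable_lborel_reflect[OF m, of x] sing_integrable[of 1] by simp
    show "(LINT y|lborel. indicator (cball 0 1) (x - y) * sing (x - y)) = sing_mass"
      using integral_lborel_reflect[OF m, of x] by (simp add: sing_mass_def)
  qed
  have s2: "integrable lborel (indicator (cball (0::real^'n) R) :: _ \<Rightarrow> real)"
    by (intro integrable_real_indicator) (auto simp: emeasure_lborel_cball_finite[unfolded infinity_ennreal_def])
  have wi: "integrable lborel w" unfolding w_def
    by (rule integrable_mult_right integrable_mult_right Bochner_Integration.integrable_add s1 s2)+
  have wI: "(LINT y|lborel. w y) = m * (c * (sing_mass + measure lborel (cball (0::real^'n) R)))"
    unfolding w_def integral_mult_right_zero Bochner_Integration.integral_add[OF s1(1) s2] s1(2) by simp
  have "AE y in lborel. y \<noteq> x" by (rule AE_lborel_singleton)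
  then have le: "AE y in lborel. norm (\<phi> y *\<^sub>R h (x - y)) \<le> w y"
  proof eventually_elim
    fix y assume y: "y \<noteq> x"
    show "norm (\<phi> y *\<^sub>R h (x - y)) \<le> w y"
    proof (cases "norm y > R")
      case True
      have "0 \<le> w y" unfolding w_def using m c by (intro mult_nonneg_nonneg add_nonneg_nonneg) (auto simp: sing_nn)
      then show ?thesis using \<phi>b(2)[OF True] by simp
    next
      case False
      have "norm (h (x - y)) \<le> c * sing (x - y)" using y by (intro hb) simp
      also have "\<dots> \<le> c * (indicator (cball 0 1) (x - y) * sing (x - y) + 1)" by (intro mult_left_mono sing_le c)
      finally have "norm (\<phi> y *\<^sub>R h (x - y)) \<le> m * (c * (indicator (cball 0 1) (x - y) * sing (x - y) + 1))"
        unfolding norm_scaleR using \<phi>b(1)[of y] m by (intro mult_mono) auto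
      moreover have "indicator (cball 0 R) y = (1::real)" using False by simp
      ultimately show ?thesis unfolding w_def by simp
    qed
  qed
  show A: ?A
  proof (rule Bochner_Integration.integrable_bound[OF wi])
    show "(\<lambda>y. \<phi> y *\<^sub>R h (x - y)) \<in> borel_measurable lborel" by measurable
    show "AE y in lborel. norm (\<phi> y *\<^sub>R h (x - y)) \<le> norm (w y)" using le by eventually_elim simp
  qed
  have "norm (LINT y|lborel. \<phi> y *\<^sub>R h (x - y)) \<le> (LINT y|lborel. norm (\<phi> y *\<^sub>R h (x - y)))"
    by (rule integral_norm_bound)
  also have "\<dots> \<le> (LINT y|lborel. w y)"
    by (rule integral_mono_AE[OF integrable_norm[OF A] wi le])
  finally show ?B unfolding wI .
qed

text \<open>Dominated convergence with the majorant \<open>4 * C * sing\<close>. Local convergence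
  in mean, tested against densities with a common bound, is what makes the energy rates converge
  uniformly in time.\<close>

lemma reg'_L1_tendsto:
  "(\<lambda>n. LINT x|lborel. indicator (cball 0 r) x * norm (reg' (1 / real (Suc n)) x - grad g x)) \<longlonglongrightarrow> 0"
proof -
  have "(\<lambda>n. LINT x|lborel. indicator (cball 0 r) x * norm (reg' (1 / real (Suc n)) x - grad g x)) \<longlonglongrightarrow> (LINT x::real^'n|lborel. 0)"
  proof (rule integral_dominated_convergence[where w="\<lambda>x. 4 * C * (indicator (cball 0 r) x * sing x)"])
    have ind: "(\<lambda>x. indicator (cball (0::real^'n) r) x :: real) \<in> borel_measurable borel"
      by (intro borel_measurable_indicator) simp
    show "(\<lambda>x. indicator (cball 0 r) x * norm (reg' (1 / real (Suc n)) x - grad g x)) \<in> borel_measurable lborel" for n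
      using reg'_measurable[of "1 / real (Suc n)"] ind by simp
    show "integrable lborel (\<lambda>x. 4 * C * (indicator (cball 0 r) x * sing x))"
      by (intro integrable_mult_right sing_integrable)
    have ne: "AE x::real^'n in lborel. x \<noteq> 0" by (rule AE_lborel_singleton)
    then show "AE x in lborel. (\<lambda>n. indicator (cball 0 r) x * norm (reg' (1 / real (Suc n)) x - grad g x)) \<longlonglongrightarrow> 0"
    proof eventually_elim
      fix x :: "real^'n" assume "x \<noteq> 0"
      then have "(\<lambda>n. indicator (cball 0 r) x * norm (reg' (1 / real (Suc n)) x - grad g x)) \<longlonglongrightarrow> indicator (cball 0 r) x * norm (grad g x - grad g x)"
        by (intro tendsto_intros reg_tendsto)
      then show "(\<lambda>n. indicator (cball 0 r) x * norm (reg' (1 / real (Suc n)) x - grad g x)) \<longlonglongrightarrow> 0" by simp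
    qed
    show "AE x in lborel. norm (indicator (cball 0 r) x * norm (reg' (1 / real (Suc n)) x - grad g x)) \<le> 4 * C * (indicator (cball 0 r) x * sing x)" for n
      using ne
    proof eventually_elim
      fix x :: "real^'n" assume x: "x \<noteq> 0"
      have "norm (reg' (1 / real (Suc n)) x - grad g x) \<le> 2 * C * sing x + 2 * C * sing x"
        using norm_triangle_ineq4[of "reg' (1 / real (Suc n)) x" "grad g x"] reg_le_sing(2)[OF x, of "1 / real (Suc n)"] grad_le_sing[OF x] by simp
      then have "indicator (cball 0 r) x * norm (reg' (1 / real (Suc n)) x - grad g x) \<le> indicator (cball 0 r) x * (4 * C * sing x)"
        by (intro mult_left_mono) auto
      then show "norm (indicator (cball 0 r) x * norm (reg' (1 / real (Suc n)) x - grad g x)) \<le> 4 * C * (indicator (cball 0 r) x * sing x)"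
        by (simp add: mult_ac)
    qed
  qed simp
  then show ?thesis by simp
qed

end

section \<open>Energy along a particle trajectory\<close>

lemma integral_empirical_pair:
  fixes f :: "(real ^ 'n) \<times> 'b \<Rightarrow> real"
  assumes N: "0 < N" and \<nu>: "prob_space \<nu>" and f[measurable]: "f \<in> borel_measurable (borel \<Otimes>\<^sub>M \<nu>)"
    and int: "\<And>i. i < N \<Longrightarrow> integrable \<nu> (\<lambda>z. f (X i, z))"
  shows "integrable (empirical N X \<Otimes>\<^sub>M \<nu>) f"
    and "(LINT p|(empirical N X \<Otimes>\<^sub>M \<nu>). f p) = (\<Sum>i<N. LINT z|\<nu>. f (X i, z)) / real N"
proof -
  interpret \<nu>: prob_space \<nu> by fact
  let ?U = "uniform_count_measure {..<N}"
  interpret U: prob_space ?U by (rule prob_space_uniform_count_measure) (use N in auto)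
  have Xm[measurable]: "X \<in> measurable ?U borel" by (simp add: measurable_def space_uniform_count_measure sets_uniform_count_measure)
  interpret E: prob_space "empirical N X" unfolding empirical_def by (rule U.prob_space_distr) measurable
  interpret P: pair_prob_space "empirical N X" \<nu> ..
  have sE[measurable_cong]: "sets (empirical N X) = sets borel" by (simp add: empirical_def)
  have fE[measurable]: "f \<in> borel_measurable (empirical N X \<Otimes>\<^sub>M \<nu>)" by measurable
  \<comment> \<open>The empirical measure charges only the points \<open>X i\<close>, so
    integrability of the sections at these points is what Fubini's theorem asks for.\<close>
  have AEE: "AE x in empirical N X. \<exists>i<N. x = X i"
    unfolding empirical_def
    by (subst AE_distr_iff) (auto simp: space_uniform_count_measure intro!: AE_I2 borel_closed finite_imp_closed
        simp: image_def[symmetric] Bex_def[symmetric])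
  have bm: "(\<lambda>x. LINT z|\<nu>. norm (f (x, z))) \<in> borel_measurable borel" by measurable
  have bm': "(\<lambda>x. LINT z|\<nu>. f (x, z)) \<in> borel_measurable borel" by measurable
  have intU: "integrable ?U h" for h :: "nat \<Rightarrow> real"
    unfolding uniform_count_measure_def by (rule integrable_point_measure_finite) auto
  have "integrable (empirical N X) (\<lambda>x. LINT z|\<nu>. norm (f (x, z)))"
    unfolding empirical_def using bm intU by (subst integrable_distr_eq) auto
  moreover have "AE x in empirical N X. integrable \<nu> (\<lambda>z. f (x, z))"
    using AEE by eventually_elim (use int in auto)
  ultimately show I: "integrable (empirical N X \<Otimes>\<^sub>M \<nu>) f"
    by (intro P.Fubini_integrable fE)
  have "(LINT p|(empirical N X \<Otimes>\<^sub>M \<nu>). f p) = (LINT x|empirical N X. (LINT z|\<nu>. f (x, z)))"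
    by (rule P.integral_fst'[OF I, symmetric])
  also have "\<dots> = (LINT i|?U. (LINT z|\<nu>. f (X i, z)))"
    unfolding empirical_def using bm' by (subst integral_distr) auto
  also have "\<dots> = (\<Sum>i<N. LINT z|\<nu>. f (X i, z)) / real N"
    by (simp add: integral_uniform_count_measure)
  finally show "(LINT p|(empirical N X \<Otimes>\<^sub>M \<nu>). f p) = (\<Sum>i<N. LINT z|\<nu>. f (X i, z)) / real N" .
qed

lemma integral_pair_swap:
  fixes f :: "'a \<times> 'b \<Rightarrow> real"
  assumes "prob_space \<mu>" "prob_space \<nu>" and f: "f \<in> borel_measurable (\<mu> \<Otimes>\<^sub>M \<nu>)"
  shows "(LINT p|(\<mu> \<Otimes>\<^sub>M \<nu>). f p) = (LINT p|(\<nu> \<Otimes>\<^sub>M \<mu>). f (snd p, fst p))"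
proof -
  interpret \<mu>: prob_space \<mu> by fact
  interpret \<nu>: prob_space \<nu> by fact
  interpret P: pair_prob_space \<mu> \<nu> ..
  have "(LINT p|(\<nu> \<Otimes>\<^sub>M \<mu>). (\<lambda>(x, y). f (y, x)) p) = (LINT p|(\<mu> \<Otimes>\<^sub>M \<nu>). f p)"
    by (rule P.integral_product_swap[OF f])
  then show ?thesis by (simp add: case_prod_beta)
qed

text \<open>Removing the diagonal is visible only between particles, where distinct positions turn
  it into \<open>i \<noteq> j\<close>. A measure with density charges no point, so in the other
  three terms the diagonal is null.\<close>

lemma modulated_integral_expand:
  fixes f :: "real ^ 'n \<Rightarrow> real ^ 'n \<Rightarrow> real"
  assumes N: "0 < N" and X: "\<And>i j. i < N \<Longrightarrow> j < N \<Longrightarrow> i \<noteq> j \<Longrightarrow> X i \<noteq> X j"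
    and \<rho>: "prob_space (density lborel (\<lambda>x. ennreal (\<rho> x)))" "\<rho> \<in> borel_measurable borel"
    and f: "(\<lambda>p. f (fst p) (snd p)) \<in> borel_measurable (borel \<Otimes>\<^sub>M borel)"
    and int: "\<And>x. integrable (density lborel (\<lambda>x. ennreal (\<rho> x))) (f x)"
      "\<And>x. integrable (density lborel (\<lambda>x. ennreal (\<rho> x))) (\<lambda>z. f z x)"
  defines "\<nu> \<equiv> density lborel (\<lambda>x. ennreal (\<rho> x))"
  shows "modulated_integral f N X \<rho> = (1 / real N)\<^sup>2 * (\<Sum>i<N. \<Sum>j\<in>{..<N} - {i}. f (X i) (X j))
    - (\<Sum>i<N. LINT z|\<nu>. f (X i) z) / real N - (\<Sum>i<N. LINT z|\<nu>. f z (X i)) / real N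
    + (LINT p|(\<nu> \<Otimes>\<^sub>M \<nu>). f (fst p) (snd p))"
proof -
  interpret \<nu>: prob_space \<nu> using \<rho>(1) by (simp add: \<nu>_def)
  have sn[measurable_cong]: "sets \<nu> = sets borel" by (simp add: \<nu>_def)
  let ?U = "uniform_count_measure {..<N}"
  interpret U: prob_space ?U by (rule prob_space_uniform_count_measure) (use N in auto)
  have Xm[measurable]: "X \<in> measurable ?U borel" by (simp add: measurable_def space_uniform_count_measure sets_uniform_count_measure)
  have pe: "prob_space (empirical N X)" unfolding empirical_def by (rule U.prob_space_distr) measurable
  have sE[measurable_cong]: "sets (empirical N X) = sets borel" by (simp add: empirical_def)
  define h where "h p = (if fst p = snd p then 0 else f (fst p) (snd p))" for p :: "(real^'n) \<times> (real^'n)"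
  have "{p::(real^'n) \<times> (real^'n). fst p = snd p} \<in> sets (borel \<Otimes>\<^sub>M borel)"
    unfolding borel_prod by (intro borel_closed closed_Collect_eq continuous_intros)
  then have hm[measurable]: "h \<in> borel_measurable (borel \<Otimes>\<^sub>M borel)"
    unfolding h_def using f by (intro measurable_If) (auto simp: borel_prod)
  have off: "offdiag_integral f \<mu> \<mu>' = (LINT p|(\<mu> \<Otimes>\<^sub>M \<mu>'). h p)" for \<mu> \<mu>'
    unfolding offdiag_integral_def h_def split_def ..
  have ne: "AE z in \<nu>. z \<noteq> x" for x
    unfolding \<nu>_def using \<rho>(2) AE_lborel_singleton[of x] by (subst AE_density) (auto elim: eventually_mono)
  have fx: "f x \<in> borel_measurable \<nu>" "(\<lambda>z. f z x) \<in> borel_measurable \<nu>" for x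
    using int[of x] by (auto simp: \<nu>_def)
  have h1: "integrable \<nu> (\<lambda>z. h (x, z))" "(LINT z|\<nu>. h (x, z)) = (LINT z|\<nu>. f x z)" for x
  proof -
    have ae: "AE z in \<nu>. f x z = h (x, z)" using ne[of x] by eventually_elim (simp add: h_def)
    have m: "(\<lambda>z. h (x, z)) \<in> borel_measurable \<nu>" by measurable
    show "integrable \<nu> (\<lambda>z. h (x, z))"
      by (rule integrable_cong_AE_imp[OF _ m ae]) (use int(1)[of x] in \<open>simp add: \<nu>_def\<close>)
    show "(LINT z|\<nu>. h (x, z)) = (LINT z|\<nu>. f x z)"
      by (rule integral_cong_AE[OF m fx(1)]) (use ae in eventually_elim, simp)
  qed
  have h2: "integrable \<nu> (\<lambda>z. h (z, x))" "(LINT z|\<nu>. h (z, x)) = (LINT z|\<nu>. f z x)" for x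
  proof -
    have ae: "AE z in \<nu>. f z x = h (z, x)" using ne[of x] by eventually_elim (simp add: h_def)
    have m: "(\<lambda>z. h (z, x)) \<in> borel_measurable \<nu>" by measurable
    show "integrable \<nu> (\<lambda>z. h (z, x))"
      by (rule integrable_cong_AE_imp[OF _ m ae]) (use int(2)[of x] in \<open>simp add: \<nu>_def\<close>)
    show "(LINT z|\<nu>. h (z, x)) = (LINT z|\<nu>. f z x)"
      by (rule integral_cong_AE[OF m fx(2)]) (use ae in eventually_elim, simp)
  qed
  have 1: "offdiag_integral f (empirical N X) \<nu> = (\<Sum>i<N. LINT z|\<nu>. f (X i) z) / real N"
    unfolding off using integral_empirical_pair(2)[OF N \<nu>.prob_space_axioms, of h X] h1 by simp
  have 2: "offdiag_integral f \<nu> (empirical N X) = (\<Sum>i<N. LINT z|\<nu>. f z (X i)) / real N"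
  proof -
    have "offdiag_integral f \<nu> (empirical N X) = (LINT p|(empirical N X \<Otimes>\<^sub>M \<nu>). h (snd p, fst p))"
      unfolding off by (rule integral_pair_swap[OF \<nu>.prob_space_axioms pe]) measurable
    also have "\<dots> = (\<Sum>i<N. LINT z|\<nu>. h (z, X i)) / real N"
      using integral_empirical_pair(2)[OF N \<nu>.prob_space_axioms, of "\<lambda>p. h (snd p, fst p)" X] h2 by simp
    finally show ?thesis using h2 by simp
  qed
  have intE: "integrable (empirical N X) r" "(LINT z|empirical N X. r z) = (\<Sum>j<N. r (X j)) / real N"
    if rm: "r \<in> borel_measurable borel" for r :: "real^'n \<Rightarrow> real"
  proof -
    show "integrable (empirical N X) r" unfolding empirical_def
      using rm by (subst integrable_distr_eq) (auto simp: uniform_count_measure_def intro!: integrable_point_measure_finite)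
    show "(LINT z|empirical N X. r z) = (\<Sum>j<N. r (X j)) / real N"
      unfolding empirical_def using rm by (subst integral_distr) (auto simp: integral_uniform_count_measure)
  qed
  have hx: "(\<lambda>z. h (x, z)) \<in> borel_measurable borel" for x by measurable
  have 3: "offdiag_integral f (empirical N X) (empirical N X) = (1 / real N)\<^sup>2 * (\<Sum>i<N. \<Sum>j\<in>{..<N} - {i}. f (X i) (X j))"
  proof -
    have s: "(\<Sum>j<N. h (X i, X j)) = (\<Sum>j\<in>{..<N} - {i}. f (X i) (X j))" if i: "i < N" for i
    proof -
      have "(\<Sum>j<N. h (X i, X j)) = h (X i, X i) + (\<Sum>j\<in>{..<N} - {i}. h (X i, X j))"
        by (rule sum.remove) (use i in auto)
      also have "(\<Sum>j\<in>{..<N} - {i}. h (X i, X j)) = (\<Sum>j\<in>{..<N} - {i}. f (X i) (X j))"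
        by (rule sum.cong) (use X i in \<open>auto simp: h_def\<close>)
      finally show ?thesis by (simp add: h_def)
    qed
    have "offdiag_integral f (empirical N X) (empirical N X) = (\<Sum>i<N. LINT z|empirical N X. h (X i, z)) / real N"
      unfolding off by (rule integral_empirical_pair(2)[OF N pe]) (use intE(1)[OF hx] in auto)
    also have "\<dots> = (\<Sum>i<N. (\<Sum>j<N. h (X i, X j)) / real N) / real N" by (simp add: intE(2)[OF hx])
    also have "(\<Sum>i<N. (\<Sum>j<N. h (X i, X j)) / real N) = (\<Sum>i<N. (\<Sum>j\<in>{..<N} - {i}. f (X i) (X j)) / real N)"
      using s by simp
    finally show ?thesis by (simp add: sum_divide_distrib[symmetric] power2_eq_square)
  qed
  have 4: "offdiag_integral f \<nu> \<nu> = (LINT p|(\<nu> \<Otimes>\<^sub>M \<nu>). f (fst p) (snd p))"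
  proof -
    interpret P: pair_prob_space \<nu> \<nu> ..
    have "AE p in \<nu> \<Otimes>\<^sub>M \<nu>. fst p \<noteq> snd p"
    proof (rule P.AE_pair_measure)
      have "{p::(real^'n) \<times> (real^'n). fst p \<noteq> snd p} \<in> sets (borel \<Otimes>\<^sub>M borel)"
        unfolding borel_prod by (intro borel_open open_Collect_neq continuous_intros)
      moreover have "sets (\<nu> \<Otimes>\<^sub>M \<nu>) = sets (borel \<Otimes>\<^sub>M borel)" by (intro sets_pair_measure_cong sn)
      ultimately show "{p \<in> space (\<nu> \<Otimes>\<^sub>M \<nu>). fst p \<noteq> snd p} \<in> sets (\<nu> \<Otimes>\<^sub>M \<nu>)"
        by (simp add: space_pair_measure \<nu>_def)
      show "AE x in \<nu>. AE y in \<nu>. fst (x, y) \<noteq> snd (x, y)"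
        by (rule AE_I2, rule eventually_mono[OF ne]) auto
    qed
    then have ae: "AE p in \<nu> \<Otimes>\<^sub>M \<nu>. h p = f (fst p) (snd p)" by eventually_elim (simp add: h_def)
    have fm: "(\<lambda>p. f (fst p) (snd p)) \<in> borel_measurable (\<nu> \<Otimes>\<^sub>M \<nu>)"
      using f measurable_cong_sets[OF sets_pair_measure_cong[OF sn sn] refl] by blast
    show ?thesis unfolding off by (rule integral_cong_AE[OF _ fm ae]) measurable
  qed
  show ?thesis
    unfolding modulated_integral_def Let_def \<nu>_def[symmetric] 1 2 3 4 ..
qed

section \<open>Regularised energies and their derivatives\<close>

lemma has_vector_derivative_imp_le:
  fixes f :: "real \<Rightarrow> 'a::real_normed_vector"
  assumes f: "\<And>t. t \<in> {a..b} \<Longrightarrow> (f has_vector_derivative f' t) (at t within {a..b})"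
    and B: "\<And>t. t \<in> {a..b} \<Longrightarrow> norm (f' t) \<le> B" and st: "s \<in> {a..b}" "t \<in> {a..b}"
  shows "norm (f s - f t) \<le> B * \<bar>s - t\<bar>"
proof -
  have "norm (f s - f t) \<le> B * norm (s - t)"
    by (rule differentiable_bound[where S="{a..b}" and f'="\<lambda>t s. s *\<^sub>R f' t"])
      (use f st onorm_scaleR_const_le[OF B] in \<open>auto simp: has_vector_derivative_def\<close>)
  then show ?thesis by simp
qed

text \<open>\<open>Q\<close> is left abstract so that one statement covers both a particle against
  the density and the density against itself: \<open>a t q\<close> is the relative position of two
  points that move with bounded speed. For fixed \<open>\<delta>\<close> the regularised kernel is
  Lipschitz, which supplies a constant majorant.\<close>

lemma (in singular_kernel) reg_integral_derivative:
  fixes a a' :: "real \<Rightarrow> 'q \<Rightarrow> real ^ 'n"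
  assumes \<delta>: "0 < \<delta>" and Q: "prob_space Q" and t: "t \<in> {0..T}"
    and a: "\<And>q t. t \<in> {0..T} \<Longrightarrow> ((\<lambda>t. a t q) has_vector_derivative a' t q) (at t within {0..T})"
    and a'b: "\<And>q t. t \<in> {0..T} \<Longrightarrow> norm (a' t q) \<le> B"
    and am: "\<And>t. t \<in> {0..T} \<Longrightarrow> a t \<in> borel_measurable Q" and a'm: "\<And>t. t \<in> {0..T} \<Longrightarrow> a' t \<in> borel_measurable Q"
  shows "((\<lambda>t. LINT q|Q. reg \<delta> (a t q)) has_vector_derivative (LINT q|Q. reg' \<delta> (a t q) \<bullet> a' t q)) (at t within {0..T})"
proof -
  interpret Q: prob_space Q by fact
  define L where "L = 2 * C * \<delta> powr ((1 - real CARD('n)) / 2)"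
  have B: "0 \<le> B" using a'b[OF t, of undefined] norm_ge_zero order_trans by blast
  have L: "0 \<le> L" using C by (simp add: L_def)
  note [measurable] = reg_measurable[OF \<delta>] reg'_measurable[OF \<delta>]
  show ?thesis
  proof (rule has_vector_derivative_lebesgue_integral[where r=1 and B="\<lambda>_. L * B", OF t])
    show "integrable Q (\<lambda>q. reg \<delta> (a s q))" if "s \<in> {0..T}" for s
    proof (rule Q.integrable_const_bound)
      show "AE q in Q. norm (reg \<delta> (a s q)) \<le> C * \<delta> powr ((1 - real CARD('n)) / 2)"
        using reg_bounded(1)[OF \<delta>] by simp
      show "(\<lambda>q. reg \<delta> (a s q)) \<in> borel_measurable Q" using am[OF that] by measurable
    qed
    show "AE q in Q. ((\<lambda>t. reg \<delta> (a t q)) has_vector_derivative reg' \<delta> (a t q) \<bullet> a' t q) (at t within {0..T})"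
    proof (rule AE_I2)
      fix q
      have "((\<lambda>t. reg \<delta> (a t q)) has_derivative (\<lambda>h. reg' \<delta> (a t q) \<bullet> (h *\<^sub>R a' t q))) (at t within {0..T})"
        by (rule has_derivative_compose[OF a[OF t, unfolded has_vector_derivative_def]
              reg_has_derivative_pos]) (use \<delta> in \<open>intro add_nonneg_pos; simp\<close>)
      then show "((\<lambda>t. reg \<delta> (a t q)) has_vector_derivative reg' \<delta> (a t q) \<bullet> a' t q) (at t within {0..T})"
        by (simp add: has_vector_derivative_def)
    qed
    show "(\<lambda>q. reg' \<delta> (a t q) \<bullet> a' t q) \<in> borel_measurable Q" using am[OF t] a'm[OF t] by measurable
    show "integrable Q (\<lambda>_. L * B)" by simp
    show "AE q in Q. \<forall>s\<in>{0..T}. dist s t < 1 \<longrightarrow> norm (reg \<delta> (a s q) - reg \<delta> (a t q)) \<le> L * B * \<bar>s - t\<bar>"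
    proof (intro AE_I2 ballI impI)
      fix q s assume s: "s \<in> {0..T}"
      have "norm (reg \<delta> (a s q) - reg \<delta> (a t q)) \<le> L * norm (a s q - a t q)"
        using reg_lipschitz[OF \<delta>] by (simp add: L_def)
      also have "\<dots> \<le> L * (B * \<bar>s - t\<bar>)"
        by (intro mult_left_mono L has_vector_derivative_imp_le[OF a a'b s t])
      finally show "norm (reg \<delta> (a s q) - reg \<delta> (a t q)) \<le> L * B * \<bar>s - t\<bar>" by simp
    qed
    show "AE q in Q. norm (reg' \<delta> (a t q) \<bullet> a' t q) \<le> L * B"
    proof (rule AE_I2)
      fix q
      have "norm (reg' \<delta> (a t q) \<bullet> a' t q) \<le> norm (reg' \<delta> (a t q)) * norm (a' t q)" by (simp add: Cauchy_Schwarz_ineq2)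
      also have "\<dots> \<le> L * B"
        using reg_bounded(2)[OF \<delta>] a'b[OF t] L unfolding L_def by (intro mult_mono) auto
      finally show "norm (reg' \<delta> (a t q) \<bullet> a' t q) \<le> L * B" .
    qed
  qed simp
qed

text \<open>A single density frozen in time; inside proofs it is interpreted with the density at the
  time under consideration.\<close>

locale kernel_density = singular_kernel g G G' C for g :: "real ^ 'n \<Rightarrow> real" and G G' C +
  fixes \<rho> :: "real ^ 'n \<Rightarrow> real" and P R :: real
  assumes \<rho>_meas[measurable]: "\<rho> \<in> borel_measurable borel"
    and \<rho>_bounds: "\<And>z. 0 \<le> \<rho> z" "\<And>z. \<rho> z \<le> P" "\<And>z. norm z > R \<Longrightarrow> \<rho> z = 0"
    and \<rho>_prob: "prob_space (density lborel (\<lambda>x. ennreal (\<rho> x)))"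
begin

definition \<mu> :: "(real ^ 'n) measure" where "\<mu> = density lborel (\<lambda>x. ennreal (\<rho> x))"

definition bnd :: real where "bnd = P * (sing_mass + measure lborel (cball (0::real^'n) R))"

sublocale mu: prob_space \<mu> unfolding \<mu>_def by (rule \<rho>_prob)

sublocale mu2: pair_prob_space \<mu> \<mu> ..

lemma sets_mu[measurable_cong]: "sets \<mu> = sets borel" by (simp add: \<mu>_def)

lemma space_mu[simp]: "space \<mu> = UNIV" by (simp add: \<mu>_def)

lemma P_nn: "0 \<le> P" using \<rho>_bounds(1)[of 0] \<rho>_bounds(2)[of 0] by linarith

lemma AE_mu_ne: "AE z in \<mu>. z \<noteq> x"
  unfolding \<mu>_def using AE_lborel_singleton[of x] by (subst AE_density) (auto elim: eventually_mono)

lemma AE_mu_supp: "AE z in \<mu>. norm z \<le> R"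
proof -
  have "AE z in lborel. 0 < ennreal (\<rho> z) \<longrightarrow> norm z \<le> R"
    by (rule AE_I2) (metis \<rho>_bounds(3) ennreal_0 less_irrefl not_le)
  then show ?thesis unfolding \<mu>_def by (subst AE_density) auto
qed

lemma AE_mu2_ne: "AE p in \<mu> \<Otimes>\<^sub>M \<mu>. fst p \<noteq> snd p"
proof (rule mu2.AE_pair_measure)
  have "{p::(real^'n) \<times> (real^'n). fst p \<noteq> snd p} \<in> sets (borel \<Otimes>\<^sub>M borel)"
    unfolding borel_prod by (intro borel_open open_Collect_neq continuous_intros)
  moreover have "sets (\<mu> \<Otimes>\<^sub>M \<mu>) = sets (borel \<Otimes>\<^sub>M borel)" by (intro sets_pair_measure_cong sets_mu)
  ultimately show "{p \<in> space (\<mu> \<Otimes>\<^sub>M \<mu>). fst p \<noteq> snd p} \<in> sets (\<mu> \<Otimes>\<^sub>M \<mu>)"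
    by (simp add: space_pair_measure)
  show "AE x in \<mu>. AE y in \<mu>. fst (x, y) \<noteq> snd (x, y)"
    by (rule AE_I2, rule eventually_mono[OF AE_mu_ne]) auto
qed

lemma integral_mu:
  fixes f :: "real ^ 'n \<Rightarrow> 'b::{banach, second_countable_topology}"
  assumes "f \<in> borel_measurable borel"
  shows "integrable \<mu> f \<longleftrightarrow> integrable lborel (\<lambda>z. \<rho> z *\<^sub>R f z)" "(LINT z|\<mu>. f z) = (LINT z|lborel. \<rho> z *\<^sub>R f z)"
  unfolding \<mu>_def using assms \<rho>_bounds(1) by (subst integrable_density integral_density; auto)+

lemma sing_mu:
  fixes h :: "real ^ 'n \<Rightarrow> 'b::{banach, second_countable_topology}"
  assumes h[measurable]: "h \<in> borel_measurable borel" and hb: "\<And>x. x \<noteq> 0 \<Longrightarrow> norm (h x) \<le> c * sing x" and c: "0 \<le> c"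
  shows "integrable \<mu> (\<lambda>z. h (x - z))" "norm (LINT z|\<mu>. h (x - z)) \<le> c * bnd"
proof -
  have \<rho>b: "\<bar>\<rho> z\<bar> \<le> P" for z using \<rho>_bounds(1,2)[of z] by simp
  have m: "(\<lambda>z. h (x - z)) \<in> borel_measurable borel" by measurable
  show "integrable \<mu> (\<lambda>z. h (x - z))" unfolding integral_mu(1)[OF m]
    by (rule sing_convolution(1)[OF h hb c \<rho>_meas \<rho>b \<rho>_bounds(3)])
  have "norm (LINT z|lborel. \<rho> z *\<^sub>R h (x - z)) \<le> P * (c * (sing_mass + measure lborel (cball (0::real^'n) R)))"
    by (rule sing_convolution(2)[OF h hb c \<rho>_meas \<rho>b \<rho>_bounds(3)])
  then show "norm (LINT z|\<mu>. h (x - z)) \<le> c * bnd" unfolding integral_mu(2)[OF m] bnd_def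
    by (simp only: mult_ac)
qed

text \<open>The inner integral is bounded uniformly in the outer point, so Fubini's theorem
  applies.\<close>

lemma sing_mu2: "integrable (\<mu> \<Otimes>\<^sub>M \<mu>) (\<lambda>p. sing (fst p - snd p))"
proof (rule mu2.Fubini_integrable)
  show "(\<lambda>p. sing (fst p - snd p)) \<in> borel_measurable (\<mu> \<Otimes>\<^sub>M \<mu>)" by measurable
  have sb: "norm (sing x) \<le> 1 * sing x" for x by (simp add: sing_nn)
  have s: "integrable \<mu> (\<lambda>z. sing (x - z))" for x
    by (rule sing_mu(1)[OF sing_measurable sb]) simp
  have s2: "\<bar>LINT z|\<mu>. sing (x - z)\<bar> \<le> bnd" for x
    using sing_mu(2)[OF sing_measurable sb] by simp
  show "integrable \<mu> (\<lambda>x. LINT y|\<mu>. norm (sing (fst (x, y) - snd (x, y))))"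
  proof (rule mu.integrable_const_bound)
    show "AE x in \<mu>. norm (LINT y|\<mu>. norm (sing (fst (x, y) - snd (x, y)))) \<le> bnd"
      using s2 by (simp add: sing_nn)
  qed measurable
  show "AE x in \<mu>. integrable \<mu> (\<lambda>y. sing (fst (x, y) - snd (x, y)))" using s by simp
qed

definition L1diff :: "nat \<Rightarrow> real \<Rightarrow> real" where
  "L1diff n r = (LINT x|lborel. indicator (cball 0 r) x * norm (reg' (1 / real (Suc n)) x - grad g x))"

lemma integrable_kernel_dot:
  fixes k w :: "real ^ 'n \<Rightarrow> real ^ 'n"
  assumes k[measurable]: "k \<in> borel_measurable borel" and kb: "\<And>x. x \<noteq> 0 \<Longrightarrow> norm (k x) \<le> 2 * C * sing x"
    and w[measurable]: "w \<in> borel_measurable borel" and wb: "\<And>z. norm (w z) \<le> W"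
  shows "integrable \<mu> (\<lambda>z. k (a - z) \<bullet> w z)"
proof (rule Bochner_Integration.integrable_bound)
  show "integrable \<mu> (\<lambda>z. W *\<^sub>R norm (k (a - z)))"
    using sing_mu(1)[OF k kb, of a] C by (intro integrable_scaleR_right integrable_norm) auto
  show "(\<lambda>z. k (a - z) \<bullet> w z) \<in> borel_measurable \<mu>" by measurable
  have "\<bar>k (a - z) \<bullet> w z\<bar> \<le> W * norm (k (a - z))" for z
    using Cauchy_Schwarz_ineq2[of "k (a - z)" "w z"] mult_left_mono[OF wb[of z], of "norm (k (a - z))"]
    by (simp add: mult.commute)
  moreover have "W * norm (k (a - z)) \<le> \<bar>W\<bar> * norm (k (a - z))" for z
    by (intro mult_right_mono) auto
  ultimately have "\<bar>k (a - z) \<bullet> w z\<bar> \<le> \<bar>W\<bar> * norm (k (a - z))" for z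
    using order_trans by blast
  then show "AE z in \<mu>. norm (k (a - z) \<bullet> w z) \<le> norm (W *\<^sub>R norm (k (a - z)))"
    by (intro AE_I2) (simp add: abs_mult)
qed

lemma integrable_kernel_dot2:
  fixes k w :: "real ^ 'n \<Rightarrow> real ^ 'n"
  assumes k[measurable]: "k \<in> borel_measurable borel" and kb: "\<And>x. x \<noteq> 0 \<Longrightarrow> norm (k x) \<le> 2 * C * sing x"
    and w[measurable]: "w \<in> borel_measurable borel" and wb: "\<And>z. norm (w z) \<le> W"
  shows "integrable (\<mu> \<Otimes>\<^sub>M \<mu>) (\<lambda>p. k (fst p - snd p) \<bullet> (w (fst p) - w (snd p)))"
proof (rule Bochner_Integration.integrable_bound)
  show "integrable (\<mu> \<Otimes>\<^sub>M \<mu>) (\<lambda>p. (2 * C * (2 * W)) * sing (fst p - snd p))"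
    by (intro integrable_mult_right sing_mu2)
  show "(\<lambda>p. k (fst p - snd p) \<bullet> (w (fst p) - w (snd p))) \<in> borel_measurable (\<mu> \<Otimes>\<^sub>M \<mu>)" by measurable
  show "AE p in \<mu> \<Otimes>\<^sub>M \<mu>. norm (k (fst p - snd p) \<bullet> (w (fst p) - w (snd p))) \<le> norm ((2 * C * (2 * W)) * sing (fst p - snd p))"
    using AE_mu2_ne
  proof eventually_elim
    fix p :: "(real^'n) \<times> (real^'n)" assume p: "fst p \<noteq> snd p"
    have W: "norm (w (fst p) - w (snd p)) \<le> 2 * W"
      using norm_triangle_ineq4[of "w (fst p)" "w (snd p)"] wb[of "fst p"] wb[of "snd p"] by linarith
    have "\<bar>k (fst p - snd p) \<bullet> (w (fst p) - w (snd p))\<bar> \<le> norm (k (fst p - snd p)) * norm (w (fst p) - w (snd p))"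
      by (rule Cauchy_Schwarz_ineq2)
    also have "\<dots> \<le> (2 * C * sing (fst p - snd p)) * (2 * W)"
      using kb[of "fst p - snd p"] p W C by (intro mult_mono) (auto simp: sing_nn)
    finally show "norm (k (fst p - snd p) \<bullet> (w (fst p) - w (snd p))) \<le> norm ((2 * C * (2 * W)) * sing (fst p - snd p))"
      by (simp add: mult_ac)
  qed
qed

text \<open>The density is at most \<open>P\<close>, and \<open>a - z\<close> has norm at most
  \<open>A + R\<close> on its support, so the difference is controlled by the local mean error of
  the kernels. The bound sees the density only through \<open>P\<close> and \<open>R\<close>, hence
  is the same at all times.\<close>

lemma L1diff_bound:
  fixes w :: "real ^ 'n \<Rightarrow> real ^ 'n"
  assumes w[measurable]: "w \<in> borel_measurable borel" and wb: "\<And>z. norm (w z) \<le> W" and a: "norm a \<le> A"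
  shows "\<bar>(LINT z|\<mu>. reg' (1 / real (Suc n)) (a - z) \<bullet> w z) - (LINT z|\<mu>. grad g (a - z) \<bullet> w z)\<bar>
    \<le> P * W * L1diff n (A + R)"
proof -
  let ?r = "reg' (1 / real (Suc n))"
  define D where "D x = indicator (cball 0 (A + R)) x * norm (?r x - grad g x)" for x :: "real^'n"
  have [measurable]: "?r \<in> borel_measurable borel" by (rule reg'_measurable) simp
  have W: "0 \<le> W" using wb[of 0] norm_ge_zero order_trans by blast
  have dm: "(\<lambda>x. ?r x - grad g x) \<in> borel_measurable borel" by measurable
  have db: "norm (?r x - grad g x) \<le> (4 * C) * sing x" if "x \<noteq> 0" for x
    using norm_triangle_ineq4[of "?r x" "grad g x"] reg_le_sing(2)[OF that, of "1 / real (Suc n)"] grad_le_sing[OF that] by simp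
  have Di: "integrable lborel D"
  proof -
    have "integrable lborel (\<lambda>x. (4 * C) * (indicator (cball 0 (A + R)) x * sing x))" by (intro integrable_mult_right sing_integrable)
    then show ?thesis
    proof (rule Bochner_Integration.integrable_bound)
      have "(\<lambda>x. indicator (cball (0::real^'n) (A + R)) x :: real) \<in> borel_measurable borel"
        by (intro borel_measurable_indicator) simp
      then show "D \<in> borel_measurable lborel" unfolding D_def using dm by simp
      have "AE x::real^'n in lborel. x \<noteq> 0" by (rule AE_lborel_singleton)
      then show "AE x in lborel. norm (D x) \<le> norm ((4 * C) * (indicator (cball 0 (A + R)) x * sing x))"
      proof eventually_elim
        fix x :: "real^'n" assume "x \<noteq> 0"
        then have "indicator (cball 0 (A + R)) x * norm (?r x - grad g x) \<le> indicator (cball 0 (A + R)) x * ((4 * C) * sing x)"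
          by (intro mult_left_mono db) auto
        then show "norm (D x) \<le> norm ((4 * C) * (indicator (cball 0 (A + R)) x * sing x))"
          unfolding D_def using C by (simp add: mult_ac sing_nn abs_mult)
      qed
    qed
  qed
  have Dr: "integrable lborel (\<lambda>z. D (a - z))" "(LINT z|lborel. D (a - z)) = L1diff n (A + R)"
    using integrable_lborel_reflect[of D a] integral_lborel_reflect[of D a] Di borel_measurable_integrable[OF Di]
    by (auto simp: L1diff_def D_def[abs_def])
  have i1: "integrable \<mu> (\<lambda>z. ?r (a - z) \<bullet> w z)" "integrable \<mu> (\<lambda>z. grad g (a - z) \<bullet> w z)"
    using reg_le_sing(2)[of _ "1 / real (Suc n)"] grad_le_sing wb by (auto intro!: integrable_kernel_dot)
  have "\<bar>(LINT z|\<mu>. ?r (a - z) \<bullet> w z) - (LINT z|\<mu>. grad g (a - z) \<bullet> w z)\<bar>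
      \<le> (LINT z|\<mu>. W * norm (?r (a - z) - grad g (a - z)))"
  proof (rule abs_integral_diff_le[OF i1])
    show "integrable \<mu> (\<lambda>z. W * norm (?r (a - z) - grad g (a - z)))"
      using sing_mu(1)[OF dm db, of a] C by (intro integrable_mult_right integrable_norm) auto
    fix z
    have "\<bar>?r (a - z) \<bullet> w z - grad g (a - z) \<bullet> w z\<bar> = \<bar>(?r (a - z) - grad g (a - z)) \<bullet> w z\<bar>" by (simp add: inner_diff_left)
    also have "\<dots> \<le> norm (?r (a - z) - grad g (a - z)) * norm (w z)" by (rule Cauchy_Schwarz_ineq2)
    also have "\<dots> \<le> norm (?r (a - z) - grad g (a - z)) * W" by (intro mult_left_mono wb) auto
    finally show "\<bar>?r (a - z) \<bullet> w z - grad g (a - z) \<bullet> w z\<bar> \<le> W * norm (?r (a - z) - grad g (a - z))" by (simp add: mult.commute)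
  qed
  also have "\<dots> = (LINT z|lborel. \<rho> z *\<^sub>R (W * norm (?r (a - z) - grad g (a - z))))"
    by (rule integral_mu(2)) measurable
  also have "\<dots> \<le> (LINT z|lborel. (P * W) * D (a - z))"
  proof (rule integral_mono)
    have "integrable \<mu> (\<lambda>z. W * norm (?r (a - z) - grad g (a - z)))"
      using sing_mu(1)[OF dm db, of a] C by (intro integrable_mult_right integrable_norm) auto
    then show "integrable lborel (\<lambda>z. \<rho> z *\<^sub>R (W * norm (?r (a - z) - grad g (a - z))))"
      by (subst (asm) integral_mu(1)) measurable
    show "integrable lborel (\<lambda>z. (P * W) * D (a - z))" by (intro integrable_mult_right Dr)
    fix z
    show "\<rho> z *\<^sub>R (W * norm (?r (a - z) - grad g (a - z))) \<le> (P * W) * D (a - z)"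
    proof (cases "norm z > R")
      case True
      then show ?thesis using \<rho>_bounds(3)[OF True] P_nn W by (simp add: D_def)
    next
      case False
      have "norm (a - z) \<le> A + R" using norm_triangle_ineq4[of a z] a False by linarith
      then have "D (a - z) = norm (?r (a - z) - grad g (a - z))" by (simp add: D_def)
      moreover have "\<rho> z * (W * norm (?r (a - z) - grad g (a - z))) \<le> P * (W * norm (?r (a - z) - grad g (a - z)))"
        using \<rho>_bounds(2) W by (intro mult_right_mono) auto
      ultimately show ?thesis by (simp add: mult.assoc)
    qed
  qed
  also have "\<dots> = P * W * L1diff n (A + R)" using Dr(2) by simp
  finally show ?thesis .
qed

lemma L1diff_bound2:
  fixes w :: "real ^ 'n \<Rightarrow> real ^ 'n"
  assumes w[measurable]: "w \<in> borel_measurable borel" and wb: "\<And>z. norm (w z) \<le> W"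
  shows "\<bar>(LINT p|(\<mu> \<Otimes>\<^sub>M \<mu>). reg' (1 / real (Suc n)) (fst p - snd p) \<bullet> (w (fst p) - w (snd p)))
      - (LINT p|(\<mu> \<Otimes>\<^sub>M \<mu>). grad g (fst p - snd p) \<bullet> (w (fst p) - w (snd p)))\<bar>
    \<le> P * (2 * W) * L1diff n (R + R)"
proof -
  let ?r = "reg' (1 / real (Suc n))"
  have [measurable]: "?r \<in> borel_measurable borel" by (rule reg'_measurable) simp
  have i: "integrable (\<mu> \<Otimes>\<^sub>M \<mu>) (\<lambda>p. ?r (fst p - snd p) \<bullet> (w (fst p) - w (snd p)))"
     "integrable (\<mu> \<Otimes>\<^sub>M \<mu>) (\<lambda>p. grad g (fst p - snd p) \<bullet> (w (fst p) - w (snd p)))"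
    using reg_le_sing(2)[of _ "1 / real (Suc n)"] grad_le_sing wb by (auto intro!: integrable_kernel_dot2)
  define I1 where "I1 a = (LINT z|\<mu>. ?r (a - z) \<bullet> (w a - w z))" for a
  define I2 where "I2 a = (LINT z|\<mu>. grad g (a - z) \<bullet> (w a - w z))" for a
  have f1: "(LINT p|(\<mu> \<Otimes>\<^sub>M \<mu>). ?r (fst p - snd p) \<bullet> (w (fst p) - w (snd p))) = (LINT a|\<mu>. I1 a)" "integrable \<mu> I1"
    using mu2.integral_fst'[OF i(1)] mu2.integrable_fst'[OF i(1)] by (simp_all add: I1_def[abs_def])
  have f2: "(LINT p|(\<mu> \<Otimes>\<^sub>M \<mu>). grad g (fst p - snd p) \<bullet> (w (fst p) - w (snd p))) = (LINT a|\<mu>. I2 a)" "integrable \<mu> I2"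
    using mu2.integral_fst'[OF i(2)] mu2.integrable_fst'[OF i(2)] by (simp_all add: I2_def[abs_def])
  \<comment> \<open>For \<open>a\<close> in the support the inner integral falls under the previous
    estimate, applied to the field \<open>w a - w z\<close> in the variable \<open>z\<close>, of
    size at most \<open>2 * W\<close>.\<close>
  have "AE a in \<mu>. \<bar>I1 a - I2 a\<bar> \<le> P * (2 * W) * L1diff n (R + R)"
    using AE_mu_supp
  proof eventually_elim
    fix a :: "real^'n" assume a: "norm a \<le> R"
    show "\<bar>I1 a - I2 a\<bar> \<le> P * (2 * W) * L1diff n (R + R)"
      unfolding I1_def I2_def
    proof (rule L1diff_bound[OF _ _ a])
      show "(\<lambda>z. w a - w z) \<in> borel_measurable borel" by measurable
      show "norm (w a - w z) \<le> 2 * W" for z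
        using norm_triangle_ineq4[of "w a" "w z"] wb[of a] wb[of z] by linarith
    qed
  qed
  then have "(LINT a|\<mu>. \<bar>I1 a - I2 a\<bar>) \<le> (LINT a|\<mu>. P * (2 * W) * L1diff n (R + R))"
    using f1 f2 by (intro integral_mono_AE) auto
  moreover have "\<bar>LINT a|\<mu>. I1 a - I2 a\<bar> \<le> (LINT a|\<mu>. \<bar>I1 a - I2 a\<bar>)" by (rule integral_abs_bound)
  moreover have "(LINT a|\<mu>. I1 a - I2 a) = (LINT a|\<mu>. I1 a) - (LINT a|\<mu>. I2 a)"
    by (rule Bochner_Integration.integral_diff) (rule f1 f2)+
  ultimately show ?thesis unfolding f1(1) f2(1) using mu.prob_space by simp
qed

lemma reg_mu_tendsto: "(\<lambda>n. LINT z|\<mu>. reg (1 / real (Suc n)) (a - z)) \<longlonglongrightarrow> (LINT z|\<mu>. g (a - z))"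
proof (rule integral_dominated_convergence[where w="\<lambda>z. C * sing (a - z)"])
  show "(\<lambda>z. reg (1 / real (Suc n)) (a - z)) \<in> borel_measurable \<mu>" for n
    using reg_measurable[of "1 / real (Suc n)"] by measurable
  show "(\<lambda>z. g (a - z)) \<in> borel_measurable \<mu>" by measurable
  show "integrable \<mu> (\<lambda>z. C * sing (a - z))"
    by (intro integrable_mult_right sing_mu(1)[where c=1] sing_measurable) (auto simp: sing_nn)
  show "AE z in \<mu>. (\<lambda>n. reg (1 / real (Suc n)) (a - z)) \<longlonglongrightarrow> g (a - z)"
    by (rule eventually_mono[OF AE_mu_ne[of a]]) (rule reg_tendsto, simp)
  show "AE z in \<mu>. norm (reg (1 / real (Suc n)) (a - z)) \<le> C * sing (a - z)" for n
    by (rule eventually_mono[OF AE_mu_ne[of a]]) (use reg_le_sing(1)[of "a - _" "1 / real (Suc n)"] in simp)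
qed

lemma reg_mu2_tendsto: "(\<lambda>n. LINT p|(\<mu> \<Otimes>\<^sub>M \<mu>). reg (1 / real (Suc n)) (fst p - snd p)) \<longlonglongrightarrow> (LINT p|(\<mu> \<Otimes>\<^sub>M \<mu>). g (fst p - snd p))"
proof (rule integral_dominated_convergence[where w="\<lambda>p. C * sing (fst p - snd p)"])
  show "(\<lambda>p. reg (1 / real (Suc n)) (fst p - snd p)) \<in> borel_measurable (\<mu> \<Otimes>\<^sub>M \<mu>)" for n
    using reg_measurable[of "1 / real (Suc n)"] by measurable
  show "(\<lambda>p. g (fst p - snd p)) \<in> borel_measurable (\<mu> \<Otimes>\<^sub>M \<mu>)" by measurable
  show "integrable (\<mu> \<Otimes>\<^sub>M \<mu>) (\<lambda>p. C * sing (fst p - snd p))"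
    by (intro integrable_mult_right sing_mu2)
  show "AE p in \<mu> \<Otimes>\<^sub>M \<mu>. (\<lambda>n. reg (1 / real (Suc n)) (fst p - snd p)) \<longlonglongrightarrow> g (fst p - snd p)"
    by (rule eventually_mono[OF AE_mu2_ne]) (rule reg_tendsto, simp)
  show "AE p in \<mu> \<Otimes>\<^sub>M \<mu>. norm (reg (1 / real (Suc n)) (fst p - snd p)) \<le> C * sing (fst p - snd p)" for n
    by (rule eventually_mono[OF AE_mu2_ne]) (use reg_le_sing(1)[of "fst _ - snd _" "1 / real (Suc n)"] in simp)
qed

end

locale particle_energy = singular_kernel g G G' C + transport T R U K J M \<rho> \<rho>' u
  for g :: "real ^ 'n \<Rightarrow> real" and G G' C T R U K J M and \<rho> \<rho>' :: "real \<Rightarrow> real ^ 'n \<Rightarrow> real"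
    and u :: "real \<Rightarrow> real ^ 'n \<Rightarrow> real ^ 'n" +
  fixes P :: real and N :: nat and x :: "real \<Rightarrow> nat \<Rightarrow> real ^ 'n"
  assumes \<rho>_bd: "\<And>t z. t \<in> {0..T} \<Longrightarrow> \<rho> t z \<le> P"
    and u_eq: "\<And>t z. t \<in> {0..T} \<Longrightarrow> u t z = - (LINT y|lborel. \<rho> t y *\<^sub>R grad g (z - y))"
    and N: "0 < N"
    and noncoll: "\<And>t i j. t \<in> {0..T} \<Longrightarrow> i < N \<Longrightarrow> j < N \<Longrightarrow> i \<noteq> j \<Longrightarrow> x t i \<noteq> x t j"
    and x_der: "\<And>t i. t \<in> {0..T} \<Longrightarrow> i < N \<Longrightarrow> ((\<lambda>s. x s i) has_vector_derivative
       - (1 / real N) *\<^sub>R (\<Sum>j\<in>{..<N} - {i}. grad g (x t i - x t j))) (at t within {0..T})"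
begin

definition v :: "real \<Rightarrow> nat \<Rightarrow> real ^ 'n" where
  "v t i = - (1 / real N) *\<^sub>R (\<Sum>j\<in>{..<N} - {i}. grad g (x t i - x t j))"

text \<open>Only the terms containing an integral can be singular along a collision-free trajectory, so only there is
  the kernel a parameter \<open>k\<close>, to be replaced by its regularisations.\<close>

definition energy :: "(real ^ 'n \<Rightarrow> real) \<Rightarrow> real \<Rightarrow> real" where
  "energy k t = (1 / real N)\<^sup>2 * (\<Sum>i<N. \<Sum>j\<in>{..<N} - {i}. g (x t i - x t j))
     - 2 / real N * (\<Sum>i<N. LINT z|law_at t. k (x t i - z))
     + (LINT p|(law_at t \<Otimes>\<^sub>M law_at t). k (fst p - snd p))"

text \<open>The formal time derivative of \<open>energy\<close>, with \<open>k\<close> in place of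
  the gradient of the kernel in the terms that involve the density.\<close>

definition energy_rate :: "(real ^ 'n \<Rightarrow> real ^ 'n) \<Rightarrow> real \<Rightarrow> real" where
  "energy_rate k t = (1 / real N)\<^sup>2 * (\<Sum>i<N. \<Sum>j\<in>{..<N} - {i}. grad g (x t i - x t j) \<bullet> (v t i - v t j))
     - 2 / real N * (\<Sum>i<N. LINT z|law_at t. k (x t i - z) \<bullet> (v t i - u t z))
     + (LINT p|(law_at t \<Otimes>\<^sub>M law_at t). k (fst p - snd p) \<bullet> (u t (fst p) - u t (snd p)))"

definition dissip :: "real \<Rightarrow> real" where
  "dissip t = 1 / real N * (\<Sum>i<N. (norm (v t i - u t (x t i)))\<^sup>2)"

definition commut :: "real \<Rightarrow> real" where
  "commut t = (1 / real N)\<^sup>2 * (\<Sum>i<N. \<Sum>j\<in>{..<N} - {i}. grad g (x t i - x t j) \<bullet> (u t (x t i) - u t (x t j)))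
     - 2 / real N * (\<Sum>i<N. LINT z|law_at t. grad g (x t i - z) \<bullet> (u t (x t i) - u t z))
     + (LINT p|(law_at t \<Otimes>\<^sub>M law_at t). grad g (fst p - snd p) \<bullet> (u t (fst p) - u t (snd p)))"

lemma zero_in: "0 \<in> {0..T}" using T by simp

lemma kernel_density: "t \<in> {0..T} \<Longrightarrow> kernel_density g G G' C (\<rho> t) P R"
  using \<rho>_meas \<rho>_nn \<rho>_bd \<rho>_supp prob_space_law_at
  by (intro kernel_density.intro kernel_density_axioms.intro singular_kernel_axioms) (auto simp: law_at_def)

lemma law_eq: "kernel_density.\<mu> (\<rho> t) = law_at t" if "t \<in> {0..T}"
  using kernel_density.\<mu>_def[OF kernel_density[OF that]] by (simp add: law_at_def)

lemma x_der': "t \<in> {0..T} \<Longrightarrow> i < N \<Longrightarrow> ((\<lambda>s. x s i) has_vector_derivative v t i) (at t within {0..T})"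
  using x_der by (simp add: v_def)

lemma x_cont: "i < N \<Longrightarrow> continuous_on {0..T} (\<lambda>t. x t i)"
  using x_der' by (meson continuous_on_eq_continuous_within has_vector_derivative_continuous)

lemma grad_cont: "i < N \<Longrightarrow> j < N \<Longrightarrow> i \<noteq> j \<Longrightarrow> continuous_on {0..T} (\<lambda>t. grad g (x t i - x t j))"
  by (rule continuous_on_compose2[OF grad_continuous_on]) (use noncoll in \<open>auto intro!: continuous_intros x_cont\<close>)

lemma v_cont: "i < N \<Longrightarrow> continuous_on {0..T} (\<lambda>t. v t i)"
  unfolding v_def by (intro continuous_intros grad_cont) auto

lemma bounded_family:
  fixes f :: "real \<Rightarrow> nat \<Rightarrow> real ^ 'n"
  assumes "\<And>i. i < N \<Longrightarrow> continuous_on {0..T} (\<lambda>t. f t i)"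
  obtains B where "0 \<le> B" "\<And>t i. t \<in> {0..T} \<Longrightarrow> i < N \<Longrightarrow> norm (f t i) \<le> B"
proof -
  have "\<exists>B. \<forall>t\<in>{0..T}. norm (f t i) \<le> B" if "i < N" for i
  proof -
    have "bounded ((\<lambda>t. f t i) ` {0..T})"
      by (intro compact_imp_bounded compact_continuous_image assms that) auto
    then show ?thesis by (auto simp: bounded_iff)
  qed
  then obtain B where B: "\<And>i t. i < N \<Longrightarrow> t \<in> {0..T} \<Longrightarrow> norm (f t i) \<le> B i" by metis
  show thesis
  proof
    show "0 \<le> (\<Sum>i<N. \<bar>B i\<bar>)" by (intro sum_nonneg) auto
    fix t i assume t: "t \<in> {0..T}" and i: "i < N"
    have "norm (f t i) \<le> \<bar>B i\<bar>" using B[OF i t] by linarith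
    also have "\<dots> \<le> (\<Sum>i<N. \<bar>B i\<bar>)" by (rule member_le_sum) (use i in auto)
    finally show "norm (f t i) \<le> (\<Sum>i<N. \<bar>B i\<bar>)" .
  qed
qed

lemma u_meas: "t \<in> {0..T} \<Longrightarrow> u t \<in> borel_measurable borel"
  by (intro borel_measurable_continuous_onI lipschitz_on_continuous_on[OF u_lip])

text \<open>In Lagrangian coordinates the measure is fixed and the time dependence sits in
  \<open>Y t\<close>, so integrals against the moving density can be differentiated through the
  positions alone.\<close>

lemma law_integral:
  fixes f :: "real ^ 'n \<Rightarrow> real"
  assumes t: "t \<in> {0..T}" and f: "f \<in> borel_measurable borel"
  shows "(LINT z|law_at t. f z) = (LINT y|law_at 0. f (Y t y))"
proof -
  have Ym: "Y t \<in> measurable (law_at 0) borel"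
    using Y_measurable[of t] t by (simp add: law_at_def)
  show ?thesis unfolding distr_Y[OF t, symmetric] by (rule integral_distr[OF Ym f])
qed

lemma law_pair:
  assumes t: "t \<in> {0..T}"
  shows "law_at t \<Otimes>\<^sub>M law_at t = distr (law_at 0 \<Otimes>\<^sub>M law_at 0) (borel \<Otimes>\<^sub>M borel) (\<lambda>(y, y'). (Y t y, Y t y'))"
proof -
  have Ym: "Y t \<in> measurable (law_at 0) borel"
    using Y_measurable[of t] t by (simp add: law_at_def)
  have "sigma_finite_measure (distr (law_at 0) borel (Y t))"
    unfolding distr_Y[OF t] using prob_space_law_at[OF t] by (simp add: prob_space_imp_sigma_finite)
  from pair_measure_distr[OF Ym Ym this] show ?thesis unfolding distr_Y[OF t] .
qed

lemma law_integral_pair: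
  fixes f :: "(real ^ 'n) \<times> (real ^ 'n) \<Rightarrow> real"
  assumes t: "t \<in> {0..T}" and f: "f \<in> borel_measurable (borel \<Otimes>\<^sub>M borel)"
  shows "(LINT p|(law_at t \<Otimes>\<^sub>M law_at t). f p) = (LINT q|(law_at 0 \<Otimes>\<^sub>M law_at 0). f (Y t (fst q), Y t (snd q)))"
proof -
  have [measurable]: "Y t \<in> borel_measurable borel" using Y_measurable[of t] t by simp
  have "(\<lambda>(y, y'). (Y t y, Y t y')) \<in> measurable (law_at 0 \<Otimes>\<^sub>M law_at 0) (borel \<Otimes>\<^sub>M borel)" by measurable
  from integral_distr[OF this f] show ?thesis unfolding law_pair[OF t, symmetric] by (simp add: split_beta)
qed

lemma reg_field_derivative:
  assumes \<delta>: "0 < \<delta>" and t: "t \<in> {0..T}" and i: "i < N"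
  shows "((\<lambda>t. LINT z|law_at t. reg \<delta> (x t i - z)) has_vector_derivative
    (LINT z|law_at t. reg' \<delta> (x t i - z) \<bullet> (v t i - u t z))) (at t within {0..T})"
proof -
  obtain Bv where Bv: "0 \<le> Bv" "\<And>t i. t \<in> {0..T} \<Longrightarrow> i < N \<Longrightarrow> norm (v t i) \<le> Bv"
    using bounded_family[of v] v_cont by metis
  note [measurable] = reg_measurable[OF \<delta>] reg'_measurable[OF \<delta>]
  have "((\<lambda>t. LINT y|law_at 0. reg \<delta> (x t i - Y t y)) has_vector_derivative
    (LINT y|law_at 0. reg' \<delta> (x t i - Y t y) \<bullet> (v t i - u t (Y t y)))) (at t within {0..T})"
  proof (rule reg_integral_derivative[OF \<delta> prob_space_law_at[OF zero_in] t])
    show "((\<lambda>t. x t i - Y t y) has_vector_derivative v t i - u t (Y t y)) (at t within {0..T})" if "t \<in> {0..T}" for t y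
      by (intro has_vector_derivative_diff x_der' Y_der that i)
    show "norm (v t i - u t (Y t y)) \<le> Bv + U" if "t \<in> {0..T}" for t y
      using norm_triangle_ineq4[of "v t i" "u t (Y t y)"] Bv(2)[OF that i] u_bd[OF that, of "Y t y"] by linarith
    show "(\<lambda>y. x t i - Y t y) \<in> borel_measurable (law_at 0)" "(\<lambda>y. v t i - u t (Y t y)) \<in> borel_measurable (law_at 0)"
      if "t \<in> {0..T}" for t
    proof -
      have [measurable]: "Y t \<in> borel_measurable borel" "u t \<in> borel_measurable borel"
        using Y_measurable[of t] u_meas that by auto
      show "(\<lambda>y. x t i - Y t y) \<in> borel_measurable (law_at 0)" "(\<lambda>y. v t i - u t (Y t y)) \<in> borel_measurable (law_at 0)"
        by measurable
    qed
  qed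
  moreover have "(LINT z|law_at t. reg' \<delta> (x t i - z) \<bullet> (v t i - u t z)) = (LINT y|law_at 0. reg' \<delta> (x t i - Y t y) \<bullet> (v t i - u t (Y t y)))"
  proof (rule law_integral[OF t])
    have [measurable]: "u t \<in> borel_measurable borel" using u_meas t by auto
    show "(\<lambda>z. reg' \<delta> (x t i - z) \<bullet> (v t i - u t z)) \<in> borel_measurable borel" by measurable
  qed
  ultimately show ?thesis
    by (intro has_vector_derivative_transform[OF t, of "\<lambda>t. LINT z|law_at t. reg \<delta> (x t i - z)"])
      (auto intro!: law_integral)
qed

lemma reg_self_derivative:
  assumes \<delta>: "0 < \<delta>" and t: "t \<in> {0..T}"
  shows "((\<lambda>t. LINT p|(law_at t \<Otimes>\<^sub>M law_at t). reg \<delta> (fst p - snd p)) has_vector_derivative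
    (LINT p|(law_at t \<Otimes>\<^sub>M law_at t). reg' \<delta> (fst p - snd p) \<bullet> (u t (fst p) - u t (snd p)))) (at t within {0..T})"
proof -
  note [measurable] = reg_measurable[OF \<delta>] reg'_measurable[OF \<delta>]
  interpret P0: prob_space "law_at 0" by (rule prob_space_law_at[OF zero_in])
  interpret P00: pair_prob_space "law_at 0" "law_at 0" ..
  have "((\<lambda>t. LINT q|(law_at 0 \<Otimes>\<^sub>M law_at 0). reg \<delta> (Y t (fst q) - Y t (snd q))) has_vector_derivative
    (LINT q|(law_at 0 \<Otimes>\<^sub>M law_at 0). reg' \<delta> (Y t (fst q) - Y t (snd q)) \<bullet> (u t (Y t (fst q)) - u t (Y t (snd q))))) (at t within {0..T})"
  proof (rule reg_integral_derivative[OF \<delta> _ t])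
    show "prob_space (law_at 0 \<Otimes>\<^sub>M law_at 0)" by unfold_locales
    show "((\<lambda>t. Y t (fst q) - Y t (snd q)) has_vector_derivative u t (Y t (fst q)) - u t (Y t (snd q))) (at t within {0..T})"
      if "t \<in> {0..T}" for t q
      by (intro has_vector_derivative_diff Y_der that)
    show "norm (u t (Y t (fst q)) - u t (Y t (snd q))) \<le> U + U" if "t \<in> {0..T}" for t q
      using norm_triangle_ineq4[of "u t (Y t (fst q))" "u t (Y t (snd q))"] u_bd[OF that, of "Y t (fst q)"] u_bd[OF that, of "Y t (snd q)"] by linarith
    show "(\<lambda>q. Y t (fst q) - Y t (snd q)) \<in> borel_measurable (law_at 0 \<Otimes>\<^sub>M law_at 0)"
      "(\<lambda>q. u t (Y t (fst q)) - u t (Y t (snd q))) \<in> borel_measurable (law_at 0 \<Otimes>\<^sub>M law_at 0)"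
      if "t \<in> {0..T}" for t
    proof -
      have [measurable]: "Y t \<in> borel_measurable borel" "u t \<in> borel_measurable borel"
        using Y_measurable[of t] u_meas that by auto
      show "(\<lambda>q. Y t (fst q) - Y t (snd q)) \<in> borel_measurable (law_at 0 \<Otimes>\<^sub>M law_at 0)"
        "(\<lambda>q. u t (Y t (fst q)) - u t (Y t (snd q))) \<in> borel_measurable (law_at 0 \<Otimes>\<^sub>M law_at 0)"
        by measurable
    qed
  qed
  moreover have "(LINT p|(law_at t \<Otimes>\<^sub>M law_at t). reg' \<delta> (fst p - snd p) \<bullet> (u t (fst p) - u t (snd p)))
    = (LINT q|(law_at 0 \<Otimes>\<^sub>M law_at 0). reg' \<delta> (Y t (fst q) - Y t (snd q)) \<bullet> (u t (Y t (fst q)) - u t (Y t (snd q))))"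
  proof -
    have [measurable]: "u t \<in> borel_measurable borel" using u_meas t by auto
    have "(\<lambda>p. reg' \<delta> (fst p - snd p) \<bullet> (u t (fst p) - u t (snd p))) \<in> borel_measurable (borel \<Otimes>\<^sub>M borel)" by measurable
    from law_integral_pair[OF t this] show ?thesis by simp
  qed
  moreover have "(LINT p|(law_at t \<Otimes>\<^sub>M law_at t). reg \<delta> (fst p - snd p))
      = (LINT q|(law_at 0 \<Otimes>\<^sub>M law_at 0). reg \<delta> (Y t (fst q) - Y t (snd q)))" if "t \<in> {0..T}" for t
  proof -
    have "(\<lambda>p::(real^'n)\<times>(real^'n). reg \<delta> (fst p - snd p)) \<in> borel_measurable (borel \<Otimes>\<^sub>M borel)" by measurable
    from law_integral_pair[OF that this] show ?thesis by simp
  qed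
  ultimately show ?thesis
    by (intro has_vector_derivative_transform[OF t, of "\<lambda>t. LINT p|(law_at t \<Otimes>\<^sub>M law_at t). reg \<delta> (fst p - snd p)"]) auto
qed

lemma interaction_derivative:
  assumes t: "t \<in> {0..T}" and i: "i < N" "j < N" "i \<noteq> j"
  shows "((\<lambda>t. g (x t i - x t j)) has_vector_derivative grad g (x t i - x t j) \<bullet> (v t i - v t j)) (at t within {0..T})"
proof -
  have "((\<lambda>t. g (x t i - x t j)) has_derivative (\<lambda>h. grad g (x t i - x t j) \<bullet> (h *\<^sub>R (v t i - v t j)))) (at t within {0..T})"
  proof (rule has_derivative_compose[OF _ g_has_derivative])
    show "((\<lambda>t. x t i - x t j) has_derivative (\<lambda>h. h *\<^sub>R (v t i - v t j))) (at t within {0..T})"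
      using has_vector_derivative_diff[OF x_der'[OF t i(1)] x_der'[OF t i(2)]] by (simp add: has_vector_derivative_def)
    show "x t i - x t j \<noteq> 0" using noncoll[OF t i] by simp
  qed
  then show ?thesis by (simp add: has_vector_derivative_def)
qed

lemma energy_reg_derivative:
  assumes \<delta>: "0 < \<delta>" and t: "t \<in> {0..T}"
  shows "(energy (reg \<delta>) has_vector_derivative energy_rate (reg' \<delta>) t) (at t within {0..T})"
  unfolding energy_def energy_rate_def
  by (intro has_vector_derivative_add has_vector_derivative_diff has_vector_derivative_mult_right has_vector_derivative_sum
      reg_self_derivative[OF \<delta> t] reg_field_derivative[OF \<delta> t] interaction_derivative[OF t]) auto

text \<open>The interaction sums contain the true gradient in both rates and cancel. The other terms
  are bounded by local mean errors on balls whose radii, like the relative speeds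
  \<open>Bv + U\<close> and \<open>2 * U\<close>, are bounded over the compact time
  interval.\<close>

lemma energy_rate_uniform:
  assumes e: "0 < e"
  shows "\<forall>\<^sub>F n in sequentially. \<forall>t\<in>{0..T}. \<bar>energy_rate (reg' (1 / real (Suc n))) t - energy_rate (grad g) t\<bar> \<le> e"
proof -
  obtain Bv where Bv: "0 \<le> Bv" "\<And>t i. t \<in> {0..T} \<Longrightarrow> i < N \<Longrightarrow> norm (v t i) \<le> Bv"
    using bounded_family[of v] v_cont by metis
  obtain Bx where Bx: "0 \<le> Bx" "\<And>t i. t \<in> {0..T} \<Longrightarrow> i < N \<Longrightarrow> norm (x t i) \<le> Bx"
    using bounded_family[of x] x_cont by metis
  define I where "I r n = (LINT x|lborel. indicator (cball (0::real^'n) r) x * norm (reg' (1 / real (Suc n)) x - grad g x))" for r n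
  define b where "b n = 2 * (P * (Bv + U) * I (Bx + R) n) + P * (2 * U) * I (R + R) n" for n
  have "b \<longlonglongrightarrow> 2 * (P * (Bv + U) * 0) + P * (2 * U) * 0"
    unfolding b_def I_def by (intro tendsto_intros reg'_L1_tendsto)
  then have ev: "\<forall>\<^sub>F n in sequentially. b n < e"
    using e by (intro order_tendstoD) auto
  have "\<bar>energy_rate (reg' (1 / real (Suc n))) t - energy_rate (grad g) t\<bar> \<le> b n" if t: "t \<in> {0..T}" for n t
  proof -
    interpret kd: kernel_density g G G' C "\<rho> t" P R by (rule kernel_density[OF t])
    note law = law_eq[OF t]
    have I_eq: "kd.L1diff n r = I r n" for r by (simp add: kd.L1diff_def I_def)
    have [measurable]: "u t \<in> borel_measurable borel" using u_meas[OF t] .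
    define A where "A k i = (LINT z|law_at t. k (x t i - z) \<bullet> (v t i - u t z))" for k :: "real^'n \<Rightarrow> real^'n" and i
    define S where "S k = (LINT p|(law_at t \<Otimes>\<^sub>M law_at t). k (fst p - snd p) \<bullet> (u t (fst p) - u t (snd p)))" for k :: "real^'n \<Rightarrow> real^'n"
    let ?r = "reg' (1 / real (Suc n))"
    have A: "\<bar>A ?r i - A (grad g) i\<bar> \<le> P * (Bv + U) * I (Bx + R) n" if i: "i < N" for i
    proof -
      have "\<bar>(LINT z|kd.\<mu>. ?r (x t i - z) \<bullet> (v t i - u t z)) - (LINT z|kd.\<mu>. grad g (x t i - z) \<bullet> (v t i - u t z))\<bar>
        \<le> P * (Bv + U) * kd.L1diff n (Bx + R)"
      proof (rule kd.L1diff_bound)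
        show "(\<lambda>z. v t i - u t z) \<in> borel_measurable borel" by measurable
        show "norm (v t i - u t z) \<le> Bv + U" for z
          using norm_triangle_ineq4[of "v t i" "u t z"] Bv(2)[OF t i] u_bd[OF t, of z] by linarith
        show "norm (x t i) \<le> Bx" by (rule Bx(2)[OF t i])
      qed
      then show ?thesis by (simp only: law I_eq A_def)
    qed
    have S: "\<bar>S ?r - S (grad g)\<bar> \<le> P * (2 * U) * I (R + R) n"
      using kd.L1diff_bound2[of "u t" U n] u_bd[OF t] by (simp add: law I_eq S_def)
    have "\<bar>(\<Sum>i<N. A ?r i) - (\<Sum>i<N. A (grad g) i)\<bar> \<le> (\<Sum>i<N. \<bar>A ?r i - A (grad g) i\<bar>)"
      unfolding sum_subtractf[symmetric] by (rule sum_abs)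
    also have "\<dots> \<le> (\<Sum>i<N. P * (Bv + U) * I (Bx + R) n)" by (intro sum_mono A) auto
    also have "\<dots> = real N * (P * (Bv + U) * I (Bx + R) n)" by simp
    finally have "2 / real N * \<bar>(\<Sum>i<N. A ?r i) - (\<Sum>i<N. A (grad g) i)\<bar> \<le> 2 / real N * (real N * (P * (Bv + U) * I (Bx + R) n))"
      by (rule mult_left_mono) simp
    also have "\<dots> = 2 * (P * (Bv + U) * I (Bx + R) n)" using N by simp
    finally have "\<bar>2 / real N * (\<Sum>i<N. A ?r i) - 2 / real N * (\<Sum>i<N. A (grad g) i)\<bar> \<le> 2 * (P * (Bv + U) * I (Bx + R) n)"
      unfolding right_diff_distrib[symmetric] abs_mult by (simp only: abs_of_nonneg zero_le_divide_iff zero_le_numeral of_nat_0_le_iff simp_thms)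
    moreover have er: "energy_rate k t = (1 / real N)\<^sup>2 * (\<Sum>i<N. \<Sum>j\<in>{..<N} - {i}. grad g (x t i - x t j) \<bullet> (v t i - v t j))
       - 2 / real N * (\<Sum>i<N. A k i) + S k" for k
      by (simp add: energy_rate_def A_def S_def)
    ultimately show ?thesis using S unfolding b_def er by linarith
  qed
  note le = this
  show ?thesis using ev
  proof eventually_elim
    fix n assume "b n < e"
    then show "\<forall>t\<in>{0..T}. \<bar>energy_rate (reg' (1 / real (Suc n))) t - energy_rate (grad g) t\<bar> \<le> e"
      using le by (intro ballI) (meson less_imp_le order_trans)
  qed
qed

end

context particle_energy begin

lemma energy_reg_tendsto:
  assumes t: "t \<in> {0..T}"
  shows "(\<lambda>n. energy (reg (1 / real (Suc n))) t) \<longlonglongrightarrow> energy g t"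
proof -
  interpret kd: kernel_density g G G' C "\<rho> t" P R by (rule kernel_density[OF t])
  show ?thesis unfolding energy_def
    by (intro tendsto_intros kd.reg_mu_tendsto[unfolded law_eq[OF t]] kd.reg_mu2_tendsto[unfolded law_eq[OF t]])
qed

text \<open>Differentiation under the integral was justified for the regularised kernels. Their
  energies converge pointwise and the derivatives converge uniformly in time, so the limit is
  differentiable with the limiting derivative.\<close>

lemma energy_derivative:
  assumes t: "t \<in> {0..T}"
  shows "(energy g has_vector_derivative energy_rate (grad g) t) (at t within {0..T})"
proof -
  have "\<exists>F. \<forall>t\<in>{0..T}. (\<lambda>n. energy (reg (1 / real (Suc n))) t) \<longlonglongrightarrow> F t \<and>
      (F has_derivative (\<lambda>h. h *\<^sub>R energy_rate (grad g) t)) (at t within {0..T})"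
  proof (rule has_derivative_sequence[where f'="\<lambda>n t h. h *\<^sub>R energy_rate (reg' (1 / real (Suc n))) t"])
    show "convex {0..T}" by simp
    show "(energy (reg (1 / real (Suc n))) has_derivative (\<lambda>h. h *\<^sub>R energy_rate (reg' (1 / real (Suc n))) t)) (at t within {0..T})"
      if "t \<in> {0..T}" for n t
      using energy_reg_derivative[OF _ that, of "1 / real (Suc n)"] by (simp add: has_vector_derivative_def)
    show "\<forall>\<^sub>F n in sequentially. \<forall>t\<in>{0..T}. \<forall>h. norm (h *\<^sub>R energy_rate (reg' (1 / real (Suc n))) t - h *\<^sub>R energy_rate (grad g) t) \<le> e * norm h"
      if "0 < e" for e
      using energy_rate_uniform[OF that]
    proof eventually_elim
      fix n assume *: "\<forall>t\<in>{0..T}. \<bar>energy_rate (reg' (1 / real (Suc n))) t - energy_rate (grad g) t\<bar> \<le> e"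
      show "\<forall>t\<in>{0..T}. \<forall>h. norm (h *\<^sub>R energy_rate (reg' (1 / real (Suc n))) t - h *\<^sub>R energy_rate (grad g) t) \<le> e * norm h"
      proof (intro ballI allI)
        fix t and h :: real assume "t \<in> {0..T}"
        then have "\<bar>h\<bar> * \<bar>energy_rate (reg' (1 / real (Suc n))) t - energy_rate (grad g) t\<bar> \<le> \<bar>h\<bar> * e"
          using * by (intro mult_left_mono) auto
        then show "norm (h *\<^sub>R energy_rate (reg' (1 / real (Suc n))) t - h *\<^sub>R energy_rate (grad g) t) \<le> e * norm h"
          by (simp add: scaleR_diff_right[symmetric] right_diff_distrib[symmetric] abs_mult mult.commute)
      qed
    qed
    show "0 \<in> {0..T}" by (rule zero_in)
    show "(\<lambda>n. energy (reg (1 / real (Suc n))) 0) \<longlonglongrightarrow> energy g 0" by (rule energy_reg_tendsto[OF zero_in])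
  qed
  then obtain F where F0: "\<forall>t\<in>{0..T}. (\<lambda>n. energy (reg (1 / real (Suc n))) t) \<longlonglongrightarrow> F t \<and>
      (F has_derivative (\<lambda>h. h *\<^sub>R energy_rate (grad g) t)) (at t within {0..T})" ..
  have F: "(\<lambda>n. energy (reg (1 / real (Suc n))) t) \<longlonglongrightarrow> F t"
      "(F has_vector_derivative energy_rate (grad g) t) (at t within {0..T})" if "t \<in> {0..T}" for t
    unfolding has_vector_derivative_def using F0 that by blast+
  have "F t = energy g t" if "t \<in> {0..T}" for t
    using LIMSEQ_unique[OF F(1)[OF that] energy_reg_tendsto[OF that]] .
  then show ?thesis by (intro has_vector_derivative_transform[OF t _ F(2)[OF t]]) auto
qed

lemma grad_conv_eq:
  assumes t: "t \<in> {0..T}"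
  shows "(LINT z|law_at t. grad g (a - z)) = - u t a" "integrable (law_at t) (\<lambda>z. grad g (a - z))"
proof -
  interpret kd: kernel_density g G G' C "\<rho> t" P R by (rule kernel_density[OF t])
  have m: "(\<lambda>z. grad g (a - z)) \<in> borel_measurable borel" by measurable
  show "(LINT z|law_at t. grad g (a - z)) = - u t a"
    using kd.integral_mu(2)[OF m] by (simp add: law_eq[OF t] u_eq[OF t])
  show "integrable (law_at t) (\<lambda>z. grad g (a - z))"
    using kd.sing_mu(1)[OF grad_measurable grad_le_sing, of a] C by (simp add: law_eq[OF t])
qed

text \<open>Let \<open>w i\<close> be the particle velocity minus the mean-field velocity at
  \<open>x t i\<close>. Replacing particle by mean-field velocities in the rate changes it by terms
  linear in \<open>w\<close>. The forces on particle \<open>i\<close> sum to \<open>- N\<close>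
  times \<open>v t i\<close>, and their mean-field counterpart integrates to \<open>- u t\<close>,
  so these terms combine to \<open>- 2 / N\<close> times the sum of the squares of
  \<open>norm (w i)\<close>.\<close>

lemma energy_rate_eq:
  assumes t: "t \<in> {0..T}"
  shows "energy_rate (grad g) t = commut t - 2 * dissip t"
proof -
  interpret kd: kernel_density g G G' C "\<rho> t" P R by (rule kernel_density[OF t])
  define w where "w i = v t i - u t (x t i)" for i
  define \<gamma> where "\<gamma> i j = grad g (x t i - x t j)" for i j
  have [measurable]: "u t \<in> borel_measurable borel" using u_meas[OF t] .
  have anti: "\<gamma> j i = - \<gamma> i j" if "i < N" "j < N" "i \<noteq> j" for i j
    using grad_minus[of "x t i - x t j"] noncoll[OF t that] by (simp add: \<gamma>_def)
  have vi: "v t i = - (1 / real N) *\<^sub>R (\<Sum>j\<in>{..<N} - {i}. \<gamma> i j)" for i by (simp add: v_def \<gamma>_def)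
  \<comment> \<open>The force \<open>\<gamma>\<close> is odd under exchange of the two particles. So
    in the double sum the difference \<open>w i - w j\<close> counts as twice the term with
    \<open>w i\<close>.\<close>
  have swap: "(\<Sum>i<N. \<Sum>j\<in>{..<N} - {i}. \<gamma> i j \<bullet> w j) = - (\<Sum>i<N. \<Sum>j\<in>{..<N} - {i}. \<gamma> i j \<bullet> w i)"
  proof -
    have "(\<Sum>i<N. \<Sum>j\<in>{..<N} - {i}. \<gamma> i j \<bullet> w j) = (\<Sum>j<N. \<Sum>i\<in>{..<N} - {j}. \<gamma> i j \<bullet> w j)"
    proof -
      have off: "(\<Sum>j\<in>{..<N} - {i}. f j) = (\<Sum>j<N. if j = i then 0 else f j)" for f :: "nat \<Rightarrow> real" and i
        by (rule sum.mono_neutral_cong_left) auto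
      have off': "(\<Sum>j\<in>{..<N} - {i}. f j) = (\<Sum>j<N. if i = j then 0 else f j)" for f :: "nat \<Rightarrow> real" and i
        by (rule sum.mono_neutral_cong_left) auto
      have "(\<Sum>i<N. \<Sum>j\<in>{..<N} - {i}. \<gamma> i j \<bullet> w j) = (\<Sum>i<N. \<Sum>j<N. if j = i then 0 else \<gamma> i j \<bullet> w j)"
        by (simp only: off)
      also have "\<dots> = (\<Sum>j<N. \<Sum>i<N. if j = i then 0 else \<gamma> i j \<bullet> w j)" by (rule sum.swap)
      also have "\<dots> = (\<Sum>j<N. \<Sum>i\<in>{..<N} - {j}. \<gamma> i j \<bullet> w j)" by (simp only: off')
      finally show ?thesis .
    qed
    also have "\<dots> = (\<Sum>j<N. \<Sum>i\<in>{..<N} - {j}. - (\<gamma> j i \<bullet> w j))"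
    proof (intro sum.cong refl)
      fix j i assume "j \<in> {..<N}" "i \<in> {..<N} - {j}"
      then have "\<gamma> i j = - \<gamma> j i" by (intro anti) auto
      then show "\<gamma> i j \<bullet> w j = - (\<gamma> j i \<bullet> w j)" by (simp only: inner_minus_left)
    qed
    finally show ?thesis by (simp add: sum_negf)
  qed
  have inner1: "(\<Sum>i<N. \<Sum>j\<in>{..<N} - {i}. \<gamma> i j \<bullet> w i) = - real N * (\<Sum>i<N. v t i \<bullet> w i)"
    unfolding sum_distrib_left
  proof (rule sum.cong[OF refl])
    fix i
    have "- real N * (v t i \<bullet> w i) = (\<Sum>j\<in>{..<N} - {i}. \<gamma> i j) \<bullet> w i" using N by (simp add: vi)
    then show "(\<Sum>j\<in>{..<N} - {i}. \<gamma> i j \<bullet> w i) = - real N * (v t i \<bullet> w i)" by (simp add: inner_sum_left)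
  qed
  have part1: "(\<Sum>i<N. \<Sum>j\<in>{..<N} - {i}. \<gamma> i j \<bullet> (v t i - v t j)) - (\<Sum>i<N. \<Sum>j\<in>{..<N} - {i}. \<gamma> i j \<bullet> (u t (x t i) - u t (x t j)))
      = - 2 * real N * (\<Sum>i<N. v t i \<bullet> w i)"
  proof -
    have "(\<Sum>i<N. \<Sum>j\<in>{..<N} - {i}. \<gamma> i j \<bullet> (v t i - v t j)) - (\<Sum>i<N. \<Sum>j\<in>{..<N} - {i}. \<gamma> i j \<bullet> (u t (x t i) - u t (x t j)))
      = (\<Sum>i<N. \<Sum>j\<in>{..<N} - {i}. \<gamma> i j \<bullet> w i) - (\<Sum>i<N. \<Sum>j\<in>{..<N} - {i}. \<gamma> i j \<bullet> w j)"
      by (simp add: sum_subtractf[symmetric] w_def inner_diff_right algebra_simps)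
    then show ?thesis using swap inner1 by simp
  qed
  have part2: "(LINT z|law_at t. grad g (x t i - z) \<bullet> (v t i - u t z)) - (LINT z|law_at t. grad g (x t i - z) \<bullet> (u t (x t i) - u t z))
      = - (u t (x t i) \<bullet> w i)" if i: "i < N" for i
  proof -
    have ig: "integrable (law_at t) (\<lambda>z. grad g (x t i - z) \<bullet> (c - u t z))" for c
    proof -
      have "integrable kd.\<mu> (\<lambda>z. grad g (x t i - z) \<bullet> (c - u t z))"
      proof (rule kd.integrable_kernel_dot)
        show "grad g \<in> borel_measurable borel" by (rule grad_measurable)
        show "norm (grad g x) \<le> 2 * C * sing x" if "x \<noteq> 0" for x using that by (rule grad_le_sing)
        show "(\<lambda>z. c - u t z) \<in> borel_measurable borel" using u_meas[OF t] by (intro borel_measurable_diff borel_measurable_const)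
        show "norm (c - u t z) \<le> norm c + U" for z
          using norm_triangle_ineq4[of c "u t z"] u_bd[OF t, of z] by linarith
      qed
      then show ?thesis by (simp add: law_eq[OF t])
    qed
    have "(LINT z|law_at t. grad g (x t i - z) \<bullet> (v t i - u t z)) - (LINT z|law_at t. grad g (x t i - z) \<bullet> (u t (x t i) - u t z))
      = (LINT z|law_at t. grad g (x t i - z) \<bullet> (v t i - u t z) - grad g (x t i - z) \<bullet> (u t (x t i) - u t z))"
      by (rule Bochner_Integration.integral_diff[symmetric]) (rule ig)+
    also have "\<dots> = (LINT z|law_at t. grad g (x t i - z) \<bullet> w i)"
      by (rule Bochner_Integration.integral_cong[OF refl]) (simp add: w_def inner_diff_right)
    also have "\<dots> = (LINT z|law_at t. grad g (x t i - z)) \<bullet> w i"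
      by (rule integral_inner_left[OF grad_conv_eq(2)[OF t]])
    finally show ?thesis by (simp add: grad_conv_eq(1)[OF t])
  qed
  have part2': "(\<Sum>i<N. LINT z|law_at t. grad g (x t i - z) \<bullet> (v t i - u t z)) - (\<Sum>i<N. LINT z|law_at t. grad g (x t i - z) \<bullet> (u t (x t i) - u t z))
      = - (\<Sum>i<N. u t (x t i) \<bullet> w i)"
    unfolding sum_subtractf[symmetric] sum_negf[symmetric] by (rule sum.cong[OF refl]) (use part2 in auto)
  have "energy_rate (grad g) t - commut t = (1 / real N)\<^sup>2 * (- 2 * real N * (\<Sum>i<N. v t i \<bullet> w i)) - 2 / real N * (- (\<Sum>i<N. u t (x t i) \<bullet> w i))"
    unfolding part1[symmetric] part2'[symmetric] energy_rate_def commut_def \<gamma>_def by (simp only: right_diff_distrib)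
  also have "\<dots> = - 2 * (1 / real N * ((\<Sum>i<N. v t i \<bullet> w i) - (\<Sum>i<N. u t (x t i) \<bullet> w i)))"
    using N by (simp add: power2_eq_square field_simps)
  also have "(\<Sum>i<N. v t i \<bullet> w i) - (\<Sum>i<N. u t (x t i) \<bullet> w i) = (\<Sum>i<N. (norm (w i))\<^sup>2)"
    by (simp add: sum_subtractf[symmetric] w_def power2_norm_eq_inner inner_diff_left)
  finally show ?thesis by (simp add: dissip_def w_def)
qed

lemma dissip_cont: "continuous_on {0..T} dissip"
proof -
  have uc: "continuous_on {0..T} (\<lambda>t. u t (x t i))" if i: "i < N" for i
    unfolding continuous_on_eq_continuous_within
  proof
    fix t assume t: "t \<in> {0..T}"
    have xt: "((\<lambda>s. x s i) \<longlongrightarrow> x t i) (at t within {0..T})"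
      using x_cont[OF i] t by (simp add: continuous_on_def)
    have "((\<lambda>s. u s (x s i) - u t (x t i)) \<longlongrightarrow> 0) (at t within {0..T})"
    proof (rule Lim_null_comparison)
      show "\<forall>\<^sub>F s in at t within {0..T}. norm (u s (x s i) - u t (x t i)) \<le> J * \<bar>s - t\<bar> + K * norm (x s i - x t i)"
        unfolding eventually_at_filter
      proof (rule always_eventually, intro allI impI)
        fix s assume s: "s \<in> {0..T}"
        have "norm (u s (x s i) - u t (x t i)) \<le> norm (u s (x s i) - u t (x s i)) + norm (u t (x s i) - u t (x t i))"
          by (metis add_diff_eq diff_add_cancel norm_triangle_ineq)
        then show "norm (u s (x s i) - u t (x t i)) \<le> J * \<bar>s - t\<bar> + K * norm (x s i - x t i)"
          using u_time[OF s t, of "x s i"] lipschitz_on_normD[OF u_lip[OF t], of "x s i" "x t i"] by linarith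
      qed
      have "((\<lambda>s. J * \<bar>s - t\<bar> + K * norm (x s i - x t i)) \<longlongrightarrow> J * \<bar>t - t\<bar> + K * norm (x t i - x t i)) (at t within {0..T})"
        by (intro tendsto_intros xt)
      then show "((\<lambda>s. J * \<bar>s - t\<bar> + K * norm (x s i - x t i)) \<longlongrightarrow> 0) (at t within {0..T})" by simp
    qed
    then show "continuous (at t within {0..T}) (\<lambda>t. u t (x t i))"
      by (simp add: continuous_within LIM_zero_iff)
  qed
  show ?thesis unfolding dissip_def by (intro continuous_intros v_cont uc) auto
qed

lemma dissip_nn: "0 \<le> dissip t"
  unfolding dissip_def by (intro mult_nonneg_nonneg sum_nonneg) auto

end

section \<open>Gronwall estimates along one trajectory\<close>

context particle_energy begin

definition total_dissip :: "real \<Rightarrow> real" where "total_dissip t = integral {0..t} dissip"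

lemma total_dissip_derivative:
  assumes t: "t \<in> {0..T}" and s: "s \<in> {0..t}"
  shows "(total_dissip has_real_derivative dissip s) (at s within {0..t})"
proof -
  have "continuous_on {0..t} dissip" by (rule continuous_on_subset[OF dissip_cont]) (use t in auto)
  then show ?thesis unfolding total_dissip_def[abs_def] has_real_derivative_iff_has_vector_derivative
    by (rule integral_has_vector_derivative[OF _ s])
qed

lemma total_dissip_0: "total_dissip 0 = 0" by (simp add: total_dissip_def)

lemma total_dissip_nn: "t \<in> {0..T} \<Longrightarrow> 0 \<le> total_dissip t"
  unfolding total_dissip_def
  by (intro Henstock_Kurzweil_Integration.integral_nonneg integrable_continuous_real continuous_on_subset[OF dissip_cont])
    (auto simp: dissip_nn)

text \<open>With twice the accumulated dissipation added, the energy has exactly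
  \<open>commut\<close> as derivative. The dissipation thus survives on the left-hand side, and one
  inequality controls both quantities.\<close>

lemma energy_gronwall:
  assumes c: "0 \<le> c"
    and comm: "\<And>t. t \<in> {0..T} \<Longrightarrow> \<bar>commut t\<bar> \<le> c * (energy g t + b)"
    and t: "t \<in> {0..T}"
  shows "energy g t + b + 2 * total_dissip t \<le> exp (c * t) * (energy g 0 + b)"
proof -
  have "energy g t + b + 2 * total_dissip t \<le> exp (c * t) * ((energy g 0 + b + 2 * total_dissip 0) + 0)"
  proof (rule gronwall[where b="\<lambda>_. 0" and B="\<lambda>_. 0" and Z="\<lambda>t. energy g t + b + 2 * total_dissip t" and Z'=commut])
    fix s assume s: "0 \<le> s" "s \<le> t"
    have sT: "s \<in> {0..T}" using s t by auto
    have "(energy g has_real_derivative energy_rate (grad g) s) (at s within {0..t})"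
      using has_vector_derivative_within_subset[OF energy_derivative[OF sT], of "{0..t}"] t
      by (simp add: has_real_derivative_iff_has_vector_derivative)
    then have "((\<lambda>t. energy g t + b + 2 * total_dissip t) has_real_derivative energy_rate (grad g) s + 0 + 2 * dissip s) (at s within {0..t})"
      using s by (intro DERIV_add DERIV_cmult DERIV_const total_dissip_derivative[OF t]) auto
    then show "((\<lambda>t. energy g t + b + 2 * total_dissip t) has_real_derivative commut s) (at s within {0..t})"
      by (simp add: energy_rate_eq[OF sT])
    have "commut s \<le> c * (energy g s + b)" using comm[OF sT] by linarith
    also have "\<dots> \<le> c * (energy g s + b + 2 * total_dissip s)"
      using total_dissip_nn[OF sT] c by (intro mult_left_mono) auto
    finally show "commut s \<le> c * (energy g s + b + 2 * total_dissip s) + 0" by simp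
  qed (use t c in auto)
  then show ?thesis by (simp add: total_dissip_0)
qed

text \<open>The velocity difference splits into the deviation of the particle from the mean field at
  its own position, whose mean square is \<open>dissip\<close>, and a Lipschitz term. Young's
  inequality costs the 1 in \<open>1 + 2 * K\<close>; the source \<open>real N * dissip\<close>
  integrates to \<open>real N * total_dissip\<close>, and the two points coincide at time 0.\<close>

lemma coupling_gronwall:
  assumes t: "t \<in> {0..T}"
  shows "(\<Sum>i<N. (norm (x t i - Y t (x 0 i)))\<^sup>2) \<le> exp ((1 + 2 * K) * t) * (real N * total_dissip t)"
proof -
  define Z where "Z t = (\<Sum>i<N. (norm (x t i - Y t (x 0 i)))\<^sup>2)" for t
  have "Z t \<le> exp ((1 + 2 * K) * t) * (Z 0 + real N * total_dissip t)"
  proof (rule gronwall[where b="\<lambda>s. real N * dissip s" and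
        Z'="\<lambda>s. \<Sum>i<N. 2 * ((x s i - Y s (x 0 i)) \<bullet> (v s i - u s (Y s (x 0 i))))"])
    fix s assume s: "0 \<le> s" "s \<le> t"
    have sT: "s \<in> {0..T}" and sub: "{0..t} \<subseteq> {0..T}" using s t by auto
    show "(Z has_real_derivative (\<Sum>i<N. 2 * ((x s i - Y s (x 0 i)) \<bullet> (v s i - u s (Y s (x 0 i)))))) (at s within {0..t})"
      unfolding Z_def
    proof (rule DERIV_sum)
      fix i assume "i \<in> {..<N}"
      then show "((\<lambda>t. (norm (x t i - Y t (x 0 i)))\<^sup>2) has_real_derivative 2 * ((x s i - Y s (x 0 i)) \<bullet> (v s i - u s (Y s (x 0 i))))) (at s within {0..t})"
        by (intro has_real_derivative_norm_square has_vector_derivative_diff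
            has_vector_derivative_within_subset[OF x_der'[OF sT] sub] has_vector_derivative_within_subset[OF Y_der[OF sT] sub]) auto
    qed
    have le: "2 * (a \<bullet> (v s i - u s (Y s (x 0 i)))) \<le> (1 + 2 * K) * (norm a)\<^sup>2 + (norm (v s i - u s (x s i)))\<^sup>2"
      if a: "a = x s i - Y s (x 0 i)" for a i
    proof -
      define e where "e = v s i - u s (x s i)"
      have "a \<bullet> (u s (x s i) - u s (Y s (x 0 i))) \<le> norm a * norm (u s (x s i) - u s (Y s (x 0 i)))"
        by (rule norm_cauchy_schwarz)
      also have "\<dots> \<le> norm a * (K * norm a)"
        unfolding a by (intro mult_left_mono lipschitz_on_normD[OF u_lip[OF sT]]) auto
      finally have 1: "a \<bullet> (u s (x s i) - u s (Y s (x 0 i))) \<le> K * (norm a)\<^sup>2" by (simp add: power2_eq_square mult_ac)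
      have "a \<bullet> e \<le> norm a * norm e" by (rule norm_cauchy_schwarz)
      moreover have "0 \<le> (norm a - norm e)\<^sup>2" by simp
      ultimately have 2: "2 * (a \<bullet> e) \<le> (norm a)\<^sup>2 + (norm e)\<^sup>2" unfolding power2_diff by linarith
      have "a \<bullet> (v s i - u s (Y s (x 0 i))) = a \<bullet> e + a \<bullet> (u s (x s i) - u s (Y s (x 0 i)))"
        by (simp add: e_def inner_diff_right)
      then have "2 * (a \<bullet> (v s i - u s (Y s (x 0 i)))) \<le> (norm a)\<^sup>2 + (norm e)\<^sup>2 + 2 * (K * (norm a)\<^sup>2)" using 1 2 by linarith
      then show ?thesis by (simp add: e_def algebra_simps)
    qed
    have "(\<Sum>i<N. 2 * ((x s i - Y s (x 0 i)) \<bullet> (v s i - u s (Y s (x 0 i)))))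
      \<le> (\<Sum>i<N. (1 + 2 * K) * (norm (x s i - Y s (x 0 i)))\<^sup>2 + (norm (v s i - u s (x s i)))\<^sup>2)"
      by (intro sum_mono le refl)
    also have "\<dots> = (1 + 2 * K) * Z s + real N * dissip s"
      unfolding sum.distrib sum_distrib_left[symmetric] Z_def dissip_def using N by simp
    finally show "(\<Sum>i<N. 2 * ((x s i - Y s (x 0 i)) \<bullet> (v s i - u s (Y s (x 0 i))))) \<le> (1 + 2 * K) * Z s + real N * dissip s" .
    show "((\<lambda>s. real N * total_dissip s) has_real_derivative real N * dissip s) (at s within {0..t})"
      using s by (intro DERIV_cmult total_dissip_derivative[OF t]) auto
  qed (use t nonneg dissip_nn total_dissip_0 in auto)
  moreover have "Z 0 = 0" by (simp add: Z_def Y_0)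
  ultimately show ?thesis by (simp add: Z_def)
qed

end

section \<open>Uniqueness of collision-free trajectories\<close>

context singular_kernel begin

lemma G'_lipschitz:
  assumes ab: "0 < a" "a \<le> b"
  obtains L where "0 \<le> L" "\<And>s t. s \<in> {a..b} \<Longrightarrow> t \<in> {a..b} \<Longrightarrow> \<bar>G' s - G' t\<bar> \<le> L * \<bar>s - t\<bar>"
proof -
  obtain G'' where G'': "\<And>s. 0 < s \<Longrightarrow> (G' has_real_derivative G'' s) (at s)" "continuous_on {0<..} G''"
    using G'_C1 unfolding C1_pos_def by blast
  have "compact (G'' ` {a..b})"
    by (intro compact_continuous_image continuous_on_subset[OF G''(2)]) (use ab in auto)
  then have "bounded (G'' ` {a..b})" by (rule compact_imp_bounded)
  then obtain L where L: "\<forall>s\<in>{a..b}. \<bar>G'' s\<bar> \<le> L" by (auto simp: bounded_iff)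
  show thesis
  proof
    show "0 \<le> \<bar>L\<bar>" by simp
    fix s t assume st: "s \<in> {a..b}" "t \<in> {a..b}"
    have "norm (G' s - G' t) \<le> \<bar>L\<bar> * norm (s - t)"
    proof (rule field_differentiable_bound[where S="{a..b}" and f'=G''])
      show "(G' has_field_derivative G'' z) (at z within {a..b})" if "z \<in> {a..b}" for z
        by (rule has_field_derivative_at_within[OF G''(1)]) (use that ab in auto)
      show "norm (G'' z) \<le> \<bar>L\<bar>" if "z \<in> {a..b}" for z using L that by force
    qed (use st in auto)
    then show "\<bar>G' s - G' t\<bar> \<le> \<bar>L\<bar> * \<bar>s - t\<bar>" by simp
  qed
qed

text \<open>An annulus is not convex, so the mean value inequality is applied to the profile
  \<open>G'\<close> on an interval of squared radii; the formula \<open>2 * G' (|x|^2)\<close> times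
  \<open>x\<close> then carries the bound over to the gradient.\<close>

lemma grad_lipschitz_annulus:
  assumes ab: "0 < a" "a \<le> b"
  obtains L where "0 \<le> L" "\<And>y z. a \<le> norm y \<Longrightarrow> norm y \<le> b \<Longrightarrow> a \<le> norm z \<Longrightarrow> norm z \<le> b
    \<Longrightarrow> norm (grad g y - grad g z) \<le> L * norm (y - z)"
proof -
  have a2: "0 < a\<^sup>2" and b2: "a\<^sup>2 \<le> b\<^sup>2" using ab by (auto intro: power_mono)
  obtain L where L: "0 \<le> L" "\<And>s t. s \<in> {a\<^sup>2..b\<^sup>2} \<Longrightarrow> t \<in> {a\<^sup>2..b\<^sup>2} \<Longrightarrow> \<bar>G' s - G' t\<bar> \<le> L * \<bar>s - t\<bar>"
    using G'_lipschitz[OF a2 b2] by blast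
  define M where "M = C * (a\<^sup>2) powr (- real CARD('n) / 2)"
  have M: "\<bar>G' s\<bar> \<le> M" if "a\<^sup>2 \<le> s" for s
  proof -
    have s: "0 < s" using that a2 by linarith
    have "\<bar>G' s\<bar> \<le> C * s powr (- real CARD('n) / 2)" by (rule G'_bd[OF s])
    also have "\<dots> \<le> M" unfolding M_def using that a2 C by (intro mult_left_mono powr_mono2') auto
    finally show ?thesis .
  qed
  have M0: "0 \<le> M" using M[of "a\<^sup>2"] by linarith
  show thesis
  proof
    show "0 \<le> 2 * (M + L * (2 * b) * b)" using L M0 ab by simp
    fix y z :: "real^'n" assume yz: "a \<le> norm y" "norm y \<le> b" "a \<le> norm z" "norm z \<le> b"
    have ne: "y \<noteq> 0" "z \<noteq> 0" using yz ab by auto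
    have in1: "(norm y)\<^sup>2 \<in> {a\<^sup>2..b\<^sup>2}" "(norm z)\<^sup>2 \<in> {a\<^sup>2..b\<^sup>2}" using yz ab by (auto intro: power_mono)
    have "(norm y)\<^sup>2 - (norm z)\<^sup>2 = (norm y + norm z) * (norm y - norm z)" by (simp add: power2_eq_square algebra_simps)
    then have "\<bar>(norm y)\<^sup>2 - (norm z)\<^sup>2\<bar> = (norm y + norm z) * \<bar>norm y - norm z\<bar>" by (simp add: abs_mult)
    also have "\<dots> \<le> (2 * b) * norm (y - z)"
      using yz ab by (intro mult_mono norm_triangle_ineq3) auto
    finally have sq: "\<bar>(norm y)\<^sup>2 - (norm z)\<^sup>2\<bar> \<le> (2 * b) * norm (y - z)" .
    have "grad g y - grad g z = 2 *\<^sub>R (G' ((norm y)\<^sup>2) *\<^sub>R (y - z) + (G' ((norm y)\<^sup>2) - G' ((norm z)\<^sup>2)) *\<^sub>R z)"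
      using ne by (simp add: grad_eq_reg' reg'_def algebra_simps)
    then have "norm (grad g y - grad g z) \<le> 2 * (\<bar>G' ((norm y)\<^sup>2)\<bar> * norm (y - z) + \<bar>G' ((norm y)\<^sup>2) - G' ((norm z)\<^sup>2)\<bar> * norm z)"
      using norm_triangle_ineq[of "G' ((norm y)\<^sup>2) *\<^sub>R (y - z)" "(G' ((norm y)\<^sup>2) - G' ((norm z)\<^sup>2)) *\<^sub>R z"] by simp
    also have "\<dots> \<le> 2 * (M * norm (y - z) + (L * ((2 * b) * norm (y - z))) * b)"
    proof (intro mult_left_mono add_mono mult_mono)
      show "\<bar>G' ((norm y)\<^sup>2)\<bar> \<le> M" using M in1 by auto
      show "\<bar>G' ((norm y)\<^sup>2) - G' ((norm z)\<^sup>2)\<bar> \<le> L * ((2 * b) * norm (y - z))"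
        using L(2)[OF in1] mult_left_mono[OF sq L(1)] by linarith
    qed (use L M0 ab yz in auto)
    finally show "norm (grad g y - grad g z) \<le> 2 * (M + L * (2 * b) * b) * norm (y - z)" by (simp add: algebra_simps)
  qed
qed

text \<open>Each mutual distance is continuous and positive on a compact interval, hence bounded
  away from zero, and there are finitely many pairs.\<close>

lemma pair_distance_bounds:
  fixes x :: "real \<Rightarrow> nat \<Rightarrow> real ^ 'n"
  assumes T: "0 \<le> T" and c: "\<And>i. i < N \<Longrightarrow> continuous_on {0..T} (\<lambda>t. x t i)"
    and nc: "\<And>t i j. t \<in> {0..T} \<Longrightarrow> i < N \<Longrightarrow> j < N \<Longrightarrow> i \<noteq> j \<Longrightarrow> x t i \<noteq> x t j"
  obtains a b where "0 < a" "a \<le> b"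
    "\<And>t i j. t \<in> {0..T} \<Longrightarrow> i < N \<Longrightarrow> j < N \<Longrightarrow> i \<noteq> j \<Longrightarrow> a \<le> norm (x t i - x t j) \<and> norm (x t i - x t j) \<le> b"
proof -
  have ex: "\<exists>a>0. \<exists>b. \<forall>t\<in>{0..T}. a \<le> norm (x t i - x t j) \<and> norm (x t i - x t j) \<le> b" if ij: "i < N" "j < N" "i \<noteq> j" for i j
  proof -
    have cc: "continuous_on {0..T} (\<lambda>t. norm (x t i - x t j))" by (intro continuous_intros c ij)
    obtain t0 where t0: "t0 \<in> {0..T}" "\<forall>t\<in>{0..T}. norm (x t0 i - x t0 j) \<le> norm (x t i - x t j)"
      using continuous_attains_inf[OF _ _ cc] T by auto
    obtain t1 where t1: "t1 \<in> {0..T}" "\<forall>t\<in>{0..T}. norm (x t i - x t j) \<le> norm (x t1 i - x t1 j)"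
      using continuous_attains_sup[OF _ _ cc] T by auto
    show ?thesis
      using t0 t1 nc[OF t0(1) ij] by (intro exI[of _ "norm (x t0 i - x t0 j)"] conjI exI[of _ "norm (x t1 i - x t1 j)"] ballI) auto
  qed
  have "\<exists>q. 0 < fst q \<and> (fst p \<noteq> snd p \<longrightarrow> (\<forall>t\<in>{0..T}. fst q \<le> norm (x t (fst p) - x t (snd p)) \<and> norm (x t (fst p) - x t (snd p)) \<le> snd q))"
    if "p \<in> {..<N}\<times>{..<N}" for p
  proof (cases "fst p = snd p")
    case True then show ?thesis by (intro exI[of _ "(1, 0)"]) simp
  next
    case False
    then obtain a b where "0 < a" "\<forall>t\<in>{0..T}. a \<le> norm (x t (fst p) - x t (snd p)) \<and> norm (x t (fst p) - x t (snd p)) \<le> b"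
      using ex[of "fst p" "snd p"] \<open>p \<in> {..<N}\<times>{..<N}\<close> by (auto simp: mem_Times_iff)
    then show ?thesis by (intro exI[of _ "(a, b)"]) simp
  qed
  then obtain q where q: "\<And>p. p \<in> {..<N}\<times>{..<N} \<Longrightarrow> 0 < fst (q p) \<and> (fst p \<noteq> snd p \<longrightarrow>
      (\<forall>t\<in>{0..T}. fst (q p) \<le> norm (x t (fst p) - x t (snd p)) \<and> norm (x t (fst p) - x t (snd p)) \<le> snd (q p)))"
    by metis
  define a where "a p = fst (q p)" for p
  define b where "b p = snd (q p)" for p
  have ab: "0 < a p" if "p \<in> {..<N}\<times>{..<N}" for p using q[OF that] by (simp add: a_def)
  have ab2: "a p \<le> norm (x t (fst p) - x t (snd p)) \<and> norm (x t (fst p) - x t (snd p)) \<le> b p"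
    if "p \<in> {..<N}\<times>{..<N}" "fst p \<noteq> snd p" "t \<in> {0..T}" for p t using q[OF that(1)] that by (simp add: a_def b_def)
  \<comment> \<open>Inserting 1 keeps the minimum defined on an empty index set, and inserting
    \<open>A\<close> into the maximum below ensures \<open>A \<le> B\<close>.\<close>
  define A where "A = Min (insert 1 (a ` ({..<N}\<times>{..<N})))"
  define B where "B = Max (insert A (b ` ({..<N}\<times>{..<N})))"
  show thesis
  proof
    show "0 < A" unfolding A_def using ab by (subst Min_gr_iff) auto
    show "A \<le> B" unfolding B_def by (rule Max_ge) auto
    fix t i j assume t: "t \<in> {0..T}" and ij: "i < N" "j < N" "i \<noteq> j"
    have p: "(i, j) \<in> {..<N}\<times>{..<N}" using ij by simp
    have "A \<le> a (i, j)" unfolding A_def using p by (intro Min_le) auto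
    moreover have "b (i, j) \<le> B" unfolding B_def using p by (intro Max_ge) auto
    ultimately show "A \<le> norm (x t i - x t j) \<and> norm (x t i - x t j) \<le> B"
      using ab2[OF p _ t] ij by auto
  qed
qed

text \<open>Both solutions keep all mutual distances in one annulus, where the force is Lipschitz,
  so Gronwall applies to the sum of squared differences. Since a particle flow is given only through
  its equation, this is what makes it commute with relabelling.\<close>

lemma particle_ode_unique:
  fixes x y :: "real \<Rightarrow> nat \<Rightarrow> real ^ 'n"
  assumes T: "0 \<le> T" and N: "0 < N"
    and x: "\<And>t i. t \<in> {0..T} \<Longrightarrow> i < N \<Longrightarrow> ((\<lambda>s. x s i) has_vector_derivative
       - (1 / real N) *\<^sub>R (\<Sum>j\<in>{..<N} - {i}. grad g (x t i - x t j))) (at t within {0..T})"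
    and y: "\<And>t i. t \<in> {0..T} \<Longrightarrow> i < N \<Longrightarrow> ((\<lambda>s. y s i) has_vector_derivative
       - (1 / real N) *\<^sub>R (\<Sum>j\<in>{..<N} - {i}. grad g (y t i - y t j))) (at t within {0..T})"
    and ncx: "\<And>t i j. t \<in> {0..T} \<Longrightarrow> i < N \<Longrightarrow> j < N \<Longrightarrow> i \<noteq> j \<Longrightarrow> x t i \<noteq> x t j"
    and ncy: "\<And>t i j. t \<in> {0..T} \<Longrightarrow> i < N \<Longrightarrow> j < N \<Longrightarrow> i \<noteq> j \<Longrightarrow> y t i \<noteq> y t j"
    and init: "\<And>i. i < N \<Longrightarrow> x 0 i = y 0 i" and i: "i < N"
  shows "x T i = y T i"
proof -
  have xc: "continuous_on {0..T} (\<lambda>t. x t i)" if "i < N" for i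
    using x that by (meson continuous_on_eq_continuous_within has_vector_derivative_continuous)
  have yc: "continuous_on {0..T} (\<lambda>t. y t i)" if "i < N" for i
    using y that by (meson continuous_on_eq_continuous_within has_vector_derivative_continuous)
  obtain a1 b1 where ab1: "0 < a1" "a1 \<le> b1" "\<And>t i j. t \<in> {0..T} \<Longrightarrow> i < N \<Longrightarrow> j < N \<Longrightarrow> i \<noteq> j \<Longrightarrow> a1 \<le> norm (x t i - x t j) \<and> norm (x t i - x t j) \<le> b1"
    using pair_distance_bounds[of T N x] T xc ncx by blast
  obtain a2 b2 where ab2: "0 < a2" "a2 \<le> b2" "\<And>t i j. t \<in> {0..T} \<Longrightarrow> i < N \<Longrightarrow> j < N \<Longrightarrow> i \<noteq> j \<Longrightarrow> a2 \<le> norm (y t i - y t j) \<and> norm (y t i - y t j) \<le> b2"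
    using pair_distance_bounds[of T N y] T yc ncy by blast
  have ab: "0 < min a1 a2" "min a1 a2 \<le> max b1 b2" using ab1 ab2 by auto
  obtain L where L: "0 \<le> L" "\<And>y z. min a1 a2 \<le> norm y \<Longrightarrow> norm y \<le> max b1 b2 \<Longrightarrow> min a1 a2 \<le> norm z \<Longrightarrow> norm z \<le> max b1 b2
    \<Longrightarrow> norm (grad g y - grad g z) \<le> L * norm (y - z)"
    using grad_lipschitz_annulus[OF ab] by blast
  define z where "z t i = x t i - y t i" for t i
  define z' where "z' t i = - (1 / real N) *\<^sub>R (\<Sum>j\<in>{..<N} - {i}. grad g (x t i - x t j)) - - (1 / real N) *\<^sub>R (\<Sum>j\<in>{..<N} - {i}. grad g (y t i - y t j))" for t i
  define Z where "Z t = (\<Sum>i<N. (norm (z t i))\<^sup>2)" for t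
  have "Z T \<le> exp ((4 * L) * T) * (Z 0 + 0)"
  proof (rule gronwall[where b="\<lambda>_. 0" and B="\<lambda>_. 0" and Z'="\<lambda>t. \<Sum>i<N. 2 * (z t i \<bullet> z' t i)"])
    fix t assume "0 \<le> t" "t \<le> T"
    then have t: "t \<in> {0..T}" by simp
    show "(Z has_real_derivative (\<Sum>i<N. 2 * (z t i \<bullet> z' t i))) (at t within {0..T})"
      unfolding Z_def z_def z'_def
      by (intro DERIV_sum has_real_derivative_norm_square has_vector_derivative_diff x[OF t] y[OF t]) auto
    have z'b: "norm (z' t i) \<le> (1 / real N) * (\<Sum>j<N. L * (norm (z t i) + norm (z t j)))" if i: "i < N" for i
    proof -
      have "z' t i = - (1 / real N) *\<^sub>R (\<Sum>j\<in>{..<N} - {i}. grad g (x t i - x t j) - grad g (y t i - y t j))"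
        by (simp add: z'_def sum_subtractf scaleR_diff_right)
      then have "norm (z' t i) = (1 / real N) * norm (\<Sum>j\<in>{..<N} - {i}. grad g (x t i - x t j) - grad g (y t i - y t j))"
        by simp
      also have "\<dots> \<le> (1 / real N) * (\<Sum>j\<in>{..<N} - {i}. norm (grad g (x t i - x t j) - grad g (y t i - y t j)))"
        by (intro mult_left_mono norm_sum) simp
      also have "\<dots> \<le> (1 / real N) * (\<Sum>j\<in>{..<N} - {i}. L * (norm (z t i) + norm (z t j)))"
      proof (intro mult_left_mono sum_mono)
        fix j assume j: "j \<in> {..<N} - {i}"
        have "norm (grad g (x t i - x t j) - grad g (y t i - y t j)) \<le> L * norm ((x t i - x t j) - (y t i - y t j))"
          using ab1(3)[OF t i, of j] ab2(3)[OF t i, of j] j by (intro L) auto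
        also have "(x t i - x t j) - (y t i - y t j) = z t i - z t j" by (simp add: z_def)
        also have "L * norm (z t i - z t j) \<le> L * (norm (z t i) + norm (z t j))"
          by (intro mult_left_mono norm_triangle_ineq4 L)
        finally show "norm (grad g (x t i - x t j) - grad g (y t i - y t j)) \<le> L * (norm (z t i) + norm (z t j))" .
      qed simp
      also have "\<dots> \<le> (1 / real N) * (\<Sum>j<N. L * (norm (z t i) + norm (z t j)))"
        using L(1) by (intro mult_left_mono sum_mono2) auto
      finally show ?thesis .
    qed
    \<comment> \<open>The inequality \<open>2 * p * (p + q) \<le> 3 * p^2 + q^2\<close> for the two
      norms, averaged over \<open>j\<close> and summed over \<open>i\<close>, gives the constant
      \<open>4 * L\<close>.\<close>
    have "(\<Sum>i<N. 2 * (z t i \<bullet> z' t i)) \<le> (\<Sum>i<N. (1 / real N) * (\<Sum>j<N. L * (3 * (norm (z t i))\<^sup>2 + (norm (z t j))\<^sup>2)))"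
    proof (rule sum_mono)
      fix i assume i: "i \<in> {..<N}"
      have "z t i \<bullet> z' t i \<le> norm (z t i) * norm (z' t i)" by (rule norm_cauchy_schwarz)
      also have "\<dots> \<le> norm (z t i) * ((1 / real N) * (\<Sum>j<N. L * (norm (z t i) + norm (z t j))))"
        using i by (intro mult_left_mono z'b) auto
      finally have "2 * (z t i \<bullet> z' t i) \<le> 2 * (norm (z t i) * ((1 / real N) * (\<Sum>j<N. L * (norm (z t i) + norm (z t j)))))" by simp
      also have "\<dots> = (1 / real N) * (\<Sum>j<N. 2 * norm (z t i) * (L * (norm (z t i) + norm (z t j))))"
        by (simp add: sum_distrib_left mult_ac)
      also have "\<dots> \<le> (1 / real N) * (\<Sum>j<N. L * (3 * (norm (z t i))\<^sup>2 + (norm (z t j))\<^sup>2))"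
      proof (intro mult_left_mono sum_mono)
        fix j
        have "0 \<le> (norm (z t i) - norm (z t j))\<^sup>2" by simp
        then have "2 * norm (z t i) * (norm (z t i) + norm (z t j)) \<le> 3 * (norm (z t i))\<^sup>2 + (norm (z t j))\<^sup>2"
          by (simp add: power2_diff power2_eq_square algebra_simps)
        then have "L * (2 * norm (z t i) * (norm (z t i) + norm (z t j))) \<le> L * (3 * (norm (z t i))\<^sup>2 + (norm (z t j))\<^sup>2)"
          by (rule mult_left_mono[OF _ L(1)])
        then show "2 * norm (z t i) * (L * (norm (z t i) + norm (z t j))) \<le> L * (3 * (norm (z t i))\<^sup>2 + (norm (z t j))\<^sup>2)"
          by (simp only: mult_ac)
      qed simp
      finally show "2 * (z t i \<bullet> z' t i) \<le> (1 / real N) * (\<Sum>j<N. L * (3 * (norm (z t i))\<^sup>2 + (norm (z t j))\<^sup>2))" .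
    qed
    also have "\<dots> = 4 * L * Z t"
    proof -
      have "(1 / real N) * (\<Sum>j<N. L * (3 * (norm (z t i))\<^sup>2 + (norm (z t j))\<^sup>2)) = 3 * L * (norm (z t i))\<^sup>2 + (L / real N) * Z t" for i
        using N by (simp add: Z_def sum_distrib_left[symmetric] sum.distrib field_simps)
      then show ?thesis using N by (simp add: sum.distrib sum_distrib_left[symmetric] Z_def[symmetric])
    qed
    finally show "(\<Sum>i<N. 2 * (z t i \<bullet> z' t i)) \<le> 4 * L * Z t + 0" by simp
  qed (use T L in auto)
  moreover have "Z 0 = 0" using init by (simp add: Z_def z_def)
  ultimately have "Z T \<le> 0" by simp
  then have "Z T = 0" unfolding Z_def by (intro antisym sum_nonneg) auto
  then have "norm (z T i) = 0" using i unfolding Z_def by (subst (asm) sum_nonneg_eq_0_iff) auto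
  then show ?thesis by (simp add: z_def)
qed

end

section \<open>Classical solutions\<close>

lemma sup_norm_le_iff: "sup_norm f \<le> ennreal c \<longleftrightarrow> (\<forall>x. norm (f x) \<le> c)" if "0 \<le> c"
  using that by (auto simp: sup_norm_def SUP_le_iff)

lemma sup_norm_finiteE:
  assumes "sup_norm f < \<infinity>"
  obtains c where "0 \<le> c" "\<And>x. norm (f x) \<le> c"
proof -
  have "sup_norm f \<le> ennreal (enn2real (sup_norm f))" using assms by simp
  then have "\<forall>x. norm (f x) \<le> enn2real (sup_norm f)" by (subst (asm) sup_norm_le_iff) auto
  then show thesis using that[of "enn2real (sup_norm f)"] by auto
qed

lemma holder_continuous_on:
  fixes f :: "real ^ 'n \<Rightarrow> 'b::real_normed_vector"
  assumes \<beta>: "0 < \<beta>" and f: "holder_seminorm \<beta> f < \<infinity>"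
  shows "continuous_on UNIV f"
proof -
  define H where "H = enn2real (holder_seminorm \<beta> f)"
  have H: "norm (f x - f y) \<le> H * norm (x - y) powr \<beta>" for x y
  proof (cases "x = y")
    case False
    have "ennreal (norm (f x - f y) / norm (x - y) powr \<beta>) \<le> holder_seminorm \<beta> f"
      unfolding holder_seminorm_def using False by (intro SUP_upper2[of "(x, y)"]) auto
    also have "\<dots> = ennreal H" using f by (simp add: H_def)
    finally have "norm (f x - f y) / norm (x - y) powr \<beta> \<le> H" by (simp add: H_def)
    then show ?thesis using False by (simp add: field_simps)
  qed simp
  show ?thesis unfolding continuous_on_def
  proof
    fix x
    have "((\<lambda>y. f y - f x) \<longlongrightarrow> 0) (at x)"
    proof (rule Lim_null_comparison)
      show "\<forall>\<^sub>F y in at x. norm (f y - f x) \<le> H * norm (y - x) powr \<beta>" using H by simp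
      have "((\<lambda>y. H * norm (y - x) powr \<beta>) \<longlongrightarrow> H * 0) (at x)"
      proof (intro tendsto_intros)
        have "((\<lambda>y. norm (y - x)) \<longlongrightarrow> norm (x - x)) (at x)" by (intro tendsto_intros)
        then show "((\<lambda>y. norm (y - x) powr \<beta>) \<longlongrightarrow> 0) (at x)"
          using \<beta> tendsto_zero_powrI[of "\<lambda>y. norm (y - x)" "at x" "\<lambda>_. \<beta>" \<beta>] by simp
      qed
      then show "((\<lambda>y. H * norm (y - x) powr \<beta>) \<longlongrightarrow> 0) (at x)" by simp
    qed
    then show "(f \<longlongrightarrow> f x) (at x)" by (simp add: LIM_zero_iff)
  qed
qed

lemma has_derivative_grad:
  fixes f :: "real ^ 'n \<Rightarrow> real"
  assumes "f differentiable at x"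
  shows "(f has_derivative (\<lambda>h. grad f x \<bullet> h)) (at x)"
proof -
  let ?D = "frechet_derivative f (at x)"
  have D: "(f has_derivative ?D) (at x)" using assms by (simp add: frechet_derivative_works)
  then have lin: "linear ?D" by (meson bounded_linear.linear has_derivative_bounded_linear)
  have "?D h = grad f x \<bullet> h" for h
  proof -
    have "(\<Sum>i\<in>UNIV. (h $ i) *\<^sub>R axis i 1) = h"
      by (simp add: vec_eq_iff axis_def if_distrib[of "\<lambda>c. _ * c"] cong: if_cong)
    then have "?D h = ?D (\<Sum>i\<in>UNIV. (h $ i) *\<^sub>R axis i 1)" by simp
    also have "\<dots> = (\<Sum>i\<in>UNIV. h $ i * ?D (axis i 1))" by (simp add: linear_sum[OF lin] linear_cmul[OF lin])
    finally show ?thesis by (simp add: grad_def inner_vec_def mult.commute)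
  qed
  then have "?D = (\<lambda>h. grad f x \<bullet> h)" by (rule ext)
  then show ?thesis using D by metis
qed

text \<open>The exceptional set is open and null, hence empty. Essential bounds for continuous
  functions thereby hold at every point.\<close>

lemma AE_lborel_closed_imp_all:
  fixes P :: "'a::euclidean_space \<Rightarrow> bool"
  assumes "closed {x. P x}" and ae: "AE x in lborel. P x"
  shows "P x"
proof (rule ccontr)
  assume "\<not> P x"
  have o: "open {x. \<not> P x}" using assms(1) unfolding closed_def Collect_neg_eq .
  have "{x. \<not> P x} \<in> null_sets lborel"
    using ae o by (subst AE_iff_null_sets) auto
  then have "negligible {x. \<not> P x}" by (simp add: negligible_iff_null_sets null_sets_completionI)
  then have "{x. \<not> P x} = {}" using o open_not_negligible by blast
  then show False using \<open>\<not> P x\<close> by blast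
qed

lemma Linf_norm_le_continuous:
  fixes f :: "real ^ 'n \<Rightarrow> 'b::real_normed_vector"
  assumes c: "continuous_on UNIV f" and f: "Linf_norm f \<le> ennreal c" and "0 \<le> c"
  shows "norm (f x) \<le> c"
proof (rule AE_lborel_closed_imp_all[where P="\<lambda>x. norm (f x) \<le> c"])
  show "closed {x. norm (f x) \<le> c}" by (intro closed_Collect_le continuous_on_norm c continuous_on_const)
  show "AE x in lborel. norm (f x) \<le> c"
    using esssup_AE[of "\<lambda>x. ennreal (norm (f x))" lborel]
  proof eventually_elim
    fix x assume "ennreal (norm (f x)) \<le> esssup lborel (\<lambda>x. ennreal (norm (f x)))"
    then have "ennreal (norm (f x)) \<le> ennreal c" using f by (simp add: Linf_norm_def)
    then show "norm (f x) \<le> c" using assms(3) by simp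
  qed
qed

text \<open>Continuity of the derivative upgrades the almost-everywhere bound to all points, and the
  mean value inequality turns it into a Lipschitz constant without loss. Hence the coupling estimate
  can use \<open>\<Lambda>\<close>, which is uniform in \<open>\<kappa>\<close>.\<close>

lemma Linf_grad_le_lipschitz:
  fixes u :: "real ^ 'n \<Rightarrow> real ^ 'n"
  assumes u: "Linf_grad u \<le> ennreal c" "0 \<le> c"
    and u': "\<And>x. (u has_derivative u' x) (at x)" and cont: "\<And>h. continuous_on UNIV (\<lambda>x. u' x h)"
  shows "c-lipschitz_on UNIV u"
proof -
  have ex: "\<exists>L. L-lipschitz_on UNIV u" using u(1) by (auto simp: Linf_grad_def top_unique split: if_splits)
  then have es: "esssup lborel (\<lambda>x. ennreal (onorm (frechet_derivative u (at x)))) \<le> ennreal c"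
    using u(1) by (simp add: Linf_grad_def)
  have "norm (u' x h) \<le> c * norm h" for x h
  proof (rule AE_lborel_closed_imp_all[where P="\<lambda>x. norm (u' x h) \<le> c * norm h"])
    show "closed {x. norm (u' x h) \<le> c * norm h}"
      by (intro closed_Collect_le continuous_on_norm cont continuous_on_const)
    show "AE x in lborel. norm (u' x h) \<le> c * norm h"
      using esssup_AE[of "\<lambda>x. ennreal (onorm (frechet_derivative u (at x)))" lborel]
    proof eventually_elim
      fix x assume "ennreal (onorm (frechet_derivative u (at x))) \<le> esssup lborel (\<lambda>x. ennreal (onorm (frechet_derivative u (at x))))"
      then have "ennreal (onorm (frechet_derivative u (at x))) \<le> ennreal c" using es by (rule order_trans)
      then have o: "onorm (u' x) \<le> c" using frechet_derivative_at[OF u'[of x]] u(2) by simp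
      have "norm (u' x h) \<le> onorm (u' x) * norm h"
        by (rule onorm[OF has_derivative_bounded_linear[OF u']])
      also have "\<dots> \<le> c * norm h" by (rule mult_right_mono[OF o]) simp
      finally show "norm (u' x h) \<le> c * norm h" .
    qed
  qed
  then show ?thesis
    by (intro lipschitz_on_normI[OF u(2)] differentiable_bound[of UNIV u u'])
      (use u' in \<open>auto intro: onorm_le\<close>)
qed

lemma sum_Basis_vec:
  fixes f :: "real ^ 'n \<Rightarrow> real"
  shows "(\<Sum>b\<in>Basis. f b) = (\<Sum>i\<in>UNIV. f (axis i 1))"
proof -
  have 1: "(Basis :: (real ^ 'n) set) = (\<lambda>i. axis i 1) ` UNIV" by (auto simp: Basis_vec_def)
  have 2: "inj (\<lambda>i::'n. axis i (1::real))" by (simp add: inj_on_def axis_eq_axis)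
  show ?thesis unfolding 1 sum.reindex[OF 2] o_def ..
qed

lemma prob_densityD:
  assumes "prob_density f"
  shows "f \<in> borel_measurable borel" "\<And>x. 0 \<le> f x" "integrable lborel f" "(LINT x|lborel. f x) = 1"
proof -
  show m: "f \<in> borel_measurable borel" and nn: "\<And>x. 0 \<le> f x" using assms by (auto simp: prob_density_def)
  have I: "(\<integral>\<^sup>+x. ennreal (f x) \<partial>lborel) = 1" using assms by (simp add: prob_density_def)
  show i: "integrable lborel f" using m nn I by (intro integrableI_nonneg) auto
  show "(LINT x|lborel. f x) = 1" using nn_integral_eq_integral[OF i] nn I by simp
qed

lemma supp_subset_ball_eq_0: "supp f \<subseteq> ball 0 R \<Longrightarrow> norm x > R \<Longrightarrow> f x = 0"
  unfolding supp_def using closure_subset[of "{x. f x \<noteq> 0}"] by (force simp: subset_iff)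

section \<open>Regularity of the mean-field velocity\<close>

lemma (in singular_kernel) grad_loc_integrable:
  "integrable lborel (\<lambda>z. indicator (cball 0 r) z *\<^sub>R grad g z)"
proof (rule Bochner_Integration.integrable_bound)
  show "integrable lborel (\<lambda>z. 2 * C * (indicator (cball 0 r) z * sing z))" by (intro integrable_mult_right sing_integrable)
  have "(\<lambda>z. indicator (cball (0::real^'n) r) z :: real) \<in> borel_measurable borel" by (intro borel_measurable_indicator) simp
  then show "(\<lambda>z. indicator (cball 0 r) z *\<^sub>R grad g z) \<in> borel_measurable lborel" by simp
  have "AE z::real^'n in lborel. z \<noteq> 0" by (rule AE_lborel_singleton)
  then show "AE z in lborel. norm (indicator (cball 0 r) z *\<^sub>R grad g z) \<le> norm (2 * C * (indicator (cball 0 r) z * sing z))"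
  proof eventually_elim
    fix z :: "real^'n" assume "z \<noteq> 0"
    then have "indicator (cball 0 r) z * norm (grad g z) \<le> indicator (cball 0 r) z * (2 * C * sing z)"
      by (intro mult_left_mono grad_le_sing) auto
    then show "norm (indicator (cball 0 r) z *\<^sub>R grad g z) \<le> norm (2 * C * (indicator (cball 0 r) z * sing z))"
      using C by (simp add: abs_mult mult_ac sing_nn)
  qed
qed

text \<open>The derivative is moved onto \<open>f\<close>, whose gradient is continuous, while the
  gradient of the kernel enters as a locally integrable factor.\<close>

lemma (in singular_kernel) conv_derivative:
  fixes f :: "real ^ 'n \<Rightarrow> real"
  assumes f: "\<And>x. f differentiable at x" and b: "\<And>x. norm (grad f x) \<le> m" and c: "continuous_on UNIV (grad f)"
    and R: "\<And>x. norm x > R \<Longrightarrow> f x = 0"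
  obtains D where "\<And>x. ((\<lambda>x. - (LINT y|lborel. f y *\<^sub>R grad g (x - y))) has_derivative D x) (at x)"
    "\<And>h. continuous_on UNIV (\<lambda>x. D x h)"
proof -
  have f': "(f has_derivative (\<lambda>h. grad f x \<bullet> h)) (at x)" for x by (rule has_derivative_grad[OF f])
  have fc: "continuous_on UNIV f"
    using f by (meson continuous_at_imp_continuous_on differentiable_imp_continuous_within)
  have fm[measurable]: "f \<in> borel_measurable borel" using fc by (rule borel_measurable_continuous_onI)
  have gc: "continuous_on UNIV (\<lambda>x. grad f x \<bullet> h)" for h by (intro continuous_intros c)
  have gm: "(\<lambda>x. grad f x \<bullet> h) \<in> borel_measurable borel" for h using gc by (rule borel_measurable_continuous_onI)
  have gb: "\<bar>grad f x \<bullet> h\<bar> \<le> m * norm h" for x h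
    using Cauchy_Schwarz_ineq2[of "grad f x" h] mult_right_mono[OF b[of x] norm_ge_zero[of h]] by linarith
  have g0: "grad f x \<bullet> h = 0" if "norm x > R" for x h
    using has_derivative_eq_0_outside[OF R f' that] by (metis)
  define D where "D x h = - (LINT z|lborel. (grad f (x - z) \<bullet> h) *\<^sub>R grad g z)" for x h
  have eq: "(LINT y|lborel. f y *\<^sub>R grad g (x - y)) = (LINT z|lborel. f (x - z) *\<^sub>R grad g z)" for x
    using integral_lborel_reflect[of "\<lambda>z. f z *\<^sub>R grad g (x - z)" x] by simp
  show thesis
  proof
    show "((\<lambda>x. - (LINT y|lborel. f y *\<^sub>R grad g (x - y))) has_derivative D x) (at x)" for x
      unfolding eq D_def
      by (intro has_derivative_minus convolution_has_derivative[OF grad_loc_integrable grad_measurable f' gm gb R])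
    show "continuous_on UNIV (\<lambda>x. D x h)" for h
      unfolding D_def
      by (intro continuous_on_minus convolution_continuous[OF grad_loc_integrable grad_measurable gc gb g0])
  qed
qed

lemma yukawa_singular_kernel:
  assumes d: "2 \<le> CARD('n::finite)" and \<kappa>: "0 < \<kappa>"
  obtains C where "singular_kernel (gker \<kappa> :: real ^ 'n \<Rightarrow> real) (gprof TYPE('n) \<kappa>) (gprof' TYPE('n) \<kappa>) C"
proof -
  obtain C where C: "0 \<le> C" "\<And>s. 0 < s \<Longrightarrow> gprof TYPE('n) \<kappa> s \<le> C * s powr ((1 - real CARD('n)) / 2)"
    "\<And>s. 0 < s \<Longrightarrow> \<bar>gprof' TYPE('n) \<kappa> s\<bar> \<le> C * s powr (- real CARD('n) / 2)"
    using gprof_bounds[OF d \<kappa>] by blast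
  have "singular_kernel (gker \<kappa> :: real ^ 'n \<Rightarrow> real) (gprof TYPE('n) \<kappa>) (gprof' TYPE('n) \<kappa>) C"
    by (rule singular_kernel.intro[OF d gker_eq_gprof[OF \<kappa>] has_real_derivative_gprof[OF d \<kappa>]
          C1_pos_gprof'[OF d \<kappa>] C(1) gprof_nonneg C(2,3)])
  then show thesis by (rule that)
qed

lemma C0_norm_tendsto_0D:
  fixes F :: "real \<Rightarrow> real ^ 'n \<Rightarrow> real"
  assumes F: "((\<lambda>s. C0_norm \<beta> (F s)) \<longlongrightarrow> 0) (at t within {0..<Ts})" and T: "T < Ts" and e: "0 < e"
  shows "\<forall>\<^sub>F s in at t within {0..T}. \<forall>x. \<bar>F s x\<bar> \<le> e"
proof -
  have "\<forall>\<^sub>F s in at t within {0..<Ts}. C0_norm \<beta> (F s) < ennreal e"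
    using F by (rule order_tendstoD(2)) (use e in simp)
  moreover have "at t within {0..T} \<le> at t within {0..<Ts}" by (rule at_le) (use T in auto)
  ultimately have "\<forall>\<^sub>F s in at t within {0..T}. C0_norm \<beta> (F s) < ennreal e"
    by (rule filter_leD[rotated])
  then show ?thesis
  proof eventually_elim
    fix s assume "C0_norm \<beta> (F s) < ennreal e"
    moreover have "sup_norm (F s) \<le> C0_norm \<beta> (F s)" by (simp add: C0_norm_def)
    ultimately have "sup_norm (F s) \<le> ennreal e" by (meson less_imp_le order_trans)
    then show "\<forall>x. \<bar>F s x\<bar> \<le> e" using sup_norm_le_iff[of e "F s"] e by simp
  qed
qed

text \<open>Compactness of \<open>{0..T}\<close>: times at which the supremum exceeds
  \<open>n\<close> would accumulate at some \<open>t\<close>, near which \<open>F\<close> stays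
  within 1 of the bounded function \<open>F t\<close>.\<close>

lemma locally_sup_bounded_imp_bounded:
  fixes F :: "real \<Rightarrow> 'a \<Rightarrow> real"
  assumes loc: "\<And>t. t \<in> {0..T} \<Longrightarrow> \<forall>\<^sub>F s in at t within {0..T}. \<forall>x. \<bar>F s x - F t x\<bar> \<le> 1"
    and pt: "\<And>t. t \<in> {0..T} \<Longrightarrow> \<exists>m. \<forall>x. \<bar>F t x\<bar> \<le> m"
  shows "\<exists>M. \<forall>t\<in>{0..T}. \<forall>x. \<bar>F t x\<bar> \<le> M"
proof (rule ccontr)
  assume no: "\<not> (\<exists>M. \<forall>t\<in>{0..T}. \<forall>x. \<bar>F t x\<bar> \<le> M)"
  then have "\<forall>n::nat. \<exists>t. t \<in> {0..T} \<and> (\<exists>x. real n < \<bar>F t x\<bar>)" by (metis not_less)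
  then obtain \<tau> where \<tau>: "\<And>n::nat. \<tau> n \<in> {0..T}" "\<And>n. \<exists>x. real n < \<bar>F (\<tau> n) x\<bar>" by metis
  obtain t r where t: "t \<in> {0..T}" and r: "strict_mono r" "(\<tau> \<circ> r) \<longlonglongrightarrow> t"
    using compact_Icc[of 0 T] \<tau>(1) unfolding compact_def by metis
  obtain m where m: "\<And>x. \<bar>F t x\<bar> \<le> m" using pt[OF t] by blast
  obtain d where d: "0 < d" "\<And>s. s \<in> {0..T} \<Longrightarrow> s \<noteq> t \<Longrightarrow> dist s t < d \<Longrightarrow> \<forall>x. \<bar>F s x - F t x\<bar> \<le> 1"
    using loc[OF t] unfolding eventually_at by blast
  have "\<forall>\<^sub>F n in sequentially. dist ((\<tau> \<circ> r) n) t < d" using r(2) d(1) by (rule tendstoD)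
  moreover have "\<forall>\<^sub>F n in sequentially. m + 1 < real n"
    by (rule eventually_gt_at_top[THEN eventually_compose_filterlim, OF filterlim_real_sequentially])
  ultimately have "\<forall>\<^sub>F n in sequentially. dist ((\<tau> \<circ> r) n) t < d \<and> m + 1 < real n" by (rule eventually_conj)
  then obtain n where n: "dist (\<tau> (r n)) t < d" "m + 1 < real n" by (auto simp: eventually_sequentially)
  obtain x where x: "real (r n) < \<bar>F (\<tau> (r n)) x\<bar>" using \<tau>(2) by blast
  have "\<bar>F (\<tau> (r n)) x - F t x\<bar> \<le> 1"
    using d(2)[OF \<tau>(1) _ n(1)] by (cases "\<tau> (r n) = t") auto
  moreover have "real n \<le> real (r n)" using seq_suble[OF r(1), of n] by simp
  ultimately show False using x m[of x] n(2) by linarith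
qed

text \<open>The given bound \<open>\<Lambda>\<close> serves at once for the velocity, its Lipschitz
  constant and the density. The constants \<open>R\<close>, \<open>J\<close> and \<open>M\<close>
  are asserted to exist for the given \<open>\<kappa>\<close>, without uniformity.\<close>

lemma classical_solution_transport:
  fixes r :: "real \<Rightarrow> real ^ 'n \<Rightarrow> real"
  assumes k: "singular_kernel (gker \<kappa> :: real ^ 'n \<Rightarrow> real) G G' C"
    and T: "0 < T" "T < Ts" and \<beta>: "0 < \<beta>" and sol: "classical_solution \<beta> \<kappa> Ts \<rho>0 r" and \<Lambda>: "0 \<le> \<Lambda>"
    and bd: "\<And>t. t \<in> {0..T} \<Longrightarrow> Linf_norm (r t) \<le> ennreal \<Lambda>"
      "\<And>t. t \<in> {0..T} \<Longrightarrow> W1inf_norm (velocity \<kappa> (r t)) \<le> ennreal \<Lambda>"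
  obtains R J M r' where "transport T R \<Lambda> \<Lambda> J M r r' (\<lambda>t. velocity \<kappa> (r t))" "\<And>t x. t \<in> {0..T} \<Longrightarrow> r t x \<le> \<Lambda>"
proof -
  interpret singular_kernel "gker \<kappa> :: real ^ 'n \<Rightarrow> real" G G' C by (rule k)
  let ?u = "\<lambda>t. velocity \<kappa> (r t)"
  have u_eq: "?u t = (\<lambda>x. - (LINT y|lborel. r t y *\<^sub>R grad (gker \<kappa>) (x - y)))" for t
    by (simp add: velocity_def[abs_def] grad_gker_conv_def)
  obtain r' where r': "\<And>\<beta>'. 0 < \<beta>' \<Longrightarrow> \<beta>' < \<beta> \<Longrightarrow> C_time_C1 \<beta>' Ts r \<and> C1_time_C0 \<beta>' Ts r r'"
    and pde: "\<And>t x. t \<in> {0..<Ts} \<Longrightarrow> (\<lambda>y. r t y *\<^sub>R ?u t y) differentiable at x \<and> r' t x + divergence (\<lambda>y. r t y *\<^sub>R ?u t y) x = 0"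
    using sol unfolding classical_solution_def by blast
  have pd: "prob_density (r t)" if "t \<in> {0..<Ts}" for t using sol that unfolding classical_solution_def by blast
  obtain R where R: "\<And>t. t \<in> {0..T} \<Longrightarrow> supp (r t) \<subseteq> ball 0 R" using sol T unfolding classical_solution_def by blast
  \<comment> \<open>The solution class provides continuity in time for every exponent strictly below
    \<open>\<beta>\<close>; one such exponent is fixed.\<close>
  have \<beta>2: "0 < \<beta> / 2" "\<beta> / 2 < \<beta>" using \<beta> by auto
  have sub: "t \<in> {0..T} \<Longrightarrow> t \<in> {0..<Ts}" for t using T by auto
  have C1: "r t \<in> C1_space (\<beta> / 2)" if "t \<in> {0..T}" for t
    using r'[OF \<beta>2] sub[OF that] unfolding C_time_C1_def by blast
  have time: "r' t \<in> C0_space (\<beta> / 2)"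
    "((\<lambda>s. C0_norm (\<beta> / 2) (\<lambda>x. (r s x - r t x) / (s - t) - r' t x)) \<longlongrightarrow> 0) (at t within {0..<Ts})"
    "((\<lambda>s. C0_norm (\<beta> / 2) (\<lambda>x. r' s x - r' t x)) \<longlongrightarrow> 0) (at t within {0..<Ts})" if "t \<in> {0..T}" for t
    using r'[OF \<beta>2] sub[OF that] unfolding C1_time_C0_def by blast+
  have diff: "r t differentiable at x" if "t \<in> {0..T}" for t x using C1[OF that] by (simp add: C1_space_def)
  have C1n: "sup_norm (grad (r t)) < \<infinity>" "holder_seminorm (\<beta> / 2) (grad (r t)) < \<infinity>" if "t \<in> {0..T}" for t
    using C1[OF that] by (auto simp: C1_space_def C1_norm_def ennreal_add_eq_top less_top)
  have supp0: "r t x = 0" if "t \<in> {0..T}" "norm x > R" for t x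
    using supp_subset_ball_eq_0[OF R[OF that(1)] that(2)] .
  have rc: "continuous_on UNIV (r t)" if "t \<in> {0..T}" for t
    using diff[OF that] by (meson continuous_at_imp_continuous_on differentiable_imp_continuous_within)
  have rb: "\<bar>r t x\<bar> \<le> \<Lambda>" if "t \<in> {0..T}" for t x
    using Linf_norm_le_continuous[OF rc[OF that] bd(1)[OF that] \<Lambda>] by simp
  have rm: "r t \<in> borel_measurable borel" if "t \<in> {0..T}" for t using rc[OF that] by (rule borel_measurable_continuous_onI)
  have gbound: "\<exists>m\<ge>0. \<forall>x. norm (grad (r t) x) \<le> m" if "t \<in> {0..T}" for t
    using C1n(1)[OF that] by (rule sup_norm_finiteE) blast
  have uD: "\<exists>D. (\<forall>x. (?u t has_derivative D x) (at x)) \<and> (\<forall>h. continuous_on UNIV (\<lambda>x. D x h))" if t: "t \<in> {0..T}" for t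
  proof -
    obtain m where m: "\<And>x. norm (grad (r t) x) \<le> m" using gbound[OF t] by blast
    have gc: "continuous_on UNIV (grad (r t))" by (rule holder_continuous_on[OF \<beta>2(1) C1n(2)[OF t]])
    show ?thesis
      by (rule conv_derivative[OF diff[OF t] m gc supp0[OF t]]) (assumption, unfold u_eq, blast)
  qed
  have u_lip: "\<Lambda>-lipschitz_on UNIV (?u t)" if t: "t \<in> {0..T}" for t
  proof -
    obtain D where D: "\<And>x. (?u t has_derivative D x) (at x)" "\<And>h. continuous_on UNIV (\<lambda>x. D x h)" using uD[OF t] by blast
    have "Linf_grad (?u t) \<le> W1inf_norm (?u t)" by (simp add: W1inf_norm_def)
    then have "Linf_grad (?u t) \<le> ennreal \<Lambda>" using bd(2)[OF t] by (rule order_trans)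
    then show ?thesis using \<Lambda> D by (rule Linf_grad_le_lipschitz)
  qed
  have u_bd: "norm (?u t x) \<le> \<Lambda>" if t: "t \<in> {0..T}" for t x
  proof -
    have "Linf_norm (?u t) \<le> W1inf_norm (?u t)" by (simp add: W1inf_norm_def)
    then have "Linf_norm (?u t) \<le> ennreal \<Lambda>" using bd(2)[OF t] by (rule order_trans)
    then show ?thesis by (intro Linf_norm_le_continuous lipschitz_on_continuous_on[OF u_lip[OF t]] \<Lambda>)
  qed
  have "\<exists>M. \<forall>t\<in>{0..T}. \<forall>x. \<bar>r' t x\<bar> \<le> M"
  proof (rule locally_sup_bounded_imp_bounded)
    show "\<forall>\<^sub>F s in at t within {0..T}. \<forall>x. \<bar>r' s x - r' t x\<bar> \<le> 1" if "t \<in> {0..T}" for t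
      by (rule C0_norm_tendsto_0D[OF time(3)[OF that] T(2)]) simp
    show "\<exists>m. \<forall>x. \<bar>r' t x\<bar> \<le> m" if "t \<in> {0..T}" for t
    proof -
      have "sup_norm (r' t) < \<infinity>" using time(1)[OF that] by (simp add: C0_space_def C0_norm_def ennreal_add_eq_top less_top)
      then have "\<exists>c\<ge>0. \<forall>x. norm (r' t x) \<le> c" by (rule sup_norm_finiteE) blast
      then show ?thesis by auto
    qed
  qed
  then obtain M where M: "\<And>t x. t \<in> {0..T} \<Longrightarrow> \<bar>r' t x\<bar> \<le> M" by blast
  have M0: "0 \<le> M" using M[of 0 0] T by simp
  have r_time: "\<forall>\<^sub>F s in at t within {0..T}. \<forall>x. \<bar>r s x - r t x - (s - t) * r' t x\<bar> \<le> e * \<bar>s - t\<bar>"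
    if t: "t \<in> {0..T}" and e: "0 < e" for t e
  proof -
    have ne: "\<forall>\<^sub>F s in at t within {0..T}. s \<noteq> t" by (simp add: eventually_at_filter)
    show ?thesis
      using C0_norm_tendsto_0D[OF time(2)[OF t] T(2) e] ne
    proof eventually_elim
      fix s assume b: "\<forall>x. \<bar>(r s x - r t x) / (s - t) - r' t x\<bar> \<le> e" and ne: "s \<noteq> t"
      show "\<forall>x. \<bar>r s x - r t x - (s - t) * r' t x\<bar> \<le> e * \<bar>s - t\<bar>"
      proof
        fix x
        have "r s x - r t x - (s - t) * r' t x = ((r s x - r t x) / (s - t) - r' t x) * (s - t)"
          using ne by (simp add: field_simps)
        then have "\<bar>r s x - r t x - (s - t) * r' t x\<bar> = \<bar>(r s x - r t x) / (s - t) - r' t x\<bar> * \<bar>s - t\<bar>"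
          by (simp only: abs_mult)
        also have "\<dots> \<le> e * \<bar>s - t\<bar>" using b by (intro mult_right_mono) auto
        finally show "\<bar>r s x - r t x - (s - t) * r' t x\<bar> \<le> e * \<bar>s - t\<bar>" .
      qed
    qed
  qed
  have r_vd: "((\<lambda>s. r s x) has_vector_derivative r' t x) (at t within {0..T})" if t: "t \<in> {0..T}" for t x
    unfolding has_vector_derivative_def has_derivative_within_alt
  proof (intro conjI allI impI)
    show "bounded_linear (\<lambda>h. h *\<^sub>R r' t x)" by (rule bounded_linear_scaleR_left)
    fix e :: real assume e: "0 < e"
    obtain d where d: "0 < d" "\<And>s. s \<in> {0..T} \<Longrightarrow> s \<noteq> t \<Longrightarrow> dist s t < d \<Longrightarrow> \<forall>x. \<bar>r s x - r t x - (s - t) * r' t x\<bar> \<le> e * \<bar>s - t\<bar>"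
      using r_time[OF t e] unfolding eventually_at by blast
    show "\<exists>d>0. \<forall>s\<in>{0..T}. norm (s - t) < d \<longrightarrow> norm (r s x - r t x - (s - t) *\<^sub>R r' t x) \<le> e * norm (s - t)"
    proof (intro exI[of _ d] conjI d(1) ballI impI)
      fix s assume s: "s \<in> {0..T}" "norm (s - t) < d"
      show "norm (r s x - r t x - (s - t) *\<^sub>R r' t x) \<le> e * norm (s - t)"
      proof (cases "s = t")
        case False then show ?thesis using d(2)[OF s(1) False] s(2) by (simp add: dist_real_def)
      qed simp
    qed
  qed
  have r_lip: "\<bar>r s x - r t x\<bar> \<le> M * \<bar>s - t\<bar>" if "s \<in> {0..T}" "t \<in> {0..T}" for s t x
  proof -
    have "norm (r s x - r t x) \<le> M * \<bar>s - t\<bar>"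
      by (rule has_vector_derivative_imp_le[OF r_vd _ that]) (use M in auto)
    then show ?thesis by simp
  qed
  \<comment> \<open>The density is Lipschitz in time with constant \<open>M\<close>, uniformly in
    space; convolution with the gradient of the kernel transfers this to the velocity.\<close>
  define J where "J = M * (2 * C * (sing_mass + measure lborel (cball (0::real^'n) R)))"
  have J0: "0 \<le> J" unfolding J_def using M0 C sing_mass_nn by simp
  have u_time: "norm (?u s x - ?u t x) \<le> J * \<bar>s - t\<bar>" if st: "s \<in> {0..T}" "t \<in> {0..T}" for s t x
  proof -
    have C2: "0 \<le> 2 * C" using C by simp
    have i: "integrable lborel (\<lambda>y. r t y *\<^sub>R grad (gker \<kappa>) (x - y))" if "t \<in> {0..T}" for t
      by (rule sing_convolution(1)[OF grad_measurable grad_le_sing C2 rm[OF that] rb[OF that] supp0[OF that]])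
    have dm: "(\<lambda>y. r s y - r t y) \<in> borel_measurable borel" using rm st by (intro borel_measurable_diff) auto
    have d0: "r s y - r t y = 0" if "norm y > R" for y using supp0[OF st(1) that] supp0[OF st(2) that] by simp
    have "norm (LINT y|lborel. (r s y - r t y) *\<^sub>R grad (gker \<kappa>) (x - y))
      \<le> (M * \<bar>s - t\<bar>) * (2 * C * (sing_mass + measure lborel (cball (0::real^'n) R)))"
      by (rule sing_convolution(2)[OF grad_measurable grad_le_sing C2 dm r_lip[OF st] d0])
    moreover have "?u s x - ?u t x = - (LINT y|lborel. (r s y - r t y) *\<^sub>R grad (gker \<kappa>) (x - y))"
      unfolding u_eq scaleR_left_diff_distrib Bochner_Integration.integral_diff[OF i[OF st(1)] i[OF st(2)]] by simp
    ultimately show ?thesis by (simp add: J_def mult_ac)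
  qed
  have "transport T R \<Lambda> \<Lambda> J M r r' ?u"
  proof
    show "0 \<le> T" "0 \<le> \<Lambda>" "0 \<le> J" using T \<Lambda> J0 by auto
    show "norm (?u t x) \<le> \<Lambda>" if "t \<in> {0..T}" for t x by (rule u_bd[OF that])
    show "\<Lambda>-lipschitz_on UNIV (?u t)" if "t \<in> {0..T}" for t by (rule u_lip[OF that])
    show "?u t differentiable at x" if "t \<in> {0..T}" for t x using uD[OF that] unfolding differentiable_def by blast
    show "norm (?u s x - ?u t x) \<le> J * \<bar>s - t\<bar>" if "s \<in> {0..T}" "t \<in> {0..T}" for s t x by (rule u_time[OF that])
    fix t assume t: "t \<in> {0..T}"
    show "0 \<le> r t x" for x by (rule prob_densityD(2)[OF pd[OF sub[OF t]]])
    show "integrable lborel (r t)" by (rule prob_densityD(3)[OF pd[OF sub[OF t]]])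
    show "(LINT x|lborel. r t x) = 1" by (rule prob_densityD(4)[OF pd[OF sub[OF t]]])
    show "r t x = 0" if "R < norm x" for x by (rule supp0[OF t that])
    show "\<bar>r' t x\<bar> \<le> M" for x by (rule M[OF t])
    show "\<forall>\<^sub>F s in at t within {0..T}. \<forall>x. \<bar>r s x - r t x - (s - t) * r' t x\<bar> \<le> e * \<bar>s - t\<bar>" if "0 < e" for e
      by (rule r_time[OF t that])
    show "\<forall>\<^sub>F s in at t within {0..T}. \<forall>x. \<bar>r' s x - r' t x\<bar> \<le> e" if "0 < e" for e
      by (rule C0_norm_tendsto_0D[OF time(3)[OF t] T(2) that])
    obtain m where m: "0 \<le> m" "\<And>x. norm (grad (r t) x) \<le> m" using gbound[OF t] by blast
    have rl: "norm (r t x - r t y) \<le> m * norm (x - y)" for x y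
    proof (rule differentiable_bound[of UNIV _ "\<lambda>x h. grad (r t) x \<bullet> h"])
      show "(r t has_derivative (\<lambda>h. grad (r t) x \<bullet> h)) (at x within UNIV)" for x using has_derivative_grad[OF diff[OF t]] by simp
      show "onorm (\<lambda>h. grad (r t) x \<bullet> h) \<le> m" for x
      proof (rule onorm_le)
        fix h
        have "norm (grad (r t) x \<bullet> h) \<le> norm (grad (r t) x) * norm h" by (simp add: Cauchy_Schwarz_ineq2)
        also have "\<dots> \<le> m * norm h" by (intro mult_right_mono m) simp
        finally show "norm (grad (r t) x \<bullet> h) \<le> m * norm h" .
      qed
    qed auto
    have "(\<Lambda> * \<Lambda> + m * \<Lambda>)-lipschitz_on UNIV (\<lambda>x. r t x *\<^sub>R ?u t x)"
    proof (rule lipschitz_on_normI)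
      show "0 \<le> \<Lambda> * \<Lambda> + m * \<Lambda>" using \<Lambda> m by simp
      fix x y
      have "r t x *\<^sub>R ?u t x - r t y *\<^sub>R ?u t y = r t x *\<^sub>R (?u t x - ?u t y) + (r t x - r t y) *\<^sub>R ?u t y"
        by (simp add: algebra_simps)
      then have "norm (r t x *\<^sub>R ?u t x - r t y *\<^sub>R ?u t y) \<le> \<bar>r t x\<bar> * norm (?u t x - ?u t y) + \<bar>r t x - r t y\<bar> * norm (?u t y)"
        by (metis norm_scaleR norm_triangle_ineq)
      also have "\<dots> \<le> \<Lambda> * (\<Lambda> * norm (x - y)) + (m * norm (x - y)) * \<Lambda>"
        using rb[OF t] lipschitz_on_normD[OF u_lip[OF t]] rl[of x y] u_bd[OF t] \<Lambda> m by (intro add_mono mult_mono) auto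
      finally show "norm (r t x *\<^sub>R ?u t x - r t y *\<^sub>R ?u t y) \<le> (\<Lambda> * \<Lambda> + m * \<Lambda>) * norm (x - y)" by (simp add: algebra_simps)
    qed
    then show "\<exists>L. L-lipschitz_on UNIV (\<lambda>x. r t x *\<^sub>R ?u t x)" by blast
    show "\<exists>v'. \<forall>x. ((\<lambda>x. r t x *\<^sub>R ?u t x) has_derivative v' x) (at x) \<and> (\<Sum>b\<in>Basis. v' x b \<bullet> b) = - r' t x"
    proof (intro exI[of _ "\<lambda>x. frechet_derivative (\<lambda>x. r t x *\<^sub>R ?u t x) (at x)"] allI conjI)
      fix x
      show "((\<lambda>x. r t x *\<^sub>R ?u t x) has_derivative frechet_derivative (\<lambda>x. r t x *\<^sub>R ?u t x) (at x)) (at x)"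
        using pde[OF sub[OF t], of x] by (simp add: frechet_derivative_works)
      have "(\<Sum>b\<in>Basis. frechet_derivative (\<lambda>x. r t x *\<^sub>R ?u t x) (at x) b \<bullet> b) = divergence (\<lambda>x. r t x *\<^sub>R ?u t x) x"
        unfolding sum_Basis_vec divergence_def by (simp add: inner_axis)
      also have "\<dots> = - r' t x" using pde[OF sub[OF t], of x] by linarith
      finally show "(\<Sum>b\<in>Basis. frechet_derivative (\<lambda>x. r t x *\<^sub>R ?u t x) (at x) b \<bullet> b) = - r' t x" .
    qed
  qed
  moreover have "r t x \<le> \<Lambda>" if "t \<in> {0..T}" for t x using rb[OF that, of x] by linarith
  ultimately show thesis by (rule that)
qed

text \<open>The supremum in \<open>Lambda_T\<close> is dominated by the finite one in
  \<open>solution_family\<close>, so \<open>enn2real\<close> loses nothing.\<close>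

lemma solution_family_bounds:
  fixes \<rho> :: "real \<Rightarrow> real \<Rightarrow> real ^ 'n \<Rightarrow> real"
  assumes fam: "solution_family \<beta> \<kappa>s Ts \<rho>0 \<rho>" and T: "0 < T" "T < Ts"
  shows "1 \<le> Lambda_T \<kappa>s T \<rho>"
    and "\<And>\<kappa> t. \<kappa> \<in> {0..\<kappa>s} \<Longrightarrow> t \<in> {0..T} \<Longrightarrow> Linf_norm (\<rho> \<kappa> t) \<le> ennreal (Lambda_T \<kappa>s T \<rho>)"
    and "\<And>\<kappa> t. \<kappa> \<in> {0..\<kappa>s} \<Longrightarrow> t \<in> {0..T} \<Longrightarrow> W1inf_norm (velocity \<kappa> (\<rho> \<kappa> t)) \<le> ennreal (Lambda_T \<kappa>s T \<rho>)"
proof -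
  define S where "S = (SUP \<kappa>\<in>{0..\<kappa>s}. SUP t\<in>{0..T}. Linf_norm (\<rho> \<kappa> t) + W1inf_norm (velocity \<kappa> (\<rho> \<kappa> t)))"
  have "S \<le> (SUP \<kappa>\<in>{0..\<kappa>s}. SUP t\<in>{0..T}.
           Linf_norm (\<rho> \<kappa> t) + holder_seminorm \<beta> (\<rho> \<kappa> t)
           + (\<integral>\<^sup>+x. ennreal ((norm x)\<^sup>2 * \<rho> \<kappa> t x) \<partial>lborel)
           + W1inf_norm (velocity \<kappa> (\<rho> \<kappa> t)))"
    unfolding S_def by (intro SUP_mono' add_right_mono) (simp add: add.assoc)
  also have "\<dots> < \<infinity>" using fam T unfolding solution_family_def by blast
  finally have S: "S < \<infinity>" .
  then have S1: "ennreal (Lambda_T \<kappa>s T \<rho>) = 1 + S" unfolding Lambda_T_def S_def[symmetric]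
    by (simp add: ennreal_add_eq_top less_top)
  have "(1::ennreal) \<le> ennreal (Lambda_T \<kappa>s T \<rho>)" unfolding S1 by simp
  then show "1 \<le> Lambda_T \<kappa>s T \<rho>" by simp
  have le: "Linf_norm (\<rho> \<kappa> t) + W1inf_norm (velocity \<kappa> (\<rho> \<kappa> t)) \<le> ennreal (Lambda_T \<kappa>s T \<rho>)"
    if "\<kappa> \<in> {0..\<kappa>s}" "t \<in> {0..T}" for \<kappa> t
  proof -
    have "Linf_norm (\<rho> \<kappa> t) + W1inf_norm (velocity \<kappa> (\<rho> \<kappa> t)) \<le> S"
      unfolding S_def by (rule SUP_upper2[OF that(1)], rule SUP_upper[OF that(2)])
    also have "\<dots> \<le> 1 + S" by simp
    finally show ?thesis unfolding S1 .
  qed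
  show "Linf_norm (\<rho> \<kappa> t) \<le> ennreal (Lambda_T \<kappa>s T \<rho>)" if "\<kappa> \<in> {0..\<kappa>s}" "t \<in> {0..T}" for \<kappa> t
    using le[OF that] by (rule order_trans[rotated]) simp
  show "W1inf_norm (velocity \<kappa> (\<rho> \<kappa> t)) \<le> ennreal (Lambda_T \<kappa>s T \<rho>)" if "\<kappa> \<in> {0..\<kappa>s}" "t \<in> {0..T}" for \<kappa> t
    using le[OF that] by (rule order_trans[rotated]) simp
qed

section \<open>Random initial data\<close>

lemma collisions_iff: "X \<in> space (config N) \<Longrightarrow> X \<notin> collisions N \<longleftrightarrow> (\<forall>i<N. \<forall>j<N. i \<noteq> j \<longrightarrow> X i \<noteq> X j)"
  by (auto simp: collisions_def)

text \<open>The constant \<open>b\<close> stands for \<open>B * eps - c_ren / N\<close>: adding it to the modulated energy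
  gives the renormalised energy plus the error term, which is nonnegative.\<close>

locale chaos = singular_kernel "gker \<kappa> :: real ^ 'n \<Rightarrow> real" G G' C
    + transport T R \<Lambda> \<Lambda> J M r r' "\<lambda>t. velocity \<kappa> (r t)"
  for \<kappa> G G' C T R \<Lambda> J M and r r' :: "real \<Rightarrow> real ^ 'n \<Rightarrow> real" +
  fixes N :: nat and \<Phi> :: "real \<Rightarrow> (nat \<Rightarrow> real ^ 'n) \<Rightarrow> nat \<Rightarrow> real ^ 'n" and b c :: real
  assumes r_bd: "\<And>t x. t \<in> {0..T} \<Longrightarrow> r t x \<le> \<Lambda>"
    and N: "0 < N"
    and flow: "particle_flow \<kappa> N \<Phi>"
    and c: "0 \<le> c"
    and lower: "\<And>t X. t \<in> {0..T} \<Longrightarrow> X \<in> space (config N) - collisions N \<Longrightarrow> 0 \<le> mod_energy \<kappa> N X (r t) + b"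
    and comm: "\<And>t X. t \<in> {0..T} \<Longrightarrow> X \<in> space (config N) - collisions N \<Longrightarrow>
      \<bar>commutator \<kappa> N X (r t) (velocity \<kappa> (r t))\<bar> \<le> c * (mod_energy \<kappa> N X (r t) + b)"
begin

lemma flow_measurable: "0 \<le> t \<Longrightarrow> \<Phi> t \<in> measurable (config N) (config N)"
  using flow by (simp add: particle_flow_def)

lemma flow_in: "0 \<le> t \<Longrightarrow> X \<in> space (config N) - collisions N \<Longrightarrow> \<Phi> t X \<in> space (config N) - collisions N"
  using flow measurable_space[OF flow_measurable, of t X] by (auto simp: particle_flow_def)

lemma flow_0: "X \<in> space (config N) - collisions N \<Longrightarrow> \<Phi> 0 X = X"
  using flow unfolding particle_flow_def by blast

lemma flow_der:
  assumes "X \<in> space (config N) - collisions N" "0 \<le> t" "i < N"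
  shows "((\<lambda>s. \<Phi> s X i) has_vector_derivative
    - (1 / real N) *\<^sub>R (\<Sum>j\<in>{..<N} - {i}. grad (gker \<kappa>) (\<Phi> t X i - \<Phi> t X j))) (at t within {0..})"
  using flow assms unfolding particle_flow_def by blast

lemma noncollision: "0 \<le> t \<Longrightarrow> X \<in> space (config N) - collisions N \<Longrightarrow> i < N \<Longrightarrow> j < N \<Longrightarrow> i \<noteq> j \<Longrightarrow> \<Phi> t X i \<noteq> \<Phi> t X j"
  using flow_in[of t X] collisions_iff[of "\<Phi> t X" N] by blast

lemma particle_energy:
  assumes X: "X \<in> space (config N) - collisions N"
  shows "particle_energy (gker \<kappa>) G G' C T R \<Lambda> \<Lambda> J M r r' (\<lambda>t. velocity \<kappa> (r t)) \<Lambda> N (\<lambda>t. \<Phi> t X)"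
proof
  show "r t z \<le> \<Lambda>" if "t \<in> {0..T}" for t z by (rule r_bd[OF that])
  show "velocity \<kappa> (r t) z = - (LINT y|lborel. r t y *\<^sub>R grad (gker \<kappa>) (z - y))" for t z
    by (simp add: velocity_def grad_gker_conv_def)
  show "0 < N" by (rule N)
  show "\<Phi> t X i \<noteq> \<Phi> t X j" if "t \<in> {0..T}" "i < N" "j < N" "i \<noteq> j" for t i j
    using that X by (intro noncollision) auto
  show "((\<lambda>s. \<Phi> s X i) has_vector_derivative
    - (1 / real N) *\<^sub>R (\<Sum>j\<in>{..<N} - {i}. grad (gker \<kappa>) (\<Phi> t X i - \<Phi> t X j))) (at t within {0..T})"
    if "t \<in> {0..T}" "i < N" for t i
    by (rule has_vector_derivative_within_subset[OF flow_der[OF X]]) (use that in auto)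
qed

lemma gker_minus: "gker \<kappa> (- x) = gker \<kappa> (x :: real ^ 'n)"
  by (cases "x = 0") (simp_all add: g_eq)

lemma zero_T: "0 \<in> {0..T}" using T by simp

lemma kd: "t \<in> {0..T} \<Longrightarrow> kernel_density (gker \<kappa> :: real ^ 'n \<Rightarrow> real) G G' C (r t) \<Lambda> R"
  using \<rho>_meas \<rho>_nn r_bd \<rho>_supp prob_space_law_at
  by (intro kernel_density.intro kernel_density_axioms.intro singular_kernel_axioms) (auto simp: law_at_def)

lemma mod_energy_expand:
  assumes t: "t \<in> {0..T}" and X: "X \<in> space (config N) - collisions N"
  shows "mod_energy \<kappa> N X (r t) = (1 / real N)\<^sup>2 * (\<Sum>i<N. \<Sum>j\<in>{..<N} - {i}. gker \<kappa> (X i - X j))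
     - 2 / real N * (\<Sum>i<N. LINT z|law_at t. gker \<kappa> (X i - z))
     + (LINT p|(law_at t \<Otimes>\<^sub>M law_at t). gker \<kappa> (fst p - snd p))"
proof -
  interpret kd: kernel_density "gker \<kappa> :: real ^ 'n \<Rightarrow> real" G G' C "r t" \<Lambda> R by (rule kd[OF t])
  have i: "integrable (law_at t) (\<lambda>z. gker \<kappa> (x - z))" for x
  proof -
    have "norm (gker \<kappa> y) \<le> C * sing y" if "y \<noteq> 0" for y :: "real^'n" using g_le_sing[OF that] by simp
    from kd.sing_mu(1)[OF g_measurable this C] show ?thesis unfolding kd.\<mu>_def law_at_def by this
  qed
  have sym: "gker \<kappa> (z - x) = gker \<kappa> (x - z)" for z x :: "real^'n" using gker_minus[of "x - z"] by simp
  have "modulated_integral (\<lambda>x y. gker \<kappa> (x - y)) N X (r t) = (1 / real N)\<^sup>2 * (\<Sum>i<N. \<Sum>j\<in>{..<N} - {i}. gker \<kappa> (X i - X j))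
    - (\<Sum>i<N. LINT z|law_at t. gker \<kappa> (X i - z)) / real N - (\<Sum>i<N. LINT z|law_at t. gker \<kappa> (z - X i)) / real N
    + (LINT p|(law_at t \<Otimes>\<^sub>M law_at t). gker \<kappa> (fst p - snd p))"
    unfolding law_at_def
  proof (rule modulated_integral_expand[OF N])
    show "X i \<noteq> X j" if "i < N" "j < N" "i \<noteq> j" for i j using X that collisions_iff by blast
    show "prob_space (density lborel (\<lambda>x. ennreal (r t x)))" by (rule kd.\<rho>_prob)
    show "r t \<in> borel_measurable borel" by (rule \<rho>_meas[OF t])
    show "(\<lambda>p. gker \<kappa> (fst p - snd p :: real^'n)) \<in> borel_measurable (borel \<Otimes>\<^sub>M borel)" by measurable
    show "integrable (density lborel (\<lambda>x. ennreal (r t x))) (\<lambda>y. gker \<kappa> (x - y))"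
      "integrable (density lborel (\<lambda>x. ennreal (r t x))) (\<lambda>z. gker \<kappa> (z - x))" for x
      using i[of x] unfolding law_at_def sym[of _ x] by auto
  qed
  moreover have "(LINT z|law_at t. gker \<kappa> (z - X i)) = (LINT z|law_at t. gker \<kappa> (X i - z))" for i
    by (rule Bochner_Integration.integral_cong[OF refl]) (rule sym)
  ultimately show ?thesis unfolding mod_energy_def by simp
qed

lemma mod_energy_eq:
  assumes t: "t \<in> {0..T}" and X: "X \<in> space (config N) - collisions N"
  shows "mod_energy \<kappa> N (\<Phi> t X) (r t) = particle_energy.energy (gker \<kappa>) r N (\<lambda>t. \<Phi> t X) (gker \<kappa>) t"
proof -
  interpret pe: particle_energy "gker \<kappa>" G G' C T R \<Lambda> \<Lambda> J M r r' "\<lambda>t. velocity \<kappa> (r t)" \<Lambda> N "\<lambda>t. \<Phi> t X"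
    by (rule particle_energy[OF X])
  show ?thesis unfolding pe.energy_def
    by (rule mod_energy_expand[OF t flow_in[OF _ X]]) (use t in simp)
qed

lemma commutator_eq:
  assumes t: "t \<in> {0..T}" and X: "X \<in> space (config N) - collisions N"
  shows "commutator \<kappa> N (\<Phi> t X) (r t) (velocity \<kappa> (r t))
    = particle_energy.commut (gker \<kappa>) r (\<lambda>t. velocity \<kappa> (r t)) N (\<lambda>t. \<Phi> t X) t"
proof -
  interpret pe: particle_energy "gker \<kappa>" G G' C T R \<Lambda> \<Lambda> J M r r' "\<lambda>t. velocity \<kappa> (r t)" \<Lambda> N "\<lambda>t. \<Phi> t X"
    by (rule particle_energy[OF X])
  interpret kd: kernel_density "gker \<kappa> :: real ^ 'n \<Rightarrow> real" G G' C "r t" \<Lambda> R by (rule kd[OF t])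
  let ?u = "velocity \<kappa> (r t)"
  define f where "f x y = (?u x - ?u y) \<bullet> grad (gker \<kappa>) (x - y)" for x y
  have um[measurable]: "?u \<in> borel_measurable borel" by (rule pe.u_meas[OF t])
  have sym: "f z x = f x z" for z x
  proof (cases "x = z")
    case False
    have 1: "grad (gker \<kappa>) (z - x) = - grad (gker \<kappa>) (x - z)" using grad_minus[of "x - z"] False by simp
    have 2: "?u z - ?u x = - (?u x - ?u z)" by simp
    show ?thesis unfolding f_def 1 2 by (simp only: inner_minus_left inner_minus_right minus_minus)
  qed simp
  have fsym: "(\<lambda>z. f z x) = f x" for x by (rule ext) (rule sym)
  have f_eq: "f x y = grad (gker \<kappa>) (x - y) \<bullet> (?u x - ?u y)" for x y by (simp add: f_def inner_commute)
  have i: "integrable (law_at t) (f x)" for x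
  proof -
    have "integrable kd.\<mu> (\<lambda>z. grad (gker \<kappa>) (x - z) \<bullet> (?u x - ?u z))"
    proof (rule kd.integrable_kernel_dot)
      show "(grad (gker \<kappa>) :: real^'n \<Rightarrow> _) \<in> borel_measurable borel" by (rule grad_measurable)
      show "norm (grad (gker \<kappa>) y) \<le> 2 * C * sing y" if "y \<noteq> 0" for y :: "real^'n" using that by (rule grad_le_sing)
      show "(\<lambda>z. ?u x - ?u z) \<in> borel_measurable borel" by (intro borel_measurable_diff borel_measurable_const um)
      show "norm (?u x - ?u z) \<le> \<Lambda> + \<Lambda>" for z
        using norm_triangle_ineq4[of "?u x" "?u z"] u_bd[OF t, of x] u_bd[OF t, of z] by linarith
    qed
    then show ?thesis by (simp add: kd.\<mu>_def law_at_def f_eq[abs_def])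
  qed
  have "modulated_integral f N (\<Phi> t X) (r t) = (1 / real N)\<^sup>2 * (\<Sum>i<N. \<Sum>j\<in>{..<N} - {i}. f (\<Phi> t X i) (\<Phi> t X j))
    - (\<Sum>i<N. LINT z|law_at t. f (\<Phi> t X i) z) / real N - (\<Sum>i<N. LINT z|law_at t. f z (\<Phi> t X i)) / real N
    + (LINT p|(law_at t \<Otimes>\<^sub>M law_at t). f (fst p) (snd p))"
    unfolding law_at_def
  proof (rule modulated_integral_expand[OF N])
    show "\<Phi> t X i \<noteq> \<Phi> t X j" if "i < N" "j < N" "i \<noteq> j" for i j using noncollision[of t X i j] t X that by simp
    show "prob_space (density lborel (\<lambda>x. ennreal (r t x)))" by (rule kd.\<rho>_prob)
    show "r t \<in> borel_measurable borel" by (rule \<rho>_meas[OF t])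
    show "(\<lambda>p. f (fst p) (snd p)) \<in> borel_measurable (borel \<Otimes>\<^sub>M borel)" unfolding f_def by measurable
    show "integrable (density lborel (\<lambda>x. ennreal (r t x))) (f x)" for x using i[of x] by (simp add: law_at_def)
    then show "integrable (density lborel (\<lambda>x. ennreal (r t x))) (\<lambda>z. f z x)" for x
      unfolding fsym by this
  qed
  then have "modulated_integral f N (\<Phi> t X) (r t) = (1 / real N)\<^sup>2 * (\<Sum>i<N. \<Sum>j\<in>{..<N} - {i}. f (\<Phi> t X i) (\<Phi> t X j))
    - 2 / real N * (\<Sum>i<N. LINT z|law_at t. f (\<Phi> t X i) z) + (LINT p|(law_at t \<Otimes>\<^sub>M law_at t). f (fst p) (snd p))"
    unfolding fsym by simp
  then show ?thesis
    unfolding commutator_def pe.commut_def f_def[symmetric, abs_def] f_eq[symmetric] by simp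
qed

lemma dissipation_eq:
  assumes t: "t \<in> {0..T}" and X: "X \<in> space (config N) - collisions N"
  shows "dissipation \<kappa> N (\<Phi> t X) (r t)
    = ennreal (particle_energy.dissip (gker \<kappa>) (\<lambda>t. velocity \<kappa> (r t)) N (\<lambda>t. \<Phi> t X) t)"
proof -
  interpret pe: particle_energy "gker \<kappa>" G G' C T R \<Lambda> \<Lambda> J M r r' "\<lambda>t. velocity \<kappa> (r t)" \<Lambda> N "\<lambda>t. \<Phi> t X"
    by (rule particle_energy[OF X])
  have "\<Phi> t X \<notin> collisions N" using flow_in[of t X] t X by simp
  moreover have "norm (pe.v t i - velocity \<kappa> (r t) (\<Phi> t X i))
      = norm ((1 / real N) *\<^sub>R (\<Sum>j\<in>{..<N} - {i}. grad (gker \<kappa>) (\<Phi> t X i - \<Phi> t X j)) - grad_gker_conv \<kappa> (r t) (\<Phi> t X i))" for i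
  proof -
    have "pe.v t i - velocity \<kappa> (r t) (\<Phi> t X i)
      = - ((1 / real N) *\<^sub>R (\<Sum>j\<in>{..<N} - {i}. grad (gker \<kappa>) (\<Phi> t X i - \<Phi> t X j)) - grad_gker_conv \<kappa> (r t) (\<Phi> t X i))"
      by (simp add: pe.v_def velocity_def)
    then show ?thesis by (simp only: norm_minus_cancel)
  qed
  ultimately show ?thesis by (simp add: dissipation_def pe.dissip_def)
qed

text \<open>Growth factors of the two Gronwall steps: \<open>amp\<close> for the modulated energy,
  \<open>amp2\<close> for the coupling, which is driven by a dissipation already amplified by
  \<open>amp\<close>.\<close>

definition amp :: real where "amp = exp (c * T)"

definition amp2 :: real where "amp2 = exp ((1 + 2 * \<Lambda>) * T) * amp"

definition init_energy :: "(nat \<Rightarrow> real ^ 'n) \<Rightarrow> real" where "init_energy X = mod_energy \<kappa> N X (r 0) + b"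

lemma amp_pos: "0 < amp" "0 < amp2" by (simp_all add: amp_def amp2_def)

lemma init_energy_nn: "X \<in> space (config N) - collisions N \<Longrightarrow> 0 \<le> init_energy X"
  unfolding init_energy_def by (rule lower[OF zero_T])

lemma energy_dissipation_bound:
  assumes t: "t \<in> {0..T}" and X: "X \<in> space (config N) - collisions N"
  shows "mod_energy \<kappa> N (\<Phi> t X) (r t) + b + 2 * particle_energy.total_dissip (gker \<kappa>) (\<lambda>t. velocity \<kappa> (r t)) N (\<lambda>t. \<Phi> t X) t
    \<le> amp * init_energy X"
proof -
  interpret pe: particle_energy "gker \<kappa>" G G' C T R \<Lambda> \<Lambda> J M r r' "\<lambda>t. velocity \<kappa> (r t)" \<Lambda> N "\<lambda>t. \<Phi> t X"
    by (rule particle_energy[OF X])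
  have e0: "pe.energy (gker \<kappa>) 0 + b = init_energy X"
    using mod_energy_eq[OF zero_T X] by (simp add: init_energy_def flow_0[OF X])
  have "pe.energy (gker \<kappa>) t + b + 2 * pe.total_dissip t \<le> exp (c * t) * (pe.energy (gker \<kappa>) 0 + b)"
  proof (rule pe.energy_gronwall[OF c _ t])
    fix s assume s: "s \<in> {0..T}"
    have "\<bar>commutator \<kappa> N (\<Phi> s X) (r s) (velocity \<kappa> (r s))\<bar> \<le> c * (mod_energy \<kappa> N (\<Phi> s X) (r s) + b)"
      by (rule comm[OF s flow_in[OF _ X]]) (use s in simp)
    then show "\<bar>pe.commut s\<bar> \<le> c * (pe.energy (gker \<kappa>) s + b)"
      by (simp add: commutator_eq[OF s X] mod_energy_eq[OF s X])
  qed
  also have "\<dots> \<le> amp * init_energy X"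
    unfolding e0 amp_def using t c init_energy_nn[OF X] by (intro mult_right_mono) (auto intro: mult_left_mono)
  finally show ?thesis by (simp add: mod_energy_eq[OF t X])
qed

lemma total_dissip_bound:
  assumes t: "t \<in> {0..T}" and X: "X \<in> space (config N) - collisions N"
  shows "particle_energy.total_dissip (gker \<kappa>) (\<lambda>t. velocity \<kappa> (r t)) N (\<lambda>t. \<Phi> t X) t \<le> amp * init_energy X"
proof -
  interpret pe: particle_energy "gker \<kappa>" G G' C T R \<Lambda> \<Lambda> J M r r' "\<lambda>t. velocity \<kappa> (r t)" \<Lambda> N "\<lambda>t. \<Phi> t X"
    by (rule particle_energy[OF X])
  have "0 \<le> mod_energy \<kappa> N (\<Phi> t X) (r t) + b"
    by (rule lower[OF t flow_in[OF _ X]]) (use t in simp)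
  then show ?thesis using energy_dissipation_bound[OF t X] pe.total_dissip_nn[OF t] by linarith
qed

lemma mod_energy_bound:
  assumes t: "t \<in> {0..T}" and X: "X \<in> space (config N) - collisions N"
  shows "mod_energy \<kappa> N (\<Phi> t X) (r t) + b \<le> amp * init_energy X"
proof -
  interpret pe: particle_energy "gker \<kappa>" G G' C T R \<Lambda> \<Lambda> J M r r' "\<lambda>t. velocity \<kappa> (r t)" \<Lambda> N "\<lambda>t. \<Phi> t X"
    by (rule particle_energy[OF X])
  show ?thesis using energy_dissipation_bound[OF t X] pe.total_dissip_nn[OF t] by linarith
qed

lemma dissipation_time_integral:
  assumes X: "X \<in> space (config N) - collisions N"
  shows "(\<integral>\<^sup>+t\<in>{0..T}. dissipation \<kappa> N (\<Phi> t X) (r t) \<partial>lborel) \<le> ennreal (amp * init_energy X)"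
proof -
  interpret pe: particle_energy "gker \<kappa>" G G' C T R \<Lambda> \<Lambda> J M r r' "\<lambda>t. velocity \<kappa> (r t)" \<Lambda> N "\<lambda>t. \<Phi> t X"
    by (rule particle_energy[OF X])
  have bi: "integrable lborel (\<lambda>t. indicator {0..T} t *\<^sub>R pe.dissip t)"
    by (intro borel_integrable_compact pe.dissip_cont) simp
  have "(\<integral>\<^sup>+t\<in>{0..T}. dissipation \<kappa> N (\<Phi> t X) (r t) \<partial>lborel) = (\<integral>\<^sup>+t. ennreal (indicator {0..T} t *\<^sub>R pe.dissip t) \<partial>lborel)"
    by (intro nn_integral_cong) (auto simp: dissipation_eq[OF _ X] indicator_def)
  also have "\<dots> = ennreal (LINT t|lborel. indicator {0..T} t *\<^sub>R pe.dissip t)"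
    by (intro nn_integral_eq_integral bi) (auto simp: pe.dissip_nn)
  also have "(LINT t|lborel. indicator {0..T} t *\<^sub>R pe.dissip t) = pe.total_dissip T"
    using set_borel_integral_eq_integral(2)[of "{0..T}" pe.dissip] bi
    by (simp add: set_integrable_def set_lebesgue_integral_def pe.total_dissip_def)
  also have "ennreal (pe.total_dissip T) \<le> ennreal (amp * init_energy X)"
    by (intro ennreal_leI total_dissip_bound[OF _ X]) (use T in simp)
  finally show ?thesis .
qed

lemma coupling_bound:
  assumes t: "t \<in> {0..T}" and X: "X \<in> space (config N) - collisions N"
  shows "(\<Sum>i<N. (norm (\<Phi> t X i - Y t (X i)))\<^sup>2) \<le> real N * (amp2 * init_energy X)"
proof -
  interpret pe: particle_energy "gker \<kappa>" G G' C T R \<Lambda> \<Lambda> J M r r' "\<lambda>t. velocity \<kappa> (r t)" \<Lambda> N "\<lambda>t. \<Phi> t X"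
    by (rule particle_energy[OF X])
  have "(\<Sum>i<N. (norm (\<Phi> t X i - Y t (\<Phi> 0 X i)))\<^sup>2) \<le> exp ((1 + 2 * \<Lambda>) * t) * (real N * pe.total_dissip t)"
    by (rule pe.coupling_gronwall[OF t])
  also have "\<dots> \<le> exp ((1 + 2 * \<Lambda>) * T) * (real N * (amp * init_energy X))"
    using t nonneg total_dissip_bound[OF t X] pe.total_dissip_nn[OF t]
    by (intro mult_mono mult_left_mono) (auto intro!: mult_left_mono)
  finally show ?thesis by (simp add: flow_0[OF X] amp2_def mult_ac)
qed

end

text \<open>Valid for arbitrary \<open>f\<close>: the left side is a supremum over simple functions
  below \<open>f\<close>, and each of them pulls back to a measurable function below
  \<open>f (T x)\<close>. Expectations under the law of the particles can thus be bounded through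
  the initial data.\<close>

lemma nn_integral_distr_le:
  assumes T: "T \<in> measurable M N"
  shows "(\<integral>\<^sup>+y. f y \<partial>distr M N T) \<le> (\<integral>\<^sup>+x. f (T x) \<partial>M)"
proof -
  have "integral\<^sup>S (distr M N T) g \<le> (\<integral>\<^sup>+x. f (T x) \<partial>M)"
    if g: "simple_function (distr M N T) g" "g \<le> f" for g
  proof -
    have gm: "g \<in> borel_measurable (distr M N T)" using borel_measurable_simple_function[OF g(1)] .
    have "integral\<^sup>S (distr M N T) g = (\<integral>\<^sup>+y. g y \<partial>distr M N T)" by (rule nn_integral_eq_simple_integral[OF g(1), symmetric])
    also have "\<dots> = (\<integral>\<^sup>+x. g (T x) \<partial>M)" by (rule nn_integral_distr[OF T gm])
    also have "\<dots> \<le> (\<integral>\<^sup>+x. f (T x) \<partial>M)" by (rule nn_integral_mono) (use g(2) in \<open>auto simp: le_fun_def\<close>)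
    finally show ?thesis .
  qed
  then show ?thesis unfolding nn_integral_def[of "distr M N T"] by (intro SUP_least) auto
qed

lemma distr_PiM_pair:
  assumes \<nu>: "prob_space \<nu>" and ij: "i \<in> I" "j \<in> I" "i \<noteq> j"
  shows "distr (PiM I (\<lambda>_. \<nu>)) (\<nu> \<Otimes>\<^sub>M \<nu>) (\<lambda>\<omega>. (\<omega> i, \<omega> j)) = \<nu> \<Otimes>\<^sub>M \<nu>"
proof (rule pair_measure_eqI[symmetric])
  show "sigma_finite_measure \<nu>" "sigma_finite_measure \<nu>" using \<nu> by (simp_all add: prob_space_imp_sigma_finite)
  show "sets (\<nu> \<Otimes>\<^sub>M \<nu>) = sets (distr (PiM I (\<lambda>_. \<nu>)) (\<nu> \<Otimes>\<^sub>M \<nu>) (\<lambda>\<omega>. (\<omega> i, \<omega> j)))" by simp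
  fix A B assume A: "A \<in> sets \<nu>" and B: "B \<in> sets \<nu>"
  have m: "(\<lambda>\<omega>. (\<omega> i, \<omega> j)) \<in> measurable (PiM I (\<lambda>_. \<nu>)) (\<nu> \<Otimes>\<^sub>M \<nu>)"
    using ij by measurable
  define F where "F k = (if k = i then A else B)" for k
  have "(\<lambda>\<omega>. (\<omega> i, \<omega> j)) -` (A \<times> B) \<inter> space (PiM I (\<lambda>_. \<nu>)) = prod_emb I (\<lambda>_. \<nu>) {i, j} (Pi\<^sub>E {i, j} F)"
    using ij by (auto simp: prod_emb_def space_PiM F_def PiE_def extensional_def restrict_def)
  then have "emeasure (distr (PiM I (\<lambda>_. \<nu>)) (\<nu> \<Otimes>\<^sub>M \<nu>) (\<lambda>\<omega>. (\<omega> i, \<omega> j))) (A \<times> B)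
      = emeasure (PiM I (\<lambda>_. \<nu>)) (prod_emb I (\<lambda>_. \<nu>) {i, j} (Pi\<^sub>E {i, j} F))"
    using A B by (subst emeasure_distr[OF m]) auto
  also have "\<dots> = (\<Prod>k\<in>{i, j}. emeasure \<nu> (F k))"
    by (rule emeasure_PiM_emb) (use \<nu> ij A B in \<open>auto simp: F_def\<close>)
  also have "\<dots> = emeasure \<nu> A * emeasure \<nu> B" using ij by (simp add: F_def)
  finally show "emeasure \<nu> A * emeasure \<nu> B = emeasure (distr (PiM I (\<lambda>_. \<nu>)) (\<nu> \<Otimes>\<^sub>M \<nu>) (\<lambda>\<omega>. (\<omega> i, \<omega> j))) (A \<times> B)" by simp
qed

lemma distr_PiM_map:
  assumes \<nu>: "prob_space \<nu>" and I: "finite I" and f: "f \<in> measurable \<nu> S"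
  shows "distr (PiM I (\<lambda>_. \<nu>)) (PiM I (\<lambda>_. S)) (\<lambda>\<omega>. \<lambda>i\<in>I. f (\<omega> i)) = PiM I (\<lambda>_. distr \<nu> S f)"
proof -
  interpret \<nu>: prob_space \<nu> by fact
  interpret D: prob_space "distr \<nu> S f" by (rule \<nu>.prob_space_distr[OF f])
  interpret P: product_prob_space "\<lambda>_. distr \<nu> S f" I ..
  interpret Q: product_prob_space "\<lambda>_. \<nu>" I ..
  have m: "(\<lambda>\<omega>. \<lambda>i\<in>I. f (\<omega> i)) \<in> measurable (PiM I (\<lambda>_. \<nu>)) (PiM I (\<lambda>_. S))"
    using f by (intro measurable_restrict measurable_compose[OF measurable_component_singleton]) auto
  show ?thesis
  proof (rule P.PiM_eqI[OF I])
    show "sets (distr (PiM I (\<lambda>_. \<nu>)) (PiM I (\<lambda>_. S)) (\<lambda>\<omega>. \<lambda>i\<in>I. f (\<omega> i))) = sets (PiM I (\<lambda>_. distr \<nu> S f))"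
      by (simp cong: sets_PiM_cong)
    fix A assume A: "\<And>i. i \<in> I \<Longrightarrow> A i \<in> sets (distr \<nu> S f)"
    have "emeasure (distr (PiM I (\<lambda>_. \<nu>)) (PiM I (\<lambda>_. S)) (\<lambda>\<omega>. \<lambda>i\<in>I. f (\<omega> i))) (Pi\<^sub>E I A)
      = emeasure (PiM I (\<lambda>_. \<nu>)) ((\<lambda>\<omega>. \<lambda>i\<in>I. f (\<omega> i)) -` Pi\<^sub>E I A \<inter> space (PiM I (\<lambda>_. \<nu>)))"
      using A I by (intro emeasure_distr[OF m] sets_PiM_I_finite) auto
    also have "(\<lambda>\<omega>. \<lambda>i\<in>I. f (\<omega> i)) -` Pi\<^sub>E I A \<inter> space (PiM I (\<lambda>_. \<nu>)) = Pi\<^sub>E I (\<lambda>i. f -` A i \<inter> space \<nu>)"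
      by (auto simp: space_PiM PiE_iff)
    also have "emeasure (PiM I (\<lambda>_. \<nu>)) (Pi\<^sub>E I (\<lambda>i. f -` A i \<inter> space \<nu>)) = (\<Prod>i\<in>I. emeasure \<nu> (f -` A i \<inter> space \<nu>))"
      by (rule Q.emeasure_PiM[OF I]) (use A f in \<open>auto intro: measurable_sets\<close>)
    also have "\<dots> = (\<Prod>i\<in>I. emeasure (distr \<nu> S f) (A i))"
      by (rule prod.cong[OF refl]) (use A f in \<open>auto simp: emeasure_distr\<close>)
    finally show "emeasure (distr (PiM I (\<lambda>_. \<nu>)) (PiM I (\<lambda>_. S)) (\<lambda>\<omega>. \<lambda>i\<in>I. f (\<omega> i))) (Pi\<^sub>E I A)
      = (\<Prod>i\<in>I. emeasure (distr \<nu> S f) (A i))" .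
  qed
qed

lemma W2_sq_le_coupling:
  fixes F H :: "'a \<Rightarrow> nat \<Rightarrow> real ^ 'n"
  assumes F: "F \<in> measurable P (config n)" and H: "H \<in> measurable P (config n)"
    and A: "A = distr P (config n) F" and B: "B = distr P (config n) H"
  shows "W2_sq n A B \<le> (\<integral>\<^sup>+X. ennreal (\<Sum>i<n. (norm (F X i - H X i))\<^sup>2) \<partial>P)"
proof -
  have sAB: "sets A = sets (config n)" "sets B = sets (config n)" by (simp_all add: A B)
  have FA: "F \<in> measurable P A" "H \<in> measurable P B"
    using F H measurable_cong_sets[OF refl sAB(1)] measurable_cong_sets[OF refl sAB(2)] by blast+
  have m: "(\<lambda>X. (F X, H X)) \<in> measurable P (A \<Otimes>\<^sub>M B)" using FA by (rule measurable_Pair)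
  \<comment> \<open>The joint law of the two configurations, which are functions on the same
    space.\<close>
  define \<gamma> where "\<gamma> = distr P (A \<Otimes>\<^sub>M B) (\<lambda>X. (F X, H X))"
  have "\<gamma> \<in> couplings A B"
    unfolding couplings_def
  proof (intro CollectI conjI)
    show "sets \<gamma> = sets (A \<Otimes>\<^sub>M B)" by (simp add: \<gamma>_def)
    have "distr \<gamma> A fst = distr P A F" unfolding \<gamma>_def by (subst distr_distr[OF measurable_fst m]) (simp add: o_def)
    also have "\<dots> = A" unfolding A by (rule distr_cong) auto
    finally show "distr \<gamma> A fst = A" .
    have "distr \<gamma> B snd = distr P B H" unfolding \<gamma>_def by (subst distr_distr[OF measurable_snd m]) (simp add: o_def)
    also have "\<dots> = B" unfolding B by (rule distr_cong) auto
    finally show "distr \<gamma> B snd = B" .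
  qed
  then have "W2_sq n A B \<le> (\<integral>\<^sup>+(X, Y). ennreal (\<Sum>i<n. (norm (X i - Y i))\<^sup>2) \<partial>\<gamma>)"
    unfolding W2_sq_def by (rule INF_lower)
  also have "\<dots> \<le> (\<integral>\<^sup>+X. (case (F X, H X) of (X, Y) \<Rightarrow> ennreal (\<Sum>i<n. (norm (X i - Y i))\<^sup>2)) \<partial>P)"
    unfolding \<gamma>_def by (rule nn_integral_distr_le[OF m])
  finally show ?thesis by simp
qed

section \<open>Expectations over independent initial positions\<close>

lemma config_component: "i < N \<Longrightarrow> (\<lambda>X. X i) \<in> measurable (config N) (borel :: (real ^ 'n) measure)"
  unfolding config_def by (rule measurable_component_singleton) simp

lemma collisions_sets: "(collisions N :: (nat \<Rightarrow> real ^ 'n) set) \<in> sets (config N)"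
proof -
  have "{X \<in> space (config N). i \<noteq> j \<and> X i = (X j :: real ^ 'n)} \<in> sets (config N)" if "i < N" "j < N" for i j
  proof (cases "i = j")
    case False
    have "{X \<in> space (config N). X i = (X j :: real ^ 'n)} \<in> sets (config N)"
      by (intro measurable_equality_set config_component that)
    moreover have "{X \<in> space (config N). i \<noteq> j \<and> X i = X j} = {X \<in> space (config N). X i = (X j :: real ^ 'n)}"
      using False by blast
    ultimately show ?thesis by metis
  next
    case True
    then have "{X \<in> space (config N). i \<noteq> j \<and> X i = (X j :: real ^ 'n)} = {}" by blast
    then show ?thesis by (metis sets.empty_sets)
  qed
  note pair = this
  have "(\<Union>i\<in>{..<N}. \<Union>j\<in>{..<N}. {X \<in> space (config N). i \<noteq> j \<and> X i = (X j :: real ^ 'n)}) \<in> sets (config N)"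
    by (rule sets.finite_UN[OF finite_lessThan], rule sets.finite_UN[OF finite_lessThan], rule pair) simp_all
  also have "(\<Union>i\<in>{..<N}. \<Union>j\<in>{..<N}. {X \<in> space (config N). i \<noteq> j \<and> X i = (X j :: real ^ 'n)}) = collisions N"
    by (auto simp: collisions_def)
  finally show ?thesis .
qed

context chaos begin

abbreviation "nc \<equiv> space (config N) - collisions N :: (nat \<Rightarrow> real ^ 'n) set"

abbreviation "P \<equiv> tensor_power N (r 0)"

lemma tensor_eq: "tensor_power k (r t) = PiM {..<k} (\<lambda>_. law_at t)"
  by (simp add: tensor_power_def law_at_def)

lemma prob_tensor: "t \<in> {0..T} \<Longrightarrow> prob_space (tensor_power k (r t))"
  unfolding tensor_eq by (intro prob_space_PiM prob_space_law_at)

lemma sets_tensor: "sets (tensor_power k (r t)) = sets (config k)"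
  unfolding tensor_eq config_def by (intro sets_PiM_cong refl sets_law_at)

lemma space_tensor: "space (tensor_power k (r t)) = space (config k)"
  by (rule sets_eq_imp_space_eq[OF sets_tensor])

lemma measurable_tensor: "measurable (tensor_power k (r t)) S = measurable (config k) S"
  by (rule measurable_cong_sets[OF sets_tensor refl])

lemma law0: "prob_space (law_at 0)" by (rule prob_space_law_at[OF zero_T])

lemma distr_coordinate: "i < N \<Longrightarrow> distr P (law_at 0) (\<lambda>X. X i) = law_at 0"
  unfolding tensor_eq by (rule distr_PiM_component[OF law0]) simp

lemma distr_coordinate_pair:
  "i < N \<Longrightarrow> j < N \<Longrightarrow> i \<noteq> j \<Longrightarrow> distr P (law_at 0 \<Otimes>\<^sub>M law_at 0) (\<lambda>X. (X i, X j)) = law_at 0 \<Otimes>\<^sub>M law_at 0"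
  unfolding tensor_eq by (rule distr_PiM_pair[OF law0]) auto

lemma coordinate_measurable: "i < N \<Longrightarrow> (\<lambda>X. X i) \<in> measurable P (law_at 0)"
  unfolding tensor_eq by (rule measurable_component_singleton) simp

lemma pair_measurable: "i < N \<Longrightarrow> j < N \<Longrightarrow> (\<lambda>X. (X i, X j)) \<in> measurable P (law_at 0 \<Otimes>\<^sub>M law_at 0)"
  by (intro measurable_Pair coordinate_measurable)

text \<open>Two independent positions with a density almost surely differ, and there are finitely
  many pairs.\<close>

lemma AE_noncollision: "AE X in P. X \<in> nc"
proof -
  interpret kd: kernel_density "gker \<kappa> :: real ^ 'n \<Rightarrow> real" G G' C "r 0" \<Lambda> R by (rule kd[OF zero_T])
  have mu: "kd.\<mu> = law_at 0" by (simp add: kd.\<mu>_def law_at_def)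
  have pr: "AE X in P. X i \<noteq> X j" if ij: "i < N" "j < N" "i \<noteq> j" for i j
  proof -
    have "AE p in law_at 0 \<Otimes>\<^sub>M law_at 0. fst p \<noteq> snd p"
      using kd.AE_mu2_ne unfolding mu .
    then have "AE p in distr P (law_at 0 \<Otimes>\<^sub>M law_at 0) (\<lambda>X. (X i, X j)). fst p \<noteq> snd p"
      by (simp only: distr_coordinate_pair[OF ij])
    from AE_distrD[OF pair_measurable[OF ij(1,2)] this] show ?thesis by simp
  qed
  have "AE X in P. \<forall>i\<in>{..<N}. \<forall>j\<in>{..<N}. i \<noteq> j \<longrightarrow> X i \<noteq> X j"
  proof (intro AE_finite_allI finite_lessThan)
    fix i j assume "i \<in> {..<N}" "j \<in> {..<N}"
    then show "AE X in P. i \<noteq> j \<longrightarrow> X i \<noteq> X j" using pr[of i j] by (cases "i = j") auto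
  qed
  moreover have "AE X in P. X \<in> space (config N)" by (rule AE_I2) (simp add: space_tensor)
  ultimately show ?thesis by eventually_elim (auto simp: collisions_iff)
qed

definition self_energy :: real where
  "self_energy = (LINT p|(law_at 0 \<Otimes>\<^sub>M law_at 0). gker \<kappa> (fst p - snd p))"

lemma integrable_self_energy: "integrable (law_at 0 \<Otimes>\<^sub>M law_at 0) (\<lambda>p. gker \<kappa> (fst p - snd p))"
proof -
  interpret kd: kernel_density "gker \<kappa> :: real ^ 'n \<Rightarrow> real" G G' C "r 0" \<Lambda> R by (rule kd[OF zero_T])
  have mu: "kd.\<mu> = law_at 0" by (simp add: kd.\<mu>_def law_at_def)
  show ?thesis
  proof (rule Bochner_Integration.integrable_bound[OF integrable_mult_right[OF kd.sing_mu2[unfolded mu], of C]])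
    show "(\<lambda>p. gker \<kappa> (fst p - snd p)) \<in> borel_measurable (law_at 0 \<Otimes>\<^sub>M law_at 0)" by measurable
    show "AE p in law_at 0 \<Otimes>\<^sub>M law_at 0. norm (gker \<kappa> (fst p - snd p)) \<le> norm (C * sing (fst p - snd p))"
      using kd.AE_mu2_ne unfolding mu
    proof eventually_elim
      fix p :: "(real^'n) \<times> (real^'n)" assume "fst p \<noteq> snd p"
      then have "\<bar>gker \<kappa> (fst p - snd p)\<bar> \<le> C * sing (fst p - snd p)" by (intro g_le_sing) simp
      then show "norm (gker \<kappa> (fst p - snd p)) \<le> norm (C * sing (fst p - snd p))" by simp
    qed
  qed
qed

text \<open>An ordered pair of distinct particles, a particle against the density, and the density
  against itself all have expected interaction \<open>self_energy\<close>. With their weights the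
  counts add up to \<open>(N - 1) / N - 2 + 1 = - 1 / N\<close>.\<close>

lemma init_energy_expectation:
  assumes a: "0 \<le> a"
  shows "(\<integral>\<^sup>+X. ennreal (a * init_energy X) \<partial>P) = ennreal (a * (b - self_energy / real N))"
proof -
  interpret L0: prob_space "law_at 0" by (rule law0)
  interpret L00: pair_prob_space "law_at 0" "law_at 0" ..
  interpret P: prob_space P by (rule prob_tensor[OF zero_T])
  define pot where "pot x = (LINT z|law_at 0. gker \<kappa> (x - z))" for x :: "real^'n"
  have pair: "integrable P (\<lambda>X. gker \<kappa> (X i - X j))" "(LINT X|P. gker \<kappa> (X i - X j)) = self_energy"
    if ij: "i < N" "j < N" "i \<noteq> j" for i j
  proof -
    have gm: "(\<lambda>p. gker \<kappa> (fst p - snd p)) \<in> borel_measurable (law_at 0 \<Otimes>\<^sub>M law_at 0)" by measurable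
    have "integrable (distr P (law_at 0 \<Otimes>\<^sub>M law_at 0) (\<lambda>X. (X i, X j))) (\<lambda>p. gker \<kappa> (fst p - snd p))"
      unfolding distr_coordinate_pair[OF ij] by (rule integrable_self_energy)
    then show "integrable P (\<lambda>X. gker \<kappa> (X i - X j))"
      by (subst (asm) integrable_distr_eq[OF pair_measurable[OF ij(1,2)] gm]) simp
    have "self_energy = (LINT p|distr P (law_at 0 \<Otimes>\<^sub>M law_at 0) (\<lambda>X. (X i, X j)). gker \<kappa> (fst p - snd p))"
      unfolding distr_coordinate_pair[OF ij] self_energy_def ..
    also have "\<dots> = (LINT X|P. gker \<kappa> (X i - X j))"
      by (subst integral_distr[OF pair_measurable[OF ij(1,2)] gm]) simp
    finally show "(LINT X|P. gker \<kappa> (X i - X j)) = self_energy" by simp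
  qed
  have potI: "integrable (law_at 0) pot" "(LINT x|law_at 0. pot x) = self_energy"
    using L00.integrable_fst'[OF integrable_self_energy] L00.integral_fst'[OF integrable_self_energy]
    by (simp_all add: pot_def[abs_def] self_energy_def)
  have single: "integrable P (\<lambda>X. pot (X i))" "(LINT X|P. pot (X i)) = self_energy" if i: "i < N" for i
  proof -
    have pm: "pot \<in> borel_measurable (law_at 0)" using potI(1) by simp
    have "integrable (distr P (law_at 0) (\<lambda>X. X i)) pot" unfolding distr_coordinate[OF i] by (rule potI(1))
    then show "integrable P (\<lambda>X. pot (X i))"
      by (subst (asm) integrable_distr_eq[OF coordinate_measurable[OF i] pm])
    have "self_energy = (LINT x|distr P (law_at 0) (\<lambda>X. X i). pot x)"
      unfolding distr_coordinate[OF i] by (rule potI(2)[symmetric])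
    also have "\<dots> = (LINT X|P. pot (X i))" by (rule integral_distr[OF coordinate_measurable[OF i] pm])
    finally show "(LINT X|P. pot (X i)) = self_energy" by simp
  qed
  define A1 where "A1 X = (\<Sum>i<N. \<Sum>j\<in>{..<N} - {i}. gker \<kappa> (X i - X j))" for X :: "nat \<Rightarrow> real^'n"
  define A2 where "A2 X = (\<Sum>i<N. pot (X i))" for X :: "nat \<Rightarrow> real^'n"
  have A1: "integrable P A1" "(LINT X|P. A1 X) = real N * (real N - 1) * self_energy"
  proof -
    have i: "integrable P (\<lambda>X. \<Sum>j\<in>{..<N} - {i}. gker \<kappa> (X i - X j))"
      "(LINT X|P. (\<Sum>j\<in>{..<N} - {i}. gker \<kappa> (X i - X j))) = (real N - 1) * self_energy" if "i < N" for i
    proof -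
      show "integrable P (\<lambda>X. \<Sum>j\<in>{..<N} - {i}. gker \<kappa> (X i - X j))"
        by (rule Bochner_Integration.integrable_sum) (use pair that in auto)
      have "(LINT X|P. (\<Sum>j\<in>{..<N} - {i}. gker \<kappa> (X i - X j))) = (\<Sum>j\<in>{..<N} - {i}. LINT X|P. gker \<kappa> (X i - X j))"
        by (rule Bochner_Integration.integral_sum) (use pair that in auto)
      also have "\<dots> = (\<Sum>j\<in>{..<N} - {i}. self_energy)" by (rule sum.cong[OF refl]) (use pair that in auto)
      also have "\<dots> = (real N - 1) * self_energy" using that by (simp add: of_nat_diff)
      finally show "(LINT X|P. (\<Sum>j\<in>{..<N} - {i}. gker \<kappa> (X i - X j))) = (real N - 1) * self_energy" .
    qed
    show "integrable P A1" unfolding A1_def by (rule Bochner_Integration.integrable_sum) (use i in auto)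
    have "(LINT X|P. A1 X) = (\<Sum>i<N. LINT X|P. (\<Sum>j\<in>{..<N} - {i}. gker \<kappa> (X i - X j)))"
      unfolding A1_def by (rule Bochner_Integration.integral_sum) (use i in auto)
    also have "\<dots> = (\<Sum>i<N. (real N - 1) * self_energy)" by (rule sum.cong[OF refl]) (use i in auto)
    finally show "(LINT X|P. A1 X) = real N * (real N - 1) * self_energy" by simp
  qed
  have A2: "integrable P A2" "(LINT X|P. A2 X) = real N * self_energy"
  proof -
    show "integrable P A2" unfolding A2_def by (rule Bochner_Integration.integrable_sum) (use single in auto)
    have "(LINT X|P. A2 X) = (\<Sum>i<N. LINT X|P. pot (X i))"
      unfolding A2_def by (rule Bochner_Integration.integral_sum) (use single in auto)
    also have "\<dots> = (\<Sum>i<N. self_energy)" by (rule sum.cong[OF refl]) (use single in auto)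
    finally show "(LINT X|P. A2 X) = real N * self_energy" by simp
  qed
  define A where "A X = (1 / real N)\<^sup>2 * A1 X - 2 / real N * A2 X + self_energy + b" for X
  have Ai: "integrable P A"
    unfolding A_def using A1(1) A2(1) by (intro Bochner_Integration.integrable_add Bochner_Integration.integrable_diff integrable_mult_right P.integrable_const) auto
  have "(LINT X|P. A X) = (1 / real N)\<^sup>2 * (real N * (real N - 1) * self_energy) - 2 / real N * (real N * self_energy) + self_energy + b"
    unfolding A_def using A1 A2 P.prob_space by simp
  also have "\<dots> = b - self_energy / real N" using N by (simp add: power2_eq_square field_simps)
  finally have AI: "(LINT X|P. A X) = b - self_energy / real N" .
  have eq: "init_energy X = A X" if "X \<in> nc" for X
    unfolding init_energy_def mod_energy_expand[OF zero_T that] A_def A1_def A2_def pot_def self_energy_def by simp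
  have "(\<integral>\<^sup>+X. ennreal (a * init_energy X) \<partial>P) = (\<integral>\<^sup>+X. ennreal (a * A X) \<partial>P)"
    by (rule nn_integral_cong_AE, rule eventually_mono[OF AE_noncollision]) (simp only: eq)
  also have "\<dots> = ennreal (LINT X|P. a * A X)"
  proof (rule nn_integral_eq_integral[OF integrable_mult_right[OF Ai]])
    show "AE X in P. 0 \<le> a * A X"
    proof (rule eventually_mono[OF AE_noncollision])
      fix X assume "X \<in> nc"
      then show "0 \<le> a * A X" using init_energy_nn[of X] eq[of X] a by simp
    qed
  qed
  finally show ?thesis by (simp add: AI)
qed

text \<open>Reduces each expectation to a deterministic bound by the initial energy for
  collision-free data.\<close>

lemma expectation_bound:
  assumes a: "0 \<le> a" and f: "\<And>X. X \<in> nc \<Longrightarrow> f X \<le> ennreal (a * init_energy X)"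
  shows "(\<integral>\<^sup>+X. f X \<partial>P) \<le> ennreal (a * (b - self_energy / real N))"
proof -
  have "(\<integral>\<^sup>+X. f X \<partial>P) \<le> (\<integral>\<^sup>+X. ennreal (a * init_energy X) \<partial>P)"
    by (rule nn_integral_mono_AE, rule eventually_mono[OF AE_noncollision]) (rule f)
  then show ?thesis unfolding init_energy_expectation[OF a] .
qed

end

text \<open>Rounding the time down to multiples of \<open>1 / Suc n\<close> gives countably many
  measurable pieces, and continuity in time identifies the limit. Times are clamped since
  \<open>f\<close> is controlled only on \<open>{a..b}\<close>.\<close>

lemma borel_measurable_continuous_in_time:
  fixes f :: "real \<Rightarrow> 'a \<Rightarrow> real"
  assumes ab: "a \<le> b" and m: "\<And>s. s \<in> {a..b} \<Longrightarrow> f s \<in> borel_measurable M"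
    and c: "\<And>x. x \<in> space M \<Longrightarrow> continuous_on {a..b} (\<lambda>s. f s x)"
  shows "(\<lambda>p. f (max a (min b (fst p))) (snd p)) \<in> borel_measurable (lborel \<Otimes>\<^sub>M M)"
proof (rule borel_measurable_LIMSEQ_real)
  define q where "q n s = max a (min b (real_of_int \<lfloor>real (Suc n) * s\<rfloor> / real (Suc n)))" for n s
  have cl: "max a (min b s) \<in> {a..b}" for s using ab by auto
  show "(\<lambda>p. f (q n (fst p)) (snd p)) \<in> borel_measurable (lborel \<Otimes>\<^sub>M M)" for n
    unfolding q_def
  proof (rule measurable_compose_countable[where f="\<lambda>i p. f (max a (min b (real_of_int i / real (Suc n)))) (snd p)"])
    show "(\<lambda>p. f (max a (min b (real_of_int i / real (Suc n)))) (snd p)) \<in> borel_measurable (lborel \<Otimes>\<^sub>M M)" for i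
      by (rule measurable_compose[OF measurable_snd m[OF cl]])
    show "(\<lambda>p. \<lfloor>real (Suc n) * fst p\<rfloor>) \<in> measurable (lborel \<Otimes>\<^sub>M M) (count_space UNIV)" by measurable
  qed
  fix p assume "p \<in> space (lborel \<Otimes>\<^sub>M M :: (real \<times> 'a) measure)"
  then have x: "snd p \<in> space M" by (auto simp: space_pair_measure)
  have lim: "(\<lambda>n. real_of_int \<lfloor>real (Suc n) * fst p\<rfloor> / real (Suc n)) \<longlonglongrightarrow> fst p"
  proof (rule tendsto_sandwich)
    show "\<forall>\<^sub>F n in sequentially. fst p - 1 / real (Suc n) \<le> real_of_int \<lfloor>real (Suc n) * fst p\<rfloor> / real (Suc n)"
    proof (rule always_eventually, rule allI)
      fix n
      have "real (Suc n) * fst p - 1 \<le> real_of_int \<lfloor>real (Suc n) * fst p\<rfloor>" by linarith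
      then have "(real (Suc n) * fst p - 1) / real (Suc n) \<le> real_of_int \<lfloor>real (Suc n) * fst p\<rfloor> / real (Suc n)"
        by (rule divide_right_mono) simp
      then show "fst p - 1 / real (Suc n) \<le> real_of_int \<lfloor>real (Suc n) * fst p\<rfloor> / real (Suc n)"
        by (simp add: diff_divide_distrib)
    qed
    show "\<forall>\<^sub>F n in sequentially. real_of_int \<lfloor>real (Suc n) * fst p\<rfloor> / real (Suc n) \<le> fst p"
    proof (rule always_eventually, rule allI)
      fix n
      have "real_of_int \<lfloor>real (Suc n) * fst p\<rfloor> / real (Suc n) \<le> (real (Suc n) * fst p) / real (Suc n)"
        by (rule divide_right_mono) (simp_all del: of_nat_Suc)
      then show "real_of_int \<lfloor>real (Suc n) * fst p\<rfloor> / real (Suc n) \<le> fst p" by simp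
    qed
    show "(\<lambda>n. fst p - 1 / real (Suc n)) \<longlonglongrightarrow> fst p"
      using tendsto_diff[OF tendsto_const LIMSEQ_inverse_real_of_nat, of "fst p"] by (simp add: inverse_eq_divide)
  qed simp
  have "(\<lambda>n. q n (fst p)) \<longlonglongrightarrow> max a (min b (fst p))"
    unfolding q_def by (intro tendsto_max tendsto_min tendsto_const lim)
  then show "(\<lambda>n. f (q n (fst p)) (snd p)) \<longlonglongrightarrow> f (max a (min b (fst p))) (snd p)"
    by (rule continuous_on_tendsto_compose[OF c[OF x]]) (use cl in \<open>auto simp: q_def\<close>)
qed

section \<open>Expected modulated energy and dissipation\<close>

context chaos begin

abbreviation "initial_error \<equiv> b - self_energy / real N"

lemma flow_measurable_tensor: "t \<in> {0..T} \<Longrightarrow> \<Phi> t \<in> measurable P (config N)"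
  unfolding measurable_tensor by (rule flow_measurable) simp

lemma sharp_energy_expectation:
  assumes t: "t \<in> {0..T}" and b: "b = e - c_ren CARD('n) \<kappa> / real N"
  shows "(\<integral>\<^sup>+X. e2ennreal (mod_energy_sharp \<kappa> N X (r t) + ereal e) \<partial>law N (r 0) \<Phi> t) \<le> ennreal (amp * initial_error)"
  unfolding law_def
proof (rule order_trans[OF nn_integral_distr_le[OF flow_measurable_tensor[OF t]]], rule expectation_bound)
  show "0 \<le> amp" using amp_pos by simp
  fix X assume X: "X \<in> nc"
  have "\<Phi> t X \<notin> collisions N" using flow_in[OF _ X, of t] t by simp
  then have "mod_energy_sharp \<kappa> N (\<Phi> t X) (r t) + ereal e = ereal (mod_energy \<kappa> N (\<Phi> t X) (r t) + b)"
    by (simp add: mod_energy_sharp_def b)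
  then show "e2ennreal (mod_energy_sharp \<kappa> N (\<Phi> t X) (r t) + ereal e) \<le> ennreal (amp * init_energy X)"
    using mod_energy_bound[OF t X] by (simp add: e2ennreal_ereal ennreal_leI)
qed

lemma dissipation_measurable:
  assumes t: "t \<in> {0..T}"
  shows "(\<lambda>X. dissipation \<kappa> N X (r t)) \<in> borel_measurable (config N)"
  unfolding dissipation_def
proof (rule measurable_If)
  show "{X \<in> space (config N). X \<in> (collisions N :: (nat \<Rightarrow> real ^ 'n) set)} \<in> sets (config N)"
  proof -
    have "{X \<in> space (config N). X \<in> (collisions N :: (nat \<Rightarrow> real ^ 'n) set)} = collisions N"
      by (auto simp: collisions_def)
    then show ?thesis using collisions_sets[of N] by simp
  qed
  have "velocity \<kappa> (r t) \<in> borel_measurable borel"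
    by (intro borel_measurable_continuous_onI lipschitz_on_continuous_on[OF u_lip[OF t]])
  then have "(\<lambda>x. - velocity \<kappa> (r t) x) \<in> borel_measurable borel" by (rule borel_measurable_uminus)
  then have gc: "grad_gker_conv \<kappa> (r t) \<in> borel_measurable borel" by (simp add: velocity_def)
  note cc = config_component
  show "(\<lambda>X. ennreal (1 / real N * (\<Sum>i<N. (norm ((1 / real N) *\<^sub>R (\<Sum>j\<in>{..<N} - {i}. grad (gker \<kappa>) (X i - X j))
      - grad_gker_conv \<kappa> (r t) (X i)))\<^sup>2))) \<in> borel_measurable (config N)"
    by (intro measurable_compose[OF _ measurable_ennreal] borel_measurable_times borel_measurable_const borel_measurable_sum
        borel_measurable_power borel_measurable_norm measurable_compose[OF _ borel_measurable_norm] borel_measurable_diff borel_measurable_scaleR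
        measurable_compose[OF _ grad_measurable] measurable_compose[OF _ gc] cc) auto
qed simp

text \<open>Tonelli's theorem exchanges time and expectation, so that the time integral is estimated
  along each trajectory. Joint measurability is obtained for the version \<open>d\<close>, which is
  0 for colliding initial data and continuous in time for every initial configuration.\<close>

lemma dissipation_expectation:
  "(\<integral>\<^sup>+t\<in>{0..T}. (\<integral>\<^sup>+X. dissipation \<kappa> N X (r t) \<partial>law N (r 0) \<Phi> t) \<partial>lborel) \<le> ennreal (amp * initial_error)"
proof -
  interpret P: prob_space P by (rule prob_tensor[OF zero_T])
  interpret LP: pair_sigma_finite lborel P ..
  define d where "d t X = indicator nc X * enn2real (dissipation \<kappa> N (\<Phi> t X) (r t))" for t X
  define f where "f p = d (max 0 (min T (fst p))) (snd p)" for p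
  have ncs: "nc \<in> sets P" using collisions_sets sets_tensor by (metis sets.compl_sets)
  have fm: "f \<in> borel_measurable (lborel \<Otimes>\<^sub>M P)"
    unfolding f_def
  proof (rule borel_measurable_continuous_in_time)
    show "0 \<le> T" using T by simp
    show "d s \<in> borel_measurable P" if "s \<in> {0..T}" for s
      unfolding d_def
      by (intro borel_measurable_times borel_measurable_indicator ncs borel_measurable_enn2real
          measurable_compose[OF flow_measurable_tensor[OF that] dissipation_measurable[OF that]])
    show "continuous_on {0..T} (\<lambda>s. d s X)" for X
    proof (cases "X \<in> nc")
      case X: True
      interpret pe: particle_energy "gker \<kappa>" G G' C T R \<Lambda> \<Lambda> J M r r' "\<lambda>t. velocity \<kappa> (r t)" \<Lambda> N "\<lambda>t. \<Phi> t X"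
        by (rule particle_energy[OF X])
      have "d s X = pe.dissip s" if "s \<in> {0..T}" for s
        using X unfolding d_def dissipation_eq[OF that X] by (simp add: pe.dissip_nn)
      then show ?thesis by (intro continuous_on_eq[OF pe.dissip_cont]) simp
    qed (simp add: d_def)
  qed
  have d_eq: "ennreal (d t X) = dissipation \<kappa> N (\<Phi> t X) (r t)" if "t \<in> {0..T}" "X \<in> nc" for t X
    using that(2) unfolding d_def dissipation_eq[OF that] by simp
  define h where "h t X = ennreal (f (t, X)) * indicator {0..T} t" for t X
  have hm: "case_prod h \<in> borel_measurable (lborel \<Otimes>\<^sub>M P)"
  proof -
    have "(\<lambda>p. indicator {0..T} (fst p) :: ennreal) \<in> borel_measurable (lborel \<Otimes>\<^sub>M P)" by measurable
    then show ?thesis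
      unfolding h_def case_prod_unfold prod.collapse
      by (intro borel_measurable_times_ennreal measurable_compose[OF fm measurable_ennreal])
  qed
  have "(\<integral>\<^sup>+t\<in>{0..T}. (\<integral>\<^sup>+X. dissipation \<kappa> N X (r t) \<partial>law N (r 0) \<Phi> t) \<partial>lborel) \<le> (\<integral>\<^sup>+t. (\<integral>\<^sup>+X. h t X \<partial>P) \<partial>lborel)"
  proof (rule nn_integral_mono)
    fix t :: real
    show "(\<integral>\<^sup>+X. dissipation \<kappa> N X (r t) \<partial>law N (r 0) \<Phi> t) * indicator {0..T} t \<le> (\<integral>\<^sup>+X. h t X \<partial>P)"
    proof (cases "t \<in> {0..T}")
      case t: True
      have "(\<integral>\<^sup>+X. dissipation \<kappa> N X (r t) \<partial>law N (r 0) \<Phi> t) \<le> (\<integral>\<^sup>+X. dissipation \<kappa> N (\<Phi> t X) (r t) \<partial>P)"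
        unfolding law_def by (rule nn_integral_distr_le[OF flow_measurable_tensor[OF t]])
      also have "\<dots> = (\<integral>\<^sup>+X. h t X \<partial>P)"
        by (rule nn_integral_cong_AE, rule eventually_mono[OF AE_noncollision])
          (use t in \<open>simp add: h_def f_def d_eq\<close>)
      finally show ?thesis using t by simp
    qed simp
  qed
  also have "\<dots> = (\<integral>\<^sup>+X. (\<integral>\<^sup>+t. h t X \<partial>lborel) \<partial>P)" by (rule LP.Fubini'[OF hm, symmetric])
  also have "\<dots> \<le> ennreal (amp * initial_error)"
  proof (rule expectation_bound)
    show "0 \<le> amp" using amp_pos by simp
    fix X assume X: "X \<in> nc"
    have "(\<integral>\<^sup>+t. h t X \<partial>lborel) = (\<integral>\<^sup>+t\<in>{0..T}. dissipation \<kappa> N (\<Phi> t X) (r t) \<partial>lborel)"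
      by (rule nn_integral_cong) (use X in \<open>auto simp: h_def f_def d_eq indicator_def\<close>)
    then show "(\<integral>\<^sup>+t. h t X \<partial>lborel) \<le> ennreal (amp * init_energy X)"
      using dissipation_time_integral[OF X] by simp
  qed
  finally show ?thesis .
qed

end

section \<open>Exchangeability and the Wasserstein bounds\<close>

context chaos begin

text \<open>The equations of motion are invariant under relabelling, so the relabelled trajectory
  and the trajectory from relabelled data solve the same problem, and uniqueness identifies
  them.\<close>

lemma flow_permute:
  assumes t: "0 \<le> t" and X: "X \<in> nc" and \<tau>: "bij_betw \<tau> {..<N} {..<N}" and n: "n < N"
  shows "(\<lambda>n\<in>{..<N}. X (\<tau> n)) \<in> nc" "\<Phi> t (\<lambda>n\<in>{..<N}. X (\<tau> n)) n = \<Phi> t X (\<tau> n)"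
proof -
  let ?Z = "\<lambda>n\<in>{..<N}. X (\<tau> n)"
  have \<tau>N: "\<tau> i < N" if "i < N" for i using bij_betwE[OF \<tau>] that by auto
  have \<tau>inj: "\<tau> i \<noteq> \<tau> j" if "i < N" "j < N" "i \<noteq> j" for i j
    using bij_betw_imp_inj_on[OF \<tau>] that by (auto simp: inj_on_def)
  have "?Z \<in> space (config N)" by (simp add: config_def space_PiM)
  moreover have "X i \<noteq> X j" if "i < N" "j < N" "i \<noteq> j" for i j using X that collisions_iff by blast
  ultimately show Z: "?Z \<in> nc" using \<tau>N \<tau>inj by (auto simp: collisions_iff)
  show "\<Phi> t ?Z n = \<Phi> t X (\<tau> n)"
  proof (rule particle_ode_unique[OF t N, of "\<lambda>s. \<Phi> s ?Z" "\<lambda>s n. \<Phi> s X (\<tau> n)"])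
    fix s i assume s: "s \<in> {0..t}" and i: "i < N"
    show "((\<lambda>s. \<Phi> s ?Z i) has_vector_derivative
       - (1 / real N) *\<^sub>R (\<Sum>j\<in>{..<N} - {i}. grad (gker \<kappa>) (\<Phi> s ?Z i - \<Phi> s ?Z j))) (at s within {0..t})"
      by (rule has_vector_derivative_within_subset[OF flow_der[OF Z]]) (use s i in auto)
    have "bij_betw \<tau> ({..<N} - {i}) ({..<N} - {\<tau> i})"
      using bij_betw_DiffI[OF \<tau>, of "{i}" "{\<tau> i}"] i \<tau>N by simp
    then have "(\<Sum>j\<in>{..<N} - {i}. grad (gker \<kappa>) (\<Phi> s X (\<tau> i) - \<Phi> s X (\<tau> j)))
        = (\<Sum>j\<in>{..<N} - {\<tau> i}. grad (gker \<kappa>) (\<Phi> s X (\<tau> i) - \<Phi> s X j))"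
      by (rule sum.reindex_bij_betw)
    then show "((\<lambda>s. \<Phi> s X (\<tau> i)) has_vector_derivative
       - (1 / real N) *\<^sub>R (\<Sum>j\<in>{..<N} - {i}. grad (gker \<kappa>) (\<Phi> s X (\<tau> i) - \<Phi> s X (\<tau> j)))) (at s within {0..t})"
      using has_vector_derivative_within_subset[OF flow_der[OF X, of s "\<tau> i"], of "{0..t}"] s i \<tau>N by auto
  next
    fix s i j assume "s \<in> {0..t}" "i < N" "j < N" "i \<noteq> j"
    then show "\<Phi> s ?Z i \<noteq> \<Phi> s ?Z j" "\<Phi> s X (\<tau> i) \<noteq> \<Phi> s X (\<tau> j)"
      using noncollision[OF _ Z] noncollision[OF _ X] \<tau>N \<tau>inj by auto
  next
    show "\<Phi> 0 ?Z i = \<Phi> 0 X (\<tau> i)" if "i < N" for i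
      using that by (simp only: flow_0[OF Z] flow_0[OF X]) simp
  qed (rule n)
qed

definition discrepancy :: "real \<Rightarrow> nat \<Rightarrow> (nat \<Rightarrow> real ^ 'n) \<Rightarrow> real" where
  "discrepancy t i X = (norm (\<Phi> t X i - Y t (X i)))\<^sup>2"

lemma discrepancy_measurable:
  assumes t: "t \<in> {0..T}" and i: "i < N"
  shows "(\<lambda>X. ennreal (discrepancy t i X)) \<in> borel_measurable P"
proof -
  have Ym: "Y t \<in> borel_measurable borel" using t by (intro Y_measurable) simp
  have ci: "(\<lambda>X. X i) \<in> borel_measurable P" unfolding measurable_tensor by (rule config_component[OF i])
  show ?thesis
    unfolding discrepancy_def
    by (intro measurable_compose[OF _ measurable_ennreal] borel_measurable_power measurable_compose[OF _ borel_measurable_norm]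
      borel_measurable_diff measurable_compose[OF flow_measurable_tensor[OF t] config_component[OF i]]
      measurable_compose[OF ci Ym])
qed

text \<open>The transposition of 0 and \<open>i\<close> preserves the product law and, since the
  flow commutes with it, carries one discrepancy to the other.\<close>

lemma discrepancy_exchangeable:
  assumes t: "t \<in> {0..T}" and i: "i < N"
  shows "(\<integral>\<^sup>+X. ennreal (discrepancy t i X) \<partial>P) = (\<integral>\<^sup>+X. ennreal (discrepancy t 0 X) \<partial>P)"
proof -
  define \<tau> where "\<tau> n = (if n = 0 then i else if n = i then 0 else n)" for n
  define \<sigma> where "\<sigma> X = (\<lambda>n\<in>{..<N}. X (\<tau> n))" for X :: "nat \<Rightarrow> real^'n"
  have \<tau>: "bij_betw \<tau> {..<N} {..<N}"
    by (rule bij_betw_byWitness[where f'=\<tau>]) (use i in \<open>auto simp: \<tau>_def\<close>)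
  have D: "distr P P \<sigma> = P"
    unfolding tensor_eq \<sigma>_def
    by (rule distr_PiM_reindex[of "{..<N}" "\<lambda>_. law_at 0" \<tau> "{..<N}"])
      (use \<tau> law0 in \<open>auto dest: bij_betw_imp_inj_on bij_betwE\<close>)
  have \<sigma>m: "\<sigma> \<in> measurable P P"
  proof -
    have "(\<lambda>X. X (\<tau> n)) \<in> measurable P (law_at 0)" if "n < N" for n
      by (rule coordinate_measurable) (use bij_betwE[OF \<tau>] that in auto)
    then show ?thesis unfolding \<sigma>_def tensor_eq[of N 0] by (intro measurable_restrict) (auto simp: tensor_eq)
  qed
  have "(\<integral>\<^sup>+X. ennreal (discrepancy t 0 X) \<partial>P) = (\<integral>\<^sup>+X. ennreal (discrepancy t 0 X) \<partial>distr P P \<sigma>)" by (simp only: D)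
  also have "\<dots> = (\<integral>\<^sup>+X. ennreal (discrepancy t 0 (\<sigma> X)) \<partial>P)"
    by (rule nn_integral_distr[OF \<sigma>m]) (use discrepancy_measurable[OF t N] in simp)
  also have "\<dots> = (\<integral>\<^sup>+X. ennreal (discrepancy t i X) \<partial>P)"
  proof (rule nn_integral_cong_AE, rule eventually_mono[OF AE_noncollision])
    fix X assume X: "X \<in> nc"
    have "\<Phi> t (\<sigma> X) 0 = \<Phi> t X (\<tau> 0)" unfolding \<sigma>_def by (rule flow_permute(2)[OF _ X \<tau> N]) (use t in simp)
    moreover have "\<sigma> X 0 = X (\<tau> 0)" using N by (simp add: \<sigma>_def)
    moreover have "\<tau> 0 = i" by (simp add: \<tau>_def)
    ultimately have "discrepancy t 0 (\<sigma> X) = discrepancy t i X" by (simp only: discrepancy_def)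
    then show "ennreal (discrepancy t 0 (\<sigma> X)) = ennreal (discrepancy t i X)" by simp
  qed
  finally show ?thesis by simp
qed

lemma discrepancy_sum:
  assumes t: "t \<in> {0..T}" and k: "k \<le> N"
  shows "(\<integral>\<^sup>+X. ennreal (\<Sum>i<k. discrepancy t i X) \<partial>P) = of_nat k * (\<integral>\<^sup>+X. ennreal (discrepancy t 0 X) \<partial>P)"
proof -
  have "(\<integral>\<^sup>+X. ennreal (\<Sum>i<k. discrepancy t i X) \<partial>P) = (\<integral>\<^sup>+X. (\<Sum>i<k. ennreal (discrepancy t i X)) \<partial>P)"
    by (simp add: discrepancy_def sum_ennreal)
  also have "\<dots> = (\<Sum>i<k. \<integral>\<^sup>+X. ennreal (discrepancy t i X) \<partial>P)"
    by (rule nn_integral_sum) (use discrepancy_measurable[OF t] k in auto)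
  also have "\<dots> = (\<Sum>i<k. \<integral>\<^sup>+X. ennreal (discrepancy t 0 X) \<partial>P)"
    by (rule sum.cong[OF refl], rule discrepancy_exchangeable[OF t]) (use k in auto)
  finally show ?thesis by simp
qed

text \<open>The coupling estimate controls only the sum over all particles; equal expectations allow
  division by \<open>N\<close>. This is why the marginal bounds are linear in
  \<open>k\<close>.\<close>

lemma discrepancy_expectation:
  assumes t: "t \<in> {0..T}"
  shows "(\<integral>\<^sup>+X. ennreal (discrepancy t 0 X) \<partial>P) \<le> ennreal (amp2 * initial_error)"
proof -
  have "of_nat N * (\<integral>\<^sup>+X. ennreal (discrepancy t 0 X) \<partial>P) = (\<integral>\<^sup>+X. ennreal (\<Sum>i<N. discrepancy t i X) \<partial>P)"
    by (rule discrepancy_sum[OF t order_refl, symmetric])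
  also have "\<dots> \<le> ennreal (real N * amp2 * initial_error)"
  proof (rule expectation_bound)
    show "0 \<le> real N * amp2" using amp_pos by simp
    show "ennreal (\<Sum>i<N. discrepancy t i X) \<le> ennreal (real N * amp2 * init_energy X)" if "X \<in> nc" for X
      using coupling_bound[OF t that] by (simp add: discrepancy_def ennreal_leI mult.assoc)
  qed
  also have "\<dots> = of_nat N * ennreal (amp2 * initial_error)"
    by (simp add: ennreal_mult' mult.assoc flip: ennreal_of_nat_eq_real_of_nat)
  finally show ?thesis using N by (subst (asm) ennreal_mult_le_mult_iff) (auto simp: ennreal_of_nat_eq_real_of_nat)
qed

text \<open>The points \<open>Y t (X i)\<close> are images of independent positions under one map,
  hence independent with density \<open>r t\<close>.\<close>

lemma distr_limit_flow:
  assumes t: "t \<in> {0..T}" and k: "k \<le> N"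
  shows "(\<lambda>X. \<lambda>i\<in>{..<k}. Y t (X i)) \<in> measurable P (config k)"
    "distr P (config k) (\<lambda>X. \<lambda>i\<in>{..<k}. Y t (X i)) = tensor_power k (r t)"
proof -
  have Ym: "Y t \<in> borel_measurable borel" using t by (intro Y_measurable) auto
  have Ym0: "Y t \<in> measurable (law_at 0) borel" using Ym measurable_cong_sets[OF sets_law_at refl] by blast
  have pm: "(\<lambda>X. \<lambda>i\<in>{..<k}. X i) \<in> measurable P (PiM {..<k} (\<lambda>_. law_at 0))"
    by (intro measurable_restrict coordinate_measurable) (use k in auto)
  have ym: "(\<lambda>\<omega>. \<lambda>i\<in>{..<k}. Y t (\<omega> i)) \<in> measurable (PiM {..<k} (\<lambda>_. law_at 0)) (config k)"
    unfolding config_def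
    by (intro measurable_restrict measurable_compose[OF _ Ym0]) auto
  have comp: "(\<lambda>\<omega>. \<lambda>i\<in>{..<k}. Y t (\<omega> i)) \<circ> (\<lambda>X. \<lambda>i\<in>{..<k}. X i) = (\<lambda>X. \<lambda>i\<in>{..<k}. Y t (X i))"
    by (auto simp: fun_eq_iff)
  show "(\<lambda>X. \<lambda>i\<in>{..<k}. Y t (X i)) \<in> measurable P (config k)"
    using measurable_comp[OF pm ym] unfolding comp .
  have "distr P (PiM {..<k} (\<lambda>_. law_at 0)) (\<lambda>X. \<lambda>i\<in>{..<k}. X i) = PiM {..<k} (\<lambda>_. law_at 0)"
    unfolding tensor_eq by (rule distr_PiM_reindex[of "{..<N}" "\<lambda>_. law_at 0" "\<lambda>i. i" "{..<k}"]) (use k law0 in auto)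
  then have "distr P (config k) (\<lambda>X. \<lambda>i\<in>{..<k}. Y t (X i))
      = distr (PiM {..<k} (\<lambda>_. law_at 0)) (config k) (\<lambda>\<omega>. \<lambda>i\<in>{..<k}. Y t (\<omega> i))"
    using distr_distr[OF ym pm] unfolding comp by simp
  also have "\<dots> = PiM {..<k} (\<lambda>_. distr (law_at 0) borel (Y t))"
    unfolding config_def by (rule distr_PiM_map[OF law0 _ Ym0]) simp
  also have "\<dots> = tensor_power k (r t)" by (simp add: tensor_eq distr_Y[OF t])
  finally show "distr P (config k) (\<lambda>X. \<lambda>i\<in>{..<k}. Y t (X i)) = tensor_power k (r t)" .
qed

lemma W2_sq_bound:
  assumes t: "t \<in> {0..T}" and k: "k \<le> N"
    and F: "F \<in> measurable P (config k)" "\<And>X i. i < k \<Longrightarrow> F X i = \<Phi> t X i"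
  shows "W2_sq k (distr P (config k) F) (tensor_power k (r t)) \<le> ennreal (real k * (amp2 * initial_error))"
proof -
  have "W2_sq k (distr P (config k) F) (tensor_power k (r t))
      \<le> (\<integral>\<^sup>+X. ennreal (\<Sum>i<k. (norm (F X i - (\<lambda>i\<in>{..<k}. Y t (X i)) i))\<^sup>2) \<partial>P)"
    by (rule W2_sq_le_coupling[OF F(1) distr_limit_flow(1)[OF t k] refl distr_limit_flow(2)[OF t k, symmetric]])
  also have "\<dots> = (\<integral>\<^sup>+X. ennreal (\<Sum>i<k. discrepancy t i X) \<partial>P)"
    by (intro nn_integral_cong arg_cong[where f=ennreal] sum.cong) (auto simp: discrepancy_def F(2))
  also have "\<dots> \<le> of_nat k * ennreal (amp2 * initial_error)"
    unfolding discrepancy_sum[OF t k] by (intro mult_left_mono discrepancy_expectation[OF t]) simp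
  also have "\<dots> = ennreal (real k * (amp2 * initial_error))"
    by (simp add: ennreal_mult' flip: ennreal_of_nat_eq_real_of_nat)
  finally show ?thesis .
qed

lemma W2_sq_law:
  assumes t: "t \<in> {0..T}"
  shows "W2_sq N (law N (r 0) \<Phi> t) (tensor_power N (r t)) \<le> ennreal (real N * (amp2 * initial_error))"
  unfolding law_def by (rule W2_sq_bound[OF t order_refl flow_measurable_tensor[OF t]]) simp

lemma W2_sq_marginal:
  assumes t: "t \<in> {0..T}" and k: "k \<le> N"
  shows "W2_sq k (marginal k (law N (r 0) \<Phi> t)) (tensor_power k (r t)) \<le> ennreal (real k * (amp2 * initial_error))"
proof -
  have rm: "(\<lambda>X. restrict X {..<k}) \<in> measurable (config N) (config k :: (nat \<Rightarrow> real ^ 'n) measure)"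
    unfolding config_def by (rule measurable_restrict_subset) (use k in auto)
  have "marginal k (law N (r 0) \<Phi> t) = distr P (config k) (\<lambda>X. restrict (\<Phi> t X) {..<k})"
    unfolding marginal_def law_def using distr_distr[OF rm flow_measurable_tensor[OF t]] by (simp add: o_def)
  moreover have "W2_sq k (distr P (config k) (\<lambda>X. restrict (\<Phi> t X) {..<k})) (tensor_power k (r t)) \<le> ennreal (real k * (amp2 * initial_error))"
    by (rule W2_sq_bound[OF t k measurable_compose[OF flow_measurable_tensor[OF t] rm]]) simp
  ultimately show ?thesis by simp
qed

end

section \<open>Error terms\<close>

text \<open>In dimension two the kernel is \<open>bessel_K 0 (\<kappa> * norm x) / (2 * pi)\<close>,
  whose numerator is at least \<open>- ln \<kappa> - ln (norm x) - 1\<close>. Adding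
  \<open>c_ren\<close> cancels the term \<open>ln \<kappa>\<close>, which is unbounded as
  \<open>\<kappa>\<close> tends to 0, and what is left depends only on \<open>D\<close>.\<close>

lemma gker_plus_c_ren_ge:
  fixes x :: "real ^ 'n"
  assumes d: "2 \<le> CARD('n)" and \<kappa>: "0 < \<kappa>" and x: "x \<noteq> 0" "norm x \<le> D" and D: "1 \<le> D"
  shows "- (ln D + 1) \<le> gker \<kappa> x + c_ren CARD('n) \<kappa>"
proof (cases "CARD('n) = 2")
  case False
  have "0 \<le> gker \<kappa> x" using gker_eq_gprof[OF \<kappa> x(1)] gprof_nonneg[where 'n='n] by metis
  moreover have "0 \<le> ln D" using D by simp
  ultimately show ?thesis using False by (simp add: c_ren_def)
next
  case True
  have n: "0 < norm x" using x by simp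
  have "gker \<kappa> x + c_ren CARD('n) \<kappa> = (bessel_K 0 (\<kappa> * norm x) + ln \<kappa>) / (2 * pi)"
    using \<kappa> n by (simp add: gker_def c_ren_def True powr_minus field_simps)
  moreover have "- (ln D + 1) \<le> bessel_K 0 (\<kappa> * norm x) + ln \<kappa>"
  proof -
    have "ln (norm x) \<le> ln D" using x(2) n D by (subst ln_le_cancel_iff) auto
    then show ?thesis using bessel_K_0_ge[of "\<kappa> * norm x"] \<kappa> n by (simp add: ln_mult)
  qed
  then have "- (ln D + 1) / (2 * pi) \<le> (bessel_K 0 (\<kappa> * norm x) + ln \<kappa>) / (2 * pi)"
    by (rule divide_right_mono) simp
  moreover have "(ln D + 1) / (2 * pi) \<le> ln D + 1"
  proof -
    have "(ln D + 1) * 1 \<le> (ln D + 1) * (2 * pi)"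
      using D pi_gt3 by (intro mult_left_mono) (auto intro: add_nonneg_nonneg)
    then show ?thesis by (simp add: pos_divide_le_eq)
  qed
  moreover have "- (ln D + 1) / (2 * pi) = - ((ln D + 1) / (2 * pi))" by (rule minus_divide_left[symmetric])
  ultimately show ?thesis by linarith
qed

text \<open>The radius \<open>R0\<close> refers to the initial density alone, in contrast to
  \<open>R\<close>, so the bound is uniform in \<open>\<kappa>\<close>. Two points of the support
  are at distance at most \<open>2 * R0\<close>.\<close>

lemma (in chaos) self_energy_ge:
  assumes \<kappa>: "0 < \<kappa>" and R0: "1 \<le> R0" "\<And>x. norm x > R0 \<Longrightarrow> r 0 x = 0"
  shows "- (ln (2 * R0) + 1) \<le> self_energy + c_ren CARD('n) \<kappa>"
proof -
  interpret kd: kernel_density "gker \<kappa> :: real ^ 'n \<Rightarrow> real" G G' C "r 0" \<Lambda> R0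
    using \<rho>_meas[OF zero_T] \<rho>_nn[OF zero_T] r_bd[OF zero_T] R0 prob_space_law_at[OF zero_T]
    by (intro kernel_density.intro kernel_density_axioms.intro singular_kernel_axioms) (auto simp: law_at_def)
  have mu: "kd.\<mu> = law_at 0" by (simp add: kd.\<mu>_def law_at_def)
  interpret L0: prob_space "law_at 0" by (rule law0)
  interpret L00: pair_prob_space "law_at 0" "law_at 0" ..
  have s: "AE x in law_at 0. norm x \<le> R0" using kd.AE_mu_supp unfolding mu .
  have "AE p in law_at 0 \<Otimes>\<^sub>M law_at 0. norm (fst p) \<le> R0 \<and> norm (snd p) \<le> R0"
  proof (rule L00.AE_pair_measure)
    show "{p \<in> space (law_at 0 \<Otimes>\<^sub>M law_at 0). norm (fst p) \<le> R0 \<and> norm (snd p) \<le> R0} \<in> sets (law_at 0 \<Otimes>\<^sub>M law_at 0)"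
      by measurable
    show "AE x in law_at 0. AE y in law_at 0. norm (fst (x, y)) \<le> R0 \<and> norm (snd (x, y)) \<le> R0"
      by (rule eventually_mono[OF s], rule eventually_mono[OF s]) simp
  qed
  moreover have "AE p in law_at 0 \<Otimes>\<^sub>M law_at 0. fst p \<noteq> snd p" using kd.AE_mu2_ne unfolding mu .
  ultimately have "AE p in law_at 0 \<Otimes>\<^sub>M law_at 0. - (ln (2 * R0) + 1) - c_ren CARD('n) \<kappa> \<le> gker \<kappa> (fst p - snd p)"
  proof eventually_elim
    fix p :: "(real^'n) \<times> (real^'n)"
    assume p: "norm (fst p) \<le> R0 \<and> norm (snd p) \<le> R0" "fst p \<noteq> snd p"
    have "norm (fst p - snd p) \<le> 2 * R0" using norm_triangle_ineq4[of "fst p" "snd p"] p by linarith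
    then show "- (ln (2 * R0) + 1) - c_ren CARD('n) \<kappa> \<le> gker \<kappa> (fst p - snd p)"
      using gker_plus_c_ren_ge[OF dim \<kappa>, of "fst p - snd p" "2 * R0"] p R0 by simp
  qed
  then have "- (ln (2 * R0) + 1) - c_ren CARD('n) \<kappa> \<le> self_energy"
    unfolding self_energy_def by (rule L00.P.integral_ge_const[OF integrable_self_energy])
  then show ?thesis by simp
qed

lemma inverse_le_rate:
  assumes "2 \<le> d" "1 \<le> N"
  shows "1 / real N \<le> rate N d"
proof (cases "d = 2")
  case True
  then show ?thesis using assms by (simp add: rate_def divide_right_mono)
next
  case False
  have "real N powr (- 1) \<le> real N powr (- 2 / real d)"
    using assms by (intro powr_mono) (auto simp: field_simps)
  then show ?thesis using False assms by (simp add: rate_def powr_minus_divide)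
qed

lemma eta_radius_bounds:
  assumes "0 < \<eta>0" "1 \<le> N" "2 \<le> d"
  shows "0 < eta_radius d \<eta>0 N" "eta_radius d \<eta>0 N < \<eta>0"
proof -
  have p: "0 < real N powr (- 1 / real d)" "real N powr (- 1 / real d) \<le> 1"
    using assms powr_mono[of "- 1 / real d" 0 "real N"] by auto
  then show "0 < eta_radius d \<eta>0 N" using assms by (simp add: eta_radius_def)
  have "eta_radius d \<eta>0 N \<le> 1 / 2 * min 1 \<eta>0 * 1"
    unfolding eta_radius_def using p assms by (intro mult_left_mono) auto
  then show "eta_radius d \<eta>0 N < \<eta>0" using assms by (simp add: min_def split: if_splits)
qed

text \<open>At a radius of order \<open>N powr (- 1 / d)\<close>, the typical distance between
  neighbouring particles, the errors \<open>ell d \<eta> / N\<close> and \<open>\<eta>^2\<close>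
  have the same order for \<open>d \<ge> 3\<close>; in dimension two the logarithm in
  \<open>ell\<close> dominates and determines the rate.\<close>

lemma eps_eta_radius_le:
  assumes \<eta>0: "0 < \<eta>0" and d: "2 \<le> d"
  obtains C where "0 \<le> C" "\<And>N \<kappa>. 1 \<le> N \<Longrightarrow> 0 < \<kappa> \<Longrightarrow> \<kappa> \<le> \<kappa>s \<Longrightarrow> eps d N \<kappa> (eta_radius d \<eta>0 N) \<le> C * rate N d"
proof -
  define m where "m = 1 / 2 * min 1 \<eta>0"
  have m: "0 < m" "m \<le> 1" using \<eta>0 by (auto simp: m_def)
  \<comment> \<open>The value of \<open>ell\<close> at the factor \<open>m\<close>, which is what
    remains of the radius once the power of \<open>N\<close> has been split off.\<close>
  define E where "E = (if d = 2 then 1 + ln (1 / m) else m powr (2 - real d))"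
  have E: "0 \<le> E" using m by (auto simp: E_def)
  have bound: "eps d N \<kappa> (eta_radius d \<eta>0 N) \<le> (E + 1 + \<kappa>s\<^sup>2) * rate N d"
    if N: "1 \<le> N" and \<kappa>: "0 < \<kappa>" "\<kappa> \<le> \<kappa>s" for N \<kappa>
  proof -
    define \<eta> where "\<eta> = m * real N powr (- 1 / real d)"
    have \<eta>: "eta_radius d \<eta>0 N = \<eta>" by (simp add: eta_radius_def \<eta>_def m_def)
    have \<eta>0: "0 < \<eta>" using m N by (simp add: \<eta>_def)
    have sq: "\<eta>\<^sup>2 \<le> real N powr (- 2 / real d)"
    proof -
      have "\<eta>\<^sup>2 = m\<^sup>2 * (real N powr (- 1 / real d) * real N powr (- 1 / real d))"
        by (simp add: \<eta>_def power2_eq_square mult_ac)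
      also have "\<dots> = m\<^sup>2 * real N powr (- 2 / real d)" unfolding powr_add[symmetric] by simp
      also have "\<dots> \<le> 1 * real N powr (- 2 / real d)"
        using m by (intro mult_right_mono) (auto intro: power_le_one)
      finally show ?thesis by simp
    qed
    have rate2: "real N powr (- 2 / real d) \<le> rate N d"
      using N by (auto simp: rate_def powr_minus_divide intro!: divide_right_mono)
    have rate0: "0 \<le> rate N d" using sq rate2 zero_le_power2[of \<eta>] by linarith
    have ell: "ell d \<eta> / real N \<le> E * rate N d"
    proof (cases "d = 2")
      case True
      have l: "ln (1 / \<eta>) = ln (1 / m) + 1 / 2 * ln (real N)"
        using m N by (simp add: \<eta>_def ln_div ln_mult ln_powr True)
      have nn: "0 \<le> ln (1 / m)" "0 \<le> ln (real N)" using m N by auto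
      have "ell d \<eta> = 1 + (ln (1 / m) + 1 / 2 * ln (real N))"
        unfolding ell_def using True nn l by simp
      also have "\<dots> \<le> (1 + ln (1 / m)) * (1 + ln (real N))"
        using nn mult_nonneg_nonneg[OF nn] by (simp add: algebra_simps)
      finally have "ell d \<eta> / real N \<le> (1 + ln (1 / m)) * (1 + ln (real N)) / real N"
        by (rule divide_right_mono) simp
      then show ?thesis by (simp add: E_def rate_def True)
    next
      case False
      have "ell d \<eta> = m powr (2 - real d) * real N powr (- 1 / real d * (2 - real d))"
        using False m N by (simp add: ell_def \<eta>_def powr_mult powr_powr)
      also have "- 1 / real d * (2 - real d) = - 2 / real d + 1" using d by (simp add: field_simps)
      also have "real N powr (- 2 / real d + 1) = real N powr (- 2 / real d) * real N"
        using N powr_add[of "real N" "- 2 / real d" 1] by simp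
      finally have "ell d \<eta> / real N = m powr (2 - real d) * real N powr (- 2 / real d)" using N by simp
      then show ?thesis by (simp add: E_def rate_def False)
    qed
    have "\<kappa>\<^sup>2 * \<eta>\<^sup>2 \<le> \<kappa>s\<^sup>2 * rate N d"
      using \<kappa> sq rate2 by (intro mult_mono power_mono) auto
    then show ?thesis using ell sq rate2 unfolding eps_def \<eta> by (simp add: algebra_simps)
  qed
  show thesis by (rule that[OF _ bound]) (use E in auto)
qed

text \<open>The commutator estimate in terms of real numbers: away from collisions the renormalised
  energy is finite, and \<open>b\<close> collects the error and the renormalisation. A field with
  norm at most \<open>\<Lambda>\<close> contributes the factor
  \<open>Ccom \<Lambda> * \<Lambda>\<close>.\<close>

lemma commutator_constantsD:
  fixes \<rho> :: "real ^ 'n \<Rightarrow> real" and u :: "real ^ 'n \<Rightarrow> real ^ 'n"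
  assumes cc: "commutator_constants TYPE('n) \<kappa>s \<eta>0 B Ccom" and \<Lambda>: "0 < \<Lambda>"
    and N: "2 \<le> N" and \<kappa>: "0 < \<kappa>" "\<kappa> \<le> \<kappa>s" and \<eta>: "0 < \<eta>" "\<eta> < \<eta>0"
    and \<rho>: "prob_density \<rho>" "Linf_norm \<rho> \<le> ennreal \<Lambda>" and X: "X \<in> space (config N) - collisions N"
  defines "b \<equiv> B \<Lambda> * eps CARD('n) N \<kappa> \<eta> - c_ren CARD('n) \<kappa> / real N"
  shows "0 \<le> mod_energy \<kappa> N X \<rho> + b"
    and "W1inf_norm u \<le> ennreal \<Lambda> \<Longrightarrow> \<bar>commutator \<kappa> N X \<rho> u\<bar> \<le> Ccom \<Lambda> * \<Lambda> * (mod_energy \<kappa> N X \<rho> + b)"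
proof -
  have E: "mod_energy_sharp \<kappa> N X \<rho> + ereal (B \<Lambda> * eps CARD('n) N \<kappa> \<eta>) = ereal (mod_energy \<kappa> N X \<rho> + b)"
    using X by (simp add: mod_energy_sharp_def b_def)
  have main: "ereal (eps CARD('n) N \<kappa> \<eta>) \<le> ereal (mod_energy \<kappa> N X \<rho> + b)" "0 \<le> eps CARD('n) N \<kappa> \<eta>" "1 \<le> Ccom \<Lambda>"
    "\<And>u :: real ^ 'n \<Rightarrow> real ^ 'n. \<exists>L. L-lipschitz_on UNIV u \<Longrightarrow>
      ereal \<bar>commutator \<kappa> N X \<rho> u\<bar> \<le> ereal (Ccom \<Lambda> * enn2real (Linf_grad u)) * ereal (mod_energy \<kappa> N X \<rho> + b)"
    using cc N \<kappa> \<eta> \<rho> X \<Lambda> unfolding commutator_constants_def Let_def E[symmetric] by auto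
  show nn: "0 \<le> mod_energy \<kappa> N X \<rho> + b" using main(1,2) by simp
  assume "W1inf_norm u \<le> ennreal \<Lambda>"
  then have u: "Linf_grad u \<le> ennreal \<Lambda>" unfolding W1inf_norm_def by (meson le_add2 order_trans add_increasing order_refl zero_le)
  then have "\<exists>L. L-lipschitz_on UNIV u" by (auto simp: Linf_grad_def top_unique split: if_splits)
  from main(4)[OF this] have "\<bar>commutator \<kappa> N X \<rho> u\<bar> \<le> Ccom \<Lambda> * enn2real (Linf_grad u) * (mod_energy \<kappa> N X \<rho> + b)" by simp
  also have "\<dots> \<le> Ccom \<Lambda> * \<Lambda> * (mod_energy \<kappa> N X \<rho> + b)"
  proof (rule mult_right_mono[OF mult_left_mono nn])
    show "enn2real (Linf_grad u) \<le> \<Lambda>" using u \<Lambda> by (simp add: enn2real_leI)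
  qed (use main(3) in simp)
  finally show "\<bar>commutator \<kappa> N X \<rho> u\<bar> \<le> Ccom \<Lambda> * \<Lambda> * (mod_energy \<kappa> N X \<rho> + b)" .
qed

theorem corollary5p6:
  fixes \<beta> \<kappa>s Ts T \<eta>0 :: real
    and \<rho>0 :: "real ^ 'n \<Rightarrow> real"
    and \<rho> :: "real \<Rightarrow> real \<Rightarrow> real ^ 'n \<Rightarrow> real"
    and B Ccom :: "real \<Rightarrow> real"
  assumes "CARD('n) \<ge> 2"
    and "0 < \<beta>" and "\<beta> < 1"
    and "0 < \<kappa>s"
    and "prob_density \<rho>0" and "\<rho>0 \<in> C1c_space \<beta>"
    and "0 < Ts" and "solution_family \<beta> \<kappa>s Ts \<rho>0 \<rho>"
    and "0 < T" and "T < Ts"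
    and "commutator_constants TYPE('n) \<kappa>s \<eta>0 B Ccom"
  shows "\<exists>C::real. 0 \<le> C \<and>
    (\<forall>N\<ge>2. \<forall>\<kappa>. 0 < \<kappa> \<and> \<kappa> \<le> \<kappa>s \<longrightarrow>
      (\<forall>\<Phi>. particle_flow \<kappa> N \<Phi> \<longrightarrow>
        (SUP t\<in>{0..T}.
            ennreal (1 / real N) * W2_sq N (law N \<rho>0 \<Phi> t) (tensor_power N (\<rho> \<kappa> t))
            + (\<integral>\<^sup>+X. e2ennreal (mod_energy_sharp \<kappa> N X (\<rho> \<kappa> t)
                 + ereal (B (Lambda_T \<kappa>s T \<rho>) * eps CARD('n) N \<kappa> (eta_radius CARD('n) \<eta>0 N)))
                 \<partial>law N \<rho>0 \<Phi> t))
          + (\<integral>\<^sup>+t\<in>{0..T}. (\<integral>\<^sup>+X. dissipation \<kappa> N X (\<rho> \<kappa> t) \<partial>law N \<rho>0 \<Phi> t) \<partial>lborel)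
          \<le> ennreal (C * rate N CARD('n)) \<and>
        (\<forall>k. 1 \<le> k \<and> k \<le> N \<longrightarrow>
          (SUP t\<in>{0..T}. W2_sq k (marginal k (law N \<rho>0 \<Phi> t)) (tensor_power k (\<rho> \<kappa> t)))
          \<le> ennreal (C * real k * rate N CARD('n)))))"
proof -
  define \<Lambda> where "\<Lambda> = Lambda_T \<kappa>s T \<rho>"
  \<comment> \<open>The rate of the energy estimate: the commutator constant times the bound for the
    gradient of the velocity. It depends on neither \<open>\<kappa>\<close> nor
    \<open>N\<close>.\<close>
  define c where "c = Ccom \<Lambda> * \<Lambda>"
  define a1 where "a1 = exp (c * T)"
  define a2 where "a2 = exp ((1 + 2 * \<Lambda>) * T) * a1"
  have \<Lambda>: "1 \<le> \<Lambda>" unfolding \<Lambda>_def by (rule solution_family_bounds(1)[OF assms(8-10)])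
  have \<rho>_bd: "Linf_norm (\<rho> \<kappa> t) \<le> ennreal \<Lambda>" "W1inf_norm (velocity \<kappa> (\<rho> \<kappa> t)) \<le> ennreal \<Lambda>"
    if "\<kappa> \<in> {0..\<kappa>s}" "t \<in> {0..T}" for \<kappa> t
    unfolding \<Lambda>_def by (rule solution_family_bounds(2,3)[OF assms(8-10) that])+
  have \<eta>0: "0 < \<eta>0" and BC: "1 \<le> B \<Lambda>" "1 \<le> Ccom \<Lambda>"
    using assms(11) \<Lambda> unfolding commutator_constants_def by auto
  have c: "0 \<le> c" using BC \<Lambda> by (simp add: c_def)
  have a: "0 < a1" "0 < a2" by (simp_all add: a1_def a2_def)
  obtain C\<epsilon> where C\<epsilon>: "0 \<le> C\<epsilon>" "\<And>N \<kappa>. 1 \<le> N \<Longrightarrow> 0 < \<kappa> \<Longrightarrow> \<kappa> \<le> \<kappa>s \<Longrightarrow>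
      eps CARD('n) N \<kappa> (eta_radius CARD('n) \<eta>0 N) \<le> C\<epsilon> * rate N CARD('n)"
    using eps_eta_radius_le[OF \<eta>0 assms(1), of \<kappa>s] by blast
  obtain R1 where R1: "supp \<rho>0 \<subseteq> ball 0 R1"
  proof -
    have "bounded (supp \<rho>0)" using assms(6) by (auto simp: C1c_space_def intro: compact_imp_bounded)
    then show thesis using that bounded_subset_ballD[of "supp \<rho>0" 0] by blast
  qed
  \<comment> \<open>The maximum with 1 keeps the logarithm of \<open>2 * R0\<close>
    nonnegative.\<close>
  define R0 where "R0 = max 1 R1"
  have R0: "1 \<le> R0" "\<And>x. norm x > R0 \<Longrightarrow> \<rho>0 x = 0"
    using supp_subset_ball_eq_0[OF R1] by (auto simp: R0_def)
  \<comment> \<open>The expected initial error per unit of rate: the first summand comes from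
    \<open>B * eps\<close>, the second from the lower bound on the renormalised self-interaction
    energy.\<close>
  define C1 where "C1 = B \<Lambda> * C\<epsilon> + (ln (2 * R0) + 1)"
  have C1: "0 \<le> C1" using BC C\<epsilon>(1) R0 unfolding C1_def by (intro add_nonneg_nonneg mult_nonneg_nonneg) auto
  \<comment> \<open>One summand each for the Wasserstein, energy and dissipation terms; the marginal
    bounds reuse \<open>a2\<close>.\<close>
  define C where "C = (a2 + a1 + a1) * C1"
  have C: "0 \<le> C" using C1 a by (simp add: C_def)
  have main: "(SUP t\<in>{0..T}.
            ennreal (1 / real N) * W2_sq N (law N \<rho>0 \<Phi> t) (tensor_power N (\<rho> \<kappa> t))
            + (\<integral>\<^sup>+X. e2ennreal (mod_energy_sharp \<kappa> N X (\<rho> \<kappa> t)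
                 + ereal (B \<Lambda> * eps CARD('n) N \<kappa> (eta_radius CARD('n) \<eta>0 N)))
                 \<partial>law N \<rho>0 \<Phi> t))
          + (\<integral>\<^sup>+t\<in>{0..T}. (\<integral>\<^sup>+X. dissipation \<kappa> N X (\<rho> \<kappa> t) \<partial>law N \<rho>0 \<Phi> t) \<partial>lborel)
          \<le> ennreal (C * rate N CARD('n))" (is ?A)
        and marg: "\<And>k. k \<le> N \<Longrightarrow>
          (SUP t\<in>{0..T}. W2_sq k (marginal k (law N \<rho>0 \<Phi> t)) (tensor_power k (\<rho> \<kappa> t)))
          \<le> ennreal (C * real k * rate N CARD('n))"
    if N: "2 \<le> N" and \<kappa>: "0 < \<kappa>" "\<kappa> \<le> \<kappa>s" and \<Phi>: "particle_flow \<kappa> N \<Phi>" for N \<kappa> \<Phi>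
  proof -
    define \<eta> where "\<eta> = eta_radius CARD('n) \<eta>0 N"
    have \<eta>: "0 < \<eta>" "\<eta> < \<eta>0" using eta_radius_bounds[OF \<eta>0 _ assms(1), of N] N by (auto simp: \<eta>_def)
    define e where "e = B \<Lambda> * eps CARD('n) N \<kappa> \<eta>"
    define b where "b = e - c_ren CARD('n) \<kappa> / real N"
    have \<kappa>': "\<kappa> \<in> {0..\<kappa>s}" using \<kappa> by simp
    have sol: "classical_solution \<beta> \<kappa> Ts \<rho>0 (\<rho> \<kappa>)" using assms(8) \<kappa>' unfolding solution_family_def by blast
    then have r0: "\<rho> \<kappa> 0 = \<rho>0" unfolding classical_solution_def by blast
    have pd: "prob_density (\<rho> \<kappa> t)" if "t \<in> {0..T}" for t
      using sol that assms(10) unfolding classical_solution_def by auto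
    obtain K where k: "singular_kernel (gker \<kappa> :: real ^ 'n \<Rightarrow> real) (gprof TYPE('n) \<kappa>) (gprof' TYPE('n) \<kappa>) K"
      using yukawa_singular_kernel[OF assms(1) \<kappa>(1)] by blast
    have \<Lambda>0: "0 \<le> \<Lambda>" "0 < \<Lambda>" using \<Lambda> by auto
    obtain R J M r' where tr: "transport T R \<Lambda> \<Lambda> J M (\<rho> \<kappa>) r' (\<lambda>t. velocity \<kappa> (\<rho> \<kappa> t))"
      and rb: "\<And>t x. t \<in> {0..T} \<Longrightarrow> \<rho> \<kappa> t x \<le> \<Lambda>"
      using classical_solution_transport[OF k assms(9,10,2) sol \<Lambda>0(1) \<rho>_bd[OF \<kappa>']] by blast
    \<comment> \<open>The constants \<open>K\<close>, \<open>R\<close>, \<open>J\<close> and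
      \<open>M\<close> were obtained for this particular \<open>\<kappa>\<close>; none of them
      occurs in \<open>C\<close>.\<close>
    interpret ch: chaos \<kappa> "gprof TYPE('n) \<kappa>" "gprof' TYPE('n) \<kappa>" K T R \<Lambda> J M "\<rho> \<kappa>" r' N \<Phi> b c
    proof (rule chaos.intro[OF k tr], unfold_locales)
      fix t and X :: "nat \<Rightarrow> real ^ 'n" assume t: "t \<in> {0..T}" and X: "X \<in> space (config N) - collisions N"
      note cd = commutator_constantsD[OF assms(11) \<Lambda>0(2) N \<kappa> \<eta> pd[OF t] \<rho>_bd(1)[OF \<kappa>' t] X, folded e_def, folded b_def]
      show "0 \<le> mod_energy \<kappa> N X (\<rho> \<kappa> t) + b" by (rule cd(1))
      show "\<bar>commutator \<kappa> N X (\<rho> \<kappa> t) (velocity \<kappa> (\<rho> \<kappa> t))\<bar> \<le> c * (mod_energy \<kappa> N X (\<rho> \<kappa> t) + b)"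
        unfolding c_def by (rule cd(2)[OF \<rho>_bd(2)[OF \<kappa>' t]])
    qed (use rb N \<Phi> c in auto)
    have amp: "ch.amp = a1" "ch.amp2 = a2" by (simp_all add: ch.amp_def ch.amp2_def a1_def a2_def)
    define q where "q = C1 * rate N CARD('n)"
    have rate: "1 / real N \<le> rate N CARD('n)" by (rule inverse_le_rate[OF assms(1)]) (use N in simp)
    then have rate0: "0 \<le> rate N CARD('n)" by (rule order_trans[rotated]) simp
    then have q: "0 \<le> q" using C1 by (simp add: q_def)
    have err: "ch.initial_error \<le> q"
    proof -
      have "e \<le> B \<Lambda> * (C\<epsilon> * rate N CARD('n))"
        unfolding e_def \<eta>_def using C\<epsilon>(2)[of N \<kappa>] N \<kappa> BC by (intro mult_left_mono) auto
      moreover have "- (ch.self_energy + c_ren CARD('n) \<kappa>) / real N \<le> (ln (2 * R0) + 1) * rate N CARD('n)"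
      proof -
        have "- (ln (2 * R0) + 1) \<le> ch.self_energy + c_ren CARD('n) \<kappa>"
          by (rule ch.self_energy_ge[OF \<kappa>(1) R0(1)]) (simp add: r0 R0(2))
        then have "- (ch.self_energy + c_ren CARD('n) \<kappa>) / real N \<le> (ln (2 * R0) + 1) / real N"
          by (intro divide_right_mono) auto
        also have "\<dots> = (ln (2 * R0) + 1) * (1 / real N)" by simp
        also have "\<dots> \<le> (ln (2 * R0) + 1) * rate N CARD('n)" using rate R0(1) by (intro mult_left_mono) auto
        finally show ?thesis .
      qed
      \<comment> \<open>The part \<open>- c_ren / N\<close> of \<open>b\<close> joins
        \<open>- self_energy / N\<close> to form the renormalised self-interaction energy, which is
        bounded below uniformly in \<open>\<kappa>\<close>.\<close>
      moreover have "ch.initial_error = e + - (ch.self_energy + c_ren CARD('n) \<kappa>) / real N"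
        by (simp add: b_def diff_divide_distrib add_divide_distrib)
      ultimately show ?thesis by (simp add: q_def C1_def algebra_simps)
    qed
    have le: "ennreal (x * ch.initial_error) \<le> ennreal (x * q)" if "0 \<le> x" for x
      using err that by (intro ennreal_leI mult_left_mono)
    have W: "ennreal (1 / real N) * W2_sq N (law N \<rho>0 \<Phi> t) (tensor_power N (\<rho> \<kappa> t)) \<le> ennreal (a2 * q)"
      if t: "t \<in> {0..T}" for t
    proof -
      have "ennreal (1 / real N) * W2_sq N (law N \<rho>0 \<Phi> t) (tensor_power N (\<rho> \<kappa> t))
          \<le> ennreal (1 / real N) * ennreal (real N * (a2 * ch.initial_error))"
        using ch.W2_sq_law[OF t] unfolding r0 amp by (intro mult_left_mono) auto
      also have "\<dots> = ennreal (a2 * ch.initial_error)" using N by (simp add: ennreal_mult'[symmetric])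
      also have "\<dots> \<le> ennreal (a2 * q)" using a by (intro le) simp
      finally show ?thesis .
    qed
    have F: "(\<integral>\<^sup>+X. e2ennreal (mod_energy_sharp \<kappa> N X (\<rho> \<kappa> t) + ereal e) \<partial>law N \<rho>0 \<Phi> t) \<le> ennreal (a1 * q)"
      if t: "t \<in> {0..T}" for t
      using ch.sharp_energy_expectation[OF t b_def] le[of a1] a unfolding r0 amp by auto
    have D: "(\<integral>\<^sup>+t\<in>{0..T}. (\<integral>\<^sup>+X. dissipation \<kappa> N X (\<rho> \<kappa> t) \<partial>law N \<rho>0 \<Phi> t) \<partial>lborel) \<le> ennreal (a1 * q)"
      using ch.dissipation_expectation le[of a1] a unfolding r0 amp by auto
    have "C * rate N CARD('n) = a2 * q + a1 * q + a1 * q" by (simp add: C_def q_def algebra_simps)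
    moreover have "ennreal (a2 * q + a1 * q + a1 * q) = ennreal (a2 * q) + ennreal (a1 * q) + ennreal (a1 * q)"
      using a q by (subst ennreal_plus, simp, simp)+ simp
    ultimately have split: "ennreal (C * rate N CARD('n)) = ennreal (a2 * q) + ennreal (a1 * q) + ennreal (a1 * q)" by simp
    show ?A
      unfolding split e_def[unfolded \<eta>_def, symmetric]
      by (intro add_mono SUP_least W F D)
    show "(SUP t\<in>{0..T}. W2_sq k (marginal k (law N \<rho>0 \<Phi> t)) (tensor_power k (\<rho> \<kappa> t)))
          \<le> ennreal (C * real k * rate N CARD('n))" if k: "k \<le> N" for k
    proof (rule SUP_least)
      fix t assume t: "t \<in> {0..T}"
      have "W2_sq k (marginal k (law N \<rho>0 \<Phi> t)) (tensor_power k (\<rho> \<kappa> t)) \<le> ennreal (real k * (a2 * ch.initial_error))"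
        using ch.W2_sq_marginal[OF t k] unfolding r0 amp .
      also have "\<dots> \<le> ennreal (C * real k * rate N CARD('n))"
      proof (rule ennreal_leI)
        have "real k * (a2 * ch.initial_error) \<le> real k * (a2 * q)" using err a by (intro mult_left_mono) auto
        also have "\<dots> \<le> real k * ((a2 + a1 + a1) * q)" using a q by (intro mult_left_mono mult_right_mono) auto
        finally show "real k * (a2 * ch.initial_error) \<le> C * real k * rate N CARD('n)"
          by (simp add: C_def q_def mult_ac)
      qed
      finally show "W2_sq k (marginal k (law N \<rho>0 \<Phi> t)) (tensor_power k (\<rho> \<kappa> t)) \<le> ennreal (C * real k * rate N CARD('n))" .
    qed
  qed
  show ?thesis
    by (intro exI[of _ C] conjI C allI impI) (use main marg in \<open>auto simp: \<Lambda>_def\<close>)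
qed

end
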